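(* Let $f:\mathcal{F}(V,\mathbb{R})\to\tilde{\mathcal{F}}(W,\mathbb{R})$ be a homomorphism of multiplicative semigroups. Suppose that $f(\mathcal{F}(V,\mathbb{R}^+\setminus\{1\}))\subset\tilde{\mathcal{F}}(W,\mathbb{R}^+\setminus\{1\})$, that $E_w\circ f(\mathbb{R}^+)=\mathbb{R}^+$ for each $w\in W$, and that there exists a map $\phi:W\to V$ such that $\phi$ is not constant on any nonempty open subset of $W$ and $\phi(w)\in\mathcal{S}_{E_w\circ f}$ for each $w\in W$. Then the following statements hold. (a) There exists an $\tilde{\mathcal{F}}$ function $\alpha:W\to\mathbb{R}^+$ such that for each $w\in W$ and each $x\in\mathcal{F}(V,\mathbb{R})$ with $x\circ\phi(w)\ne0$, $$f(x)(w)=f(\mathrm{sgn}(x\circ\phi(w)))(w)\,|x\circ\phi(w)|^{\alpha(w)},\qquad( * )$$ where $\mathrm{sgn}(x\circ\phi(w))$ is considered as a constant function on $V$. Furthermore, $\phi$ is an $\tilde{\mathcal{F}}$ map. (b) If in (a) $\phi$ is an open map, then $( * )$ holds for each $w\in W$ and each $x\in\mathcal{F}(V,\mathbb{R})$. (c) If in (a) $\mathcal{F}(V,\mathbb{R})\subset C^1(V,\mathbb{R})$ and $f(x)\in C^1(W,\mathbb{R})$ for each $x\in\mathcal{F}(V,\mathbb{R})$, then $\alpha(w)\ge1$ for each $w\in W$.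
   Context: All manifolds are Hausdorff. $V$ and $W$ are finite dimensional $C^\infty$ manifolds, possibly with boundary, not necessarily paracompact or connected. Smoothness classes: $\mathcal{F}$ is a fixed class among $C^k$, $k=0,1,\dots,\infty$ (in the Michal–Bastiani or the Fréchet sense), locally Hölder $C^{k,\alpha}$, $k=0,1,\dots$, $0\le\alpha\le1$ ($C^{k,0}=C^k$), or locally Sobolev $W^{k,p}$, $k=1,2,\dots$, $1\le p<\infty$, with $kp>\dim_{\mathbb{R}}V$, or $k=\dim_{\mathbb{R}}V$ and $p=1$. $\tilde{\mathcal{F}}$ is another (possibly different) class from the same list, with $V$ replaced by $W$. $\mathcal{F}(V,\mathbb{R})$ is the multiplicative semigroup of real valued $\mathcal{F}$ functions on $V$ under pointwise multiplication; $\mathcal{F}_c(V,\mathbb{R})$ is the subset of functions with compact support (in the usual sense of the closure of the nonzero set). $\mathbb{R}^+$ is the set of positive reals, also identified with the positive constant functions in $\mathcal{F}(V,\mathbb{R})$; $\mathcal{F}(V,\mathbb{R}^+\setminus\{1\})$ is the set of $x\in\mathcal{F}(V,\mathbb{R})$ with values in $\mathbb{R}^+\setminus\{1\}$. $\mathrm{sgn}(t)$ is $1,0,-1$ according as $t>0$, $t=0$, $t<0$. $E_w$ is evaluation at $w$. A point $v_0\in V$ is a support point of the semigroup homomorphism $E_w\circ f$ if for every open neighborhood $O$ of $v_0$ there exists $x\in\mathcal{F}_c(V,\mathbb{R})$ with $\operatorname{supp}x\subset O$ and $E_w\circ f(x)\ne0$. $\mathcal{S}_{E_w\circ f}\subset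 V$ is the set of support points. *)

theory Defs
  imports "HOL-Analysis.Analysis"
begin

section \<open>Smoothness classes on subsets of a Euclidean space\<close>

text \<open>
  The sets \<open>S\<close> below are the images of charts: relatively open subsets of a closed half-space, so
  that derivatives within \<open>S\<close> are unique also at boundary points. Higher derivatives are evaluated
  on directions \<open>v 0, v 1, ...\<close>, of which the derivative of order \<open>j\<close> uses the first \<open>j\<close>. As the
  spaces are finite dimensional, requiring differentiability and continuity of
  \<open>x \<mapsto> D\<^sup>j g(x)(v 0, ..., v (j - 1))\<close> for all \<open>v\<close> is the same as requiring them of
  \<open>x \<mapsto> D\<^sup>j g(x)\<close> as a map into the multilinear maps.
\<close>

primrec frechet_iter ::
  "'e::euclidean_space set \<Rightarrow> ('e \<Rightarrow> 'f::euclidean_space) \<Rightarrow> nat \<Rightarrow> 'e \<Rightarrow> (nat \<Rightarrow> 'e) \<Rightarrow> 'f" where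
  "frechet_iter S g 0 x v = g x"
| "frechet_iter S g (Suc j) x v =
     frechet_derivative (\<lambda>y. frechet_iter S g j y v) (at x within S) (v j)"

definition frechet_Ck_on ::
  "enat \<Rightarrow> 'e::euclidean_space set \<Rightarrow> ('e \<Rightarrow> 'f::euclidean_space) \<Rightarrow> bool" where
  "frechet_Ck_on k S g \<longleftrightarrow>
     (\<forall>j v. enat j < k \<longrightarrow> (\<lambda>x. frechet_iter S g j x v) differentiable_on S) \<and>
     (\<forall>j v. enat j \<le> k \<longrightarrow> continuous_on S (\<lambda>x. frechet_iter S g j x v))"

text \<open>
  Michal--Bastiani: the iterated directional derivatives exist in the interior of \<open>S\<close> and extend to
  maps on \<open>S \<times> E\<^sup>j\<close> that are jointly continuous in the point and the directions. The space
  \<open>nat \<Rightarrow> 'e\<close> carries the product topology; the derivative of order \<open>j\<close> depends only on the first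
  \<open>j\<close> factors.
\<close>

primrec dir_iter ::
  "('e::euclidean_space \<Rightarrow> 'f::euclidean_space) \<Rightarrow> nat \<Rightarrow> 'e \<Rightarrow> (nat \<Rightarrow> 'e) \<Rightarrow> 'f" where
  "dir_iter g 0 x v = g x"
| "dir_iter g (Suc j) x v = vector_derivative (\<lambda>t. dir_iter g j (x + t *\<^sub>R v j) v) (at 0)"

definition bastiani_Ck_on ::
  "enat \<Rightarrow> 'e::euclidean_space set \<Rightarrow> ('e \<Rightarrow> 'f::euclidean_space) \<Rightarrow> bool" where
  "bastiani_Ck_on k S g \<longleftrightarrow>
     continuous_on S g \<and>
     (\<forall>j. enat j < k \<longrightarrow> (\<forall>x\<in>interior S. \<forall>v.
        (\<lambda>t. dir_iter g j (x + t *\<^sub>R v j) v) differentiable (at 0))) \<and>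
     (\<forall>j. enat j \<le> k \<longrightarrow> (\<exists>G. continuous_on (S \<times> UNIV) G \<and>
        (\<forall>x\<in>interior S. \<forall>v. G (x, v) = dir_iter g j x v)))"

definition locally_hoelder_on ::
  "real \<Rightarrow> 'e::euclidean_space set \<Rightarrow> ('e \<Rightarrow> 'f::euclidean_space) \<Rightarrow> bool" where
  "locally_hoelder_on a S u \<longleftrightarrow>
     (\<forall>x\<in>S. \<exists>r>0. \<exists>C. \<forall>y\<in>S \<inter> ball x r. \<forall>z\<in>S \<inter> ball x r.
        norm (u y - u z) \<le> C * dist y z powr a)"

text \<open>For \<open>a = 0\<close> the Hoelder condition follows from continuity, so that \<open>C\<^sup>k\<^sup>,\<^sup>0 = C\<^sup>k\<close>.\<close>

definition hoelder_Ck_on ::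
  "nat \<Rightarrow> real \<Rightarrow> 'e::euclidean_space set \<Rightarrow> ('e \<Rightarrow> 'f::euclidean_space) \<Rightarrow> bool" where
  "hoelder_Ck_on k a S g \<longleftrightarrow>
     frechet_Ck_on (enat k) S g \<and> (\<forall>v. locally_hoelder_on a S (\<lambda>x. frechet_iter S g k x v))"

definition test_function :: "'e::euclidean_space set \<Rightarrow> ('e \<Rightarrow> real) \<Rightarrow> bool" where
  "test_function X \<psi> \<longleftrightarrow>
     frechet_Ck_on \<infinity> UNIV \<psi> \<and> compact (closure {x. \<psi> x \<noteq> 0}) \<and> closure {x. \<psi> x \<noteq> 0} \<subseteq> X"

definition weak_derivative_on ::
  "'e::euclidean_space set \<Rightarrow> ('e \<Rightarrow> 'f::euclidean_space) \<Rightarrow> nat \<Rightarrow> (nat \<Rightarrow> 'e) \<Rightarrow> ('e \<Rightarrow> 'f) \<Rightarrow> bool" where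
  "weak_derivative_on X g j v h \<longleftrightarrow>
     (\<forall>\<psi>. test_function X \<psi> \<longrightarrow>
        (LINT x:X|lborel. frechet_iter UNIV \<psi> j x v *\<^sub>R g x) =
        (- 1) ^ j *\<^sub>R (LINT x:X|lborel. \<psi> x *\<^sub>R h x))"

text \<open>
  A locally Sobolev function is represented by its continuous representative. The sequences \<open>v\<close> of
  basis vectors encode the partial derivatives of order \<open>j\<close>. Taking compact subsets of \<open>S\<close>, rather
  than of its interior, makes the weak derivatives locally \<open>L\<^sup>p\<close> up to the boundary.
\<close>

definition sobolev_on ::
  "nat \<Rightarrow> real \<Rightarrow> 'e::euclidean_space set \<Rightarrow> ('e \<Rightarrow> 'f::euclidean_space) \<Rightarrow> bool" where
  "sobolev_on k p S g \<longleftrightarrow>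
     continuous_on S g \<and>
     (\<forall>j\<le>k. \<forall>v. range v \<subseteq> Basis \<longrightarrow>
        (\<exists>h. h \<in> borel_measurable borel \<and>
             weak_derivative_on (interior S) g j v h \<and>
             (\<forall>K. compact K \<and> K \<subseteq> S \<longrightarrow> set_integrable lborel K (\<lambda>x. norm (h x) powr p))))"

datatype smoothness =
    Frechet enat
  | Michal_Bastiani enat
  | Hoelder nat real
  | Sobolev nat real

primrec class_on ::
  "smoothness \<Rightarrow> 'e::euclidean_space set \<Rightarrow> ('e \<Rightarrow> 'f::euclidean_space) \<Rightarrow> bool" where
  "class_on (Frechet k) S g \<longleftrightarrow> frechet_Ck_on k S g"
| "class_on (Michal_Bastiani k) S g \<longleftrightarrow> bastiani_Ck_on k S g"
| "class_on (Hoelder k a) S g \<longleftrightarrow> hoelder_Ck_on k a S g"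
| "class_on (Sobolev k p) S g \<longleftrightarrow> sobolev_on k p S g"

primrec admissible :: "nat \<Rightarrow> smoothness \<Rightarrow> bool" where
  "admissible d (Frechet k) \<longleftrightarrow> True"
| "admissible d (Michal_Bastiani k) \<longleftrightarrow> True"
| "admissible d (Hoelder k a) \<longleftrightarrow> 0 \<le> a \<and> a \<le> 1"
| "admissible d (Sobolev k p) \<longleftrightarrow>
     1 \<le> k \<and> 1 \<le> p \<and> (real k * p > real d \<or> k = d \<and> p = 1)"


section \<open>Manifolds with boundary\<close>

text \<open>
  A manifold is a type of class \<open>t2_space\<close> with a smooth atlas; a chart is given by its domain and
  its coordinate map into \<open>'e\<close>. No countability assumption is made.

  The case \<open>a = 0\<close>, \<open>b \<ge> 0\<close> in \<open>model_open\<close> gives the open subsets of the whole space. Since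
  every Euclidean space type has positive dimension, zero-dimensional manifolds are
  modelled on the one-point subset \<open>{0}\<close>, on which all the classes above contain every function.
\<close>

type_synonym ('v, 'e) atlas = "('v set \<times> ('v \<Rightarrow> 'e)) set"

definition model_open :: "nat \<Rightarrow> 'e::euclidean_space set \<Rightarrow> bool" where
  "model_open d S \<longleftrightarrow>
     (if d = 0 then S \<subseteq> {0} else d = DIM('e) \<and> (\<exists>a b. openin (top_of_set {x. a \<bullet> x \<le> b}) S))"

definition smooth_atlas :: "nat \<Rightarrow> ('v::t2_space, 'e::euclidean_space) atlas \<Rightarrow> bool" where
  "smooth_atlas d \<A> \<longleftrightarrow>
     (\<Union>(U, c)\<in>\<A>. U) = UNIV \<and>
     (\<forall>(U, c)\<in>\<A>. open U \<and> homeomorphism U (c ` U) c (inv_into U c) \<and> model_open d (c ` U)) \<and>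
     (\<forall>(U, c)\<in>\<A>. \<forall>(U', c')\<in>\<A>. frechet_Ck_on \<infinity> (c ` (U \<inter> U')) (c' \<circ> inv_into U c))"

definition class_functions ::
  "smoothness \<Rightarrow> ('v::t2_space, 'e::euclidean_space) atlas \<Rightarrow> ('v \<Rightarrow> real) set" where
  "class_functions \<kappa> \<A> = {x. \<forall>(U, c)\<in>\<A>. class_on \<kappa> (c ` U) (x \<circ> inv_into U c)}"

definition class_map ::
  "smoothness \<Rightarrow> ('w::t2_space, 'f::euclidean_space) atlas \<Rightarrow> ('v::t2_space, 'e::euclidean_space) atlas
     \<Rightarrow> ('w \<Rightarrow> 'v) \<Rightarrow> bool" where
  "class_map \<kappa> \<B> \<A> \<phi> \<longleftrightarrow>
     continuous_on UNIV \<phi> \<and>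
     (\<forall>(U, c)\<in>\<A>. \<forall>(U', c')\<in>\<B>.
        class_on \<kappa> (c' ` (U' \<inter> \<phi> -` U)) (c \<circ> \<phi> \<circ> inv_into U' c'))"


section \<open>Support points\<close>

definition supp :: "('v::topological_space \<Rightarrow> real) \<Rightarrow> 'v set" where
  "supp x = closure {v. x v \<noteq> 0}"

definition support_points :: "('v::topological_space \<Rightarrow> real) set \<Rightarrow> (('v \<Rightarrow> real) \<Rightarrow> real) \<Rightarrow> 'v set" where
  "support_points F h =
     {v. \<forall>N. open N \<and> v \<in> N \<longrightarrow> (\<exists>x\<in>F. compact (supp x) \<and> supp x \<subseteq> N \<and> h x \<noteq> 0)}"

end

theory Submission
  imports Defs
begin

text \<open>
  Multiplying by functions supported near \<open>\<phi> w\<close> shows that \<open>f x w\<close> depends only on the germ of \<open>x\<close> at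
  \<open>\<phi> w\<close>, and then, by cutting \<open>x\<close> off to a function with values in \<open>{0<..} - {1}\<close>, only on \<open>x (\<phi> w)\<close>. So
  \<open>t \<mapsto> ln (f (e\<^sup>t) w)\<close> is additive. As \<open>\<phi>\<close> is nowhere locally constant, a nonlinear additive function
  would lead to some \<open>x\<close> with \<open>f x\<close> unbounded near a point; hence it is \<open>t \<mapsto> t * \<alpha> w\<close> with
  \<open>\<alpha> w = ln (f e w)\<close>.

  The function \<open>\<alpha>\<close> and the coordinates of \<open>\<phi>\<close> are built by logarithms from functions \<open>f x\<close> all of whose
  powers \<open>f (x\<^sup>n)\<close> lie in the class. This determines their regularity also in the Sobolev case, where
  composition with the logarithm cannot be applied directly: linear combinations of the derivatives of
  \<open>exp (n * \<alpha>)\<close> for finitely many \<open>n\<close> isolate the terms occurring in the chain rule, so that their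
  integrability comes for free.

  If \<open>\<alpha> < 1\<close> near a point, then a curve along which a coordinate of \<open>\<phi>\<close> has nonzero derivative turns
  \<open>f x\<close>, for \<open>x\<close> that coordinate minus a constant, into a function behaving like \<open>\<bar>t\<bar> powr \<alpha>\<close>, which is not
  differentiable.
\<close>

section \<open>Relatively open subsets of half-spaces\<close>

text \<open>Excluding the value 1 is what recovers x (\<phi> w). Choose k > 0 such that the constant
  k has image f x w at w, by surjectivity on constants. Then x / k has image 1 at w, so x / k is 1
  at \<phi> w: otherwise it could be cut off to a positive function avoiding 1, whose image avoids
  1. The powers come from the formula itself: the constant exp n gives exp (n * \<alpha>), and exp
  (n * exp y) for a coordinate y gives exp (n * exp (y \<circ> \<phi>) * \<alpha>), where the factor
  exp y keeps the recovered product positive. In the Sobolev case \<alpha> is at first only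
  continuous, so no weak derivative of it may be used. Its increments along almost every line are
  bounded by those of exp \<alpha>, and the combinations are arranged such that all terms with the
  derivative of \<alpha> cancel. For \<alpha> \<ge> 1 the regularity result is applied once more to
  the same f with target class C^1; \<phi> becomes differentiable, and the mean value theorem on a
  segment in a chart of W finds the point with nonzero derivative.\<close>

definition halfspace_open :: "'e::euclidean_space set \<Rightarrow> bool" where
  "halfspace_open S \<longleftrightarrow> (\<exists>a b. openin (top_of_set {x. a \<bullet> x \<le> b}) S)"

lemma halfspace_open_openin:
  "halfspace_open S \<Longrightarrow> openin (top_of_set S) S' \<Longrightarrow> halfspace_open S'"
  unfolding halfspace_open_def by (meson openin_trans)

lemma open_imp_halfspace_open: "open S \<Longrightarrow> halfspace_open S"
  unfolding halfspace_open_def by (rule exI[of _ 0], rule exI[of _ 0]) simp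

lemma halfspace_open_ball:
  assumes "halfspace_open S" "x \<in> S"
  obtains a b r where "r > 0" "S \<inter> ball x r = {x. a \<bullet> x \<le> b} \<inter> ball x r" "a \<bullet> x \<le> b"
proof -
  obtain a b where ab: "openin (top_of_set {x. a \<bullet> x \<le> b}) S"
    using assms unfolding halfspace_open_def by auto
  then obtain T where T: "open T" "S = {x. a \<bullet> x \<le> b} \<inter> T"
    unfolding openin_open by auto
  then obtain r where "r > 0" "ball x r \<subseteq> T"
    using assms open_contains_ball[of T] by auto
  then show ?thesis using that[of r a b] T assms by auto
qed

lemma halfspace_open_convex_ball:
  assumes "halfspace_open S" "x \<in> S" "R > 0"
  obtains r where "r > 0" "r \<le> R" "convex (S \<inter> ball x r)"
proof -
  obtain a b r where r: "r > 0" "S \<inter> ball x r = {x. a \<bullet> x \<le> b} \<inter> ball x r" "a \<bullet> x \<le> b"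
    by (rule halfspace_open_ball[OF assms(1,2)])
  have "S \<inter> ball x (min r R) = {x. a \<bullet> x \<le> b} \<inter> ball x (min r R)"
    using r(2) by (simp add: set_eq_iff) blast
  moreover have "convex ({x. a \<bullet> x \<le> b} \<inter> ball x (min r R))"
    by (intro convex_Int convex_halfspace_le convex_ball)
  ultimately show ?thesis using that[of "min r R"] r assms(3) by auto
qed

text \<open>Either u or -u does not increase \<open>a \<bullet> x\<close>, so a short segment
  leaving x in that direction stays in the half-space. One-sided segments are all that a boundary
  point offers, and they determine derivatives within S.\<close>

lemma halfspace_open_direction:
  assumes "halfspace_open S" "x \<in> S"
  obtains s r where "s = 1 \<or> s = (-1::real)" "r > 0"
    "\<And>t. 0 \<le> t \<Longrightarrow> t \<le> r \<Longrightarrow> x + (s * t) *\<^sub>R u \<in> S"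
proof -
  obtain a b r where r: "r > 0" "S \<inter> ball x r = {x. a \<bullet> x \<le> b} \<inter> ball x r" "a \<bullet> x \<le> b"
    by (rule halfspace_open_ball[OF assms])
  define s where "s = (if a \<bullet> u \<le> 0 then 1 else (-1::real))"
  have s: "s * (a \<bullet> u) \<le> 0" "\<bar>s\<bar> = 1" unfolding s_def by auto
  \<comment> \<open>The length q keeps the displacement below r; the summand 1 covers u = 0.\<close>
  define q where "q = r / (2 * (norm u + 1))"
  have nu: "norm u + 1 > 0" by (simp add: add_nonneg_pos)
  have q: "q > 0" using r nu unfolding q_def by simp
  have "x + (s * t) *\<^sub>R u \<in> S" if t: "0 \<le> t" "t \<le> q" for t
  proof -
    have "norm ((s * t) *\<^sub>R u) = t * norm u" using s t by (simp add: abs_mult)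
    also have "\<dots> \<le> q * norm u" using t by (simp add: mult_right_mono)
    also have "\<dots> \<le> q * (norm u + 1)" using q by simp
    also have "\<dots> = r / 2" unfolding q_def using nu by (simp add: divide_simps)
    also have "\<dots> < r" using r(1) by simp
    finally have "x + (s * t) *\<^sub>R u \<in> ball x r" by (simp add: dist_norm)
    moreover have "a \<bullet> (x + (s * t) *\<^sub>R u) = a \<bullet> x + t * (s * (a \<bullet> u))"
      by (simp add: inner_add_right)
    then have "a \<bullet> (x + (s * t) *\<^sub>R u) \<le> b"
      using r(3) mult_nonneg_nonpos[OF t(1) s(1)] by linarith
    ultimately have "x + (s * t) *\<^sub>R u \<in> {x. a \<bullet> x \<le> b} \<inter> ball x r" by simp
    then show ?thesis using r(2) by blast
  qed
  then show ?thesis using that[of s q] q unfolding s_def by auto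
qed

lemma halfspace_open_derivative_unique:
  assumes "halfspace_open S" "x \<in> S"
    "(g has_derivative D) (at x within S)" "(g has_derivative D') (at x within S)"
  shows "D = D'"
proof (rule frechet_derivative_unique_within[OF assms(3,4)])
  fix i :: 'a and e :: real assume "i \<in> Basis" "e > 0"
  obtain s r where s: "s = 1 \<or> s = (-1::real)" "r > 0"
    "\<And>t. 0 \<le> t \<Longrightarrow> t \<le> r \<Longrightarrow> x + (s * t) *\<^sub>R i \<in> S"
    using halfspace_open_direction[OF assms(1,2), of i] by metis
  have "x + (s * min r (e/2)) *\<^sub>R i \<in> S" using s(2,3) \<open>e > 0\<close> by simp
  moreover have "0 < \<bar>s * min r (e/2)\<bar>" "\<bar>s * min r (e/2)\<bar> < e"
    using s \<open>e > 0\<close> by (auto simp: abs_mult)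
  ultimately show "\<exists>d. 0 < \<bar>d\<bar> \<and> \<bar>d\<bar> < e \<and> x + d *\<^sub>R i \<in> S" by blast
qed

text \<open>Subtracting a small multiple of the normal a makes \<open>a \<bullet> x \<le> b\<close>
  strict. This density extends identities and estimates from the interior to boundary
  points.\<close>

lemma halfspace_open_subset_closure_interior:
  fixes S :: "'e::euclidean_space set"
  assumes "halfspace_open S"
  shows "S \<subseteq> closure (interior S)"
proof
  fix x assume x: "x \<in> S"
  obtain a b r where r: "r > 0" "S \<inter> ball x r = {x. a \<bullet> x \<le> b} \<inter> ball x r" "a \<bullet> x \<le> b"
    by (rule halfspace_open_ball[OF assms x])
  show "x \<in> closure (interior S)"
  proof (cases "a = 0")
    case True
    then have "{x. a \<bullet> x \<le> b} = UNIV" using r(3) by simp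
    then have "ball x r \<subseteq> S" using r(2) by blast
    then have "x \<in> interior S" using r(1) by (meson centre_in_ball interior_maximal open_ball subsetD)
    then show ?thesis using closure_subset by auto
  next
    case False
    have sub: "{x. a \<bullet> x < b} \<inter> ball x r \<subseteq> interior S"
    proof (intro interior_maximal open_Int open_halfspace_lt open_ball)
      have "{x. a \<bullet> x < b} \<inter> ball x r \<subseteq> {x. a \<bullet> x \<le> b} \<inter> ball x r" by auto
      then show "{x. a \<bullet> x < b} \<inter> ball x r \<subseteq> S" using r(2) by blast
    qed
    show ?thesis unfolding closure_approachable
    proof (intro allI impI)
      fix e :: real assume "e > 0"
      define d where "d = min e r / (2 * norm a)"
      have "d > 0" using \<open>e > 0\<close> r False unfolding d_def by simp
      have "dist (x - d *\<^sub>R a) x = d * norm a" using \<open>d > 0\<close> by (simp add: dist_norm)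
      also have "\<dots> = min e r / 2" using False unfolding d_def by simp
      finally have di: "dist (x - d *\<^sub>R a) x = min e r / 2" .
      have "d * (a \<bullet> a) > 0" using \<open>d > 0\<close> False by simp
      then have "a \<bullet> (x - d *\<^sub>R a) < b" using r(3) by (simp add: inner_diff_right)
      moreover have "x - d *\<^sub>R a \<in> ball x r" using di r(1) \<open>e > 0\<close> by (simp add: dist_commute)
      ultimately have "x - d *\<^sub>R a \<in> interior S" using sub by auto
      then show "\<exists>y\<in>interior S. dist y x < e"
        using di \<open>e > 0\<close> r(1) by (intro bexI[of _ "x - d *\<^sub>R a"]) auto
    qed
  qed
qed

lemma halfspace_open_borel: "halfspace_open S \<Longrightarrow> S \<in> sets borel"
proof -
  assume "halfspace_open S"
  then obtain a b T where "open T" "S = {x. a \<bullet> x \<le> b} \<inter> T"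
    unfolding halfspace_open_def openin_open by auto
  moreover have "{x. a \<bullet> x \<le> b} \<in> sets borel"
    by (intro borel_closed closed_halfspace_le)
  ultimately show "S \<in> sets borel" by auto
qed

section \<open>Hoelder classes by recursion on the order\<close>

text \<open>The direction comes before the point, so that \<open>dderiv S g e\<close> is again a
  function on S to which the recursion on the order applies.\<close>

definition dderiv :: "'e::euclidean_space set \<Rightarrow> ('e \<Rightarrow> 'f::euclidean_space) \<Rightarrow> 'e \<Rightarrow> 'e \<Rightarrow> 'f" where
  "dderiv S g e x = frechet_derivative g (at x within S) e"

text \<open>Only the derivatives of top order carry the Hoelder bound. Continuity is demanded
  separately at order 0, because for a = 0 the bound merely says that g is locally bounded.\<close>

primrec hold :: "real \<Rightarrow> nat \<Rightarrow> 'e::euclidean_space set \<Rightarrow> ('e \<Rightarrow> 'f::euclidean_space) \<Rightarrow> bool" where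
  "hold a 0 S g \<longleftrightarrow> continuous_on S g \<and> locally_hoelder_on a S g"
| "hold a (Suc k) S g \<longleftrightarrow> g differentiable_on S \<and> (\<forall>e. hold a k S (dderiv S g e))"

text \<open>The definition adds the newest direction \<open>v j\<close> outermost; here the first
  direction \<open>v 0\<close> is split off innermost, which matches the recursion of
  \<open>hold\<close>.\<close>

lemma frechet_iter_shift:
  "frechet_iter S g (Suc j) x v = frechet_iter S (dderiv S g (v 0)) j x (\<lambda>i. v (Suc i))"
proof (induction j arbitrary: x)
  case 0
  show ?case by (simp add: dderiv_def)
next
  case (Suc j)
  show ?case by (simp only: frechet_iter.simps(2)[of S g "Suc j"] Suc) simp
qed

lemma hoelder_eq_hold: "hoelder_Ck_on k a S g \<longleftrightarrow> hold a k S g"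
proof (induction k arbitrary: g)
  case 0
  then show ?case
    by (auto simp: hoelder_Ck_on_def frechet_Ck_on_def enat_0_iff)
next
  case (Suc k)
  have sh: "frechet_iter S g (Suc j) x (case_nat e v) = frechet_iter S (dderiv S g e) j x v" for j x e v
    using frechet_iter_shift[of S g j x "case_nat e v"] by simp
  show ?case
  proof
    assume L: "hoelder_Ck_on (Suc k) a S g"
    have d: "(\<lambda>x. frechet_iter S g j x v) differentiable_on S" if "j < Suc k" for j v
      using L that unfolding hoelder_Ck_on_def frechet_Ck_on_def by auto
    have c: "continuous_on S (\<lambda>x. frechet_iter S g j x v)" if "j \<le> Suc k" for j v
      using L that unfolding hoelder_Ck_on_def frechet_Ck_on_def by auto
    have h: "locally_hoelder_on a S (\<lambda>x. frechet_iter S g (Suc k) x v)" for v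
      using L unfolding hoelder_Ck_on_def by blast
    have "hoelder_Ck_on k a S (dderiv S g e)" for e
      unfolding hoelder_Ck_on_def frechet_Ck_on_def sh[symmetric]
      using d c h by (auto simp del: frechet_iter.simps(2))
    moreover have "g differentiable_on S" using d[of 0] by simp
    ultimately show "hold a (Suc k) S g" using Suc by simp
  next
    assume R: "hold a (Suc k) S g"
    then have R': "hoelder_Ck_on k a S (dderiv S g e)" for e using Suc by simp
    have gd: "g differentiable_on S" using R by simp
    have "(\<lambda>x. frechet_iter S g j x v) differentiable_on S" if "j < Suc k" for j v
    proof (cases j)
      case 0
      then show ?thesis using gd by simp
    next
      case (Suc i)
      then show ?thesis
        using that R'[of "v 0"] unfolding Suc frechet_iter_shift hoelder_Ck_on_def frechet_Ck_on_def
        by (auto simp del: frechet_iter.simps(2))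
    qed
    moreover have "continuous_on S (\<lambda>x. frechet_iter S g j x v)" if "j \<le> Suc k" for j v
    proof (cases j)
      case 0
      then show ?thesis using gd differentiable_imp_continuous_on by auto
    next
      case (Suc i)
      then show ?thesis
        using that R'[of "v 0"] unfolding Suc frechet_iter_shift hoelder_Ck_on_def frechet_Ck_on_def
        by (auto simp del: frechet_iter.simps(2))
    qed
    moreover have "locally_hoelder_on a S (\<lambda>x. frechet_iter S g (Suc k) x v)" for v
      using R'[of "v 0"] unfolding frechet_iter_shift hoelder_Ck_on_def by blast
    ultimately show "hoelder_Ck_on (Suc k) a S g"
      unfolding hoelder_Ck_on_def frechet_Ck_on_def by (auto simp del: frechet_iter.simps(2))
  qed
qed

lemma continuous_locally_hoelder_0:
  assumes "continuous_on S u"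
  shows "locally_hoelder_on 0 S u"
  unfolding locally_hoelder_on_def
proof
  fix x assume x: "x \<in> S"
  then obtain r where r: "r > 0" "\<And>y. y \<in> S \<Longrightarrow> dist y x < r \<Longrightarrow> dist (u y) (u x) < 1"
    using assms unfolding continuous_on_iff by (metis zero_less_one)
  have "norm (u y - u z) \<le> 2 * dist y z powr 0"
    if "y \<in> S \<inter> ball x r" "z \<in> S \<inter> ball x r" for y z
  \<comment> \<open>\<open>0 powr 0\<close> is 0, so the bound by 2 is available only for distinct
    points.\<close>
  proof (cases "y = z")
    case False
    have "dist (u y) (u x) < 1" "dist (u z) (u x) < 1"
      using that by (auto intro!: r(2) simp: dist_commute[of _ x])
    then have "dist (u y) (u z) < 2" using dist_triangle2[of "u y" "u z" "u x"] by simp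
    then show ?thesis using False by (simp add: dist_norm)
  qed simp
  then show "\<exists>r>0. \<exists>C. \<forall>y\<in>S \<inter> ball x r. \<forall>z\<in>S \<inter> ball x r. norm (u y - u z) \<le> C * dist y z powr 0"
    using r(1) by blast
qed

lemma frechet_nat_eq_hold: "frechet_Ck_on (enat k) S g \<longleftrightarrow> hold 0 k S g"
proof -
  have "locally_hoelder_on 0 S (\<lambda>x. frechet_iter S g k x v)" if "frechet_Ck_on (enat k) S g" for v
    using that by (intro continuous_locally_hoelder_0) (auto simp: frechet_Ck_on_def)
  then show ?thesis unfolding hoelder_eq_hold[symmetric] hoelder_Ck_on_def by blast
qed

lemma frechet_infinity_eq_hold: "frechet_Ck_on \<infinity> S g \<longleftrightarrow> (\<forall>k. hold 0 k S g)"
proof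
  assume L: "frechet_Ck_on \<infinity> S g"
  show "\<forall>k. hold 0 k S g"
    unfolding frechet_nat_eq_hold[symmetric] using L by (auto simp: frechet_Ck_on_def)
next
  assume R: "\<forall>k. hold 0 k S g"
  have R': "frechet_Ck_on (enat k) S g" for k using R by (simp add: frechet_nat_eq_hold)
  show "frechet_Ck_on \<infinity> S g"
    unfolding frechet_Ck_on_def
  proof (intro conjI allI impI)
    fix j v
    show "(\<lambda>x. frechet_iter S g j x v) differentiable_on S"
      using R'[of "Suc j"] by (auto simp: frechet_Ck_on_def)
    show "continuous_on S (\<lambda>x. frechet_iter S g j x v)"
      using R'[of j] by (auto simp: frechet_Ck_on_def)
  qed
qed

lemma has_derivative_cong_on:
  assumes "\<And>x. x \<in> S \<Longrightarrow> g x = h x" "x \<in> S"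
  shows "(g has_derivative D) (at x within S) \<longleftrightarrow> (h has_derivative D) (at x within S)"
  using has_derivative_transform[OF assms(2), of g h D] has_derivative_transform[OF assms(2), of h g D] assms(1)
  by auto

lemma dderiv_cong:
  assumes "\<And>x. x \<in> S \<Longrightarrow> g x = h x" "x \<in> S"
  shows "dderiv S g e x = dderiv S h e x"
  using has_derivative_cong_on[OF assms(1,2)] by (simp add: dderiv_def frechet_derivative_def)

lemma locally_hoelder_on_cong:
  assumes "\<And>x. x \<in> S \<Longrightarrow> g x = h x"
  shows "locally_hoelder_on a S g \<longleftrightarrow> locally_hoelder_on a S h"
  unfolding locally_hoelder_on_def using assms by simp

lemma hold_cong:
  assumes "\<And>x. x \<in> S \<Longrightarrow> g x = h x"
  shows "hold a k S g \<longleftrightarrow> hold a k S h"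
  using assms
proof (induction k arbitrary: g h)
  case 0
  have "continuous_on S g \<longleftrightarrow> continuous_on S h"
    by (rule continuous_on_cong[OF refl]) (rule 0)
  moreover have "locally_hoelder_on a S g \<longleftrightarrow> locally_hoelder_on a S h"
    by (rule locally_hoelder_on_cong) (rule 0)
  ultimately show ?case by simp
next
  case (Suc k)
  have "g differentiable_on S \<longleftrightarrow> h differentiable_on S"
    unfolding differentiable_on_def differentiable_def
    by (intro ball_cong refl ex_cong1 has_derivative_cong_on) (rule Suc.prems)
  moreover have "hold a k S (dderiv S g e) \<longleftrightarrow> hold a k S (dderiv S h e)" for e
    by (rule Suc.IH) (rule dderiv_cong, rule Suc.prems)
  ultimately show ?case unfolding hold.simps by blast
qed

lemma at_within_openin:
  assumes "openin (top_of_set S) S'" "x \<in> S'"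
  shows "at x within S' = at x within S"
proof -
  obtain T where T: "open T" "S' = S \<inter> T" using assms(1) unfolding openin_open by auto
  show ?thesis
    by (rule at_within_nhd[of x T]) (use T assms in auto)
qed

lemma dderiv_openin:
  assumes "openin (top_of_set S) S'" "x \<in> S'"
  shows "dderiv S' g e x = dderiv S g e x"
  by (simp add: dderiv_def at_within_openin[OF assms])

lemma hold_openin:
  assumes "openin (top_of_set S) S'" "hold a k S g"
  shows "hold a k S' g"
  using assms(2)
proof (induction k arbitrary: g)
  case 0
  have "S' \<subseteq> S" using assms(1) openin_imp_subset by auto
  have "locally_hoelder_on a S' g"
    unfolding locally_hoelder_on_def
  proof
    fix x assume "x \<in> S'"
    then obtain r C where "r > 0"
      "\<forall>y\<in>S \<inter> ball x r. \<forall>z\<in>S \<inter> ball x r. norm (g y - g z) \<le> C * dist y z powr a"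
      using 0 \<open>S' \<subseteq> S\<close> unfolding hold.simps locally_hoelder_on_def by blast
    then show "\<exists>r>0. \<exists>C. \<forall>y\<in>S' \<inter> ball x r. \<forall>z\<in>S' \<inter> ball x r.
        norm (g y - g z) \<le> C * dist y z powr a"
      using \<open>S' \<subseteq> S\<close> by (intro exI[of _ r] conjI exI[of _ C]) auto
  qed
  then show ?case using 0 \<open>S' \<subseteq> S\<close> by (auto intro: continuous_on_subset)
next
  case (Suc k)
  have sub: "S' \<subseteq> S" using assms(1) openin_imp_subset by auto
  have "hold a k S' (dderiv S' g e)" for e
  proof -
    have "hold a k S' (dderiv S g e)" using Suc by simp
    then show ?thesis by (subst hold_cong[where h = "dderiv S g e"]) (auto intro: dderiv_openin[OF assms(1)])
  qed
  then show ?case using Suc sub by (auto intro: differentiable_on_subset)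
qed

lemma hold_local:
  assumes "\<And>x. x \<in> S \<Longrightarrow> \<exists>S'. openin (top_of_set S) S' \<and> x \<in> S' \<and> hold a k S' g"
  shows "hold a k S g"
  using assms
proof (induction k arbitrary: g)
  case 0
  have "continuous_on S g"
    unfolding continuous_on_eq_continuous_within
  proof
    fix x assume "x \<in> S"
    then obtain S' where S': "openin (top_of_set S) S'" "x \<in> S'" "continuous_on S' g"
      using 0[OF \<open>x \<in> S\<close>] by auto
    then show "continuous (at x within S) g"
      using at_within_openin[OF S'(1,2)] by (auto simp: continuous_on_eq_continuous_within)
  qed
  moreover have "locally_hoelder_on a S g"
    unfolding locally_hoelder_on_def
  proof
    fix x assume "x \<in> S"
    then obtain S' where S': "openin (top_of_set S) S'" "x \<in> S'" "locally_hoelder_on a S' g"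
      using 0[OF \<open>x \<in> S\<close>] by auto
    then obtain T where T: "open T" "S' = S \<inter> T" unfolding openin_open by auto
    obtain q where q: "q > 0" "ball x q \<subseteq> T" using T S' open_contains_ball[of T] by auto
    obtain r C where r: "r > 0" "\<And>y z. y\<in>S' \<inter> ball x r \<Longrightarrow> z\<in>S' \<inter> ball x r \<Longrightarrow>
        norm (g y - g z) \<le> C * dist y z powr a"
      using S' unfolding locally_hoelder_on_def by meson
    have "norm (g y - g z) \<le> C * dist y z powr a"
      if "y \<in> S \<inter> ball x (min q r)" "z \<in> S \<inter> ball x (min q r)" for y z
      using that q T by (intro r(2)) auto
    then show "\<exists>r>0. \<exists>C. \<forall>y\<in>S \<inter> ball x r. \<forall>z\<in>S \<inter> ball x r.
        norm (g y - g z) \<le> C * dist y z powr a"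
      using q(1) r(1) by (intro exI[of _ "min q r"] conjI exI[of _ C] ballI) auto
  qed
  ultimately show ?case by simp
next
  case (Suc k)
  have "g differentiable (at x within S)" if "x \<in> S" for x
  proof -
    obtain S' where S': "openin (top_of_set S) S'" "x \<in> S'" "g differentiable_on S'"
      using Suc.prems[OF \<open>x \<in> S\<close>] by auto
    then show ?thesis using at_within_openin[OF S'(1,2)] unfolding differentiable_on_def by auto
  qed
  moreover have "hold a k S (dderiv S g e)" for e
  proof (rule Suc.IH)
    fix x assume "x \<in> S"
    then obtain S' where S': "openin (top_of_set S) S'" "x \<in> S'" "hold a k S' (dderiv S' g e)"
      using Suc.prems[OF \<open>x \<in> S\<close>] by auto
    then show "\<exists>S'. openin (top_of_set S) S' \<and> x \<in> S' \<and> hold a k S' (dderiv S g e)"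
      using hold_cong[of S' "dderiv S' g e" "dderiv S g e" a k] dderiv_openin[OF S'(1)] by blast
  qed
  ultimately show ?case by (simp add: differentiable_on_def)
qed

text \<open>Derivatives within S are unique, so an explicitly given family g' may stand for the one
  chosen by \<open>frechet_derivative\<close>.\<close>

lemma hold_SucI:
  assumes "halfspace_open S"
    and d: "\<And>x. x \<in> S \<Longrightarrow> (g has_derivative g' x) (at x within S)"
    and h: "\<And>e. hold a k S (\<lambda>x. g' x e)"
  shows "hold a (Suc k) S g"
proof -
  have "dderiv S g e x = g' x e" if "x \<in> S" for x e
  proof -
    have "(g has_derivative frechet_derivative g (at x within S)) (at x within S)"
      using d[OF that] frechet_derivative_works unfolding differentiable_def by blast
    then show ?thesis
      unfolding dderiv_def using halfspace_open_derivative_unique[OF assms(1) that d[OF that]] by simp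
  qed
  then have "hold a k S (dderiv S g e)" for e
    using h[of e] by (subst hold_cong[where h = "\<lambda>x. g' x e"]) auto
  moreover have "g differentiable_on S"
    using d unfolding differentiable_on_def differentiable_def by blast
  ultimately show ?thesis by simp
qed

lemma hold_SucD:
  assumes "hold a (Suc k) S g"
  obtains g' where "\<And>x. x \<in> S \<Longrightarrow> (g has_derivative g' x) (at x within S)"
    "\<And>e. hold a k S (\<lambda>x. g' x e)"
proof
  show "(g has_derivative frechet_derivative g (at x within S)) (at x within S)" if "x \<in> S" for x
    using assms that frechet_derivative_works unfolding hold.simps differentiable_on_def by blast
  show "hold a k S (\<lambda>x. frechet_derivative g (at x within S) e)" for e
    using assms by (simp add: dderiv_def[abs_def])
qed

lemma hold_continuous: "hold a k S g \<Longrightarrow> continuous_on S g"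
  by (cases k) (auto intro: differentiable_imp_continuous_on)

lemma hold_0: "hold a k S g \<Longrightarrow> hold 0 k S g"
  by (induction k arbitrary: g) (auto intro: continuous_locally_hoelder_0)

section \<open>Local Hoelder bounds for continuously differentiable functions\<close>

lemma linear_expand_Basis:
  fixes D :: "'e::euclidean_space \<Rightarrow> 'f::real_vector"
  assumes "linear D"
  shows "D u = (\<Sum>b\<in>Basis. (u \<bullet> b) *\<^sub>R D b)"
proof -
  have "D u = D (\<Sum>b\<in>Basis. (u \<bullet> b) *\<^sub>R b)" by (simp add: euclidean_representation)
  then show ?thesis by (simp only: linear_sum[OF assms] linear_cmul[OF assms])
qed

lemma has_derivative_norm_bound:
  fixes D :: "'e::euclidean_space \<Rightarrow> 'f::real_normed_vector"
  assumes "linear D"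
  shows "norm (D u) \<le> (\<Sum>b\<in>Basis. norm (D b)) * norm u"
proof -
  have "norm (D u) = norm (\<Sum>b\<in>Basis. (u \<bullet> b) *\<^sub>R D b)"
    using linear_expand_Basis[OF assms, of u] by simp
  also have "\<dots> \<le> (\<Sum>b\<in>Basis. norm ((u \<bullet> b) *\<^sub>R D b))" by (rule norm_sum)
  also have "\<dots> \<le> (\<Sum>b\<in>Basis. norm (D b) * norm u)"
  proof (rule sum_mono)
    fix b :: 'e assume "b \<in> Basis"
    then have "\<bar>u \<bullet> b\<bar> * norm (D b) \<le> norm u * norm (D b)"
      by (intro mult_right_mono Basis_le_norm) auto
    then show "norm ((u \<bullet> b) *\<^sub>R D b) \<le> norm (D b) * norm u" by (simp add: mult.commute)
  qed
  finally show ?thesis by (simp add: sum_distrib_right)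
qed

text \<open>On a convex relative ball the mean value inequality gives a Lipschitz bound, the
  derivative being controlled by its finitely many values on the basis. A radius of at most 1/2
  keeps distances at most 1, where d \<le> d powr a.\<close>

lemma C1_locally_hoelder:
  fixes g :: "'e::euclidean_space \<Rightarrow> 'f::euclidean_space"
  assumes S: "halfspace_open S" and a: "0 \<le> a" "a \<le> 1"
    and d: "\<And>x. x \<in> S \<Longrightarrow> (g has_derivative g' x) (at x within S)"
    and c: "\<And>e. continuous_on S (\<lambda>x. g' x e)"
  shows "locally_hoelder_on a S g"
  unfolding locally_hoelder_on_def
proof
  fix x assume x: "x \<in> S"
  define M where "M y = (\<Sum>b\<in>Basis. norm (g' y b))" for y
  have "continuous_on S M" unfolding M_def by (intro continuous_intros c)
  then obtain q where q: "q > 0" "\<And>y. y \<in> S \<Longrightarrow> dist y x < q \<Longrightarrow> dist (M y) (M x) < 1"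
    using x unfolding continuous_on_iff by (metis zero_less_one)
  obtain r where r: "r > 0" "r \<le> min q (1/2)" "convex (S \<inter> ball x r)"
    using halfspace_open_convex_ball[OF S x, of "min q (1/2)"] q(1) by auto
  have "norm (g y - g z) \<le> (M x + 1) * dist y z powr a"
    if y: "y \<in> S \<inter> ball x r" and z: "z \<in> S \<inter> ball x r" for y z
  proof -
    have M0: "M x \<ge> 0" unfolding M_def by (simp add: sum_nonneg)
    have "norm (g y - g z) \<le> (M x + 1) * norm (y - z)"
    proof (rule differentiable_bound[OF r(3) _ _ y z])
      fix p assume p: "p \<in> S \<inter> ball x r"
      show "(g has_derivative g' p) (at p within S \<inter> ball x r)"
        using d p by (auto intro: has_derivative_subset)
      have "linear (g' p)" using d p by (auto intro: has_derivative_linear)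
      have "M p \<le> M x + 1" using q(2)[of p] p r(2) by (auto simp: dist_real_def dist_commute)
      show "onorm (g' p) \<le> M x + 1"
      proof (rule onorm_le)
        fix u
        have "norm (g' p u) \<le> M p * norm u"
          unfolding M_def by (rule has_derivative_norm_bound) fact
        also have "\<dots> \<le> (M x + 1) * norm u" using \<open>M p \<le> M x + 1\<close> by (simp add: mult_right_mono)
        finally show "norm (g' p u) \<le> (M x + 1) * norm u" .
      qed
    qed
    also have "dist y z \<le> dist y z powr a"
    proof (cases "y = z")
      case False
      have "dist y z \<le> 1"
        using y z r(2) dist_triangle3[of y z x] by (auto simp: dist_commute)
      then have "dist y z powr 1 \<le> dist y z powr a"
        using a False by (intro powr_mono') auto
      then show ?thesis by simp
    qed simp
    then have "(M x + 1) * norm (y - z) \<le> (M x + 1) * dist y z powr a"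
      using M0 by (intro mult_left_mono) (auto simp: dist_norm)
    finally show ?thesis .
  qed
  then show "\<exists>r>0. \<exists>C. \<forall>y\<in>S \<inter> ball x r. \<forall>z\<in>S \<inter> ball x r. norm (g y - g z) \<le> C * dist y z powr a"
    using r(1) by blast
qed

lemma hold_Suc_weaken:
  assumes "halfspace_open S" "0 \<le> a" "a \<le> 1" "hold 0 (Suc k) S g"
  shows "hold a k S g"
  using assms(4)
proof (induction k arbitrary: g)
  case 0
  obtain g' where g': "\<And>x. x \<in> S \<Longrightarrow> (g has_derivative g' x) (at x within S)"
    "\<And>e. hold 0 0 S (\<lambda>x. g' x e)"
    using hold_SucD[OF 0] by metis
  have "locally_hoelder_on a S g"
    by (rule C1_locally_hoelder[OF assms(1-3) g'(1)]) (use g'(2) in auto)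
  then show ?case using hold_continuous[OF 0] by simp
next
  case (Suc k)
  then show ?case by auto
qed

lemma hold_decreasing:
  assumes "halfspace_open S" "0 \<le> a" "a \<le> 1" "hold a (Suc k) S g"
  shows "hold a k S g"
  using hold_Suc_weaken[OF assms(1-3) hold_0[OF assms(4)]] .

lemma smooth_hold:
  assumes "halfspace_open S" "0 \<le> a" "a \<le> 1" "frechet_Ck_on \<infinity> S g"
  shows "hold a k S g"
  using assms(4) hold_Suc_weaken[OF assms(1-3)] unfolding frechet_infinity_eq_hold by blast

section \<open>Closure under sums, linear maps, products and smooth outer functions\<close>

lemma hold_const: "halfspace_open S \<Longrightarrow> hold a k S (\<lambda>_. c)"
proof (induction k arbitrary: c)
  case 0
  show ?case
    unfolding hold.simps locally_hoelder_on_def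
    by (intro conjI continuous_on_const ballI exI[of _ 1] exI[of _ "0::real"]) auto
next
  case (Suc k)
  show ?case
    by (rule hold_SucI[OF Suc.prems, where g' = "\<lambda>x e. 0"]) (use Suc in auto)
qed

lemma hold_add:
  assumes S: "halfspace_open S" and "hold a k S g" "hold a k S h"
  shows "hold a k S (\<lambda>x. g x + h x)"
  using assms(2,3)
proof (induction k arbitrary: g h)
  case 0
  have "locally_hoelder_on a S (\<lambda>x. g x + h x)"
    unfolding locally_hoelder_on_def
  proof
    fix x assume "x \<in> S"
    then obtain r C q D where r: "r > 0" "q > 0"
      "\<And>y z. y \<in> S \<inter> ball x r \<Longrightarrow> z \<in> S \<inter> ball x r \<Longrightarrow> norm (g y - g z) \<le> C * dist y z powr a"
      "\<And>y z. y \<in> S \<inter> ball x q \<Longrightarrow> z \<in> S \<inter> ball x q \<Longrightarrow> norm (h y - h z) \<le> D * dist y z powr a"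
      using 0 unfolding hold.simps locally_hoelder_on_def by metis
    have "norm (g y + h y - (g z + h z)) \<le> (C + D) * dist y z powr a"
      if "y \<in> S \<inter> ball x (min r q)" "z \<in> S \<inter> ball x (min r q)" for y z
    proof -
      have "norm (g y - g z) \<le> C * dist y z powr a" using that by (intro r) auto
      moreover have "norm (h y - h z) \<le> D * dist y z powr a" using that by (intro r) auto
      ultimately show ?thesis
        using norm_triangle_ineq[of "g y - g z" "h y - h z"] by (simp add: algebra_simps)
    qed
    then show "\<exists>r>0. \<exists>C. \<forall>y\<in>S \<inter> ball x r. \<forall>z\<in>S \<inter> ball x r.
        norm (g y + h y - (g z + h z)) \<le> C * dist y z powr a"
      using r(1,2) by (intro exI[of _ "min r q"] conjI exI[of _ "C + D"]) auto
  qed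
  then show ?case using 0 by (auto intro: continuous_intros)
next
  case (Suc k)
  obtain g' where g': "\<And>x. x \<in> S \<Longrightarrow> (g has_derivative g' x) (at x within S)"
    "\<And>e. hold a k S (\<lambda>x. g' x e)"
    using hold_SucD[OF Suc.prems(1)] by metis
  obtain h' where h': "\<And>x. x \<in> S \<Longrightarrow> (h has_derivative h' x) (at x within S)"
    "\<And>e. hold a k S (\<lambda>x. h' x e)"
    using hold_SucD[OF Suc.prems(2)] by metis
  show ?case
    by (rule hold_SucI[OF S, where g' = "\<lambda>x e. g' x e + h' x e"])
      (auto intro!: has_derivative_add g' h' Suc.IH)
qed

lemma hold_sum:
  assumes "halfspace_open S" "\<And>i. i \<in> I \<Longrightarrow> hold a k S (g i)"
  shows "hold a k S (\<lambda>x. \<Sum>i\<in>I. g i x)"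
  using assms(2)
  by (induction I rule: infinite_finite_induct) (auto intro: hold_const hold_add assms(1))

lemma hold_linear:
  assumes S: "halfspace_open S" and L: "bounded_linear L" and "hold a k S g"
  shows "hold a k S (\<lambda>x. L (g x))"
  using assms(3)
proof (induction k arbitrary: g)
  case 0
  obtain K where K: "\<And>x. norm (L x) \<le> norm x * K" "K > 0" using L bounded_linear.pos_bounded by blast
  have "locally_hoelder_on a S (\<lambda>x. L (g x))"
    unfolding locally_hoelder_on_def
  proof
    fix x assume "x \<in> S"
    then obtain r C where r: "r > 0"
      "\<And>y z. y \<in> S \<inter> ball x r \<Longrightarrow> z \<in> S \<inter> ball x r \<Longrightarrow> norm (g y - g z) \<le> C * dist y z powr a"
      using 0 unfolding hold.simps locally_hoelder_on_def by metis
    have "norm (L (g y) - L (g z)) \<le> (C * K) * dist y z powr a"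
      if "y \<in> S \<inter> ball x r" "z \<in> S \<inter> ball x r" for y z
    proof -
      have "norm (L (g y) - L (g z)) \<le> norm (g y - g z) * K"
        using K(1)[of "g y - g z"] L by (simp add: bounded_linear.linear linear_diff)
      also have "\<dots> \<le> C * dist y z powr a * K" using r(2)[OF that] K(2) by (simp add: mult_right_mono)
      finally show ?thesis by (simp add: algebra_simps)
    qed
    then show "\<exists>r>0. \<exists>C. \<forall>y\<in>S \<inter> ball x r. \<forall>z\<in>S \<inter> ball x r.
        norm (L (g y) - L (g z)) \<le> C * dist y z powr a"
      using r(1) by blast
  qed
  then show ?case using 0 L by (auto intro: bounded_linear.continuous_on)
next
  case (Suc k)
  obtain g' where g': "\<And>x. x \<in> S \<Longrightarrow> (g has_derivative g' x) (at x within S)"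
    "\<And>e. hold a k S (\<lambda>x. g' x e)"
    using hold_SucD[OF Suc.prems(1)] by metis
  show ?case
    by (rule hold_SucI[OF S, where g' = "\<lambda>x e. L (g' x e)"])
      (auto intro!: bounded_linear.has_derivative[OF L] g' Suc.IH)
qed

lemma locally_hoelder_bounded:
  assumes "continuous_on S g" "x \<in> S"
  obtains r where "r > 0" "\<And>y. y \<in> S \<inter> ball x r \<Longrightarrow> norm (g y) \<le> norm (g x) + 1"
proof -
  obtain r where r: "r > 0" "\<And>y. y \<in> S \<Longrightarrow> dist y x < r \<Longrightarrow> dist (g y) (g x) < 1"
    using assms unfolding continuous_on_iff by (metis zero_less_one)
  have "norm (g y) \<le> norm (g x) + 1" if "y \<in> S \<inter> ball x r" for y
    using r(2)[of y] that norm_triangle_ineq2[of "g y" "g x"] by (auto simp: dist_norm dist_commute)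
  then show ?thesis using r(1) that by blast
qed

lemma hold_mult:
  fixes g h :: "'e::euclidean_space \<Rightarrow> real"
  assumes S: "halfspace_open S" and a: "0 \<le> a" "a \<le> 1" and "hold a k S g" "hold a k S h"
  shows "hold a k S (\<lambda>x. g x * h x)"
  using assms(4,5)
proof (induction k arbitrary: g h)
  case 0
  have "locally_hoelder_on a S (\<lambda>x. g x * h x)"
    unfolding locally_hoelder_on_def
  proof
    fix x assume x: "x \<in> S"
    then obtain r C q D where r: "r > 0" "q > 0"
      "\<And>y z. y \<in> S \<inter> ball x r \<Longrightarrow> z \<in> S \<inter> ball x r \<Longrightarrow> norm (g y - g z) \<le> C * dist y z powr a"
      "\<And>y z. y \<in> S \<inter> ball x q \<Longrightarrow> z \<in> S \<inter> ball x q \<Longrightarrow> norm (h y - h z) \<le> D * dist y z powr a"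
      using 0 unfolding hold.simps locally_hoelder_on_def by metis
    obtain r1 where r1: "r1 > 0" "\<And>y. y \<in> S \<inter> ball x r1 \<Longrightarrow> norm (g y) \<le> norm (g x) + 1"
      using locally_hoelder_bounded[OF _ x] 0 by (metis hold.simps(1))
    obtain r2 where r2: "r2 > 0" "\<And>y. y \<in> S \<inter> ball x r2 \<Longrightarrow> norm (h y) \<le> norm (h x) + 1"
      using locally_hoelder_bounded[OF _ x] 0 by (metis hold.simps(1))
    let ?r = "min (min r q) (min r1 r2)"
    have "norm (g y * h y - g z * h z) \<le> ((norm (g x) + 1) * D + (norm (h x) + 1) * C) * dist y z powr a"
      if "y \<in> S \<inter> ball x ?r" "z \<in> S \<inter> ball x ?r" for y z
    proof -
      have *: "norm (g y - g z) \<le> C * dist y z powr a" "norm (h y - h z) \<le> D * dist y z powr a"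
        "norm (g y) \<le> norm (g x) + 1" "norm (h z) \<le> norm (h x) + 1"
        using that by (intro r r1 r2; simp)+
      have "g y * h y - g z * h z = g y * (h y - h z) + h z * (g y - g z)"
        by (simp add: algebra_simps)
      then have "norm (g y * h y - g z * h z) \<le> norm (g y) * norm (h y - h z) + norm (h z) * norm (g y - g z)"
        by (metis norm_mult norm_triangle_ineq)
      also have "\<dots> \<le> (norm (g x) + 1) * (D * dist y z powr a) + (norm (h x) + 1) * (C * dist y z powr a)"
        using * by (intro add_mono mult_mono) auto
      finally show ?thesis by (simp add: algebra_simps)
    qed
    then show "\<exists>r>0. \<exists>C. \<forall>y\<in>S \<inter> ball x r. \<forall>z\<in>S \<inter> ball x r.
        norm (g y * h y - g z * h z) \<le> C * dist y z powr a"
      using r(1,2) r1(1) r2(1)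
      by (intro exI[of _ ?r] conjI exI[of _ "(norm (g x) + 1) * D + (norm (h x) + 1) * C"] ballI) auto
  qed
  then show ?case using 0 by (auto intro: continuous_intros)
next
  case (Suc k)
  obtain g' where g': "\<And>x. x \<in> S \<Longrightarrow> (g has_derivative g' x) (at x within S)"
    "\<And>e. hold a k S (\<lambda>x. g' x e)"
    using hold_SucD[OF Suc.prems(1)] by metis
  obtain h' where h': "\<And>x. x \<in> S \<Longrightarrow> (h has_derivative h' x) (at x within S)"
    "\<And>e. hold a k S (\<lambda>x. h' x e)"
    using hold_SucD[OF Suc.prems(2)] by metis
  \<comment> \<open>The product rule leaves one factor undifferentiated, which is then needed at
    order k; lowering the order keeps the Hoelder exponent because a \<le> 1.\<close>
  note low = hold_decreasing[OF S a Suc.prems(1)] hold_decreasing[OF S a Suc.prems(2)]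
  show ?case
    by (rule hold_SucI[OF S, where g' = "\<lambda>x e. g x * h' x e + g' x e * h x"])
      (auto intro!: has_derivative_mult g' h' hold_add S Suc.IH low)
qed

text \<open>The derivative of the composition is a finite sum of products of components of g' with
  \<open>dderiv T s b (g x)\<close>. Since s is smooth, its directional derivatives are smooth again
  and the induction hypothesis applies to them. At order 0 a local Lipschitz bound for s
  suffices.\<close>

lemma hold_compose:
  fixes s :: "'g::euclidean_space \<Rightarrow> real" and g :: "'e::euclidean_space \<Rightarrow> 'g"
  assumes S: "halfspace_open S" and T: "halfspace_open T" and a: "0 \<le> a" "a \<le> 1"
    and s: "frechet_Ck_on \<infinity> T s" and g: "hold a k S g" and sub: "g ` S \<subseteq> T"
  shows "hold a k S (\<lambda>x. s (g x))"
  using s g sub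
proof (induction k arbitrary: s g)
  case 0
  have s1: "continuous_on T s" "locally_hoelder_on 1 T s"
    using smooth_hold[OF T _ _ 0(1), of 1 0] by auto
  have "locally_hoelder_on a S (\<lambda>x. s (g x))"
    unfolding locally_hoelder_on_def
  proof
    fix x assume x: "x \<in> S"
    obtain r C where r: "r > 0"
      "\<And>y z. y \<in> S \<inter> ball x r \<Longrightarrow> z \<in> S \<inter> ball x r \<Longrightarrow> norm (g y - g z) \<le> C * dist y z powr a"
      using 0 x unfolding hold.simps locally_hoelder_on_def by metis
    obtain q D where q: "q > 0"
      "\<And>y z. y \<in> T \<inter> ball (g x) q \<Longrightarrow> z \<in> T \<inter> ball (g x) q \<Longrightarrow> norm (s y - s z) \<le> D * dist y z powr 1"
      using s1 x 0(3) unfolding locally_hoelder_on_def by (metis image_subset_iff)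
    obtain p where p: "p > 0" "\<And>y. y \<in> S \<Longrightarrow> dist y x < p \<Longrightarrow> dist (g y) (g x) < q"
      using 0(2) x q(1) unfolding hold.simps continuous_on_iff by metis
    have "norm (s (g y) - s (g z)) \<le> (\<bar>D\<bar> * C) * dist y z powr a"
      if "y \<in> S \<inter> ball x (min p r)" "z \<in> S \<inter> ball x (min p r)" for y z
    proof -
      have "g y \<in> T \<inter> ball (g x) q" "g z \<in> T \<inter> ball (g x) q"
        using p(2)[of y] p(2)[of z] that 0(3) by (auto simp: dist_commute)
      then have "norm (s (g y) - s (g z)) \<le> D * dist (g y) (g z)" using q(2) by fastforce
      also have "\<dots> \<le> \<bar>D\<bar> * norm (g y - g z)" by (simp add: dist_norm mult_right_mono)
      also have "\<dots> \<le> \<bar>D\<bar> * (C * dist y z powr a)" using that by (intro mult_left_mono r) auto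
      finally show ?thesis by simp
    qed
    then show "\<exists>r>0. \<exists>C. \<forall>y\<in>S \<inter> ball x r. \<forall>z\<in>S \<inter> ball x r.
        norm (s (g y) - s (g z)) \<le> C * dist y z powr a"
      using r(1) p(1) by (intro exI[of _ "min p r"] conjI exI[of _ "\<bar>D\<bar> * C"] ballI) auto
  qed
  moreover have "continuous_on S (\<lambda>x. s (g x))"
    using s1(1) 0 by (auto intro: continuous_on_compose2)
  ultimately show ?case by simp
next
  case (Suc k)
  obtain g' where g': "\<And>x. x \<in> S \<Longrightarrow> (g has_derivative g' x) (at x within S)"
    "\<And>e. hold a k S (\<lambda>x. g' x e)"
    using hold_SucD[OF Suc.prems(2)] by metis
  have sd: "(s has_derivative frechet_derivative s (at y within T)) (at y within T)" if "y \<in> T" for y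
    using Suc.prems(1) that frechet_derivative_works
    unfolding frechet_infinity_eq_hold by (metis differentiable_on_def hold.simps(2))
  have ss: "frechet_Ck_on \<infinity> T (dderiv T s b)" for b
    using Suc.prems(1) unfolding frechet_infinity_eq_hold using hold.simps(2) by blast
  show ?case
  proof (rule hold_SucI[OF S])
    fix x assume x: "x \<in> S"
    show "((\<lambda>x. s (g x)) has_derivative (\<lambda>e. \<Sum>b\<in>Basis. (g' x e \<bullet> b) * dderiv T s b (g x))) (at x within S)"
    proof -
      let ?L = "frechet_derivative s (at (g x) within T)"
      have gT: "g x \<in> T" using x Suc.prems(3) by auto
      have "linear ?L" using sd[OF gT] has_derivative_linear by blast
      then have "?L u = (\<Sum>b\<in>Basis. (u \<bullet> b) * dderiv T s b (g x))" for u
        unfolding dderiv_def using linear_expand_Basis[of ?L u] by simp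
      then have "(\<lambda>e. ?L (g' x e)) = (\<lambda>e. \<Sum>b\<in>Basis. (g' x e \<bullet> b) * dderiv T s b (g x))" by auto
      moreover have "((\<lambda>x. s (g x)) has_derivative (\<lambda>e. ?L (g' x e))) (at x within S)"
        using has_derivative_in_compose2[of T s "\<lambda>y. frechet_derivative s (at y within T)" g S x "g' x"]
          sd Suc.prems(3) x g'(1)[OF x] by auto
      ultimately show ?thesis by simp
    qed
  next
    fix e
    have "hold a k S (\<lambda>x. g' x e \<bullet> b)" for b
      by (rule hold_linear[OF S bounded_linear_inner_left g'(2)])
    moreover have "hold a k S (\<lambda>x. dderiv T s b (g x))" for b
      by (rule Suc.IH[OF ss hold_decreasing[OF S a Suc.prems(2)] Suc.prems(3)])
    ultimately show "hold a k S (\<lambda>x. \<Sum>b\<in>Basis. (g' x e \<bullet> b) * dderiv T s b (g x))"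
      by (intro hold_sum S hold_mult a)
  qed
qed

lemma hold_componentwise:
  assumes "halfspace_open S" "\<And>b. b \<in> Basis \<Longrightarrow> hold a k S (\<lambda>x. g x \<bullet> b)"
  shows "hold a k S g"
proof -
  have "hold a k S (\<lambda>x. \<Sum>b\<in>Basis. (g x \<bullet> b) *\<^sub>R b)"
    by (intro hold_sum assms(1) hold_linear[OF assms(1) bounded_linear_scaleR_left] assms(2))
  then show ?thesis by (simp add: euclidean_representation)
qed

section \<open>Michal--Bastiani differentiability\<close>

lemma halfspace_open_frechet_derivative:
  assumes "halfspace_open S" "x \<in> S" "(g has_derivative D) (at x within S)"
  shows "frechet_derivative g (at x within S) = D"
proof (rule halfspace_open_derivative_unique[OF assms(1,2) _ assms(3)])
  show "(g has_derivative frechet_derivative g (at x within S)) (at x within S)"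
    using assms(3) frechet_derivative_works unfolding differentiable_def by blast
qed

lemma eq_on_halfspace_open:
  fixes f h :: "'e::euclidean_space \<Rightarrow> 'f::euclidean_space"
  assumes "halfspace_open S" "continuous_on S f" "continuous_on S h"
    "\<And>x. x \<in> interior S \<Longrightarrow> f x = h x" "x \<in> S"
  shows "f x = h x"
proof (rule ccontr)
  assume ne: "f x \<noteq> h x"
  have "continuous_on S (\<lambda>x. f x - h x)" using assms by (intro continuous_intros)
  then have "\<exists>r>0. \<forall>y\<in>S. dist y x < r \<longrightarrow> dist (f y - h y) (f x - h x) < norm (f x - h x)"
    using assms(5) ne unfolding continuous_on_iff by simp
  then obtain r where r: "r > 0"
    "\<And>y. y \<in> S \<Longrightarrow> dist y x < r \<Longrightarrow> dist (f y - h y) (f x - h x) < norm (f x - h x)"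
    by metis
  obtain y where y: "y \<in> interior S" "dist y x < r"
    using halfspace_open_subset_closure_interior[OF assms(1)] assms(5) r(1)
    unfolding closure_approachable subset_iff by blast
  have "y \<in> S" using y(1) interior_subset by auto
  then show False using r(2)[of y] y assms(4)[of y] by (simp add: dist_norm norm_minus_commute)
qed

text \<open>The chain rule for t \<mapsto> c * t gives homogeneity in the interior; both sides are
  continuous up to the boundary.\<close>

lemma directional_derivative_scaleR:
  fixes g :: "'e::euclidean_space \<Rightarrow> 'f::euclidean_space"
  assumes S: "halfspace_open S" and x: "x \<in> S"
    and G: "continuous_on (S \<times> UNIV) G"
    and d: "\<And>x u. x \<in> interior S \<Longrightarrow> ((\<lambda>t. g (x + t *\<^sub>R u)) has_vector_derivative G (x, u)) (at 0)"
  shows "G (x, c *\<^sub>R u) = c *\<^sub>R G (x, u)"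
proof -
  have hom_int: "G (y, c *\<^sub>R u) = c *\<^sub>R G (y, u)" if "y \<in> interior S" for y
  proof -
    have "((\<lambda>t. c * t) has_vector_derivative c) (at 0)"
      unfolding has_real_derivative_iff_has_vector_derivative[symmetric]
      by (auto intro!: derivative_eq_intros)
    then have "((\<lambda>t. g (y + t *\<^sub>R u)) \<circ> (\<lambda>t. c * t) has_vector_derivative c *\<^sub>R G (y, u)) (at 0)"
      by (rule vector_diff_chain_at) (use d[OF that, of u] in simp)
    moreover have "(\<lambda>t. g (y + t *\<^sub>R u)) \<circ> (\<lambda>t. c * t) = (\<lambda>t. g (y + t *\<^sub>R (c *\<^sub>R u)))"
      by (auto simp: mult.commute)
    ultimately show ?thesis using d[OF that, of "c *\<^sub>R u"] vector_derivative_unique_at by metis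
  qed
  have contu: "continuous_on S (\<lambda>x. G (x, u))" for u
    by (intro continuous_on_compose2[OF G] continuous_intros) auto
  show ?thesis
    by (rule eq_on_halfspace_open[OF S _ _ _ x]) (auto intro!: contu continuous_intros hom_int)
qed

text \<open>By compactness of the unit sphere and homogeneity, G (x, u) is within e * norm u of G
  (x0, u) for all x near x0. The mean value inequality on segments then gives the bound at interior
  points of a convex piece, and a limit gives it at boundary points. Linearity of G in the direction
  is not yet available.\<close>

lemma directional_difference_bound:
  fixes g :: "'e::euclidean_space \<Rightarrow> 'f::euclidean_space"
  assumes S: "halfspace_open S" and x0: "x0 \<in> S" and e: "e > 0"
    and g: "continuous_on S g"
    and G: "continuous_on (S \<times> UNIV) G"
    and d: "\<And>x u. x \<in> interior S \<Longrightarrow> ((\<lambda>t. g (x + t *\<^sub>R u)) has_vector_derivative G (x, u)) (at 0)"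
  obtains r where "r > 0" "convex (S \<inter> ball x0 r)"
    "\<And>y z. y \<in> S \<inter> ball x0 r \<Longrightarrow> z \<in> S \<inter> ball x0 r \<Longrightarrow>
       norm (g z - g y - G (x0, z - y)) \<le> e * norm (z - y)"
proof -
  note hom = directional_derivative_scaleR[OF S _ G d]
  have "continuous_on (S \<times> sphere 0 1) G" using G by (rule continuous_on_subset) auto
  then obtain X where X: "x0 \<in> X" "open X"
    "\<forall>x\<in>X \<inter> S. \<forall>t\<in>sphere 0 1. dist (G (x, t)) (G (x0, t)) \<le> e"
    by (rule continuous_on_prod_compactE[OF _ _ x0 e]) auto
  have near: "norm (G (x, u) - G (x0, u)) \<le> e * norm u" if x: "x \<in> X \<inter> S" for x u
  proof (cases "u = 0")
    case True
    then show ?thesis using hom[of x 0 0] hom[of x0 0 0] x x0 by simp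
  next
    case False
    define w where "w = u /\<^sub>R norm u"
    have w: "w \<in> sphere 0 1" "u = norm u *\<^sub>R w" using False by (auto simp: w_def)
    have "G (x, u) - G (x0, u) = norm u *\<^sub>R (G (x, w) - G (x0, w))"
      using hom[of x "norm u" w] hom[of x0 "norm u" w] w(2) x x0 by (simp add: scaleR_diff_right)
    then have "norm (G (x, u) - G (x0, u)) = norm u * dist (G (x, w)) (G (x0, w))"
      by (simp add: dist_norm)
    also have "\<dots> \<le> norm u * e" using X(3) x w(1) by (intro mult_left_mono) auto
    finally show ?thesis by (simp add: mult.commute)
  qed
  obtain q where q: "q > 0" "ball x0 q \<subseteq> X" using X open_contains_ball[of X] by auto
  obtain r where r: "r > 0" "r \<le> q" "convex (S \<inter> ball x0 r)"
    using halfspace_open_convex_ball[OF S x0 q(1)] by auto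
  let ?C = "S \<inter> ball x0 r"
  have intC: "interior ?C = interior S \<inter> ball x0 r" by (simp add: interior_Int)
  have int_bound: "norm (g z - g y - G (x0, z - y)) \<le> e * norm (z - y)"
    if yz: "y \<in> interior ?C" "z \<in> interior ?C" for y z
  proof -
    \<comment> \<open>Subtracting the motion with the derivative frozen at x0 leaves a curve whose
      speed is at most e * norm (z - y).\<close>
    define h where "h t = g (y + t *\<^sub>R (z - y)) - t *\<^sub>R G (x0, z - y)" for t
    have seg: "y + t *\<^sub>R (z - y) \<in> interior ?C" if "t \<in> {0..1}" for t
    proof -
      have "y + t *\<^sub>R (z - y) = (1 - t) *\<^sub>R y + t *\<^sub>R z" by (simp add: algebra_simps)
      then show ?thesis
        using convexD_alt[OF convex_interior[OF r(3)] yz, of t] that by auto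
    qed
    have der: "(h has_vector_derivative G (y + t *\<^sub>R (z - y), z - y) - G (x0, z - y)) (at t)"
      if "t \<in> {0..1}" for t
    proof -
      have "((\<lambda>s. g ((y + t *\<^sub>R (z - y)) + s *\<^sub>R (z - y))) has_vector_derivative
          G (y + t *\<^sub>R (z - y), z - y)) (at 0)"
        using seg[OF that] intC by (intro d) auto
      then have "((\<lambda>s. g ((y + t *\<^sub>R (z - y)) + s *\<^sub>R (z - y))) \<circ> (\<lambda>s. s - t) has_vector_derivative
          1 *\<^sub>R G (y + t *\<^sub>R (z - y), z - y)) (at t)"
        by (intro vector_diff_chain_at) (auto intro!: derivative_eq_intros)
      moreover have "(\<lambda>s. g ((y + t *\<^sub>R (z - y)) + s *\<^sub>R (z - y))) \<circ> (\<lambda>s. s - t) =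
          (\<lambda>s. g (y + s *\<^sub>R (z - y)))"
        by (auto simp: algebra_simps)
      ultimately have "((\<lambda>s. g (y + s *\<^sub>R (z - y))) has_vector_derivative
          G (y + t *\<^sub>R (z - y), z - y)) (at t)" by simp
      then show ?thesis unfolding h_def by (auto intro!: derivative_eq_intros)
    qed
    have "norm (h 1 - h 0) \<le> (e * norm (z - y)) * norm (1 - 0 :: real)"
    proof (rule differentiable_bound[of "{0..1}"])
      fix t :: real assume t: "t \<in> {0..1}"
      show "(h has_derivative (\<lambda>s. s *\<^sub>R (G (y + t *\<^sub>R (z - y), z - y) - G (x0, z - y)))) (at t within {0..1})"
        using der[OF t] unfolding has_vector_derivative_def by (rule has_derivative_at_withinI)
      have "y + t *\<^sub>R (z - y) \<in> X \<inter> S"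
        using seg[OF t] q(2) r(2) interior_subset[of S] unfolding intC by auto
      then show "onorm (\<lambda>s. s *\<^sub>R (G (y + t *\<^sub>R (z - y), z - y) - G (x0, z - y))) \<le> e * norm (z - y)"
        using near by (intro onorm_le) (auto simp: mult.commute mult_left_mono)
    qed auto
    then show ?thesis by (simp add: h_def algebra_simps)
  qed
  have "norm (g z - g y - G (x0, z - y)) \<le> e * norm (z - y)" if yz: "y \<in> ?C" "z \<in> ?C" for y z
  proof -
    have "x0 \<in> closure (interior S)" using halfspace_open_subset_closure_interior[OF S] x0 by auto
    then obtain p where p: "p \<in> interior ?C"
      unfolding closure_approachable intC using r(1) by (auto simp: dist_commute)
    \<comment> \<open>Both points are pulled towards the interior point p, which scales their
      difference by 1 - s; then s tends to 0.\<close>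
    define sh where "sh s w = w - s *\<^sub>R (w - p)" for s w
    have int: "sh s w \<in> interior ?C" if "w \<in> ?C" "0 < s" "s \<le> 1" for w s
      unfolding sh_def by (rule mem_interior_convex_shrink[OF r(3) p that])
    have diff: "sh s z - sh s y = (1 - s) *\<^sub>R (z - y)" for s by (simp add: sh_def algebra_simps)
    have tend: "((\<lambda>s. g (sh s w)) \<longlongrightarrow> g w) (at_right 0)" if "w \<in> ?C" for w
    proof -
      have "((\<lambda>s. sh s w) \<longlongrightarrow> w) (at_right 0)"
        unfolding sh_def by (auto intro!: tendsto_eq_intros)
      moreover have ev: "\<forall>\<^sub>F s in at_right 0. sh s w \<in> S"
        unfolding eventually_at_right_field
        using int[OF that] interior_subset[of ?C] by (intro exI[of _ 1]) (auto simp: subset_iff)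
      moreover have "(g \<longlongrightarrow> g w) (at w within S)" using g that by (auto simp: continuous_on_def)
      ultimately show ?thesis
        using that by (intro continuous_on_tendsto_compose[OF g]) auto
    qed
    have "((\<lambda>s. norm (g (sh s z) - g (sh s y) - G (x0, (1 - s) *\<^sub>R (z - y)))) \<longlongrightarrow>
        norm (g z - g y - (1 - 0) *\<^sub>R G (x0, z - y))) (at_right 0)"
      by (simp only: hom[OF x0]) (intro tendsto_intros tend yz)
    moreover have "((\<lambda>s. e * norm ((1 - s) *\<^sub>R (z - y))) \<longlongrightarrow> e * norm ((1 - 0) *\<^sub>R (z - y))) (at_right (0::real))"
      by (intro tendsto_intros)
    moreover have "\<forall>\<^sub>F s in at_right (0::real). norm (g (sh s z) - g (sh s y) - G (x0, (1 - s) *\<^sub>R (z - y)))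
        \<le> e * norm ((1 - s) *\<^sub>R (z - y))"
      unfolding eventually_at_right_field
    proof (intro exI[of _ 1] conjI allI impI)
      fix s :: real assume s: "0 < s" "s < 1"
      show "norm (g (sh s z) - g (sh s y) - G (x0, (1 - s) *\<^sub>R (z - y))) \<le> e * norm ((1 - s) *\<^sub>R (z - y))"
        using int_bound[OF int[OF yz(1), of s] int[OF yz(2), of s]] s unfolding diff by simp
    qed simp
    ultimately have "norm (g z - g y - (1 - 0) *\<^sub>R G (x0, z - y)) \<le> e * norm ((1 - 0) *\<^sub>R (z - y))"
      by (intro tendsto_le[of "at_right (0::real)"]) auto
    then show ?thesis by simp
  qed
  then show ?thesis using that[of r] r by blast
qed

text \<open>Additivity of G (x0, u) in u is obtained by comparing the increments of g along the
  sides of a small triangle p, p + t u, p + t u + t v. The triangle sits at an interior point p near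
  x0, because x0 itself may lie on the boundary and its triangle may leave S. The difference bound
  with base point x0 is then the estimate of the remainder.\<close>

lemma directional_imp_has_derivative:
  fixes g :: "'e::euclidean_space \<Rightarrow> 'f::euclidean_space"
  assumes S: "halfspace_open S" and x0: "x0 \<in> S"
    and g: "continuous_on S g"
    and G: "continuous_on (S \<times> UNIV) G"
    and d: "\<And>x u. x \<in> interior S \<Longrightarrow> ((\<lambda>t. g (x + t *\<^sub>R u)) has_vector_derivative G (x, u)) (at 0)"
  shows "(g has_derivative (\<lambda>u. G (x0, u))) (at x0 within S)"
proof -
  let ?L = "\<lambda>u. G (x0, u)"
  have approx: "\<exists>p\<in>interior S. dist p x0 < r" if "r > 0" for r
    using halfspace_open_subset_closure_interior[OF S] x0 that
    unfolding closure_approachable subset_iff by blast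
  have small: "\<exists>p r. r > 0 \<and> ball p r \<subseteq> S \<inter> ball x0 q" if "q > 0" for q
  proof -
    obtain p where p: "p \<in> interior S" "dist p x0 < q" using approx[OF \<open>q > 0\<close>] by auto
    have "open (interior S \<inter> ball x0 q)" "p \<in> interior S \<inter> ball x0 q" using p by (auto simp: dist_commute)
    then obtain r where "r > 0" "ball p r \<subseteq> interior S \<inter> ball x0 q" using open_contains_ball by metis
    then show ?thesis using interior_subset[of S] by blast
  qed
  note hom = directional_derivative_scaleR[OF S x0 G d]
  have add: "?L (u + v) = ?L u + ?L v" for u v
  proof -
    define M where "M = norm (u + v) + norm u + norm v"
    have M0: "M \<ge> 0" by (simp add: M_def)
    have *: "norm (?L (u + v) - ?L u - ?L v) \<le> e * M" if e: "e > 0" for e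
    proof -
      obtain r where r: "r > 0" "convex (S \<inter> ball x0 r)"
        "\<And>y z. y \<in> S \<inter> ball x0 r \<Longrightarrow> z \<in> S \<inter> ball x0 r \<Longrightarrow>
           norm (g z - g y - ?L (z - y)) \<le> e * norm (z - y)"
        by (rule directional_difference_bound[OF S x0 e g G]) (erule d, rule that)
      obtain p s where p: "s > 0" "ball p s \<subseteq> S \<inter> ball x0 r" using small[OF r(1)] by blast
      define t where "t = s / (M + 1)"
      have t: "t > 0" using p(1) M0 by (simp add: t_def)
      have "t * (M + 1) = s" using M0 by (simp add: t_def)
      then have tM: "t * M < s" using t by (simp add: distrib_left)
      let ?q = "p + t *\<^sub>R u + t *\<^sub>R v"
      have in_ball: "p + t *\<^sub>R w \<in> S \<inter> ball x0 r" if "norm w \<le> M" for w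
      proof (rule subsetD[OF p(2)])
        have "norm (t *\<^sub>R w) \<le> t * M" using t that by simp
        then show "p + t *\<^sub>R w \<in> ball p s" using tM by (simp add: dist_norm)
      qed
      have in_C: "p \<in> S \<inter> ball x0 r" "p + t *\<^sub>R u \<in> S \<inter> ball x0 r" "?q \<in> S \<inter> ball x0 r"
        using in_ball[of 0] in_ball[of u] in_ball[of "u + v"] M0
        by (simp_all add: M_def scaleR_add_right add.assoc)
      have 1: "norm (g ?q - g p - t *\<^sub>R ?L (u + v)) \<le> e * (t * norm (u + v))"
      proof -
        have "?q - p = t *\<^sub>R (u + v)" by (simp add: scaleR_add_right)
        then show ?thesis using r(3)[OF in_C(1,3)] t hom[of t "u + v"] by (simp only: norm_scaleR abs_of_pos)
      qed
      have 2: "norm (g (p + t *\<^sub>R u) - g p - t *\<^sub>R ?L u) \<le> e * (t * norm u)"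
      proof -
        have "(p + t *\<^sub>R u) - p = t *\<^sub>R u" by simp
        then show ?thesis using r(3)[OF in_C(1,2)] t hom[of t u] by (simp only: norm_scaleR abs_of_pos)
      qed
      have 3: "norm (g ?q - g (p + t *\<^sub>R u) - t *\<^sub>R ?L v) \<le> e * (t * norm v)"
      proof -
        have "?q - (p + t *\<^sub>R u) = t *\<^sub>R v" by simp
        then show ?thesis using r(3)[OF in_C(2,3)] t hom[of t v] by (simp only: norm_scaleR abs_of_pos)
      qed
      have "t *\<^sub>R (?L (u + v) - ?L u - ?L v) =
          (g (p + t *\<^sub>R u) - g p - t *\<^sub>R ?L u) + (g ?q - g (p + t *\<^sub>R u) - t *\<^sub>R ?L v)
          - (g ?q - g p - t *\<^sub>R ?L (u + v))"
        by (simp add: algebra_simps)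
      then have "norm (t *\<^sub>R (?L (u + v) - ?L u - ?L v)) \<le> e * (t * norm u) + e * (t * norm v) + e * (t * norm (u + v))"
        using norm_triangle_le_diff[OF order_trans[OF add_right_mono[OF norm_triangle_le[OF add_mono[OF 2 3]]]
            add_left_mono[OF 1]]] by simp
      then have "t * norm (?L (u + v) - ?L u - ?L v) \<le> t * (e * M)"
        unfolding norm_scaleR using t(1) by (simp add: M_def distrib_left mult.left_commute)
      then show ?thesis using t(1) by simp
    qed
    have "norm (?L (u + v) - ?L u - ?L v) \<le> e" if "e > 0" for e
    proof -
      have "norm (?L (u + v) - ?L u - ?L v) \<le> e / (M + 1) * M"
        using that M0 by (intro *) auto
      also have "\<dots> \<le> e / (M + 1) * (M + 1)" using that M0 by (intro mult_left_mono) auto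
      finally show ?thesis using M0 by simp
    qed
    then have "norm (?L (u + v) - ?L u - ?L v) \<le> 0"
      using field_le_epsilon[of "norm (?L (u + v) - ?L u - ?L v)" 0] by simp
    then have "?L (u + v) - ?L u - ?L v = 0" by simp
    then show ?thesis by (simp only: diff_diff_eq right_minus_eq)
  qed
  have "linear ?L" by (rule linearI) (auto simp: add hom)
  then have bl: "bounded_linear ?L" by (rule linear_conv_bounded_linear[THEN iffD1])
  show ?thesis
    unfolding has_derivative_within_alt
  proof (intro conjI bl allI impI)
    fix e :: real assume "e > 0"
    obtain r where r: "r > 0" "convex (S \<inter> ball x0 r)"
      "\<And>y z. y \<in> S \<inter> ball x0 r \<Longrightarrow> z \<in> S \<inter> ball x0 r \<Longrightarrow>
         norm (g z - g y - ?L (z - y)) \<le> e * norm (z - y)"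
      by (rule directional_difference_bound[OF S x0 \<open>e > 0\<close> g G]) (erule d, rule that)
    then show "\<exists>d>0. \<forall>y\<in>S. norm (y - x0) < d \<longrightarrow> norm (g y - g x0 - ?L (y - x0)) \<le> e * norm (y - x0)"
      using x0 by (intro exI[of _ r] conjI ballI impI r(3)) (auto simp: dist_norm norm_minus_commute)
  qed
qed

section \<open>Joint continuity of iterated derivatives and comparison of the two notions of
  differentiability\<close>

lemma frechet_iter_linear_combination:
  fixes g :: "'i \<Rightarrow> 'e::euclidean_space \<Rightarrow> 'f::euclidean_space"
  assumes S: "halfspace_open S" and "\<And>i. i \<in> I \<Longrightarrow> hold 0 j S (g i)" "x \<in> S"
  shows "frechet_iter S (\<lambda>x. \<Sum>i\<in>I. c i *\<^sub>R g i x) j x v = (\<Sum>i\<in>I. c i *\<^sub>R frechet_iter S (g i) j x v)"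
  using assms(2,3)
proof (induction j arbitrary: x)
  case 0
  then show ?case by simp
next
  case (Suc j)
  let ?F = "\<lambda>y. \<Sum>i\<in>I. c i *\<^sub>R frechet_iter S (g i) j y v"
  have low: "hold 0 j S (g i)" if "i \<in> I" for i
    by (rule hold_decreasing[OF S]) (use Suc.prems(1)[OF that] in auto)
  have d: "((\<lambda>y. frechet_iter S (g i) j y v) has_derivative
      frechet_derivative (\<lambda>y. frechet_iter S (g i) j y v) (at x within S)) (at x within S)" if "i \<in> I" for i
    using Suc.prems(1)[OF that] Suc.prems(2) frechet_derivative_works
    unfolding frechet_nat_eq_hold[symmetric] frechet_Ck_on_def differentiable_on_def by (metis enat_ord_simps(2) lessI)
  have "(?F has_derivative (\<lambda>u. \<Sum>i\<in>I. c i *\<^sub>R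
      frechet_derivative (\<lambda>y. frechet_iter S (g i) j y v) (at x within S) u)) (at x within S)"
    by (intro has_derivative_sum has_derivative_scaleR_right d)
  then have D: "((\<lambda>y. frechet_iter S (\<lambda>x. \<Sum>i\<in>I. c i *\<^sub>R g i x) j y v) has_derivative (\<lambda>u. \<Sum>i\<in>I. c i *\<^sub>R
      frechet_derivative (\<lambda>y. frechet_iter S (g i) j y v) (at x within S) u)) (at x within S)"
    by (rule has_derivative_transform[OF Suc.prems(2), rotated]) (use Suc.IH low in auto)
  show ?case
    unfolding frechet_iter.simps halfspace_open_frechet_derivative[OF S Suc.prems(2) D] ..
qed

lemma dderiv_expand_Basis:
  assumes "g differentiable_on S" "x \<in> S"
  shows "dderiv S g e x = (\<Sum>b\<in>Basis. (e \<bullet> b) *\<^sub>R dderiv S g b x)"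
proof -
  have "linear (frechet_derivative g (at x within S))"
    using assms frechet_derivative_works has_derivative_linear unfolding differentiable_on_def by blast
  then show ?thesis unfolding dderiv_def by (rule linear_expand_Basis)
qed

lemma frechet_iter_cong:
  assumes "\<And>x. x \<in> S \<Longrightarrow> g x = h x" "x \<in> S"
  shows "frechet_iter S g j x v = frechet_iter S h j x v"
  using assms(2)
proof (induction j arbitrary: x)
  case 0
  then show ?case using assms(1) by simp
next
  case (Suc j)
  show ?case
    using dderiv_cong[of S "\<lambda>y. frechet_iter S g j y v" "\<lambda>y. frechet_iter S h j y v" x "v j"] Suc
    by (simp add: dderiv_def)
qed

text \<open>Expanding the first direction in the basis makes the dependence on it a finite sum with
  continuous coefficients; the remaining directions are handled by induction on the order.\<close>

lemma frechet_iter_jointly_continuous: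
  fixes g :: "'e::euclidean_space \<Rightarrow> 'f::euclidean_space"
  assumes S: "halfspace_open S" and "hold 0 j S g"
  shows "continuous_on (S \<times> UNIV) (\<lambda>p. frechet_iter S g j (fst p) (snd p))"
  using assms(2)
proof (induction j arbitrary: g)
  case 0
  then have "continuous_on S g" by simp
  then show ?case by (auto intro!: continuous_on_compose2[of S g] continuous_intros)
next
  case (Suc j)
  have h: "hold 0 j S (dderiv S g b)" for b using Suc.prems by simp
  let ?t = "\<lambda>v::nat \<Rightarrow> 'e. \<lambda>i. v (Suc i)"
  have eq: "frechet_iter S g (Suc j) x v =
      (\<Sum>b\<in>Basis. (v 0 \<bullet> b) *\<^sub>R frechet_iter S (dderiv S g b) j x (?t v))" if "x \<in> S" for x v
  proof -
    have "frechet_iter S g (Suc j) x v = frechet_iter S (dderiv S g (v 0)) j x (?t v)"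
      by (rule frechet_iter_shift)
    also have "\<dots> = frechet_iter S (\<lambda>x. \<Sum>b\<in>Basis. (v 0 \<bullet> b) *\<^sub>R dderiv S g b x) j x (?t v)"
      using Suc.prems by (intro frechet_iter_cong dderiv_expand_Basis that) auto
    also have "\<dots> = (\<Sum>b\<in>Basis. (v 0 \<bullet> b) *\<^sub>R frechet_iter S (dderiv S g b) j x (?t v))"
      by (intro frechet_iter_linear_combination S h that)
    finally show ?thesis .
  qed
  have ct: "continuous_on UNIV (\<lambda>v::nat \<Rightarrow> 'e. v i)" for i by (rule continuous_on_product_coordinates)
  have tail: "continuous_on UNIV ?t" by (intro continuous_on_coordinatewise_then_product ct)
  have "continuous_on (S \<times> UNIV) (\<lambda>p. \<Sum>b\<in>Basis. (snd p 0 \<bullet> b) *\<^sub>R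
      frechet_iter S (dderiv S g b) j (fst p) (?t (snd p)))"
  proof (intro continuous_on_sum continuous_on_scaleR continuous_on_inner continuous_on_const)
    show "continuous_on (S \<times> UNIV) (\<lambda>p::'e \<times> (nat \<Rightarrow> 'e). snd p 0)"
      by (rule continuous_on_compose2[OF ct]) (auto intro: continuous_intros)
    fix b :: 'e
    have "continuous_on (S \<times> UNIV) (\<lambda>p::'e \<times> (nat \<Rightarrow> 'e). (fst p, ?t (snd p)))"
      by (intro continuous_on_Pair continuous_on_compose2[OF tail]) (auto intro: continuous_intros)
    then have "continuous_on (S \<times> UNIV) (\<lambda>p. frechet_iter S (dderiv S g b) j
        (fst (fst p, ?t (snd p))) (snd (fst p, ?t (snd p))))"
      by (rule continuous_on_compose2[OF Suc.IH[OF h]]) auto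
    then show "continuous_on (S \<times> UNIV) (\<lambda>p. frechet_iter S (dderiv S g b) j (fst p) (?t (snd p)))"
      by (simp only: fst_conv snd_conv)
  qed
  then show ?case
  proof (rule continuous_on_eq)
    fix p :: "'e \<times> (nat \<Rightarrow> 'e)" assume "p \<in> S \<times> UNIV"
    then have "fst p \<in> S" by auto
    from eq[OF this, of "snd p"]
    show "(\<Sum>b\<in>Basis. (snd p 0 \<bullet> b) *\<^sub>R frechet_iter S (dderiv S g b) j (fst p) (?t (snd p))) =
        frechet_iter S g (Suc j) (fst p) (snd p)" by (rule sym)
  qed
qed

text \<open>Order j reads only the directions below j, so slot j is free to serve as the variable
  direction of the next differentiation.\<close>

lemma dir_iter_upd: "j \<le> i \<Longrightarrow> dir_iter g j x (v(i := e)) = dir_iter g j x v"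
  by (induction j arbitrary: x) auto

lemma line_derivative_interior:
  assumes "(f has_derivative D) (at x within S)" "x \<in> interior S"
    "\<And>y. y \<in> interior S \<Longrightarrow> f y = h y"
  shows "((\<lambda>t. h (x + t *\<^sub>R u)) has_vector_derivative D u) (at 0)"
proof -
  have f: "(f has_derivative D) (at x)"
    using assms(1) unfolding at_within_interior[OF assms(2)] .
  have "(h has_derivative D) (at x)"
    by (rule has_derivative_transform_within_open[OF f open_interior assms(2,3)])
  then have D: "(h has_derivative D) (at (x + 0 *\<^sub>R u))" by simp
  have "((\<lambda>t. x + t *\<^sub>R u) has_derivative (\<lambda>t. t *\<^sub>R u)) (at 0)"
    by (auto intro!: derivative_eq_intros)
  from diff_chain_at[OF this D] have "(h \<circ> (\<lambda>t. x + t *\<^sub>R u) has_derivative D \<circ> (\<lambda>t. t *\<^sub>R u)) (at 0)" .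
  moreover have "D \<circ> (\<lambda>t. t *\<^sub>R u) = (\<lambda>t. t *\<^sub>R D u)"
    using has_derivative_linear[OF assms(1)] by (auto simp: linear_cmul)
  ultimately show ?thesis by (simp add: has_vector_derivative_def o_def)
qed

text \<open>The continuous extensions G j are the candidates for the derivatives up to the boundary.
  If the Frechet derivative of order j equals G j on S, the directional derivatives in the interior
  and the continuity of G (Suc j) give a Frechet derivative at every point of S, and it is G (Suc
  j).\<close>

lemma bastiani_imp_frechet:
  fixes g :: "'e::euclidean_space \<Rightarrow> 'f::euclidean_space"
  assumes S: "halfspace_open S" and g: "bastiani_Ck_on k S g"
  shows "frechet_Ck_on k S g"
proof -
  have cont: "continuous_on S g" using g by (simp add: bastiani_Ck_on_def)
  have diff: "(\<lambda>t. dir_iter g j (x + t *\<^sub>R v j) v) differentiable (at 0)"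
    if "enat j < k" "x \<in> interior S" for j x v
    using g that unfolding bastiani_Ck_on_def by blast
  have "\<forall>j. \<exists>G. enat j \<le> k \<longrightarrow> continuous_on (S \<times> UNIV) G \<and>
      (\<forall>x\<in>interior S. \<forall>v. G (x, v) = dir_iter g j x v)"
    using g unfolding bastiani_Ck_on_def by blast
  then obtain G where G: "\<And>j. enat j \<le> k \<Longrightarrow> continuous_on (S \<times> UNIV) (G j)"
    "\<And>j x v. enat j \<le> k \<Longrightarrow> x \<in> interior S \<Longrightarrow> G j (x, v) = dir_iter g j x v" by metis
  have contG: "continuous_on S (\<lambda>x. G j (x, v))" if "enat j \<le> k" for j v
    by (intro continuous_on_compose2[OF G(1)[OF that]] continuous_intros) auto
  have der: "((\<lambda>x. frechet_iter S g j x v) has_derivative (\<lambda>u. G (Suc j) (x, v(j := u)))) (at x within S)"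
    if j: "enat j < k" and eq: "\<And>v y. y \<in> S \<Longrightarrow> frechet_iter S g j y v = G j (y, v)" and x: "x \<in> S" for j x v
  proof -
    have j1: "enat (Suc j) \<le> k" using j by (simp add: Suc_ile_eq)
    have upd: "continuous_on UNIV (\<lambda>u. v(j := u))"
    proof (rule continuous_on_coordinatewise_then_product)
      fix i show "continuous_on UNIV (\<lambda>u. (v(j := u)) i)" by (cases "i = j") auto
    qed
    have Gc: "continuous_on (S \<times> UNIV) (\<lambda>p. G (Suc j) (fst p, v(j := snd p)))"
      by (rule continuous_on_compose2[OF G(1)[OF j1]])
        (intro continuous_on_Pair continuous_on_fst continuous_on_id
          continuous_on_compose2[OF upd continuous_on_snd[OF continuous_on_id] subset_UNIV], auto)
    have "continuous_on S (\<lambda>y. frechet_iter S g j y v)"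
      using contG[of j v] j eq by (simp cong: continuous_on_cong)
    moreover have "((\<lambda>t. frechet_iter S g j (y + t *\<^sub>R u) v) has_vector_derivative
        G (Suc j) (y, v(j := u))) (at 0)" if y: "y \<in> interior S" for y u
    proof -
      have "((\<lambda>t. dir_iter g j (y + t *\<^sub>R u) (v(j := u))) has_vector_derivative
          G (Suc j) (y, v(j := u))) (at 0)"
        using diff[OF j y, of "v(j := u)"] G(2)[OF j1 y, of "v(j := u)"]
        by (simp add: vector_derivative_works)
      moreover have "dir_iter g j (y + t *\<^sub>R u) (v(j := u)) = frechet_iter S g j (y + t *\<^sub>R u) v"
        if "y + t *\<^sub>R u \<in> interior S" for t
        using that eq[of "y + t *\<^sub>R u" v] G(2)[of j "y + t *\<^sub>R u" v] j interior_subset[of S]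
        by (auto simp: dir_iter_upd)
      moreover have "open ((\<lambda>t. y + t *\<^sub>R u) -` interior S)"
        by (intro open_vimage open_interior continuous_intros)
      moreover have "0 \<in> (\<lambda>t. y + t *\<^sub>R u) -` interior S" using y by simp
      ultimately show ?thesis
        using has_vector_derivative_transform_within_open[of
          "\<lambda>t. dir_iter g j (y + t *\<^sub>R u) (v(j := u))" _ 0 "(\<lambda>t. y + t *\<^sub>R u) -` interior S"
          "\<lambda>t. frechet_iter S g j (y + t *\<^sub>R u) v"] by simp
    qed
    ultimately show ?thesis
      using directional_imp_has_derivative[OF S x _ Gc, of "\<lambda>y. frechet_iter S g j y v"] by simp
  qed
  have eq: "enat j \<le> k \<Longrightarrow> x \<in> S \<Longrightarrow> frechet_iter S g j x v = G j (x, v)" for j x v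
  proof (induction j arbitrary: x v)
    case 0
    then show ?case
      using eq_on_halfspace_open[OF S cont contG[OF 0(1), of v] _ 0(2)] G(2)[OF 0(1)] by simp
  next
    case (Suc j)
    then have j: "enat j < k" by (simp add: Suc_ile_eq)
    have D: "((\<lambda>x. frechet_iter S g j x v) has_derivative (\<lambda>u. G (Suc j) (x, v(j := u)))) (at x within S)"
      using der[OF j] Suc.IH j Suc.prems(2) by simp
    then have "frechet_derivative (\<lambda>x. frechet_iter S g j x v) (at x within S) = (\<lambda>u. G (Suc j) (x, v(j := u)))"
      by (rule halfspace_open_frechet_derivative[OF S Suc.prems(2)])
    then show ?case by simp
  qed
  show ?thesis
    unfolding frechet_Ck_on_def
  proof (intro conjI allI impI)
    fix j v assume j: "enat j < k"
    show "(\<lambda>x. frechet_iter S g j x v) differentiable_on S"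
      unfolding differentiable_on_def differentiable_def
      using der[OF j eq[OF less_imp_le[OF j]], of _ v] by blast
  next
    fix j v assume j: "enat j \<le> k"
    show "continuous_on S (\<lambda>x. frechet_iter S g j x v)"
      using contG[OF j, of v] eq[OF j] by (simp cong: continuous_on_cong)
  qed
qed

lemma frechet_imp_bastiani:
  fixes g :: "'e::euclidean_space \<Rightarrow> 'f::euclidean_space"
  assumes S: "halfspace_open S" and g: "frechet_Ck_on k S g"
  shows "bastiani_Ck_on k S g"
proof -
  have hold: "hold 0 j S g" if "enat j \<le> k" for j
    unfolding frechet_nat_eq_hold[symmetric] frechet_Ck_on_def
  proof (intro conjI allI impI)
    fix i v
    show "(\<lambda>x. frechet_iter S g i x v) differentiable_on S" if "enat i < enat j"
      using g less_le_trans[OF that \<open>enat j \<le> k\<close>] unfolding frechet_Ck_on_def by blast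
    show "continuous_on S (\<lambda>x. frechet_iter S g i x v)" if "enat i \<le> enat j"
      using g order_trans[OF that \<open>enat j \<le> k\<close>] unfolding frechet_Ck_on_def by blast
  qed
  have der: "((\<lambda>x. frechet_iter S g j x v) has_derivative
      frechet_derivative (\<lambda>x. frechet_iter S g j x v) (at x within S)) (at x within S)"
    if "enat j < k" "x \<in> S" for j x v
    using g that frechet_derivative_works unfolding frechet_Ck_on_def differentiable_on_def by blast
  have line: "((\<lambda>t. dir_iter g j (x + t *\<^sub>R v j) v) has_vector_derivative frechet_iter S g (Suc j) x v) (at 0)"
    if "enat j < k" "x \<in> interior S" "\<And>y v. y \<in> interior S \<Longrightarrow> frechet_iter S g j y v = dir_iter g j y v" for j x v
  proof -
    have "x \<in> S" using that(2) interior_subset by auto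
    from line_derivative_interior[OF der[OF that(1) this] that(2,3), of "v j"] show ?thesis by simp
  qed
  have eq: "enat j \<le> k \<Longrightarrow> x \<in> interior S \<Longrightarrow> frechet_iter S g j x v = dir_iter g j x v" for j x v
  proof (induction j arbitrary: x v)
    case (Suc j)
    then have j: "enat j < k" "enat j \<le> k" by (auto simp: Suc_ile_eq)
    show ?case
      using line[OF j(1) Suc.prems(2) Suc.IH[OF j(2)], of v] by (simp add: vector_derivative_at)
  qed simp
  show ?thesis
    unfolding bastiani_Ck_on_def
  proof (intro conjI allI impI ballI)
    show "continuous_on S g" using hold_continuous[OF hold[of 0]] by (simp add: zero_enat_def[symmetric])
  next
    fix j x v assume "enat j < k" "x \<in> interior S"
    then show "(\<lambda>t. dir_iter g j (x + t *\<^sub>R v j) v) differentiable at 0"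
      using line[of j x v] eq[of j] by (auto simp: differentiableI_vector)
  next
    fix j assume j: "enat j \<le> k"
    show "\<exists>G. continuous_on (S \<times> UNIV) G \<and> (\<forall>x\<in>interior S. \<forall>v. G (x, v) = dir_iter g j x v)"
      using frechet_iter_jointly_continuous[OF S hold[OF j]] eq[OF j]
      by (intro exI[of _ "\<lambda>p. frechet_iter S g j (fst p) (snd p)"]) auto
  qed
qed

lemma bastiani_eq_frechet: "halfspace_open S \<Longrightarrow> bastiani_Ck_on k S g \<longleftrightarrow> frechet_Ck_on k S g"
  using bastiani_imp_frechet frechet_imp_bastiani by blast

section \<open>Smooth functions\<close>

lemma smooth_add:
  assumes "halfspace_open S" "frechet_Ck_on \<infinity> S g" "frechet_Ck_on \<infinity> S h"
  shows "frechet_Ck_on \<infinity> S (\<lambda>x. g x + h x)"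
  using assms unfolding frechet_infinity_eq_hold by (blast intro: hold_add)

lemma smooth_const: "halfspace_open S \<Longrightarrow> frechet_Ck_on \<infinity> S (\<lambda>_. c)"
  unfolding frechet_infinity_eq_hold by (blast intro: hold_const)

lemma smooth_mult:
  fixes g h :: "'e::euclidean_space \<Rightarrow> real"
  assumes "halfspace_open S" "frechet_Ck_on \<infinity> S g" "frechet_Ck_on \<infinity> S h"
  shows "frechet_Ck_on \<infinity> S (\<lambda>x. g x * h x)"
  unfolding frechet_infinity_eq_hold
proof
  fix k show "hold 0 k S (\<lambda>x. g x * h x)"
    by (rule hold_mult[OF assms(1)]) (use assms in \<open>auto simp: frechet_infinity_eq_hold\<close>)
qed

lemma smooth_linear:
  assumes "halfspace_open S" "bounded_linear L" "frechet_Ck_on \<infinity> S g"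
  shows "frechet_Ck_on \<infinity> S (\<lambda>x. L (g x))"
  unfolding frechet_infinity_eq_hold
proof
  fix k show "hold 0 k S (\<lambda>x. L (g x))"
    by (rule hold_linear[OF assms(1,2)]) (use assms in \<open>auto simp: frechet_infinity_eq_hold\<close>)
qed

lemma smooth_sum:
  assumes "halfspace_open S" "\<And>i. i \<in> I \<Longrightarrow> frechet_Ck_on \<infinity> S (g i)"
  shows "frechet_Ck_on \<infinity> S (\<lambda>x. \<Sum>i\<in>I. g i x)"
  unfolding frechet_infinity_eq_hold
proof
  fix k show "hold 0 k S (\<lambda>x. \<Sum>i\<in>I. g i x)"
    by (rule hold_sum[OF assms(1)]) (use assms in \<open>auto simp: frechet_infinity_eq_hold\<close>)
qed

lemma smooth_compose:
  fixes s :: "'g::euclidean_space \<Rightarrow> real"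
  assumes "halfspace_open S" "halfspace_open T" "frechet_Ck_on \<infinity> T s" "frechet_Ck_on \<infinity> S g" "g ` S \<subseteq> T"
  shows "frechet_Ck_on \<infinity> S (\<lambda>x. s (g x))"
  unfolding frechet_infinity_eq_hold
proof
  fix k show "hold 0 k S (\<lambda>x. s (g x))"
    by (rule hold_compose[OF assms(1,2) _ _ assms(3) _ assms(5)])
      (use assms in \<open>auto simp: frechet_infinity_eq_hold\<close>)
qed

lemma smooth_cong:
  assumes "\<And>x. x \<in> S \<Longrightarrow> g x = h x"
  shows "frechet_Ck_on \<infinity> S g \<longleftrightarrow> frechet_Ck_on \<infinity> S h"
proof -
  have "hold 0 k S g \<longleftrightarrow> hold 0 k S h" for k by (rule hold_cong) (rule assms)
  then show ?thesis unfolding frechet_infinity_eq_hold by simp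
qed

lemma smooth_openin:
  "openin (top_of_set S) S' \<Longrightarrow> frechet_Ck_on \<infinity> S g \<Longrightarrow> frechet_Ck_on \<infinity> S' g"
  unfolding frechet_infinity_eq_hold using hold_openin by blast

lemma smooth_local:
  assumes "\<And>x. x \<in> S \<Longrightarrow> \<exists>S'. openin (top_of_set S) S' \<and> x \<in> S' \<and> frechet_Ck_on \<infinity> S' g"
  shows "frechet_Ck_on \<infinity> S g"
  unfolding frechet_infinity_eq_hold
proof
  fix k show "hold 0 k S g"
    by (rule hold_local) (use assms in \<open>auto simp: frechet_infinity_eq_hold\<close>)
qed

lemma smooth_open_subset:
  assumes "frechet_Ck_on \<infinity> UNIV g" "halfspace_open S" "open S"
  shows "frechet_Ck_on \<infinity> S g"
  by (rule smooth_openin[OF _ assms(1)]) (use assms in auto)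

lemma smooth_id: "halfspace_open S \<Longrightarrow> frechet_Ck_on \<infinity> S (\<lambda>x. x)"
  unfolding frechet_infinity_eq_hold
proof
  fix k assume S: "halfspace_open S"
  show "hold 0 k S (\<lambda>x. x)"
  proof (cases k)
    case 0
    then show ?thesis by (simp add: continuous_locally_hoelder_0)
  next
    case (Suc j)
    show ?thesis unfolding Suc
      by (rule hold_SucI[OF S, where g' = "\<lambda>x e. e"]) (auto intro: hold_const S)
  qed
qed

lemma smooth_inner: "halfspace_open S \<Longrightarrow> frechet_Ck_on \<infinity> S (\<lambda>x. x \<bullet> b)"
  by (rule smooth_linear[OF _ bounded_linear_inner_left smooth_id])

lemma smooth_continuous: "frechet_Ck_on \<infinity> S g \<Longrightarrow> continuous_on S g"
  unfolding frechet_infinity_eq_hold using hold_continuous by blast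

text \<open>Listing all derivatives of \<open>D 0\<close> explicitly gives names to the coefficients
  D m (\<alpha> x) that occur in repeated chain rules.\<close>

definition derivative_sequence :: "real set \<Rightarrow> (nat \<Rightarrow> real \<Rightarrow> real) \<Rightarrow> bool" where
  "derivative_sequence T D \<longleftrightarrow> (\<forall>m. \<forall>y\<in>T. (D m has_real_derivative D (Suc m) y) (at y))"

lemma derivative_sequence_continuous:
  "derivative_sequence T D \<Longrightarrow> continuous_on T (D m)"
  unfolding derivative_sequence_def
  by (meson DERIV_isCont continuous_at_imp_continuous_on)

lemma derivative_sequence_smooth:
  assumes "derivative_sequence T D" "open T"
  shows "frechet_Ck_on \<infinity> T (D m)"
  unfolding frechet_infinity_eq_hold
proof
  fix k
  have T: "halfspace_open T" by (rule open_imp_halfspace_open) fact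
  show "hold 0 k T (D m)"
  proof (induction k arbitrary: m)
    case 0
    show ?case using derivative_sequence_continuous[OF assms(1)] by (simp add: continuous_locally_hoelder_0)
  next
    case (Suc k)
    show ?case
    proof (rule hold_SucI[OF T])
      fix x assume "x \<in> T"
      then show "(D m has_derivative (\<lambda>e. D (Suc m) x * e)) (at x within T)"
        using assms(1) unfolding derivative_sequence_def has_field_derivative_def
        by (blast intro: has_derivative_at_withinI)
    next
      show "hold 0 k T (\<lambda>x. D (Suc m) x * e)" for e
        by (rule hold_linear[OF T bounded_linear_mult_left Suc])
    qed
  qed
qed

lemma derivative_sequence_exp: "derivative_sequence UNIV (\<lambda>_. exp)"
  by (auto simp: derivative_sequence_def intro!: derivative_eq_intros)

lemma derivative_sequence_id:
  "derivative_sequence UNIV (\<lambda>m y. if m = 0 then y else if m = 1 then 1 else 0)"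
  unfolding derivative_sequence_def
proof (intro allI ballI)
  fix m :: nat and y :: real
  consider "m = 0" | "m = 1" | "m \<ge> 2" by linarith
  then show "((\<lambda>y. if m = 0 then y else if m = 1 then 1 else 0) has_real_derivative
      (if Suc m = 0 then y else if Suc m = 1 then 1 else 0)) (at y)"
    by cases (auto intro!: derivative_eq_intros)
qed

lemma derivative_sequence_inverse:
  "derivative_sequence {0<..} (\<lambda>m y. (-1) ^ m * fact m * inverse y ^ Suc m)"
  unfolding derivative_sequence_def
proof (intro allI ballI)
  fix m and y :: real assume "y \<in> {0<..}"
  then have "((\<lambda>y. inverse y ^ Suc m) has_real_derivative
      real (Suc m) * (- (inverse y ^ Suc (Suc 0)) * inverse y ^ (Suc m - Suc 0))) (at y)"
    by (intro DERIV_power DERIV_inverse) auto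
  from DERIV_cmult[OF this, of "(-1) ^ m * fact m"]
  show "((\<lambda>y. (-1) ^ m * fact m * inverse y ^ Suc m) has_real_derivative
      (-1) ^ Suc m * fact (Suc m) * inverse y ^ Suc (Suc m)) (at y)"
    by (rule DERIV_cong) simp
qed

lemma derivative_sequence_ln:
  "derivative_sequence {0<..} (\<lambda>m y. case m of 0 \<Rightarrow> ln y | Suc i \<Rightarrow> (-1) ^ i * fact i * inverse y ^ Suc i)"
  unfolding derivative_sequence_def
proof (intro allI ballI)
  fix m and y :: real assume y: "y \<in> {0<..}"
  show "((\<lambda>y. case m of 0 \<Rightarrow> ln y | Suc i \<Rightarrow> (-1) ^ i * fact i * inverse y ^ Suc i) has_real_derivative
      (case Suc m of 0 \<Rightarrow> ln y | Suc i \<Rightarrow> (-1) ^ i * fact i * inverse y ^ Suc i)) (at y)"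
  proof (cases m)
    case 0
    then show ?thesis using y by (auto intro!: derivative_eq_intros simp: inverse_eq_divide)
  next
    case (Suc i)
    then show ?thesis
      using derivative_sequence_inverse y unfolding derivative_sequence_def by simp
  qed
qed

lemma smooth_exp: "frechet_Ck_on \<infinity> UNIV (exp :: real \<Rightarrow> real)"
  using derivative_sequence_smooth[OF derivative_sequence_exp open_UNIV] by simp

lemma smooth_ln: "frechet_Ck_on \<infinity> {0<..} (ln :: real \<Rightarrow> real)"
  using derivative_sequence_smooth[OF derivative_sequence_ln, of 0] by simp

lemma smooth_inverse: "frechet_Ck_on \<infinity> {0<..} (inverse :: real \<Rightarrow> real)"
  using derivative_sequence_smooth[OF derivative_sequence_inverse, of 0] by simp

section \<open>Bump functions\<close>

text \<open>\<open>flat 0\<close> is the classical smooth function exp (- 1/x) vanishing for x \<le>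
  0; the powers of 1/x make the family closed under differentiation up to linear
  combinations.\<close>

definition flat :: "nat \<Rightarrow> real \<Rightarrow> real" where
  "flat q x = (if x > 0 then (1/x) ^ q * exp (- (1/x)) else 0)"

lemma flat_tendsto_0: "(flat q \<longlongrightarrow> 0) (at_right 0)"
proof -
  have "((\<lambda>y::real. y ^ q / exp y) \<longlongrightarrow> 0) at_top" by (rule tendsto_power_div_exp_0)
  moreover have "filterlim (\<lambda>x::real. inverse x) at_top (at_right 0)" by (rule filterlim_inverse_at_top_right)
  ultimately have "((\<lambda>x::real. inverse x ^ q / exp (inverse x)) \<longlongrightarrow> 0) (at_right 0)"
    by (rule filterlim_compose)
  then show ?thesis
    by (rule Lim_transform_eventually)
      (auto simp: eventually_at_right_field flat_def exp_minus divide_inverse intro!: exI[of _ 1])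
qed

lemma flat_deriv:
  "(flat q has_real_derivative flat (q + 2) x - q * flat (Suc q) x) (at x)"
proof -
  consider "x > 0" | "x < 0" | "x = 0" by linarith
  then show ?thesis
  proof cases
    case 1
    have "((\<lambda>x. (1/x) ^ q * exp (- (1/x))) has_real_derivative flat (q + 2) x - q * flat (Suc q) x) (at x)"
    proof -
      have inv: "((\<lambda>x. 1/x) has_real_derivative - ((1/x)^2)) (at x)"
        using 1 by (auto intro!: derivative_eq_intros simp: power2_eq_square)
      have e: "((\<lambda>x. exp (- (1/x))) has_real_derivative exp (- (1/x)) * (1/x)^2) (at x)"
        using DERIV_fun_exp[OF DERIV_minus[OF inv]] by simp
      have p: "((\<lambda>x. (1/x) ^ q) has_real_derivative - (q * (1/x) ^ Suc q)) (at x)"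
      proof (cases q)
        case (Suc i)
        then show ?thesis
          using DERIV_power[OF inv, of q] by (simp add: power2_eq_square algebra_simps)
      qed simp
      show ?thesis
        using DERIV_mult[OF p e] 1 by (simp add: flat_def power2_eq_square algebra_simps)
    qed
    then show ?thesis
      by (rule has_field_derivative_transform_within_open[where S = "{0<..}"]) (use 1 in \<open>auto simp: flat_def\<close>)
  next
    case 2
    have "((\<lambda>x::real. 0) has_real_derivative flat (q + 2) x - q * flat (Suc q) x) (at x)"
      using 2 by (simp add: flat_def)
    then show ?thesis
      by (rule has_field_derivative_transform_within_open[where S = "{..<0}"]) (use 2 in \<open>auto simp: flat_def\<close>)
  next
    case 3
    have "((\<lambda>h. (flat q (0 + h) - flat q 0) / h) \<longlongrightarrow> 0) (at 0)"
    proof (rule filterlim_split_at)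
      show "((\<lambda>h. (flat q (0 + h) - flat q 0) / h) \<longlongrightarrow> 0) (at_left 0)"
        by (rule Lim_transform_eventually[OF tendsto_const])
          (auto simp: flat_def eventually_at_left_field intro!: exI[of _ "-1"])
      show "((\<lambda>h. (flat q (0 + h) - flat q 0) / h) \<longlongrightarrow> 0) (at_right 0)"
        by (rule Lim_transform_eventually[OF flat_tendsto_0[of "Suc q"]])
          (auto simp: flat_def eventually_at_right_field intro!: exI[of _ 1])
    qed
    then show ?thesis using 3 by (simp add: DERIV_def flat_def)
  qed
qed

lemma smooth_flat: "frechet_Ck_on \<infinity> UNIV (flat q)"
  unfolding frechet_infinity_eq_hold
proof
  have U: "halfspace_open (UNIV :: real set)" by (rule open_imp_halfspace_open) simp
  fix k show "hold 0 k UNIV (flat q)"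
  proof (induction k arbitrary: q)
    case 0
    have "continuous_on UNIV (flat q)"
      using flat_deriv DERIV_isCont continuous_at_imp_continuous_on by blast
    then show ?case by (simp add: continuous_locally_hoelder_0)
  next
    case (Suc k)
    show ?case
    proof (rule hold_SucI[OF U])
      show "(flat q has_derivative (\<lambda>e. (flat (q + 2) x + (- q) * flat (Suc q) x) * e)) (at x within UNIV)" for x
        using flat_deriv[of q x] unfolding has_field_derivative_def by simp
      show "hold 0 k UNIV (\<lambda>x. (flat (q + 2) x + (- q) * flat (Suc q) x) * e)" for e
        by (intro hold_linear[OF U bounded_linear_mult_left] hold_add[OF U Suc]
            hold_linear[OF U bounded_linear_mult_right Suc])
    qed
  qed
qed

lemma flat_nonneg: "flat q x \<ge> 0" by (simp add: flat_def)
lemma flat_pos_iff: "flat q x > 0 \<longleftrightarrow> x > 0" by (simp add: flat_def)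

definition smooth_step :: "real \<Rightarrow> real" where
  "smooth_step x = flat 0 x * inverse (flat 0 x + flat 0 (1 - x))"

lemma smooth_step_eq_0: "x \<le> 0 \<Longrightarrow> smooth_step x = 0"
  by (simp add: smooth_step_def flat_def)

lemma smooth_step_eq_1: "x \<ge> 1 \<Longrightarrow> smooth_step x = 1"
  by (simp add: smooth_step_def flat_def)

lemma smooth_step_denominator: "flat 0 x + flat 0 (1 - x) > 0"
  using flat_pos_iff[of 0 x] flat_pos_iff[of 0 "1 - x"] flat_nonneg[of 0 x] flat_nonneg[of 0 "1 - x"]
  by linarith

lemma smooth_step_bounds: "0 \<le> smooth_step x" "smooth_step x \<le> 1"
  using smooth_step_denominator[of x] flat_nonneg[of 0 x] flat_nonneg[of 0 "1 - x"]
  by (auto simp: smooth_step_def divide_simps)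

lemma halfspace_open_UNIV: "halfspace_open UNIV"
  by (rule open_imp_halfspace_open) simp

lemma smooth_smooth_step: "frechet_Ck_on \<infinity> UNIV smooth_step"
proof -
  note U = halfspace_open_UNIV
  have r: "frechet_Ck_on \<infinity> UNIV (\<lambda>x::real. 1 + (-1) * x)"
    by (intro smooth_add U smooth_const smooth_mult smooth_id)
  have f: "frechet_Ck_on \<infinity> UNIV (\<lambda>x. flat 0 (1 - x))"
    using smooth_compose[OF U U smooth_flat r] by simp
  have "frechet_Ck_on \<infinity> UNIV (\<lambda>x. inverse (flat 0 x + flat 0 (1 - x)))"
    by (rule smooth_compose[OF U _ smooth_inverse smooth_add[OF U smooth_flat f]])
      (use smooth_step_denominator in \<open>auto intro: open_imp_halfspace_open\<close>)
  then show ?thesis unfolding smooth_step_def[abs_def] by (intro smooth_mult U smooth_flat)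
qed

lemma smooth_dist_square: "frechet_Ck_on \<infinity> UNIV (\<lambda>y::'e::euclidean_space. (dist y y0)\<^sup>2)"
proof -
  note U = halfspace_open_UNIV
  have "frechet_Ck_on \<infinity> UNIV (\<lambda>y. \<Sum>b\<in>Basis. (y \<bullet> b + - (y0 \<bullet> b)) * (y \<bullet> b + - (y0 \<bullet> b)))"
    by (intro smooth_sum U smooth_mult smooth_add smooth_inner smooth_const)
  moreover have "(dist y y0)\<^sup>2 = (\<Sum>b\<in>Basis. (y \<bullet> b + - (y0 \<bullet> b)) * (y \<bullet> b + - (y0 \<bullet> b)))" for y
  proof -
    have "(dist y y0)\<^sup>2 = (y - y0) \<bullet> (y - y0)" by (simp add: dist_norm power2_norm_eq_inner)
    also have "\<dots> = (\<Sum>b\<in>Basis. ((y - y0) \<bullet> b) * ((y - y0) \<bullet> b))" by (rule euclidean_inner)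
    finally show ?thesis by (simp add: inner_diff_left)
  qed
  ultimately show ?thesis by simp
qed

text \<open>The squared distance is smooth also at the centre. The constants make the argument of
  the step 0 at distance r and at least 1 up to distance r / 2.\<close>

definition bump :: "'e::euclidean_space \<Rightarrow> real \<Rightarrow> 'e \<Rightarrow> real" where
  "bump y0 r y = smooth_step (2 - 2 / r\<^sup>2 * (dist y y0)\<^sup>2)"

lemma smooth_bump: "frechet_Ck_on \<infinity> UNIV (bump y0 r)"
proof -
  note U = halfspace_open_UNIV
  have "frechet_Ck_on \<infinity> UNIV (\<lambda>y. 2 + (- (2 / r\<^sup>2)) * (dist y y0)\<^sup>2)"
    by (intro smooth_add smooth_mult smooth_const smooth_dist_square U)
  from smooth_compose[OF U U smooth_smooth_step this] show ?thesis
    by (simp add: bump_def[abs_def])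
qed

lemma bump_bounds: "0 \<le> bump y0 r y" "bump y0 r y \<le> 1"
  by (simp_all add: bump_def smooth_step_bounds)

lemma bump_eq_0: "r > 0 \<Longrightarrow> dist y y0 \<ge> r \<Longrightarrow> bump y0 r y = 0"
proof -
  assume r: "r > 0" "dist y y0 \<ge> r"
  then have "r\<^sup>2 \<le> (dist y y0)\<^sup>2" by (intro power_mono) auto
  then show ?thesis unfolding bump_def using r by (intro smooth_step_eq_0) (simp add: field_simps)
qed

lemma bump_eq_1: "r > 0 \<Longrightarrow> dist y y0 \<le> r / 2 \<Longrightarrow> bump y0 r y = 1"
proof -
  assume r: "r > 0" "dist y y0 \<le> r / 2"
  then have "(dist y y0)\<^sup>2 \<le> (r/2)\<^sup>2" by (intro power_mono) auto
  then have "(dist y y0)\<^sup>2 \<le> r\<^sup>2 / 4" by (simp add: power_divide)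
  then have "2 * (dist y y0)\<^sup>2 \<le> r\<^sup>2" using zero_le_power2[of r] by linarith
  then show ?thesis unfolding bump_def using r by (intro smooth_step_eq_1) (simp add: field_simps)
qed

section \<open>Interpolation by a smooth function of one variable\<close>

lemma smooth_derivative_sequence:
  fixes g :: "real \<Rightarrow> real"
  assumes "frechet_Ck_on \<infinity> UNIV g"
  obtains D where "D 0 = g" "derivative_sequence UNIV D"
proof -
  define D where "D m = ((\<lambda>h. dderiv UNIV h 1) ^^ m) g" for m
  have sm: "frechet_Ck_on \<infinity> UNIV (D m)" for m
  proof (induction m)
    case (Suc m)
    then show ?case unfolding D_def frechet_infinity_eq_hold using hold.simps(2) by fastforce
  qed (simp add: D_def assms)
  have "(D m has_real_derivative D (Suc m) y) (at y)" for m y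
  proof -
    have "D m differentiable (at y)"
      using sm[of m] unfolding frechet_infinity_eq_hold by (metis UNIV_I differentiable_on_def hold.simps(2))
    then have d: "(D m has_derivative frechet_derivative (D m) (at y)) (at y)"
      by (simp add: frechet_derivative_works)
    moreover have "frechet_derivative (D m) (at y) = (*) (D (Suc m) y)"
    proof
      fix e
      have "frechet_derivative (D m) (at y) (e *\<^sub>R 1) = e *\<^sub>R frechet_derivative (D m) (at y) 1"
        by (rule linear_cmul[OF has_derivative_linear[OF d]])
      then show "frechet_derivative (D m) (at y) e = D (Suc m) y * e"
        by (simp add: D_def dderiv_def)
    qed
    ultimately show ?thesis by (simp add: has_field_derivative_def)
  qed
  then show ?thesis using that[of D] by (simp add: D_def derivative_sequence_def)
qed

lemma derivative_sequence_zero: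
  assumes "derivative_sequence UNIV D" "open U" "\<And>x. x \<in> U \<Longrightarrow> D 0 x = 0" "x \<in> U"
  shows "D m x = 0"
  using assms(4)
proof (induction m arbitrary: x)
  case (Suc m)
  have "((\<lambda>x. 0) has_real_derivative D (Suc m) x) (at x)"
  proof (rule has_field_derivative_transform_within_open[OF _ assms(2) Suc.prems])
    show "(D m has_real_derivative D (Suc m) x) (at x)"
      using assms(1) unfolding derivative_sequence_def by simp
  qed (rule Suc.IH)
  then show ?case using DERIV_unique DERIV_const by blast
qed (use assms in simp)

text \<open>The function is a series of bumps with disjoint supports around the points \<open>r n\<close>.\<close>

lemma smooth_interpolation:
  fixes r :: "nat \<Rightarrow> real"
  assumes r: "\<And>n. r n > 0" "\<And>n. r (Suc n) \<le> r n / 4"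
  obtains \<delta> where "\<And>n. \<delta> n > (0::real)"
    "\<And>\<epsilon>. (\<And>n. \<bar>\<epsilon> n\<bar> \<le> \<delta> n) \<Longrightarrow> \<exists>\<theta>. frechet_Ck_on \<infinity> UNIV \<theta> \<and> (\<forall>n. \<theta> (r n) = \<epsilon> n)"
proof -
  obtain B where B: "B 0 = bump (0::real) 1" "derivative_sequence UNIV B"
    using smooth_derivative_sequence[OF smooth_bump] by metis
  have B_zero: "B m x = 0" if "\<bar>x\<bar> > 1" for m x
    by (rule derivative_sequence_zero[OF B(2), of "- {-1..1}"])
      (use that in \<open>auto simp: B(1) dist_real_def intro!: bump_eq_0\<close>)
  have "\<exists>M. \<forall>x. \<bar>B m x\<bar> \<le> M" for m
  proof -
    have "bounded (B m ` {-1..1})"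
      using derivative_sequence_continuous[OF B(2), of m]
      by (intro compact_imp_bounded compact_continuous_image) (auto intro: continuous_on_subset)
    then obtain M where "\<forall>y\<in>B m ` {-1..1}. \<bar>y\<bar> \<le> M" unfolding bounded_real by blast
    then have "\<And>x. x \<in> {-1..1} \<Longrightarrow> \<bar>B m x\<bar> \<le> M" by blast
    moreover have "B m x = 0" if "x \<notin> {-1..1}" for x using B_zero[of x m] that by auto
    ultimately have "\<bar>B m x\<bar> \<le> max M 0" for x by (cases "x \<in> {-1..1}") (auto simp: le_max_iff_disj)
    then show ?thesis by blast
  qed
  then obtain M where M: "\<And>m x. \<bar>B m x\<bar> \<le> M m" by metis
  have M0: "M m \<ge> 0" for m using M[of m 0] by linarith
  \<comment> \<open>As r drops by a factor 4 at each index, |r n - r k| \<ge> r k / 2 for all n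
    \<noteq> k, so the bump of radius \<rho> k vanishes at all other nodes.\<close>
  define \<rho> where "\<rho> n = r n / 2" for n
  have \<rho>: "\<rho> n > 0" for n using r by (simp add: \<rho>_def)
  \<comment> \<open>The m-th derivative of the n-th term is at most \<delta> n / \<rho> n ^ m * M m.
    The minimum over m \<le> n bounds this by (1/2)^n whenever n \<ge> m, so one sequence makes the
    series of derivatives of every order converge uniformly. The summand 1 avoids division by
    zero.\<close>
  define \<delta> where "\<delta> n = Min ((\<lambda>m. (1/2)^n * \<rho> n ^ m / (M m + 1)) ` {..n})" for n
  have \<delta>: "\<delta> n > 0" for n
    unfolding \<delta>_def using \<rho> M0 by (subst Min_gr_iff) (auto intro!: divide_pos_pos add_nonneg_pos)
  have \<delta>_le: "\<delta> n \<le> (1/2)^n * \<rho> n ^ m / (M m + 1)" if "m \<le> n" for m n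
    unfolding \<delta>_def using that by (intro Min_le) auto
  have "\<exists>\<theta>. frechet_Ck_on \<infinity> UNIV \<theta> \<and> (\<forall>n. \<theta> (r n) = \<epsilon> n)" if \<epsilon>: "\<And>n. \<bar>\<epsilon> n\<bar> \<le> \<delta> n" for \<epsilon>
  proof -
    define t where "t m n x = \<epsilon> n / \<rho> n ^ m * B m ((x - r n) / \<rho> n)" for m n x
    define K where "K m n = \<bar>\<epsilon> n\<bar> / \<rho> n ^ m * M m" for m n
    have tK: "norm (t m n x) \<le> K m n" for m n x
    proof -
      have "norm (t m n x) = \<bar>\<epsilon> n\<bar> / \<rho> n ^ m * \<bar>B m ((x - r n) / \<rho> n)\<bar>"
        unfolding t_def using \<rho>[of n] by (simp add: abs_mult)
      also have "\<dots> \<le> \<bar>\<epsilon> n\<bar> / \<rho> n ^ m * M m" using \<rho>[of n] M by (intro mult_left_mono) auto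
      finally show ?thesis by (simp add: K_def)
    qed
    have "summable (K m)" for m
    proof (rule summable_comparison_test')
      show "summable (\<lambda>n. (1/2::real)^n)" by (simp add: summable_geometric)
      fix n assume "m \<le> n"
      have "K m n \<le> \<delta> n / \<rho> n ^ m * M m"
        unfolding K_def using \<epsilon>[of n] \<rho>[of n] M0[of m] by (intro mult_right_mono divide_right_mono) auto
      also have "\<dots> \<le> ((1/2)^n * \<rho> n ^ m / (M m + 1)) / \<rho> n ^ m * M m"
        using \<delta>_le[OF \<open>m \<le> n\<close>] \<rho>[of n] M0[of m] by (intro mult_right_mono divide_right_mono) auto
      also have "\<dots> = (1/2)^n * (M m / (M m + 1))" using \<rho>[of n] by simp
      also have "\<dots> \<le> (1/2)^n * 1" using M0[of m] by (intro mult_left_mono) auto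
      finally show "norm (K m n) \<le> (1/2)^n" using M0[of m] \<rho>[of n] by (simp add: K_def)
    qed
    note sumK = this
    define D where "D m x = (\<Sum>n. t m n x)" for m x
    have summ: "summable (\<lambda>n. t m n x)" for m x
      by (rule summable_comparison_test'[OF sumK[of m]]) (rule tK)
    have unif: "uniform_limit UNIV (\<lambda>n x. \<Sum>i<n. t m i x) (D m) sequentially" for m
      unfolding D_def by (rule Weierstrass_m_test[OF _ sumK[of m]]) (use tK in auto)
    have dt: "(t m n has_real_derivative t (Suc m) n x) (at x)" for m n x
    proof -
      have "(B m has_real_derivative B (Suc m) ((x - r n) / \<rho> n)) (at ((x - r n) / \<rho> n))"
        using B(2) by (simp add: derivative_sequence_def)
      moreover have "((\<lambda>x. (x - r n) / \<rho> n) has_real_derivative 1 / \<rho> n) (at x)"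
        using \<rho>[of n] by (auto intro!: derivative_eq_intros)
      ultimately have "((\<lambda>x. B m ((x - r n) / \<rho> n)) has_real_derivative
          B (Suc m) ((x - r n) / \<rho> n) * (1 / \<rho> n)) (at x)" by (rule DERIV_chain2)
      from DERIV_cmult[OF this, of "\<epsilon> n / \<rho> n ^ m"] show ?thesis
        unfolding t_def[abs_def] by (simp add: mult.commute mult.left_commute)
    qed
    have "(D m has_real_derivative D (Suc m) y) (at y)" for m y
    proof -
      have "\<exists>g. \<forall>x\<in>UNIV. (\<lambda>n. t m n x) sums g x \<and> (g has_field_derivative D (Suc m) x) (at x within UNIV)"
        by (rule has_field_derivative_series[OF convex_UNIV _ unif UNIV_I summ]) (use dt in auto)
      then obtain g where g: "\<And>x. (\<lambda>n. t m n x) sums g x" "\<And>x. (g has_real_derivative D (Suc m) x) (at x)"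
        by auto
      have "g = D m" using g(1) by (auto simp: D_def sums_unique)
      then show ?thesis using g(2) by simp
    qed
    then have "derivative_sequence UNIV D" by (simp add: derivative_sequence_def)
    then have "frechet_Ck_on \<infinity> UNIV (D 0)" by (rule derivative_sequence_smooth) simp
    moreover have "D 0 (r n) = \<epsilon> n" for n
    proof -
      have dec: "r (i + Suc j) \<le> r i / 4" for i j
      proof (induction j)
        case (Suc j)
        then show ?case using r(2)[of "i + Suc j"] r(1)[of "i + Suc j"] by simp
      qed (use r in auto)
      have "t 0 k (r n) = 0" if "k \<noteq> n" for k
      proof -
        have "\<bar>r n - r k\<bar> \<ge> \<rho> k"
        proof (cases "k < n")
          case True
          then show ?thesis using dec[of k "n - Suc k"] r(1)[of k] by (simp add: \<rho>_def)
        next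
          case False
          then show ?thesis using dec[of n "k - Suc n"] r(1)[of k] that by (simp add: \<rho>_def)
        qed
        then have "\<bar>(r n - r k) / \<rho> k\<bar> \<ge> 1" using \<rho>[of k] by simp
        then show ?thesis by (simp add: t_def B(1) bump_eq_0 dist_real_def)
      qed
      then have "D 0 (r n) = (\<Sum>k\<in>{n}. t 0 k (r n))"
        unfolding D_def by (intro suminf_finite) auto
      then show ?thesis by (simp add: t_def B(1) bump_eq_1)
    qed
    ultimately show ?thesis by blast
  qed
  then show ?thesis using that[of \<delta>] \<delta> by blast
qed

section \<open>Weak derivatives of the first order\<close>

definition locally_integrable :: "'e::euclidean_space set \<Rightarrow> ('e \<Rightarrow> real) \<Rightarrow> bool" where
  "locally_integrable X h \<longleftrightarrow>
     h \<in> borel_measurable borel \<and> (\<forall>K. compact K \<longrightarrow> K \<subseteq> X \<longrightarrow> set_integrable lborel K h)"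

definition weak_deriv :: "'e::euclidean_space set \<Rightarrow> 'e \<Rightarrow> ('e \<Rightarrow> real) \<Rightarrow> ('e \<Rightarrow> real) \<Rightarrow> bool" where
  "weak_deriv X e u h \<longleftrightarrow> (\<forall>\<psi>. test_function X \<psi> \<longrightarrow>
     (\<integral>x. dderiv UNIV \<psi> e x * u x \<partial>lborel) = - (\<integral>x. \<psi> x * h x \<partial>lborel))"

lemma locally_integrable_measurable [measurable_dest]:
  "locally_integrable X h \<Longrightarrow> h \<in> borel_measurable borel"
  by (simp add: locally_integrable_def)

lemma locally_integrable_subset:
  "locally_integrable X h \<Longrightarrow> Y \<subseteq> X \<Longrightarrow> locally_integrable Y h"
  unfolding locally_integrable_def by blast

lemma locally_integrable_add:
  assumes "locally_integrable X u" "locally_integrable X h"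
  shows "locally_integrable X (\<lambda>x. u x + h x)"
  using assms unfolding locally_integrable_def
  by (auto simp: set_integrable_def distrib_left intro!: Bochner_Integration.integrable_add)

lemma integrable_compact_support:
  assumes h: "locally_integrable X h" and K: "compact K" "K \<subseteq> X"
    and \<xi>: "continuous_on UNIV \<xi>" "\<And>x. x \<notin> K \<Longrightarrow> \<xi> x = 0"
  shows "integrable lborel (\<lambda>x. \<xi> x * h x)"
proof -
  have "compact (\<xi> ` K)" using \<xi>(1) K(1) by (intro compact_continuous_image) (auto intro: continuous_on_subset)
  then obtain M where M: "\<And>x. x \<in> K \<Longrightarrow> norm (\<xi> x) \<le> M"
    using compact_imp_bounded bounded_iff by (metis imageI)
  have i: "integrable lborel (\<lambda>x. indicator K x *\<^sub>R h x)"
    using h K unfolding locally_integrable_def set_integrable_def by auto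
  have [measurable]: "\<xi> \<in> borel_measurable borel" using \<xi>(1) by (simp add: borel_measurable_continuous_onI)
  have [measurable]: "h \<in> borel_measurable borel" using h by (rule locally_integrable_measurable)
  show ?thesis
  proof (rule Bochner_Integration.integrable_bound[OF integrable_mult_right[OF i, of M]])
    show "AE x in lborel. norm (\<xi> x * h x) \<le> norm (M * (indicator K x *\<^sub>R h x))"
    proof (rule AE_I2)
      fix x
      show "norm (\<xi> x * h x) \<le> norm (M * (indicator K x *\<^sub>R h x))"
      proof (cases "x \<in> K")
        case True
        then have "\<bar>\<xi> x\<bar> \<le> \<bar>M\<bar>" using M[OF True] by simp
        then show ?thesis using True by (simp add: abs_mult mult_right_mono)
      qed (simp add: \<xi>)
    qed
  qed measurable
qed

lemma test_function_support:
  assumes "test_function X \<psi>"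
  shows "compact (closure {x. \<psi> x \<noteq> 0})" "closure {x. \<psi> x \<noteq> 0} \<subseteq> X"
    "x \<notin> closure {x. \<psi> x \<noteq> 0} \<Longrightarrow> \<psi> x = 0"
  using assms closure_subset[of "{x. \<psi> x \<noteq> 0}"] unfolding test_function_def by auto

lemma test_function_continuous: "test_function X \<psi> \<Longrightarrow> continuous_on UNIV \<psi>"
  unfolding test_function_def by (blast intro: smooth_continuous)

lemma dderiv_zero:
  assumes "open U" "x \<in> U" "\<And>y. y \<in> U \<Longrightarrow> \<psi> y = 0"
  shows "dderiv UNIV \<psi> e x = 0"
proof -
  have "(\<psi> has_derivative (\<lambda>_. 0)) (at x)"
    by (rule has_derivative_transform_within_open[OF _ assms(1,2)]) (use assms(3) in auto)
  then show ?thesis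
    unfolding dderiv_def by (subst halfspace_open_frechet_derivative[OF halfspace_open_UNIV]) auto
qed

lemma smooth_dderiv: "frechet_Ck_on \<infinity> S g \<Longrightarrow> frechet_Ck_on \<infinity> S (dderiv S g e)"
  unfolding frechet_infinity_eq_hold using hold.simps(2) by blast

lemma smooth_has_derivative:
  assumes "frechet_Ck_on \<infinity> S g" "x \<in> S"
  shows "(g has_derivative (\<lambda>e. dderiv S g e x)) (at x within S)"
proof -
  have "g differentiable_on S"
    using assms(1) unfolding frechet_infinity_eq_hold by (meson hold.simps(2))
  then show ?thesis using assms(2) unfolding dderiv_def differentiable_on_def
    by (simp add: frechet_derivative_works)
qed

lemma dderiv_zero_support:
  assumes "x \<notin> closure {x. \<psi> x \<noteq> 0}"
  shows "dderiv UNIV \<psi> e x = 0"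
proof (rule dderiv_zero)
  show "x \<in> - closure {x. \<psi> x \<noteq> 0}" using assms by simp
  show "open (- closure {x. \<psi> x \<noteq> 0})" by (intro open_Compl closed_closure)
  show "\<psi> y = 0" if "y \<in> - closure {x. \<psi> x \<noteq> 0}" for y
    using that closure_subset[of "{x. \<psi> x \<noteq> 0}"] by auto
qed

lemma compact_closure_subset:
  fixes K :: "'e::euclidean_space set"
  assumes "compact K" "A \<subseteq> K"
  shows "compact (closure A)" "closure A \<subseteq> K"
proof -
  show sub: "closure A \<subseteq> K" by (rule closure_minimal[OF assms(2) compact_imp_closed[OF assms(1)]])
  show "compact (closure A)"
    using assms(1) sub compact_Int_closed[of K "closure A"] by (simp add: Int_absorb1)
qed

lemma test_function_I:
  assumes "frechet_Ck_on \<infinity> UNIV \<psi>" "compact K" "K \<subseteq> X" "\<And>x. x \<notin> K \<Longrightarrow> \<psi> x = 0"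
  shows "test_function X \<psi>"
proof -
  have "{x. \<psi> x \<noteq> 0} \<subseteq> K" using assms(4) by blast
  then show ?thesis
    unfolding test_function_def using compact_closure_subset[OF assms(2)] assms(1,3) by blast
qed

lemma test_function_dderiv:
  assumes "test_function X \<psi>"
  shows "test_function X (dderiv UNIV \<psi> e)"
  by (rule test_function_I[OF _ test_function_support(1,2)[OF assms]])
    (use assms dderiv_zero_support in \<open>auto simp: test_function_def intro: smooth_dderiv\<close>)

lemma test_function_integrable:
  assumes "test_function X \<psi>" "locally_integrable X h"
  shows "integrable lborel (\<lambda>x. \<psi> x * h x)"
  by (rule integrable_compact_support[OF assms(2) test_function_support(1,2)[OF assms(1)]
      test_function_continuous[OF assms(1)]]) (rule test_function_support(3)[OF assms(1)])

subsection \<open>Uniqueness\<close>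

lemma smooth_prod:
  fixes g :: "'i \<Rightarrow> 'e::euclidean_space \<Rightarrow> real"
  assumes "halfspace_open S" "\<And>i. i \<in> I \<Longrightarrow> frechet_Ck_on \<infinity> S (g i)"
  shows "frechet_Ck_on \<infinity> S (\<lambda>x. \<Prod>i\<in>I. g i x)"
  using assms(2)
  by (induction I rule: infinite_finite_induct) (auto intro: smooth_const smooth_mult assms(1))

lemma smooth_compose_UNIV:
  fixes s :: "real \<Rightarrow> real"
  assumes "frechet_Ck_on \<infinity> UNIV s" "frechet_Ck_on \<infinity> UNIV g"
  shows "frechet_Ck_on \<infinity> UNIV (\<lambda>x. s (g x))"
  by (rule smooth_compose[OF halfspace_open_UNIV halfspace_open_UNIV assms]) simp

text \<open>With q smooth, positive exactly on the open box and 0 elsewhere, the functions 1 - exp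
  (- n q) are test functions that increase to the indicator of the open box; dominated convergence
  passes to the limit.\<close>

lemma integral_box_eq_0:
  fixes h :: "'e::euclidean_space \<Rightarrow> real"
  assumes h: "locally_integrable X h"
    and zero: "\<And>\<psi>. test_function X \<psi> \<Longrightarrow> (\<integral>x. \<psi> x * h x \<partial>lborel) = 0"
    and box: "cbox a b \<subseteq> X"
  shows "(LINT x:box a b|lborel. h x) = 0"
proof -
  note U = halfspace_open_UNIV
  define q where "q x = (\<Prod>i\<in>Basis. flat 0 (x \<bullet> i + - (a \<bullet> i)) * flat 0 ((-1) * (x \<bullet> i) + b \<bullet> i))" for x
  have q_smooth: "frechet_Ck_on \<infinity> UNIV q"
    unfolding q_def
    by (intro smooth_prod U smooth_mult smooth_compose_UNIV[OF smooth_flat] smooth_add smooth_inner smooth_const)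
  have q0: "q x \<ge> 0" for x unfolding q_def by (intro prod_nonneg mult_nonneg_nonneg ballI flat_nonneg)
  have q_pos: "q x > 0 \<longleftrightarrow> x \<in> box a b" for x
  proof
    assume "x \<in> box a b"
    then show "q x > 0" unfolding q_def by (intro prod_pos mult_pos_pos ballI) (auto simp: flat_pos_iff mem_box)
  next
    assume "q x > 0"
    then have "q x \<noteq> 0" by simp
    then have "\<forall>i\<in>Basis. flat 0 (x \<bullet> i + - (a \<bullet> i)) * flat 0 ((-1) * (x \<bullet> i) + b \<bullet> i) \<noteq> 0"
      unfolding q_def by (simp add: prod_zero_iff)
    then show "x \<in> box a b" by (auto simp: mem_box flat_def split: if_splits)
  qed
  have q_zero: "q x = 0" if "x \<notin> cbox a b" for x
    using that q0[of x] q_pos[of x] box_subset_cbox[of a b] by fastforce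
  define \<psi> where "\<psi> n x = 1 + (-1) * exp ((- real n) * q x)" for n x
  have tf: "test_function X (\<psi> n)" for n
  proof (rule test_function_I[OF _ compact_cbox box])
    show "frechet_Ck_on \<infinity> UNIV (\<psi> n)"
      unfolding \<psi>_def by (intro smooth_add smooth_mult smooth_const U smooth_compose_UNIV[OF smooth_exp] q_smooth)
  qed (simp add: \<psi>_def q_zero)
  have hm [measurable]: "h \<in> borel_measurable borel" using h by (rule locally_integrable_measurable)
  have \<psi>m [measurable]: "\<psi> n \<in> borel_measurable borel" for n
    using test_function_continuous[OF tf] by (simp add: borel_measurable_continuous_onI)
  have \<psi>_bd: "\<bar>\<psi> n x\<bar> \<le> indicator (cbox a b) x" for n x
  proof (cases "x \<in> cbox a b")
    case True
    have "exp (- real n * q x) \<le> 1" using q0[of x] by simp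
    then show ?thesis using True exp_ge_zero[of "- real n * q x"] unfolding \<psi>_def
      by (simp add: abs_le_iff)
  next
    case False
    then show ?thesis using q_zero by (simp add: \<psi>_def)
  qed
  have "(\<lambda>n. \<integral>x. \<psi> n x * h x \<partial>lborel) \<longlonglongrightarrow> (\<integral>x. indicator (box a b) x * h x \<partial>lborel)"
  proof (rule integral_dominated_convergence)
    show "integrable lborel (\<lambda>x. norm (indicator (cbox a b) x *\<^sub>R h x))"
      using h box compact_cbox unfolding locally_integrable_def set_integrable_def by (intro integrable_norm) auto
    show "AE x in lborel. norm (\<psi> n x * h x) \<le> norm (indicator (cbox a b) x *\<^sub>R h x)" for n
      using \<psi>_bd[of n] by (intro AE_I2) (simp add: abs_mult mult_right_mono)
    show "AE x in lborel. (\<lambda>n. \<psi> n x * h x) \<longlonglongrightarrow> indicator (box a b) x * h x"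
    proof (rule AE_I2)
      fix x
      have "(\<lambda>n. \<psi> n x) \<longlonglongrightarrow> indicator (box a b) x"
      proof (cases "x \<in> box a b")
        case True
        then have qx: "q x > 0" by (simp add: q_pos)
        have "(\<lambda>n. 1 + (-1) * exp (- q x) ^ n) \<longlonglongrightarrow> 1 + (-1) * 0"
          using qx by (intro tendsto_intros LIMSEQ_power_zero) auto
        moreover have "exp (- q x) ^ n = exp (- real n * q x)" for n
          by (simp add: exp_of_nat_mult[symmetric])
        ultimately show ?thesis using True by (simp add: \<psi>_def)
      next
        case False
        then have "q x = 0" using q_pos[of x] q0[of x] by linarith
        then show ?thesis using False by (simp add: \<psi>_def)
      qed
      then show "(\<lambda>n. \<psi> n x * h x) \<longlonglongrightarrow> indicator (box a b) x * h x" by (intro tendsto_intros)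
    qed
  qed auto
  moreover have "(\<lambda>n. \<integral>x. \<psi> n x * h x \<partial>lborel) = (\<lambda>n. 0)" using zero[OF tf] by simp
  ultimately have "(\<integral>x. indicator (box a b) x * h x \<partial>lborel) = 0" using LIMSEQ_unique tendsto_const by metis
  then show ?thesis by (simp add: set_lebesgue_integral_def)
qed

text \<open>Open boxes are an intersection-stable generator of the Borel sets, so the integral of h
  vanishes over every Borel subset of the box, in particular over the sets where h > 0 and where h <
  0.\<close>

lemma AE_box_eq_0:
  fixes h :: "'e::euclidean_space \<Rightarrow> real"
  assumes h: "h \<in> borel_measurable borel" "set_integrable lborel (box a b) h"
    and zero: "\<And>c d. box c d \<subseteq> box a b \<Longrightarrow> (LINT x:box c d|lborel. h x) = 0"
  shows "AE x in lborel. x \<in> box a b \<longrightarrow> h x = 0"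
proof -
  note hm [measurable] = h(1)
  let ?Q = "box a b"
  let ?P = "\<lambda>A. (LINT x:A \<inter> ?Q|lborel. h x) = 0"
  let ?G = "range (\<lambda>(a, b). box a b :: 'e set)"
  have borel: "sets (borel :: 'e measure) = sigma_sets UNIV ?G"
    by (subst borel_eq_box) simp
  have int: "set_integrable lborel (A \<inter> ?Q) h" if "A \<in> sets borel" for A
    using set_integrable_subset[OF h(2), of "A \<inter> ?Q"] that by auto
  have P: "?P A" if "A \<in> sets borel" for A
  proof -
    have "Int_stable ?G" unfolding Int_stable_def by (auto simp: box_Int_box)
    moreover have "?G \<subseteq> Pow UNIV" by auto
    moreover have "A \<in> sigma_sets UNIV ?G" using that borel by simp
    ultimately show ?thesis
    proof (induction rule: sigma_sets_induct_disjoint)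
      case (basic A)
      then obtain c d where A: "A = box c d" by auto
      show ?case unfolding A box_Int_box by (rule zero) (simp only: box_Int_box[symmetric] Int_lower2)
    next
      case empty
      show ?case by (simp add: set_lebesgue_integral_def)
    next
      case (compl A)
      then have A: "A \<in> sets borel" by (simp add: borel)
      have "(LINT x:?Q|lborel. h x) = (LINT x:(A \<inter> ?Q) \<union> ((UNIV - A) \<inter> ?Q)|lborel. h x)"
        by (rule arg_cong[where f = "\<lambda>B. LINT x:B|lborel. h x"]) auto
      also have "\<dots> = (LINT x:A \<inter> ?Q|lborel. h x) + (LINT x:(UNIV - A) \<inter> ?Q|lborel. h x)"
        by (rule set_integral_Un) (use int[of A] int[of "UNIV - A"] A in auto)
      finally show ?case using compl zero[of a b] by simp
    next
      case (union A)
      have Ai: "A i \<in> sets borel" for i using union(2) by (auto simp: borel)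
      have "(LINT x:(\<Union>i. A i \<inter> ?Q)|lborel. h x) = (\<Sum>i. (LINT x:A i \<inter> ?Q|lborel. h x))"
      proof (rule lebesgue_integral_countable_add)
        show "A i \<inter> ?Q \<in> sets lborel" for i using Ai by auto
        show "i \<noteq> j \<Longrightarrow> A i \<inter> ?Q \<inter> (A j \<inter> ?Q) = {}" for i j
          using union(1) unfolding disjoint_family_on_def by auto
        have "(\<Union>i. A i \<inter> ?Q) = (\<Union>i. A i) \<inter> ?Q" by auto
        then show "set_integrable lborel (\<Union>i. A i \<inter> ?Q) h" using int[of "\<Union>i. A i"] Ai by auto
      qed
      moreover have "(\<Union>i. A i \<inter> ?Q) = (\<Union>i. A i) \<inter> ?Q" by auto
      ultimately show ?case using union(3) by simp
    qed
  qed
  have "AE x in lborel. indicator (?Q \<inter> {x. s * h x > 0}) x * (s * h x) = 0" for s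
  proof -
    have A: "{x. s * h x > 0} \<in> sets borel" by measurable
    have i: "integrable lborel (\<lambda>x. indicator (?Q \<inter> {x. s * h x > 0}) x * (s * h x))"
      using integrable_mult_right[OF int[OF A, unfolded set_integrable_def], of s]
      by (simp add: Int_commute mult.left_commute)
    have "(\<integral>x. indicator (?Q \<inter> {x. s * h x > 0}) x * (s * h x) \<partial>lborel) = s * (LINT x:{x. s * h x > 0} \<inter> ?Q|lborel. h x)"
      unfolding set_lebesgue_integral_def
      by (subst integral_mult_right_zero[symmetric]) (simp add: Int_commute mult.left_commute)
    then have "(\<integral>x. indicator (?Q \<inter> {x. s * h x > 0}) x * (s * h x) \<partial>lborel) = 0" using P[OF A] by simp
    then show ?thesis
      by (subst (asm) integral_nonneg_eq_0_iff_AE[OF i]) (auto simp: indicator_def)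
  qed
  from this[of 1] this[of "-1"] show ?thesis
    by eventually_elim (auto simp: indicator_def split: if_splits)
qed

text \<open>The fundamental lemma of the calculus of variations; the Lindelof property reduces it to
  countably many boxes.\<close>

lemma AE_eq_0_if_test_integrals_vanish:
  fixes h :: "'e::euclidean_space \<Rightarrow> real"
  assumes X: "open X" and h: "locally_integrable X h"
    and zero: "\<And>\<psi>. test_function X \<psi> \<Longrightarrow> (\<integral>x. \<psi> x * h x \<partial>lborel) = 0"
  shows "AE x in lborel. x \<in> X \<longrightarrow> h x = 0"
proof -
  let ?F = "{box a b | a b. cbox a b \<subseteq> X}"
  obtain F where F: "F \<subseteq> ?F" "countable F" "\<Union>F = \<Union>?F"
    by (rule Lindelof[of ?F]) auto
  have "\<Union>?F = X"
  proof
    show "\<Union>?F \<subseteq> X" using box_subset_cbox by blast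
    show "X \<subseteq> \<Union>?F"
    proof
      fix x assume "x \<in> X"
      then obtain a b where "x \<in> box a b" "cbox a b \<subseteq> X"
        using open_contains_cbox[OF X] by metis
      then show "x \<in> \<Union>?F" by blast
    qed
  qed
  have "AE x in lborel. x \<in> Q \<longrightarrow> h x = 0" if QF: "Q \<in> F" for Q
  proof -
    obtain a b where Q: "Q = box a b" "cbox a b \<subseteq> X" using subsetD[OF F(1) QF] by auto
    show ?thesis unfolding Q(1)
    proof (rule AE_box_eq_0)
      show "h \<in> borel_measurable borel" using h by (rule locally_integrable_measurable)
      have "set_integrable lborel (cbox a b) h" using h Q(2) compact_cbox unfolding locally_integrable_def by blast
      then show "set_integrable lborel (box a b) h"
        by (rule set_integrable_subset[OF _ _ box_subset_cbox]) simp
      fix c d assume sub: "box c d \<subseteq> box a b"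
      show "(LINT x:box c d|lborel. h x) = 0"
      proof (cases "box c d = {}")
        case False
        then have "cbox c d \<subseteq> cbox a b" using sub closure_box[OF False] closure_mono[OF sub]
          by (metis box_subset_cbox closed_cbox closure_minimal order_trans)
        then show ?thesis using integral_box_eq_0[OF h zero] Q(2) by blast
      qed (simp add: set_lebesgue_integral_def)
    qed
  qed
  then have "AE x in lborel. \<forall>Q\<in>F. x \<in> Q \<longrightarrow> h x = 0" by (subst AE_ball_countable[OF F(2)]) blast
  then show ?thesis 
  proof eventually_elim
    case (elim x)
    have "x \<in> X \<Longrightarrow> x \<in> \<Union>F" using F(3) \<open>\<Union>?F = X\<close> by simp
    then show ?case using elim by blast
  qed
qed

lemma weak_deriv_unique:
  assumes X: "open X" and h: "locally_integrable X h" "locally_integrable X k"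
    and w: "weak_deriv X e u h" "weak_deriv X e u k"
  shows "AE x in lborel. x \<in> X \<longrightarrow> h x = k x"
proof -
  have k': "locally_integrable X (\<lambda>x. - k x)"
    using h(2) unfolding locally_integrable_def set_integrable_def by auto
  have l: "locally_integrable X (\<lambda>x. h x + - k x)" by (rule locally_integrable_add[OF h(1) k'])
  have "(\<integral>x. \<psi> x * (h x + - k x) \<partial>lborel) = 0" if t: "test_function X \<psi>" for \<psi>
  proof -
    have "(\<integral>x. \<psi> x * h x \<partial>lborel) = (\<integral>x. \<psi> x * k x \<partial>lborel)"
      using w t unfolding weak_deriv_def by fastforce
    then show ?thesis
      using test_function_integrable[OF t h(1)] test_function_integrable[OF t h(2)]
      by (simp add: right_diff_distrib)
  qed
  then have "AE x in lborel. x \<in> X \<longrightarrow> h x + - k x = 0"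
    by (rule AE_eq_0_if_test_integrals_vanish[OF X l])
  then show ?thesis by eventually_elim auto
qed

subsection \<open>Weak derivatives and differences along lines\<close>

lemma integral_translate:
  fixes f :: "'e::euclidean_space \<Rightarrow> real"
  assumes "f \<in> borel_measurable borel"
  shows "(\<integral>x. f (x + c) \<partial>lborel) = (\<integral>x. f x \<partial>lborel)"
proof -
  have "(\<integral>x. f x \<partial>lborel) = (\<integral>x. f x \<partial>distr lborel borel ((+) c))" by (simp only: lborel_distr_plus)
  also have "\<dots> = (\<integral>x. f (c + x) \<partial>lborel)" by (rule integral_distr) (use assms in auto)
  finally show ?thesis by (simp add: add.commute)
qed

lemma integrable_translate:
  fixes f :: "'e::euclidean_space \<Rightarrow> real"
  assumes "integrable lborel f"
  shows "integrable lborel (\<lambda>x. f (x + c))"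
proof -
  have "integrable (distr lborel borel ((+) c)) f" using assms by (simp only: lborel_distr_plus)
  then have "integrable lborel (\<lambda>x. f (c + x))"
    using assms by (subst (asm) integrable_distr_eq) auto
  then show ?thesis by (simp add: add.commute)
qed

text \<open>For fixed \<sigma> a translation does not change the integral of w, so a bound by a
  sheared copy of w over a bounded interval of \<sigma> gives integrability on the product, as
  Fubini requires.\<close>

lemma integrable_sheared:
  fixes w :: "'e::euclidean_space \<Rightarrow> real" and F :: "real \<times> 'e \<Rightarrow> real"
  assumes w: "integrable lborel w" and F [measurable]: "F \<in> borel_measurable (lborel \<Otimes>\<^sub>M lborel)"
    and bound: "\<And>\<sigma> x. \<bar>F (\<sigma>, x)\<bar> \<le> indicator {0..\<delta>} \<sigma> * w (x + (c * \<sigma>) *\<^sub>R e)"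
  shows "integrable (lborel \<Otimes>\<^sub>M lborel) F"
proof (rule lborel_pair.Fubini_integrable[OF F])
  have wm [measurable]: "w \<in> borel_measurable borel" using w by auto
  have wt: "integrable lborel (\<lambda>x. w (x + (c * \<sigma>) *\<^sub>R e))" for \<sigma> by (rule integrable_translate[OF w])
  have int: "integrable lborel (\<lambda>x. F (\<sigma>, x))" for \<sigma>
    by (rule Bochner_Integration.integrable_bound[OF integrable_mult_right[OF wt, of "indicator {0..\<delta>} \<sigma>"]])
      (use bound in \<open>auto intro!: AE_I2 order_trans[OF _ abs_ge_self]\<close>)
  show "AE \<sigma> in lborel. integrable lborel (\<lambda>x. F (\<sigma>, x))" using int by simp
  show "integrable lborel (\<lambda>\<sigma>. \<integral>x. norm (F (\<sigma>, x)) \<partial>lborel)"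
  proof (rule Bochner_Integration.integrable_bound)
    show "integrable lborel (\<lambda>\<sigma>. indicator {0..\<delta>} \<sigma> * (\<integral>x. w x \<partial>lborel))"
      by (intro integrable_mult_left integrable_real_indicator) (auto simp: emeasure_lborel_Icc_eq)
    show "AE \<sigma> in lborel. norm (\<integral>x. norm (F (\<sigma>, x)) \<partial>lborel) \<le> norm (indicator {0..\<delta>} \<sigma> * (\<integral>x. w x \<partial>lborel))"
    proof (rule AE_I2)
      fix \<sigma> :: real
      have "(\<integral>x. norm (F (\<sigma>, x)) \<partial>lborel) \<le> (\<integral>x. indicator {0..\<delta>} \<sigma> * w (x + (c * \<sigma>) *\<^sub>R e) \<partial>lborel)"
        by (intro integral_mono integrable_norm int integrable_mult_right wt) (use bound in auto)
      also have "\<dots> = indicator {0..\<delta>} \<sigma> * (\<integral>x. w x \<partial>lborel)"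
        by (simp add: integral_translate[OF wm])
      finally show "norm (\<integral>x. norm (F (\<sigma>, x)) \<partial>lborel) \<le> norm (indicator {0..\<delta>} \<sigma> * (\<integral>x. w x \<partial>lborel))"
        by (simp add: order_trans[OF _ abs_ge_self])
    qed
  qed measurable
qed

definition line_in :: "'e::euclidean_space set \<Rightarrow> 'e \<Rightarrow> real \<Rightarrow> 'e \<Rightarrow> bool" where
  "line_in X e \<delta> x \<longleftrightarrow> (\<forall>\<sigma>\<in>{0..\<delta>}. x + \<sigma> *\<^sub>R e \<in> X)"

text \<open>The complement consists of the differences of points of the closed set - X and points of
  a compact segment, hence it is closed.\<close>

lemma open_line_in:
  assumes "open X"
  shows "open {x. line_in X e \<delta> x}"
proof -
  let ?T = "(\<lambda>\<sigma>. \<sigma> *\<^sub>R e) ` {0..\<delta>}"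
  have "compact ?T" by (intro compact_continuous_image continuous_intros compact_Icc)
  then have "closed (\<Union>y\<in>-X. \<Union>t\<in>?T. {y - t})"
    using assms by (intro closed_compact_differences) auto
  then have "open (- (\<Union>y\<in>-X. \<Union>t\<in>?T. {y - t}))" by (rule open_Compl)
  moreover have "{x. line_in X e \<delta> x} = - (\<Union>y\<in>-X. \<Union>t\<in>?T. {y - t})"
    unfolding line_in_def
  proof safe
    fix x y \<sigma> assume "\<forall>s\<in>{0..\<delta>}. (y - \<sigma> *\<^sub>R e) + s *\<^sub>R e \<in> X" "y \<notin> X" "\<sigma> \<in> {0..\<delta>}"
    then show False by force
  next
    fix x \<sigma> assume x: "x \<notin> (\<Union>y\<in>-X. \<Union>t\<in>?T. {y - t})" and "\<sigma> \<in> {0..\<delta>}"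
    show "x + \<sigma> *\<^sub>R e \<in> X"
    proof (rule ccontr)
      assume "x + \<sigma> *\<^sub>R e \<notin> X"
      moreover have "x = (x + \<sigma> *\<^sub>R e) - \<sigma> *\<^sub>R e" by simp
      ultimately show False using x \<open>\<sigma> \<in> {0..\<delta>}\<close> by blast
    qed
  qed
  ultimately show ?thesis by (simp only:)
qed

definition sweep :: "'e::euclidean_space set \<Rightarrow> 'e \<Rightarrow> real \<Rightarrow> 'e set" where
  "sweep K e \<delta> = (\<lambda>p. fst p + snd p *\<^sub>R e) ` (K \<times> {0..\<delta>})"

lemma compact_sweep: "compact K \<Longrightarrow> compact (sweep K e \<delta>)"
  unfolding sweep_def by (intro compact_continuous_image continuous_intros compact_Times compact_Icc)

lemma sweep_subset: "(\<And>x. x \<in> K \<Longrightarrow> line_in X e \<delta> x) \<Longrightarrow> sweep K e \<delta> \<subseteq> X"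
  unfolding sweep_def line_in_def by auto

lemma sweepI: "x \<in> K \<Longrightarrow> 0 \<le> \<sigma> \<Longrightarrow> \<sigma> \<le> \<delta> \<Longrightarrow> x + \<sigma> *\<^sub>R e \<in> sweep K e \<delta>"
  unfolding sweep_def by force

text \<open>Equal to 0 for \<open>t < 0\<close>, as \<open>{0..t}\<close> is then empty.\<close>

definition line_integral :: "('e::euclidean_space \<Rightarrow> real) \<Rightarrow> 'e \<Rightarrow> 'e \<Rightarrow> real \<Rightarrow> real" where
  "line_integral h e x t = (LINT \<sigma>:{0..t}|lborel. h (x + \<sigma> *\<^sub>R e))"

lemma line_integral_measurable [measurable]:
  fixes h :: "'e::euclidean_space \<Rightarrow> real"
  assumes [measurable]: "h \<in> borel_measurable borel"
  shows "(\<lambda>p. line_integral h e (fst p) (snd p)) \<in> borel_measurable (borel \<Otimes>\<^sub>M borel)"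
proof -
  have "(\<lambda>p. \<integral>\<sigma>. (if 0 \<le> \<sigma> \<and> \<sigma> \<le> snd p then 1 else 0) * h (fst p + \<sigma> *\<^sub>R e) \<partial>lborel)
      \<in> borel_measurable (borel \<Otimes>\<^sub>M borel)" by measurable
  moreover have "(\<lambda>p. line_integral h e (fst p) (snd p)) =
      (\<lambda>p. \<integral>\<sigma>. (if 0 \<le> \<sigma> \<and> \<sigma> \<le> snd p then 1 else 0) * h (fst p + \<sigma> *\<^sub>R e) \<partial>lborel)"
    unfolding line_integral_def set_lebesgue_integral_def
    by (intro ext Bochner_Integration.integral_cong) (auto simp: indicator_def)
  ultimately show ?thesis by simp
qed

lemma line_integral_measurable_left [measurable]:
  fixes h :: "'e::euclidean_space \<Rightarrow> real"
  assumes [measurable]: "h \<in> borel_measurable borel"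
  shows "(\<lambda>x. line_integral h e x t) \<in> borel_measurable borel"
  using measurable_compose[OF _ line_integral_measurable[OF assms], of "\<lambda>x. (x, t)" borel e] by simp

text \<open>Averaging along lines is moved from w to \<psi>: by Fubini and translation invariance
  both double integrals equal the same iterated integral over \<sigma>. The dominating function is w
  cut off to the set swept by K, which is compact in X.\<close>

lemma line_transport:
  fixes w \<psi> :: "'e::euclidean_space \<Rightarrow> real"
  assumes w: "locally_integrable X w" and K: "compact K" "\<And>x. x \<in> K \<Longrightarrow> line_in X e t x"
    and \<psi> [measurable]: "\<psi> \<in> borel_measurable borel"
    and \<psi>b: "\<And>x. \<bar>\<psi> x\<bar> \<le> M" "\<And>x. x \<notin> K \<Longrightarrow> \<psi> x = 0"
  shows "(\<integral>x. \<psi> x * line_integral w e x t \<partial>lborel) = (LINT \<sigma>:{0..t}|lborel. (\<integral>x. \<psi> (x - \<sigma> *\<^sub>R e) * w x \<partial>lborel))"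
    and "(\<integral>x. (LINT \<sigma>:{0..t}|lborel. \<psi> (x - \<sigma> *\<^sub>R e)) * w x \<partial>lborel) =
      (LINT \<sigma>:{0..t}|lborel. (\<integral>x. \<psi> (x - \<sigma> *\<^sub>R e) * w x \<partial>lborel))"
    and "integrable lborel (\<lambda>x. \<psi> x * line_integral w e x t)"
    and "AE x in lborel. integrable lborel (\<lambda>\<sigma>. indicator {0..t} \<sigma> * (\<psi> x * w (x + \<sigma> *\<^sub>R e)))"
    and "\<sigma> \<in> {0..t} \<Longrightarrow> integrable lborel (\<lambda>x. \<psi> x * w (x + \<sigma> *\<^sub>R e))"
proof -
  have [measurable]: "w \<in> borel_measurable borel" using w by (rule locally_integrable_measurable)
  let ?K = "sweep K e t"
  have cK: "compact ?K" "?K \<subseteq> X" by (rule compact_sweep[OF K(1)], rule sweep_subset[OF K(2)])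
  have [measurable]: "?K \<in> sets borel" using cK(1) by (simp add: borel_compact)
  define b where "b x = M * \<bar>indicator ?K x * w x\<bar>" for x
  have M0: "M \<ge> 0" using \<psi>b(1)[of undefined] by linarith
  have bi: "integrable lborel b"
    unfolding b_def using w cK unfolding locally_integrable_def set_integrable_def
    by (intro integrable_mult_right integrable_abs) auto
  define F1 where "F1 p = indicator {0..t} (fst p) * (\<psi> (snd p) * w (snd p + fst p *\<^sub>R e))" for p :: "real \<times> 'e"
  define F2 where "F2 p = indicator {0..t} (fst p) * (\<psi> (snd p - fst p *\<^sub>R e) * w (snd p))" for p :: "real \<times> 'e"
  have m1 [measurable]: "F1 \<in> borel_measurable (lborel \<Otimes>\<^sub>M lborel)" unfolding F1_def by measurable
  have m2 [measurable]: "F2 \<in> borel_measurable (lborel \<Otimes>\<^sub>M lborel)" unfolding F2_def by measurable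
  have b1: "\<bar>\<psi> x * w (x + \<sigma> *\<^sub>R e)\<bar> \<le> b (x + \<sigma> *\<^sub>R e)" if "\<sigma> \<in> {0..t}" for x \<sigma>
  proof (cases "x \<in> K")
    case True
    then have "x + \<sigma> *\<^sub>R e \<in> ?K" using sweepI that by auto
    then show ?thesis unfolding b_def by (simp add: abs_mult mult_right_mono \<psi>b)
  qed (use M0 in \<open>simp add: \<psi>b b_def\<close>)
  have b2: "\<bar>\<psi> (x - \<sigma> *\<^sub>R e) * w x\<bar> \<le> b x" if "\<sigma> \<in> {0..t}" for x \<sigma>
    using b1[OF that, of "x - \<sigma> *\<^sub>R e"] by simp
  have i1: "integrable (lborel \<Otimes>\<^sub>M lborel) F1"
    by (rule integrable_sheared[OF bi m1, of t 1 e]) (use b1 in \<open>auto simp: F1_def indicator_def\<close>)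
  have i2: "integrable (lborel \<Otimes>\<^sub>M lborel) F2"
    by (rule integrable_sheared[OF bi m2, of t 0 e]) (use b2 in \<open>auto simp: F2_def indicator_def\<close>)
  have i1': "integrable (lborel \<Otimes>\<^sub>M lborel) (case_prod (\<lambda>\<sigma> x. F1 (\<sigma>, x)))" using i1 by simp
  have i2': "integrable (lborel \<Otimes>\<^sub>M lborel) (case_prod (\<lambda>\<sigma> x. F2 (\<sigma>, x)))" using i2 by simp
  have mid1: "(\<integral>x. F1 (\<sigma>, x) \<partial>lborel) = indicator {0..t} \<sigma> *\<^sub>R (\<integral>x. \<psi> (x - \<sigma> *\<^sub>R e) * w x \<partial>lborel)" for \<sigma>
    using integral_translate[of "\<lambda>x. \<psi> (x - \<sigma> *\<^sub>R e) * w x" "\<sigma> *\<^sub>R e"] by (simp add: F1_def)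
  have mid2: "(\<integral>x. F2 (\<sigma>, x) \<partial>lborel) = indicator {0..t} \<sigma> *\<^sub>R (\<integral>x. \<psi> (x - \<sigma> *\<^sub>R e) * w x \<partial>lborel)" for \<sigma>
    by (simp add: F2_def)
  have o1: "(\<integral>\<sigma>. F1 (\<sigma>, x) \<partial>lborel) = \<psi> x * line_integral w e x t" for x
    unfolding line_integral_def set_lebesgue_integral_def F1_def
    by (subst integral_mult_right_zero[symmetric]) (simp add: mult.left_commute)
  have o2: "(\<integral>\<sigma>. F2 (\<sigma>, x) \<partial>lborel) = (LINT \<sigma>:{0..t}|lborel. \<psi> (x - \<sigma> *\<^sub>R e)) * w x" for x
    unfolding set_lebesgue_integral_def F2_def
    by (subst integral_mult_left_zero[symmetric]) (simp add: mult.assoc)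
  show "(\<integral>x. \<psi> x * line_integral w e x t \<partial>lborel) = (LINT \<sigma>:{0..t}|lborel. (\<integral>x. \<psi> (x - \<sigma> *\<^sub>R e) * w x \<partial>lborel))"
    using lborel_pair.Fubini_integral[OF i1'] unfolding mid1 o1 set_lebesgue_integral_def .
  show "(\<integral>x. (LINT \<sigma>:{0..t}|lborel. \<psi> (x - \<sigma> *\<^sub>R e)) * w x \<partial>lborel) =
      (LINT \<sigma>:{0..t}|lborel. (\<integral>x. \<psi> (x - \<sigma> *\<^sub>R e) * w x \<partial>lborel))"
    using lborel_pair.Fubini_integral[OF i2'] unfolding mid2 o2 set_lebesgue_integral_def .
  show "integrable lborel (\<lambda>x. \<psi> x * line_integral w e x t)"
    using lborel_pair.integrable_snd[OF i1'] unfolding o1 .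
  show "AE x in lborel. integrable lborel (\<lambda>\<sigma>. indicator {0..t} \<sigma> * (\<psi> x * w (x + \<sigma> *\<^sub>R e)))"
    using lborel_pair.AE_integrable_snd[OF i1'] by (simp add: F1_def)
  show "integrable lborel (\<lambda>x. \<psi> x * w (x + \<sigma> *\<^sub>R e))" if "\<sigma> \<in> {0..t}"
    by (rule Bochner_Integration.integrable_bound[OF integrable_translate[OF bi, of "\<sigma> *\<^sub>R e"]])
      (use b1[OF that] in \<open>auto intro!: AE_I2 order_trans[OF _ abs_ge_self]\<close>)
qed

lemma test_function_line_difference:
  fixes \<psi> :: "'e::euclidean_space \<Rightarrow> real"
  assumes "frechet_Ck_on \<infinity> UNIV \<psi>" "0 \<le> t"
  shows "\<psi> (x - t *\<^sub>R e) - \<psi> x = - (LINT \<sigma>:{0..t}|lborel. dderiv UNIV \<psi> e (x - \<sigma> *\<^sub>R e))"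
proof -
  let ?F = "\<lambda>\<sigma>. \<psi> (x - \<sigma> *\<^sub>R e)"
  let ?f = "\<lambda>\<sigma>. - dderiv UNIV \<psi> e (x - \<sigma> *\<^sub>R e)"
  have d: "(?F has_vector_derivative ?f \<sigma>) (at \<sigma> within {0..t})" for \<sigma>
  proof -
    have D: "(\<psi> has_derivative (\<lambda>u. dderiv UNIV \<psi> u (x - \<sigma> *\<^sub>R e))) (at (x - \<sigma> *\<^sub>R e))"
      using smooth_has_derivative[OF assms(1), of "x - \<sigma> *\<^sub>R e"] by simp
    have "((\<lambda>\<sigma>. x - \<sigma> *\<^sub>R e) has_derivative (\<lambda>s. - (s *\<^sub>R e))) (at \<sigma> within {0..t})"
      by (auto intro!: derivative_eq_intros)
    from has_derivative_compose[OF this D] have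
      "(?F has_derivative (\<lambda>s. dderiv UNIV \<psi> (- (s *\<^sub>R e)) (x - \<sigma> *\<^sub>R e))) (at \<sigma> within {0..t})" .
    moreover have "dderiv UNIV \<psi> (- (s *\<^sub>R e)) (x - \<sigma> *\<^sub>R e) = s *\<^sub>R ?f \<sigma>" for s
      using linear_cmul[OF has_derivative_linear[OF D], of "- s" e] by simp
    ultimately show ?thesis by (simp add: has_vector_derivative_def)
  qed
  have "continuous_on UNIV (dderiv UNIV \<psi> e)" by (intro smooth_continuous smooth_dderiv assms)
  then have "continuous_on {0..t} (\<lambda>\<sigma>. dderiv UNIV \<psi> e (x - \<sigma> *\<^sub>R e))"
    by (rule continuous_on_compose2) (intro continuous_intros, simp)
  then have c: "continuous_on {0..t} ?f" by (rule continuous_on_minus)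
  have "(\<integral>\<sigma>. indicator {0..t} \<sigma> *\<^sub>R ?f \<sigma> \<partial>lborel) = ?F t - ?F 0"
    by (rule integral_FTC_atLeastAtMost[OF assms(2) d c])
  then show ?thesis by (simp add: set_lebesgue_integral_def)
qed

lemma test_function_bounded:
  assumes "test_function X \<psi>"
  obtains M where "\<And>x. \<bar>\<psi> x\<bar> \<le> M"
proof -
  let ?K = "closure {x. \<psi> x \<noteq> 0}"
  have "compact (\<psi> ` ?K)"
    using test_function_continuous[OF assms] test_function_support(1)[OF assms]
    by (intro compact_continuous_image) (auto intro: continuous_on_subset)
  then have "bounded (\<psi> ` ?K)" by (rule compact_imp_bounded)
  then obtain M where M: "\<forall>y\<in>\<psi> ` ?K. norm y \<le> M" unfolding bounded_iff by blast
  have "\<bar>\<psi> x\<bar> \<le> \<bar>M\<bar>" for x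
  proof (cases "x \<in> ?K")
    case True
    then show ?thesis using M by force
  next
    case False
    then show ?thesis using test_function_support(3)[OF assms False] by simp
  qed
  then show ?thesis by (rule that)
qed

lemma test_function_measurable: "test_function X \<psi> \<Longrightarrow> \<psi> \<in> borel_measurable borel"
  by (intro borel_measurable_continuous_onI test_function_continuous)

lemma smooth_translate:
  fixes \<psi> :: "'e::euclidean_space \<Rightarrow> real"
  assumes "frechet_Ck_on \<infinity> UNIV \<psi>"
  shows "frechet_Ck_on \<infinity> UNIV (\<lambda>x. \<psi> (x + c))"
  by (rule smooth_compose[OF halfspace_open_UNIV halfspace_open_UNIV assms])
    (auto intro!: smooth_add smooth_id smooth_const halfspace_open_UNIV)

lemma dderiv_translate:
  fixes \<psi> :: "'e::euclidean_space \<Rightarrow> real"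
  assumes "frechet_Ck_on \<infinity> UNIV \<psi>"
  shows "dderiv UNIV (\<lambda>x. \<psi> (x + c)) e x = dderiv UNIV \<psi> e (x + c)"
proof -
  have D: "(\<psi> has_derivative (\<lambda>u. dderiv UNIV \<psi> u (x + c))) (at (x + c))"
    using smooth_has_derivative[OF assms, of "x + c"] by simp
  have "((\<lambda>x. x + c) has_derivative (\<lambda>u. u)) (at x)" by (auto intro!: derivative_eq_intros)
  from has_derivative_compose[OF this D]
  have "((\<lambda>x. \<psi> (x + c)) has_derivative (\<lambda>u. dderiv UNIV \<psi> u (x + c))) (at x within UNIV)" by simp
  from halfspace_open_frechet_derivative[OF halfspace_open_UNIV UNIV_I this] show ?thesis
    by (simp add: dderiv_def)
qed

lemma test_function_translate:
  assumes \<psi>: "test_function {x. line_in X e t x} \<psi>" and \<sigma>: "\<sigma> \<in> {0..t}"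
  shows "test_function X (\<lambda>x. \<psi> (x - \<sigma> *\<^sub>R e))"
proof (rule test_function_I)
  let ?K = "closure {x. \<psi> x \<noteq> 0}"
  show "frechet_Ck_on \<infinity> UNIV (\<lambda>x. \<psi> (x - \<sigma> *\<^sub>R e))"
    using smooth_translate[of \<psi> "- (\<sigma> *\<^sub>R e)"] \<psi> by (simp add: test_function_def)
  show "compact (sweep ?K e t)" by (rule compact_sweep[OF test_function_support(1)[OF \<psi>]])
  show "sweep ?K e t \<subseteq> X" by (rule sweep_subset) (use test_function_support(2)[OF \<psi>] in auto)
  fix x assume "x \<notin> sweep ?K e t"
  then have "x - \<sigma> *\<^sub>R e \<notin> ?K" using sweepI[of "x - \<sigma> *\<^sub>R e" ?K \<sigma> t e] \<sigma> by auto
  then show "\<psi> (x - \<sigma> *\<^sub>R e) = 0" by (rule test_function_support(3)[OF \<psi>])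
qed

lemma line_integral_locally_integrable:
  assumes w: "locally_integrable X w"
  shows "locally_integrable {x. line_in X e t x} (\<lambda>x. line_integral w e x t)"
  unfolding locally_integrable_def
proof (intro conjI allI impI)
  have [measurable]: "w \<in> borel_measurable borel" using w by (rule locally_integrable_measurable)
  show "(\<lambda>x. line_integral w e x t) \<in> borel_measurable borel" by measurable
  fix K assume K: "compact K" "K \<subseteq> {x. line_in X e t x}"
  then have [measurable]: "K \<in> sets borel" by (simp add: borel_compact)
  have "integrable lborel (\<lambda>x. indicator K x * line_integral w e x t)"
    by (rule line_transport(3)[OF w K(1), of e t "indicator K" 1]) (use K(2) in \<open>auto simp: indicator_def\<close>)
  then show "set_integrable lborel K (\<lambda>x. line_integral w e x t)" by (simp add: set_integrable_def)
qed

lemma translate_locally_integrable: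
  assumes w: "locally_integrable X w" and t: "0 \<le> t"
  shows "locally_integrable {x. line_in X e t x} (\<lambda>x. w (x + t *\<^sub>R e))"
  unfolding locally_integrable_def
proof (intro conjI allI impI)
  have [measurable]: "w \<in> borel_measurable borel" using w by (rule locally_integrable_measurable)
  show "(\<lambda>x. w (x + t *\<^sub>R e)) \<in> borel_measurable borel" by measurable
  fix K assume K: "compact K" "K \<subseteq> {x. line_in X e t x}"
  then have [measurable]: "K \<in> sets borel" by (simp add: borel_compact)
  have "integrable lborel (\<lambda>x. indicator K x * w (x + t *\<^sub>R e))"
    by (rule line_transport(5)[OF w K(1), of e t "indicator K" 1]) (use K(2) t in \<open>auto simp: indicator_def\<close>)
  then show "set_integrable lborel K (\<lambda>x. w (x + t *\<^sub>R e))" by (simp add: set_integrable_def)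
qed

lemma line_in_start: "0 \<le> t \<Longrightarrow> line_in X e t x \<Longrightarrow> x \<in> X"
  unfolding line_in_def by force

lemma locally_integrable_uminus: "locally_integrable X h \<Longrightarrow> locally_integrable X (\<lambda>x. - h x)"
  unfolding locally_integrable_def set_integrable_def by auto

text \<open>Tested against \<psi>, the difference of u becomes a difference of translates of \<psi>,
  which is an integral of directional derivatives of these translates. Each translate is a test
  function on X, so the weak derivative applies to it, and Fubini turns the result back into the
  line integral of h.\<close>

lemma weak_deriv_difference:
  fixes u h :: "'e::euclidean_space \<Rightarrow> real"
  assumes X: "open X" and u: "locally_integrable X u" and h: "locally_integrable X h"
    and wd: "weak_deriv X e u h" and t: "0 \<le> t"
  shows "AE x in lborel. line_in X e t x \<longrightarrow> u (x + t *\<^sub>R e) - u x = line_integral h e x t"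
proof -
  let ?Y = "{x. line_in X e t x}"
  have [measurable]: "u \<in> borel_measurable borel" "h \<in> borel_measurable borel"
    using u h by (auto intro: locally_integrable_measurable)
  have lu: "locally_integrable ?Y u"
    by (rule locally_integrable_subset[OF u]) (use line_in_start[OF t] in auto)
  note lt = translate_locally_integrable[OF u t, of e]
  note li = line_integral_locally_integrable[OF h, of e t]
  let ?g = "\<lambda>x. (u (x + t *\<^sub>R e) + - u x) + - line_integral h e x t"
  have lg: "locally_integrable ?Y ?g"
    by (intro locally_integrable_add locally_integrable_uminus lu lt li)
  have "(\<integral>x. \<psi> x * ?g x \<partial>lborel) = 0" if \<psi>: "test_function ?Y \<psi>" for \<psi>
  proof -
    note sm = \<psi>[unfolded test_function_def, THEN conjunct1]
    note supp = test_function_support[OF \<psi>]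
    have lin: "x \<in> closure {x. \<psi> x \<noteq> 0} \<Longrightarrow> line_in X e t x" for x using supp(2) by auto
    obtain M where M: "\<And>x. \<bar>\<psi> x\<bar> \<le> M" using test_function_bounded[OF \<psi>] by metis
    obtain M' where M': "\<And>x. \<bar>dderiv UNIV \<psi> e x\<bar> \<le> M'"
      using test_function_bounded[OF test_function_dderiv[OF \<psi>]] by metis
    have m [measurable]: "\<psi> \<in> borel_measurable borel" "dderiv UNIV \<psi> e \<in> borel_measurable borel"
      by (rule test_function_measurable[OF \<psi>], rule test_function_measurable[OF test_function_dderiv[OF \<psi>]])
    note ti = line_transport[OF h supp(1) lin m(1) M supp(3)]
    note ti' = line_transport[OF u supp(1) lin m(2) M' dderiv_zero_support]
    have i: "integrable lborel (\<lambda>x. \<psi> x * u (x + t *\<^sub>R e))" "integrable lborel (\<lambda>x. \<psi> x * u x)"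
      "integrable lborel (\<lambda>x. \<psi> x * line_integral h e x t)"
      using test_function_integrable[OF \<psi>] lu lt li by auto
    have tf: "test_function X (\<lambda>x. \<psi> (x - s *\<^sub>R e))" if "s \<in> {0..t}" for s
      by (rule test_function_translate[OF \<psi> that])
    have "(\<integral>x. \<psi> x * u (x + t *\<^sub>R e) \<partial>lborel) - (\<integral>x. \<psi> x * u x \<partial>lborel)
        = (\<integral>x. \<psi> (x - t *\<^sub>R e) * u x \<partial>lborel) - (\<integral>x. \<psi> x * u x \<partial>lborel)"
      using integral_translate[of "\<lambda>x. \<psi> (x - t *\<^sub>R e) * u x" "t *\<^sub>R e"] by simp
    also have "\<dots> = (\<integral>x. (\<psi> (x - t *\<^sub>R e) - \<psi> x) * u x \<partial>lborel)"
      using test_function_integrable[OF tf[of t] u] i(2) t by (simp add: left_diff_distrib)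
    also have "\<dots> = (\<integral>x. - ((LINT \<sigma>:{0..t}|lborel. dderiv UNIV \<psi> e (x - \<sigma> *\<^sub>R e)) * u x) \<partial>lborel)"
      by (simp add: test_function_line_difference[OF sm t])
    also have "\<dots> = - (LINT \<sigma>:{0..t}|lborel. (\<integral>x. dderiv UNIV \<psi> e (x - \<sigma> *\<^sub>R e) * u x \<partial>lborel))"
      by (simp add: ti'(2))
    also have "\<dots> = - (LINT \<sigma>:{0..t}|lborel. - (\<integral>x. \<psi> (x - \<sigma> *\<^sub>R e) * h x \<partial>lborel))"
    proof -
      have "(\<integral>x. dderiv UNIV \<psi> e (x - \<sigma> *\<^sub>R e) * u x \<partial>lborel) = - (\<integral>x. \<psi> (x - \<sigma> *\<^sub>R e) * h x \<partial>lborel)"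
        if "\<sigma> \<in> {0..t}" for \<sigma>
        using wd[unfolded weak_deriv_def, rule_format, OF tf[OF that]]
          dderiv_translate[OF sm, of "- (\<sigma> *\<^sub>R e)" e] by simp
      then have "(LINT \<sigma>:{0..t}|lborel. (\<integral>x. dderiv UNIV \<psi> e (x - \<sigma> *\<^sub>R e) * u x \<partial>lborel)) =
          (LINT \<sigma>:{0..t}|lborel. - (\<integral>x. \<psi> (x - \<sigma> *\<^sub>R e) * h x \<partial>lborel))"
        by (intro set_lebesgue_integral_cong) auto
      then show ?thesis by simp
    qed
    also have "\<dots> = (\<integral>x. \<psi> x * line_integral h e x t \<partial>lborel)"
      by (simp add: ti(1) set_lebesgue_integral_def)
    finally show ?thesis using i by (simp add: right_diff_distrib)
  qed
  from AE_eq_0_if_test_integrals_vanish[OF open_line_in[OF X] lg this]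
  have "AE x in lborel. x \<in> ?Y \<longrightarrow> ?g x = 0" by simp
  then show ?thesis by eventually_elim auto
qed

lemma set_integral_Icc_bound:
  fixes f :: "real \<Rightarrow> real"
  assumes "a \<le> b" "\<And>\<sigma>. \<sigma> \<in> {a..b} \<Longrightarrow> \<bar>f \<sigma>\<bar> \<le> M"
  shows "\<bar>LINT \<sigma>:{a..b}|lborel. f \<sigma>\<bar> \<le> M * (b - a)"
proof (cases "set_integrable lborel {a..b} f")
  case True
  have i: "integrable lborel (\<lambda>\<sigma>. indicator {a..b} \<sigma> * M)"
    using assms(1) by (intro integrable_mult_left integrable_real_indicator) (auto simp: emeasure_lborel_Icc_eq)
  have "\<bar>LINT \<sigma>:{a..b}|lborel. f \<sigma>\<bar> \<le> (\<integral>\<sigma>. norm (indicator {a..b} \<sigma> *\<^sub>R f \<sigma>) \<partial>lborel)"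
    unfolding set_lebesgue_integral_def real_norm_def[symmetric] by (rule integral_norm_bound)
  also have "\<dots> \<le> (\<integral>\<sigma>. indicator {a..b} \<sigma> * M \<partial>lborel)"
    using True assms(2) unfolding set_integrable_def
    by (intro integral_mono i integrable_norm) (auto simp: indicator_def)
  also have "\<dots> = M * (b - a)" using assms(1) by simp
  finally show ?thesis .
next
  case False
  have "0 \<le> M" using assms(2)[of a] assms(1) by (auto intro: order_trans[OF abs_ge_zero])
  then show ?thesis using False assms(1)
    by (simp add: set_integrable_def set_lebesgue_integral_def not_integrable_integral_eq)
qed

lemma AE_lborel_interval_ex:
  assumes "AE t in lborel. P t" "a < (b::real)"
  shows "\<exists>t\<in>{a<..<b}. P t"
proof (rule ccontr)
  assume n: "\<not> (\<exists>t\<in>{a<..<b}. P t)"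
  obtain N where N: "{t \<in> space lborel. \<not> P t} \<subseteq> N" "emeasure lborel N = 0" "N \<in> sets lborel"
    using assms(1) by (rule AE_E)
  have "{a<..<b} \<subseteq> N" using n N(1) by auto
  then have "emeasure lborel {a<..<b} \<le> emeasure lborel N" using N(3) by (rule emeasure_mono)
  then show False using N(2) assms(2) by simp
qed

lemma AE_continuous_zero:
  fixes f :: "real \<Rightarrow> real"
  assumes "0 < \<delta>" "continuous_on {0..\<delta>} f" "AE t in lborel. t \<in> {0..\<delta>} \<longrightarrow> f t = 0" "t \<in> {0..\<delta>}"
  shows "f t = 0"
proof (rule ccontr)
  assume "f t \<noteq> 0"
  then obtain d where d: "d > 0" "\<And>s. s \<in> {0..\<delta>} \<Longrightarrow> dist s t < d \<Longrightarrow> dist (f s) (f t) < \<bar>f t\<bar>"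
    using assms(2,4) unfolding continuous_on_iff by (metis zero_less_abs_iff)
  define a b where "a = max 0 (t - d)" and "b = min \<delta> (t + d)"
  have "a < b" using d(1) assms(1,4) by (auto simp: a_def b_def)
  then obtain s where s: "s \<in> {a<..<b}" "s \<in> {0..\<delta>} \<longrightarrow> f s = 0"
    using AE_lborel_interval_ex[OF assms(3)] by blast
  then have "s \<in> {0..\<delta>}" "dist s t < d" by (auto simp: a_def b_def dist_real_def)
  then show False using d(2)[of s] s(2) by (simp add: dist_real_def)
qed

text \<open>The averages of \<xi> over shrinking segments converge pointwise by continuity and are
  bounded by M on the compact swept set, so dominated convergence applies.\<close>

lemma line_average_tendsto:
  fixes w \<xi> :: "'e::euclidean_space \<Rightarrow> real"
  assumes w: "locally_integrable X w" and K: "compact K" "\<And>x. x \<in> K \<Longrightarrow> line_in X e \<delta> x"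
    and \<xi>: "continuous_on UNIV \<xi>" "\<And>x. \<bar>\<xi> x\<bar> \<le> M" "\<And>x. x \<notin> K \<Longrightarrow> \<xi> x = 0"
    and t: "\<And>n. 0 < t n" "\<And>n. t n \<le> \<delta>" "t \<longlonglongrightarrow> 0"
  shows "(\<lambda>n. (1 / t n) * (\<integral>x. (LINT \<sigma>:{0..t n}|lborel. \<xi> (x - \<sigma> *\<^sub>R e)) * w x \<partial>lborel))
    \<longlonglongrightarrow> (\<integral>x. \<xi> x * w x \<partial>lborel)"
proof -
  have [measurable]: "w \<in> borel_measurable borel" using w by (rule locally_integrable_measurable)
  have [measurable]: "\<xi> \<in> borel_measurable borel" using \<xi>(1) by (rule borel_measurable_continuous_onI)
  let ?K = "sweep K e \<delta>"
  have cK: "compact ?K" "?K \<subseteq> X" by (rule compact_sweep[OF K(1)], rule sweep_subset[OF K(2)])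
  define A where "A n x = (1 / t n) * (LINT \<sigma>:{0..t n}|lborel. \<xi> (x - \<sigma> *\<^sub>R e))" for n x
  have LI: "(LINT \<sigma>:{0..t n}|lborel. \<xi> (x - \<sigma> *\<^sub>R e)) = line_integral \<xi> (- e) x (t n)" for n x
    by (simp add: line_integral_def)
  have Am [measurable]: "A n \<in> borel_measurable borel" for n
    unfolding A_def[abs_def] LI by measurable
  have M0: "M \<ge> 0" using \<xi>(2)[of undefined] by linarith
  have Ab: "\<bar>A n x\<bar> \<le> M * indicator ?K x" for n x
  proof (cases "x \<in> ?K")
    case True
    have "\<bar>LINT \<sigma>:{0..t n}|lborel. \<xi> (x - \<sigma> *\<^sub>R e)\<bar> \<le> M * (t n - 0)"
      using t(1)[of n] \<xi>(2) by (intro set_integral_Icc_bound) auto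
    then show ?thesis using True t(1)[of n] by (simp add: A_def abs_mult field_simps)
  next
    case False
    have "\<xi> (x - \<sigma> *\<^sub>R e) = 0" if "\<sigma> \<in> {0..t n}" for \<sigma>
    proof (rule \<xi>(3))
      show "x - \<sigma> *\<^sub>R e \<notin> K" using sweepI[of "x - \<sigma> *\<^sub>R e" K \<sigma> \<delta> e] False that t(2)[of n] by auto
    qed
    then have "\<bar>LINT \<sigma>:{0..t n}|lborel. \<xi> (x - \<sigma> *\<^sub>R e)\<bar> \<le> 0 * (t n - 0)"
      using t(1)[of n] by (intro set_integral_Icc_bound) auto
    then show ?thesis using False by (simp add: A_def)
  qed
  have lim: "(\<lambda>n. A n x) \<longlonglongrightarrow> \<xi> x" for x
  proof (rule LIMSEQ_I)
    fix r :: real assume r: "0 < r"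
    have "continuous_on UNIV (\<lambda>\<sigma>. \<xi> (x - \<sigma> *\<^sub>R e))"
      by (rule continuous_on_compose2[OF \<xi>(1)]) (intro continuous_intros, simp)
    then obtain d where d: "d > 0" "\<And>\<sigma>. dist \<sigma> 0 < d \<Longrightarrow> dist (\<xi> (x - \<sigma> *\<^sub>R e)) (\<xi> (x - 0 *\<^sub>R e)) < r/2"
      using r unfolding continuous_on_iff by (metis UNIV_I half_gt_zero)
    obtain N where N: "\<And>n. n \<ge> N \<Longrightarrow> t n < d"
      using LIMSEQ_D[OF t(3) d(1)] t(1) by (auto simp: abs_of_pos)
    show "\<exists>N. \<forall>n\<ge>N. norm (A n x - \<xi> x) < r"
    proof (intro exI allI impI)
      fix n assume "n \<ge> N"
      have "\<bar>LINT \<sigma>:{0..t n}|lborel. \<xi> (x - \<sigma> *\<^sub>R e) - \<xi> x\<bar> \<le> (r/2) * (t n - 0)"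
        using t(1)[of n] d(2) N[OF \<open>n \<ge> N\<close>]
        by (intro set_integral_Icc_bound) (auto simp: dist_real_def less_imp_le)
      moreover have "(LINT \<sigma>:{0..t n}|lborel. \<xi> (x - \<sigma> *\<^sub>R e) - \<xi> x) =
          (LINT \<sigma>:{0..t n}|lborel. \<xi> (x - \<sigma> *\<^sub>R e)) - (LINT \<sigma>:{0..t n}|lborel. \<xi> x)"
      proof (rule set_integral_diff)
        show "set_integrable lborel {0..t n} (\<lambda>\<sigma>. \<xi> (x - \<sigma> *\<^sub>R e))"
          by (intro borel_integrable_atLeastAtMost' continuous_on_compose2[OF \<xi>(1)] continuous_intros) auto
        show "set_integrable lborel {0..t n} (\<lambda>\<sigma>. \<xi> x)"
          by (intro borel_integrable_atLeastAtMost' continuous_intros)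
      qed
      moreover have "(LINT \<sigma>:{0..t n}|lborel. \<xi> x) = t n * \<xi> x"
        using t(1)[of n] by (simp add: set_lebesgue_integral_def)
      moreover have "A n x - \<xi> x = (1 / t n) * ((LINT \<sigma>:{0..t n}|lborel. \<xi> (x - \<sigma> *\<^sub>R e)) - t n * \<xi> x)"
        using t(1)[of n] by (simp add: A_def field_simps)
      ultimately have J: "\<bar>(LINT \<sigma>:{0..t n}|lborel. \<xi> (x - \<sigma> *\<^sub>R e)) - t n * \<xi> x\<bar> \<le> (r/2) * t n"
        and "A n x - \<xi> x = (1 / t n) * ((LINT \<sigma>:{0..t n}|lborel. \<xi> (x - \<sigma> *\<^sub>R e)) - t n * \<xi> x)"
        by simp_all
      then have "\<bar>A n x - \<xi> x\<bar> = \<bar>(LINT \<sigma>:{0..t n}|lborel. \<xi> (x - \<sigma> *\<^sub>R e)) - t n * \<xi> x\<bar> / t n"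
        using t(1)[of n] by (simp add: abs_mult)
      also have "\<dots> \<le> ((r/2) * t n) / t n" using J t(1)[of n] by (intro divide_right_mono) auto
      finally have "\<bar>A n x - \<xi> x\<bar> \<le> (r/2) * t n / t n" .
      then show "norm (A n x - \<xi> x) < r" using t(1)[of n] r by simp
    qed
  qed
  have "(\<lambda>n. \<integral>x. A n x * w x \<partial>lborel) \<longlonglongrightarrow> (\<integral>x. \<xi> x * w x \<partial>lborel)"
  proof (rule integral_dominated_convergence)
    show "integrable lborel (\<lambda>x. M * \<bar>indicator ?K x *\<^sub>R w x\<bar>)"
      using w cK unfolding locally_integrable_def set_integrable_def
      by (intro integrable_mult_right integrable_abs) auto
    show "AE x in lborel. (\<lambda>n. A n x * w x) \<longlonglongrightarrow> \<xi> x * w x"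
      by (intro AE_I2 tendsto_mult lim tendsto_const)
    show "AE x in lborel. norm (A n x * w x) \<le> M * \<bar>indicator ?K x *\<^sub>R w x\<bar>" for n
    proof (rule AE_I2)
      fix x
      show "norm (A n x * w x) \<le> M * \<bar>indicator ?K x *\<^sub>R w x\<bar>"
        using mult_right_mono[OF Ab[of n x], of "\<bar>w x\<bar>"] by (simp add: abs_mult mult.assoc)
    qed
  qed measurable
  moreover have "(\<integral>x. A n x * w x \<partial>lborel) =
      (1 / t n) * (\<integral>x. (LINT \<sigma>:{0..t n}|lborel. \<xi> (x - \<sigma> *\<^sub>R e)) * w x \<partial>lborel)" for n
    by (simp add: A_def)
  ultimately show ?thesis by simp
qed

lemma AE_lines_commute:
  fixes u h :: "'e::euclidean_space \<Rightarrow> real"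
  assumes [measurable]: "u \<in> borel_measurable borel" "h \<in> borel_measurable borel" "K \<in> sets borel"
  shows "(AE t in lborel. AE x in lborel. t \<in> {0..\<delta>} \<longrightarrow> x \<in> K \<longrightarrow> u (x + t *\<^sub>R e) - u x = line_integral h e x t)
    \<longleftrightarrow> (AE x in lborel. AE t in lborel. t \<in> {0..\<delta>} \<longrightarrow> x \<in> K \<longrightarrow> u (x + t *\<^sub>R e) - u x = line_integral h e x t)"
proof (rule lborel_pair.AE_commute)
  have [measurable]: "(\<lambda>p. line_integral h e (snd p) (fst p)) \<in> borel_measurable (borel \<Otimes>\<^sub>M borel)"
    using measurable_compose[OF _ line_integral_measurable[OF assms(2)], of "\<lambda>p. (snd p, fst p)" "borel \<Otimes>\<^sub>M borel" e]
    by simp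
  show "{p \<in> space (lborel \<Otimes>\<^sub>M lborel). fst p \<in> {0..\<delta>} \<longrightarrow> snd p \<in> K \<longrightarrow>
      u (snd p + fst p *\<^sub>R e) - u (snd p) = line_integral h e (snd p) (fst p)} \<in> sets (lborel \<Otimes>\<^sub>M lborel)"
    by measurable
qed

text \<open>One half of the characterization of weak derivatives by absolute continuity on almost
  every line. The identity known for each t and almost every x becomes, by exchanging the null sets,
  an identity for almost every x and almost every t.\<close>

lemma weak_deriv_lines:
  fixes u h :: "'e::euclidean_space \<Rightarrow> real"
  assumes X: "open X" and u: "locally_integrable X u" and h: "locally_integrable X h"
    and wd: "weak_deriv X e u h" and K: "compact K" "\<And>x. x \<in> K \<Longrightarrow> line_in X e \<delta> x"
  shows "AE x in lborel. x \<in> K \<longrightarrow> set_integrable lborel {0..\<delta>} (\<lambda>\<sigma>. h (x + \<sigma> *\<^sub>R e)) \<and>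
    (AE t in lborel. t \<in> {0..\<delta>} \<longrightarrow> u (x + t *\<^sub>R e) - u x = line_integral h e x t)"
proof -
  have m [measurable]: "u \<in> borel_measurable borel" "h \<in> borel_measurable borel" "K \<in> sets borel"
    using u h K(1) by (auto intro: locally_integrable_measurable borel_compact)
  have "AE x in lborel. integrable lborel (\<lambda>\<sigma>. indicator {0..\<delta>} \<sigma> * (indicator K x * h (x + \<sigma> *\<^sub>R e)))"
    by (rule line_transport(4)[OF h K, of "indicator K" 1]) (auto simp: indicator_def)
  moreover have "AE x in lborel. AE t in lborel. t \<in> {0..\<delta>} \<longrightarrow> x \<in> K \<longrightarrow> u (x + t *\<^sub>R e) - u x = line_integral h e x t"
  proof (subst AE_lines_commute[OF m, symmetric], rule AE_I2)
    fix t :: real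
    show "AE x in lborel. t \<in> {0..\<delta>} \<longrightarrow> x \<in> K \<longrightarrow> u (x + t *\<^sub>R e) - u x = line_integral h e x t"
    proof (cases "t \<in> {0..\<delta>}")
      case True
      then have t: "0 \<le> t" by simp
      have l: "line_in X e t x" if "x \<in> K" for x
        using K(2)[OF that] True unfolding line_in_def by auto
      then show ?thesis using weak_deriv_difference[OF X u h wd t] by eventually_elim (use l in blast)
    next
      case False
      then show ?thesis by (intro AE_I2) blast
    qed
  qed
  ultimately show ?thesis
  proof eventually_elim
    case (elim x)
    show ?case
    proof
      assume "x \<in> K"
      then show "set_integrable lborel {0..\<delta>} (\<lambda>\<sigma>. h (x + \<sigma> *\<^sub>R e)) \<and>
          (AE t in lborel. t \<in> {0..\<delta>} \<longrightarrow> u (x + t *\<^sub>R e) - u x = line_integral h e x t)"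
        using elim by (simp add: set_integrable_def)
    qed
  qed
qed

text \<open>The other half: the identity is tested against \<psi>, divided by t, and t tends to 0.
  Differences of Z are shifted onto \<psi>, where the averages of the derivative converge.\<close>

lemma weak_deriv_if_lines:
  fixes Z R :: "'e::euclidean_space \<Rightarrow> real"
  assumes Z: "locally_integrable X Z" and R: "locally_integrable X R"
    and lines: "\<And>K. compact K \<Longrightarrow> K \<subseteq> X \<Longrightarrow> \<exists>\<delta>>0. (\<forall>x\<in>K. line_in X e \<delta> x) \<and>
      (AE x in lborel. x \<in> K \<longrightarrow> (AE t in lborel. t \<in> {0..\<delta>} \<longrightarrow> Z (x + t *\<^sub>R e) - Z x = line_integral R e x t))"
  shows "weak_deriv X e Z R"
  unfolding weak_deriv_def
proof (intro allI impI)
  fix \<psi> assume \<psi>: "test_function X \<psi>"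
  let ?K = "closure {x. \<psi> x \<noteq> 0}"
  note supp = test_function_support[OF \<psi>]
  note sm = \<psi>[unfolded test_function_def, THEN conjunct1]
  have m [measurable]: "Z \<in> borel_measurable borel" "R \<in> borel_measurable borel" "?K \<in> sets borel"
    using Z R supp(1) by (auto intro: locally_integrable_measurable borel_compact)
  have m\<psi> [measurable]: "\<psi> \<in> borel_measurable borel" "dderiv UNIV \<psi> e \<in> borel_measurable borel"
    by (rule test_function_measurable[OF \<psi>], rule test_function_measurable[OF test_function_dderiv[OF \<psi>]])
  obtain M where M: "\<And>x. \<bar>\<psi> x\<bar> \<le> M" using test_function_bounded[OF \<psi>] by metis
  obtain M' where M': "\<And>x. \<bar>dderiv UNIV \<psi> e x\<bar> \<le> M'"
    using test_function_bounded[OF test_function_dderiv[OF \<psi>]] by metis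
  obtain \<delta> where \<delta>: "\<delta> > 0" "\<forall>x\<in>?K. line_in X e \<delta> x"
    "AE x in lborel. x \<in> ?K \<longrightarrow> (AE t in lborel. t \<in> {0..\<delta>} \<longrightarrow> Z (x + t *\<^sub>R e) - Z x = line_integral R e x t)"
    using lines[OF supp(1,2)] by (elim exE conjE) (rule that)
  have lin: "x \<in> ?K \<Longrightarrow> line_in X e \<delta> x" for x using \<delta>(2) by blast
  have "AE x in lborel. AE t in lborel. t \<in> {0..\<delta>} \<longrightarrow> x \<in> ?K \<longrightarrow> Z (x + t *\<^sub>R e) - Z x = line_integral R e x t"
    using \<delta>(3) by eventually_elim auto
  then have ae: "AE t in lborel. AE x in lborel. t \<in> {0..\<delta>} \<longrightarrow> x \<in> ?K \<longrightarrow> Z (x + t *\<^sub>R e) - Z x = line_integral R e x t"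
    by (subst AE_lines_commute[OF m])
  \<comment> \<open>The identity holds only for almost every t, but such t exist in every interval
    (0, \<delta> / (n + 1)) and so form a null sequence.\<close>
  have "\<exists>t\<in>{0<..<\<delta> / Suc n}. AE x in lborel. t \<in> {0..\<delta>} \<longrightarrow> x \<in> ?K \<longrightarrow> Z (x + t *\<^sub>R e) - Z x = line_integral R e x t" for n
    by (rule AE_lborel_interval_ex[OF ae]) (use \<delta>(1) in simp)
  then have "\<forall>n. \<exists>t. t \<in> {0<..<\<delta> / Suc n} \<and>
      (AE x in lborel. t \<in> {0..\<delta>} \<longrightarrow> x \<in> ?K \<longrightarrow> Z (x + t *\<^sub>R e) - Z x = line_integral R e x t)"
    by blast
  from choice[OF this] obtain t where t: "\<And>n. t n \<in> {0<..<\<delta> / Suc n}"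
    "\<And>n. AE x in lborel. t n \<in> {0..\<delta>} \<longrightarrow> x \<in> ?K \<longrightarrow> Z (x + t n *\<^sub>R e) - Z x = line_integral R e x (t n)"
    by blast
  have t0: "0 < t n" "t n \<le> \<delta>" for n
  proof -
    show "0 < t n" using t(1)[of n] by simp
    have "\<delta> / Suc n \<le> \<delta>" using \<delta>(1) by (simp add: field_simps)
    then show "t n \<le> \<delta>" using t(1)[of n] by simp
  qed
  have tlim: "t \<longlonglongrightarrow> 0"
  proof (rule tendsto_sandwich)
    show "(\<lambda>n. 0) \<longlonglongrightarrow> (0::real)" by simp
    show "(\<lambda>n. \<delta> / Suc n) \<longlonglongrightarrow> 0" using LIMSEQ_Suc[OF lim_const_over_n[of \<delta>]] by simp
  qed (use t(1) in \<open>auto intro!: always_eventually less_imp_le\<close>)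
  have eq: "- (\<integral>x. (LINT \<sigma>:{0..t n}|lborel. dderiv UNIV \<psi> e (x - \<sigma> *\<^sub>R e)) * Z x \<partial>lborel) =
      (\<integral>x. (LINT \<sigma>:{0..t n}|lborel. \<psi> (x - \<sigma> *\<^sub>R e)) * R x \<partial>lborel)" for n
  proof -
    have lin': "x \<in> ?K \<Longrightarrow> line_in X e (t n) x" for x
      using lin[of x] t0(2)[of n] unfolding line_in_def by auto
    have tn: "t n \<in> {0..t n}" "0 \<le> t n" "t n \<in> {0..\<delta>}" using t0[of n] by auto
    note ti = line_transport[OF R supp(1) lin' m\<psi>(1) M supp(3)]
    have i1: "integrable lborel (\<lambda>x. \<psi> x * Z (x + t n *\<^sub>R e))"
      by (rule line_transport(5)[OF Z supp(1) lin' m\<psi>(1) M supp(3) tn(1)])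
    have i3: "integrable lborel (\<lambda>x. \<psi> (x - t n *\<^sub>R e) * Z x)"
      using integrable_translate[OF i1, of "- (t n *\<^sub>R e)"] by simp
    have i2: "integrable lborel (\<lambda>x. \<psi> x * Z x)" by (rule test_function_integrable[OF \<psi> Z])
    have "- (\<integral>x. (LINT \<sigma>:{0..t n}|lborel. dderiv UNIV \<psi> e (x - \<sigma> *\<^sub>R e)) * Z x \<partial>lborel) =
        (\<integral>x. (\<psi> (x - t n *\<^sub>R e) - \<psi> x) * Z x \<partial>lborel)"
      by (simp add: test_function_line_difference[OF sm tn(2)])
    also have "\<dots> = (\<integral>x. \<psi> (x - t n *\<^sub>R e) * Z x \<partial>lborel) - (\<integral>x. \<psi> x * Z x \<partial>lborel)"
      using i2 i3 by (simp add: left_diff_distrib)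
    also have "\<dots> = (\<integral>x. \<psi> x * Z (x + t n *\<^sub>R e) \<partial>lborel) - (\<integral>x. \<psi> x * Z x \<partial>lborel)"
      using integral_translate[of "\<lambda>x. \<psi> (x - t n *\<^sub>R e) * Z x" "t n *\<^sub>R e"] by simp
    also have "\<dots> = (\<integral>x. \<psi> x * (Z (x + t n *\<^sub>R e) - Z x) \<partial>lborel)"
      using i1 i2 by (simp add: right_diff_distrib)
    also have "\<dots> = (\<integral>x. \<psi> x * line_integral R e x (t n) \<partial>lborel)"
    proof (rule integral_cong_AE)
      show "AE x in lborel. \<psi> x * (Z (x + t n *\<^sub>R e) - Z x) = \<psi> x * line_integral R e x (t n)"
        using t(2)[of n]
      proof eventually_elim
        case (elim x)
        then show ?case using supp(3)[of x] tn(3) by (cases "x \<in> ?K") auto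
      qed
    qed measurable
    also have "\<dots> = (\<integral>x. (LINT \<sigma>:{0..t n}|lborel. \<psi> (x - \<sigma> *\<^sub>R e)) * R x \<partial>lborel)"
      using ti(1,2) by simp
    finally show ?thesis .
  qed
  have "(\<lambda>n. (1 / t n) * (\<integral>x. (LINT \<sigma>:{0..t n}|lborel. dderiv UNIV \<psi> e (x - \<sigma> *\<^sub>R e)) * Z x \<partial>lborel))
      \<longlonglongrightarrow> (\<integral>x. dderiv UNIV \<psi> e x * Z x \<partial>lborel)"
    by (rule line_average_tendsto[OF Z supp(1) lin test_function_continuous[OF test_function_dderiv[OF \<psi>]] M' dderiv_zero_support t0 tlim])
  from tendsto_minus[OF this]
  have "(\<lambda>n. (1 / t n) * (\<integral>x. (LINT \<sigma>:{0..t n}|lborel. \<psi> (x - \<sigma> *\<^sub>R e)) * R x \<partial>lborel))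
      \<longlonglongrightarrow> - (\<integral>x. dderiv UNIV \<psi> e x * Z x \<partial>lborel)"
    by (simp add: eq[symmetric])
  moreover have "(\<lambda>n. (1 / t n) * (\<integral>x. (LINT \<sigma>:{0..t n}|lborel. \<psi> (x - \<sigma> *\<^sub>R e)) * R x \<partial>lborel))
      \<longlonglongrightarrow> (\<integral>x. \<psi> x * R x \<partial>lborel)"
    by (rule line_average_tendsto[OF R supp(1) lin test_function_continuous[OF \<psi>] M supp(3) t0 tlim])
  ultimately have "- (\<integral>x. dderiv UNIV \<psi> e x * Z x \<partial>lborel) = (\<integral>x. \<psi> x * R x \<partial>lborel)"
    by (rule LIMSEQ_unique)
  then show "(\<integral>x. dderiv UNIV \<psi> e x * Z x \<partial>lborel) = - (\<integral>x. \<psi> x * R x \<partial>lborel)" by simp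
qed

section \<open>A product rule for absolutely continuous functions on an interval\<close>

lemma local_to_global_increment:
  fixes F B :: "real \<Rightarrow> real"
  assumes d: "d > 0" and t: "0 \<le> t" "t \<le> \<delta>"
    and inc: "\<And>a b. 0 \<le> a \<Longrightarrow> a \<le> b \<Longrightarrow> b \<le> \<delta> \<Longrightarrow> b - a < d \<Longrightarrow> \<bar>F b - F a\<bar> \<le> B b - B a"
  shows "\<bar>F t - F 0\<bar> \<le> B t - B 0"
proof -
  obtain n :: nat where n: "t / d < real n" using reals_Archimedean2 by blast
  then have n0: "n > 0" using t(1) d by (metis divide_nonneg_pos not_less of_nat_0 gr0I)
  define p where "p i = t * real i / real n" for i
  have step: "\<bar>F (p (Suc i)) - F (p i)\<bar> \<le> B (p (Suc i)) - B (p i)" if "i < n" for i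
  proof (rule inc)
    show "0 \<le> p i" using t(1) by (simp add: p_def)
    show "p i \<le> p (Suc i)" unfolding p_def using t(1) by (intro divide_right_mono mult_left_mono) auto
    have "t * real (Suc i) \<le> t * real n" using that t(1) by (intro mult_left_mono) auto
    then have "p (Suc i) \<le> t" unfolding p_def using n0 by (simp add: pos_divide_le_eq)
    then show "p (Suc i) \<le> \<delta>" using t(2) by simp
    have "p (Suc i) - p i = t / real n" using n0 by (simp add: p_def field_simps)
    also have "\<dots> < d" using n n0 d by (simp add: field_simps)
    finally show "p (Suc i) - p i < d" .
  qed
  have "F t - F 0 = (\<Sum>i<n. F (p (Suc i)) - F (p i))" "B t - B 0 = (\<Sum>i<n. B (p (Suc i)) - B (p i))"
    using sum_lessThan_telescope[of "\<lambda>i. F (p i)" n] sum_lessThan_telescope[of "\<lambda>i. B (p i)" n] n0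
    by (simp_all add: p_def)
  moreover have "\<bar>\<Sum>i<n. F (p (Suc i)) - F (p i)\<bar> \<le> (\<Sum>i<n. \<bar>F (p (Suc i)) - F (p i)\<bar>)" by (rule sum_abs)
  moreover have "(\<Sum>i<n. \<bar>F (p (Suc i)) - F (p i)\<bar>) \<le> (\<Sum>i<n. B (p (Suc i)) - B (p i))"
    by (rule sum_mono) (use step in auto)
  ultimately show ?thesis by linarith
qed

lemma compact_family_uniform:
  fixes g :: "'i \<Rightarrow> real \<Rightarrow> real"
  assumes "finite I" "\<And>i. i \<in> I \<Longrightarrow> continuous_on {0..\<delta>} (g i)" "\<epsilon> > 0"
  shows "\<exists>d>0. \<forall>i\<in>I. \<forall>s\<in>{0..\<delta>}. \<forall>t\<in>{0..\<delta>}. \<bar>s - t\<bar> < d \<longrightarrow> \<bar>g i s - g i t\<bar> \<le> \<epsilon>"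
  using assms(1,2)
proof (induction I rule: finite_induct)
  case empty
  show ?case by (auto intro: exI[of _ 1])
next
  case (insert i I)
  then obtain d where d: "d > 0" "\<forall>i\<in>I. \<forall>s\<in>{0..\<delta>}. \<forall>t\<in>{0..\<delta>}. \<bar>s - t\<bar> < d \<longrightarrow> \<bar>g i s - g i t\<bar> \<le> \<epsilon>"
    by auto
  have "uniformly_continuous_on {0..\<delta>} (g i)"
    by (rule compact_uniformly_continuous) (use insert in auto)
  then obtain d' where d': "d' > 0" "\<And>s t. s \<in> {0..\<delta>} \<Longrightarrow> t \<in> {0..\<delta>} \<Longrightarrow> dist t s < d' \<Longrightarrow> dist (g i t) (g i s) < \<epsilon>"
    using assms(3) unfolding uniformly_continuous_on_def by metis
  have "\<bar>g i s - g i t\<bar> \<le> \<epsilon>" if "s \<in> {0..\<delta>}" "t \<in> {0..\<delta>}" "\<bar>s - t\<bar> < d'" for s t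
    using d'(2)[OF that(2,1)] that(3) by (simp add: dist_real_def)
  then show ?case using d d'(1) by (intro exI[of _ "min d d'"]) auto
qed

lemma set_integral_Icc_combine:
  fixes f :: "real \<Rightarrow> real"
  assumes "set_integrable lborel {0..\<delta>} f" "0 \<le> a" "a \<le> b" "b \<le> \<delta>"
  shows "(LINT s:{0..b}|lborel. f s) - (LINT s:{0..a}|lborel. f s) = (LINT s:{a..b}|lborel. f s)"
    "set_integrable lborel {a..b} f"
proof -
  have i: "set_integrable lborel {c..d} f" if "0 \<le> c" "d \<le> \<delta>" for c d
    by (rule set_integrable_subset[OF assms(1)]) (use that in auto)
  note e = set_borel_integral_eq_integral(2)[OF i]
  have "integral {0..a} f + integral {a..b} f = integral {0..b} f"
    using set_borel_integral_eq_integral(1)[OF i[of 0 b]] assms by (intro Henstock_Kurzweil_Integration.integral_combine) auto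
  then show "(LINT s:{0..b}|lborel. f s) - (LINT s:{0..a}|lborel. f s) = (LINT s:{a..b}|lborel. f s)"
    using e[of 0 a] e[of a b] e[of 0 b] assms by simp
  show "set_integrable lborel {a..b} f" using i assms by auto
qed

text \<open>
  A product rule for \<open>\<Sum>i. G i (\<alpha> t) * u i t\<close> with absolutely continuous \<open>u i\<close>, in the case in which the
  terms with the derivative of \<open>\<alpha>\<close> cancel; then the derivative of \<open>\<alpha>\<close> need not exist.
\<close>

lemma line_product_rule:
  fixes \<alpha> \<gamma> :: "real \<Rightarrow> real" and u \<eta> G G' :: "'i \<Rightarrow> real \<Rightarrow> real"
  assumes I: "finite I"
    and \<alpha>: "continuous_on {0..\<delta>} \<alpha>"
    and \<gamma>: "set_integrable lborel {0..\<delta>} \<gamma>"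
    and \<alpha>\<gamma>: "\<And>a b. 0 \<le> a \<Longrightarrow> a \<le> b \<Longrightarrow> b \<le> \<delta> \<Longrightarrow> \<bar>\<alpha> b - \<alpha> a\<bar> \<le> (LINT s:{a..b}|lborel. \<gamma> s)"
    and \<eta>: "\<And>i. i \<in> I \<Longrightarrow> set_integrable lborel {0..\<delta>} (\<eta> i)"
    and u: "\<And>i t. i \<in> I \<Longrightarrow> t \<in> {0..\<delta>} \<Longrightarrow> u i t = c i + (LINT s:{0..t}|lborel. \<eta> i s)"
    and G: "\<And>i t. i \<in> I \<Longrightarrow> t \<in> {0..\<delta>} \<Longrightarrow> (G i has_real_derivative G' i (\<alpha> t)) (at (\<alpha> t))"
    and G': "\<And>i. i \<in> I \<Longrightarrow> continuous_on (\<alpha> ` {0..\<delta>}) (G' i)"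
    and cancel: "\<And>t. t \<in> {0..\<delta>} \<Longrightarrow> (\<Sum>i\<in>I. G' i (\<alpha> t) * u i t) = 0"
    and t: "t \<in> {0..\<delta>}"
  shows "(\<Sum>i\<in>I. G i (\<alpha> t) * u i t) - (\<Sum>i\<in>I. G i (\<alpha> 0) * u i 0) =
      (LINT s:{0..t}|lborel. (\<Sum>i\<in>I. G i (\<alpha> s) * \<eta> i s))"
proof -
  have Gc: "continuous_on {0..\<delta>} (\<lambda>t. G i (\<alpha> t))" if "i \<in> I" for i
  proof (rule continuous_on_compose2[OF _ \<alpha> order_refl])
    show "continuous_on (\<alpha> ` {0..\<delta>}) (G i)"
    proof (intro continuous_at_imp_continuous_on ballI)
      fix y assume "y \<in> \<alpha> ` {0..\<delta>}"
      then obtain t where "t \<in> {0..\<delta>}" "y = \<alpha> t" by blast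
      then show "isCont (G i) y" using DERIV_isCont[OF G[OF that]] by blast
    qed
  qed
  have G'c: "continuous_on {0..\<delta>} (\<lambda>t. G' i (\<alpha> t))" if "i \<in> I" for i
    by (rule continuous_on_compose2[OF G'[OF that] \<alpha> order_refl])
  have prod_int: "set_integrable lborel {0..\<delta>} (\<lambda>s. g s * \<eta> i s)"
    if "i \<in> I" "continuous_on {0..\<delta>} g" for i g
  proof -
    have "compact (g ` {0..\<delta>})" using that(2) by (intro compact_continuous_image) auto
    then have "bounded (g ` {0..\<delta>})" by (rule compact_imp_bounded)
    then obtain M where "\<forall>y\<in>g ` {0..\<delta>}. norm y \<le> M" unfolding bounded_iff by blast
    then have M: "\<bar>g s\<bar> \<le> M" if "s \<in> {0..\<delta>}" for s using that by simp
    have m: "(\<lambda>s. indicator {0..\<delta>} s *\<^sub>R g s) \<in> borel_measurable borel"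
      using that(2) by (intro borel_measurable_continuous_on_indicator) auto
    have m2: "(\<lambda>s. indicator {0..\<delta>} s *\<^sub>R \<eta> i s) \<in> borel_measurable borel"
      using \<eta>[OF that(1)] unfolding set_integrable_def by auto
    have "(\<lambda>s. (indicator {0..\<delta>} s *\<^sub>R g s) * (indicator {0..\<delta>} s *\<^sub>R \<eta> i s)) \<in> borel_measurable borel"
      using m m2 by (rule borel_measurable_times)
    also have "(\<lambda>s. (indicator {0..\<delta>} s *\<^sub>R g s) * (indicator {0..\<delta>} s *\<^sub>R \<eta> i s)) =
        (\<lambda>s. indicator {0..\<delta>} s *\<^sub>R (g s * \<eta> i s))" by (auto simp: indicator_def)
    finally have m3: "(\<lambda>s. indicator {0..\<delta>} s *\<^sub>R (g s * \<eta> i s)) \<in> borel_measurable lborel" by simp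
    show ?thesis
      unfolding set_integrable_def
    proof (rule Bochner_Integration.integrable_bound[OF _ m3])
      show "integrable lborel (\<lambda>s. M * (indicator {0..\<delta>} s *\<^sub>R \<eta> i s))"
        using \<eta>[OF that(1)] unfolding set_integrable_def by (rule integrable_mult_right)
      show "AE s in lborel. norm (indicator {0..\<delta>} s *\<^sub>R (g s * \<eta> i s)) \<le> norm (M * (indicator {0..\<delta>} s *\<^sub>R \<eta> i s))"
      proof (rule AE_I2)
        fix s
        have "\<bar>g s\<bar> \<le> \<bar>M\<bar>" if "s \<in> {0..\<delta>}" using M[OF that] by simp
        then show "norm (indicator {0..\<delta>} s *\<^sub>R (g s * \<eta> i s)) \<le> norm (M * (indicator {0..\<delta>} s *\<^sub>R \<eta> i s))"
          by (auto simp: indicator_def abs_mult intro: mult_right_mono)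
      qed
    qed
  qed
  define R where "R s = (\<Sum>i\<in>I. G i (\<alpha> s) * \<eta> i s)" for s
  have Ri: "set_integrable lborel {0..\<delta>} R"
    unfolding R_def set_integrable_def scaleR_sum_right
  proof (rule Bochner_Integration.integrable_sum)
    show "integrable lborel (\<lambda>s. indicator {0..\<delta>} s *\<^sub>R (G i (\<alpha> s) * \<eta> i s))" if "i \<in> I" for i
      using prod_int[OF that Gc[OF that]] unfolding set_integrable_def .
  qed
  \<comment> \<open>The increments of \<Phi>, the defect in the claimed identity, will be at most
    \<epsilon> times those of B, the integral of \<beta>. As \<epsilon> is arbitrary, \<Phi> is
    constant.\<close>
  define \<beta> where "\<beta> s = \<gamma> s + (\<Sum>i\<in>I. \<bar>\<eta> i s\<bar>)" for s
  have abs_\<eta>: "set_integrable lborel {0..\<delta>} (\<lambda>s. \<bar>\<eta> i s\<bar>)" if "i \<in> I" for i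
    using set_integrable_abs[OF \<eta>[OF that]] .
  have sum_\<eta>: "set_integrable lborel {0..\<delta>} (\<lambda>s. \<Sum>i\<in>I. \<bar>\<eta> i s\<bar>)"
    using abs_\<eta> unfolding set_integrable_def scaleR_sum_right by (rule Bochner_Integration.integrable_sum)
  have \<beta>i: "set_integrable lborel {0..\<delta>} \<beta>"
    unfolding \<beta>_def by (rule set_integral_add(1)[OF \<gamma> sum_\<eta>])
  define B where "B t = (LINT s:{0..t}|lborel. \<beta> s)" for t
  define \<Phi> where "\<Phi> t = (\<Sum>i\<in>I. G i (\<alpha> t) * u i t) - (LINT s:{0..t}|lborel. R s)" for t
  define U where "U i = \<bar>c i\<bar> + (LINT s:{0..\<delta>}|lborel. \<bar>\<eta> i s\<bar>)" for i
  have U: "\<bar>u i a\<bar> \<le> U i" if "i \<in> I" "a \<in> {0..\<delta>}" for i a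
  proof -
    have sub: "set_integrable lborel {0..a} (\<eta> i)"
      by (rule set_integrable_subset[OF \<eta>[OF that(1)]]) (use that in auto)
    have "\<bar>LINT s:{0..a}|lborel. \<eta> i s\<bar> \<le> (LINT s:{0..a}|lborel. \<bar>\<eta> i s\<bar>)"
      using set_integral_norm_bound[OF sub] by simp
    also have "\<dots> \<le> (LINT s:{0..\<delta>}|lborel. \<bar>\<eta> i s\<bar>)"
      using abs_\<eta>[OF that(1)] set_integrable_abs[OF sub] that(2) unfolding set_lebesgue_integral_def set_integrable_def
      by (intro integral_mono) (auto simp: indicator_def)
    finally show ?thesis using u[OF that] by (simp add: U_def)
  qed
  have U0: "0 \<le> U i" if "i \<in> I" for i using U[OF that t] by (rule order_trans[OF abs_ge_zero])
  have key: "\<bar>\<Phi> t - \<Phi> 0\<bar> \<le> \<epsilon> * (B t - B 0)" if \<epsilon>: "\<epsilon> > 0" for \<epsilon>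
  proof -
    \<comment> \<open>Chosen such that both \<epsilon>' and \<epsilon>' times the sum of the bounds
      U i are at most \<epsilon>.\<close>
    define \<epsilon>' where "\<epsilon>' = \<epsilon> / (1 + (\<Sum>i\<in>I. U i))"
    have S0: "0 \<le> (\<Sum>i\<in>I. U i)" by (rule sum_nonneg) (rule U0)
    have \<epsilon>': "\<epsilon>' > 0" "\<epsilon>' \<le> \<epsilon>" "(\<Sum>i\<in>I. U i) * \<epsilon>' \<le> \<epsilon>"
    proof -
      show "\<epsilon>' > 0" using \<epsilon> S0 by (simp add: \<epsilon>'_def)
      have "\<epsilon>' * (1 + (\<Sum>i\<in>I. U i)) = \<epsilon>" using S0 by (simp add: \<epsilon>'_def)
      then have *: "\<epsilon>' + (\<Sum>i\<in>I. U i) * \<epsilon>' = \<epsilon>" by (simp add: algebra_simps)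
      have "0 \<le> (\<Sum>i\<in>I. U i) * \<epsilon>'" using S0 \<open>\<epsilon>' > 0\<close> by simp
      then show "\<epsilon>' \<le> \<epsilon>" "(\<Sum>i\<in>I. U i) * \<epsilon>' \<le> \<epsilon>" using * \<open>\<epsilon>' > 0\<close> by linarith+
    qed
    obtain d1 where d1: "d1 > 0" "\<forall>i\<in>I. \<forall>s\<in>{0..\<delta>}. \<forall>t\<in>{0..\<delta>}. \<bar>s - t\<bar> < d1 \<longrightarrow> \<bar>G i (\<alpha> s) - G i (\<alpha> t)\<bar> \<le> \<epsilon>'"
      using compact_family_uniform[of I \<delta> "\<lambda>i t. G i (\<alpha> t)", OF I Gc \<epsilon>'(1)] by auto
    obtain d2 where d2: "d2 > 0" "\<forall>i\<in>I. \<forall>s\<in>{0..\<delta>}. \<forall>t\<in>{0..\<delta>}. \<bar>s - t\<bar> < d2 \<longrightarrow> \<bar>G' i (\<alpha> s) - G' i (\<alpha> t)\<bar> \<le> \<epsilon>'"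
      using compact_family_uniform[of I \<delta> "\<lambda>i t. G' i (\<alpha> t)", OF I G'c \<epsilon>'(1)] by auto
    have "\<bar>\<Phi> t - \<Phi> 0\<bar> \<le> \<epsilon> * B t - \<epsilon> * B 0"
    proof (rule local_to_global_increment[of "min d1 d2" t \<delta> \<Phi> "\<lambda>t. \<epsilon> * B t"])
      show "0 < min d1 d2" using d1(1) d2(1) by simp
      show "0 \<le> t" "t \<le> \<delta>" using t by auto
      fix a b assume ab: "0 \<le> a" "a \<le> b" "b \<le> \<delta>" "b - a < min d1 d2"
      have mem: "a \<in> {0..\<delta>}" "b \<in> {0..\<delta>}" using ab by auto
      have ab_sub: "set_integrable lborel {a..b} f" if "set_integrable lborel {0..\<delta>} f" for f :: "real \<Rightarrow> real"
        by (rule set_integral_Icc_combine(2)[OF that ab(1-3)])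
      \<comment> \<open>D1 collects the change of the u i with G i taken at the right end point,
        compared with the integral of R; D2 collects the change of G i (\<alpha>) with u i frozen at
        the left end point.\<close>
      define D1 where "D1 = (\<Sum>i\<in>I. G i (\<alpha> b) * (u i b - u i a)) - (LINT s:{a..b}|lborel. R s)"
      define D2 where "D2 = (\<Sum>i\<in>I. (G i (\<alpha> b) - G i (\<alpha> a)) * u i a)"
      have "\<Phi> b - \<Phi> a = D1 + D2"
        using set_integral_Icc_combine(1)[OF Ri ab(1-3)]
        by (simp add: \<Phi>_def D1_def D2_def sum.distrib[symmetric] sum_subtractf[symmetric] algebra_simps)
      moreover have "\<bar>D1\<bar> \<le> \<epsilon> * (LINT s:{a..b}|lborel. (\<Sum>i\<in>I. \<bar>\<eta> i s\<bar>))"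
      proof -
        have du: "u i b - u i a = (LINT s:{a..b}|lborel. \<eta> i s)" if "i \<in> I" for i
          using set_integral_Icc_combine(1)[OF \<eta>[OF that] ab(1-3)] u[OF that mem(1)] u[OF that mem(2)] by simp
        have ii: "set_integrable lborel {a..b} (\<lambda>s. (G i (\<alpha> b) - G i (\<alpha> s)) * \<eta> i s)" if "i \<in> I" for i
          by (intro ab_sub prod_int that continuous_intros Gc)
        have "D1 = (\<Sum>i\<in>I. (LINT s:{a..b}|lborel. G i (\<alpha> b) * \<eta> i s)) - (\<Sum>i\<in>I. (LINT s:{a..b}|lborel. G i (\<alpha> s) * \<eta> i s))"
        proof -
          have "(LINT s:{a..b}|lborel. R s) = (\<Sum>i\<in>I. (LINT s:{a..b}|lborel. G i (\<alpha> s) * \<eta> i s))"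
            unfolding R_def set_lebesgue_integral_def scaleR_sum_right
            using ab_sub[OF prod_int[OF _ Gc]] unfolding set_integrable_def by (intro Bochner_Integration.integral_sum)
          then show ?thesis by (simp add: D1_def du)
        qed
        also have "\<dots> = (\<Sum>i\<in>I. (LINT s:{a..b}|lborel. (G i (\<alpha> b) - G i (\<alpha> s)) * \<eta> i s))"
          unfolding sum_subtractf[symmetric]
        proof (rule sum.cong[OF refl])
          fix i assume i: "i \<in> I"
          have "set_integrable lborel {a..b} (\<lambda>s. G i (\<alpha> b) * \<eta> i s)"
            by (rule set_integrable_mult_right) (rule ab_sub[OF \<eta>[OF i]])
          from set_integral_diff(2)[OF this ab_sub[OF prod_int[OF i Gc[OF i]]]]
          show "(LINT s:{a..b}|lborel. G i (\<alpha> b) * \<eta> i s) - (LINT s:{a..b}|lborel. G i (\<alpha> s) * \<eta> i s) =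
              (LINT s:{a..b}|lborel. (G i (\<alpha> b) - G i (\<alpha> s)) * \<eta> i s)"
            by (simp add: left_diff_distrib)
        qed
        finally have "\<bar>D1\<bar> \<le> (\<Sum>i\<in>I. \<bar>LINT s:{a..b}|lborel. (G i (\<alpha> b) - G i (\<alpha> s)) * \<eta> i s\<bar>)"
          by (simp add: sum_abs)
        also have "\<dots> \<le> (\<Sum>i\<in>I. (LINT s:{a..b}|lborel. \<epsilon> * \<bar>\<eta> i s\<bar>))"
        proof (rule sum_mono)
          fix i assume i: "i \<in> I"
          have "\<bar>LINT s:{a..b}|lborel. (G i (\<alpha> b) - G i (\<alpha> s)) * \<eta> i s\<bar> \<le>
              (LINT s:{a..b}|lborel. \<bar>(G i (\<alpha> b) - G i (\<alpha> s)) * \<eta> i s\<bar>)"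
            using set_integral_norm_bound[OF ii[OF i]] by simp
          also have "\<dots> \<le> (LINT s:{a..b}|lborel. \<epsilon> * \<bar>\<eta> i s\<bar>)"
          proof (rule set_integral_mono)
            show "set_integrable lborel {a..b} (\<lambda>s. \<bar>(G i (\<alpha> b) - G i (\<alpha> s)) * \<eta> i s\<bar>)"
              by (rule set_integrable_abs[OF ii[OF i]])
            show "set_integrable lborel {a..b} (\<lambda>s. \<epsilon> * \<bar>\<eta> i s\<bar>)"
              by (rule set_integrable_mult_right) (rule ab_sub[OF abs_\<eta>[OF i]])
            fix s assume s: "s \<in> {a..b}"
            then have "\<bar>b - s\<bar> < d1" "s \<in> {0..\<delta>}" using ab by auto
            then have "\<bar>G i (\<alpha> b) - G i (\<alpha> s)\<bar> \<le> \<epsilon>'" using d1(2) i mem(2) by blast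
            then show "\<bar>(G i (\<alpha> b) - G i (\<alpha> s)) * \<eta> i s\<bar> \<le> \<epsilon> * \<bar>\<eta> i s\<bar>"
              using \<epsilon>'(2) by (simp add: abs_mult mult_right_mono)
          qed
          finally show "\<bar>LINT s:{a..b}|lborel. (G i (\<alpha> b) - G i (\<alpha> s)) * \<eta> i s\<bar> \<le> (LINT s:{a..b}|lborel. \<epsilon> * \<bar>\<eta> i s\<bar>)" .
        qed
        also have "\<dots> = \<epsilon> * (\<Sum>i\<in>I. (LINT s:{a..b}|lborel. \<bar>\<eta> i s\<bar>))"
          by (simp add: sum_distrib_left)
        also have "(\<Sum>i\<in>I. (LINT s:{a..b}|lborel. \<bar>\<eta> i s\<bar>)) = (LINT s:{a..b}|lborel. (\<Sum>i\<in>I. \<bar>\<eta> i s\<bar>))"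
          unfolding set_lebesgue_integral_def scaleR_sum_right
          using ab_sub[OF abs_\<eta>] unfolding set_integrable_def by (intro Bochner_Integration.integral_sum[symmetric])
        finally show ?thesis .
      qed
      moreover have "\<bar>D2\<bar> \<le> \<epsilon> * (LINT s:{a..b}|lborel. \<gamma> s)"
      proof -
        \<comment> \<open>With u frozen at a, D2 is an increment of \<Psi> between \<alpha> a and
          \<alpha> b. By the cancellation hypothesis the derivative of \<Psi> vanishes at \<alpha>
          a. Every value in between is \<alpha> s for some s in [a, b], so the derivative stays
          small there; only the size of \<alpha> b - \<alpha> a enters, never a derivative of
          \<alpha>.\<close>
        define \<Psi> where "\<Psi> y = (\<Sum>i\<in>I. G i y * u i a)" for y
        define \<Psi>' where "\<Psi>' y = (\<Sum>i\<in>I. G' i y * u i a)" for y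
        have \<alpha>ab: "continuous_on {a..b} \<alpha>" by (rule continuous_on_subset[OF \<alpha>]) (use ab in auto)
        have "connected (\<alpha> ` {a..b})" by (intro connected_continuous_image \<alpha>ab connected_Icc)
        then have hit: "\<exists>s\<in>{a..b}. \<alpha> s = y" if "min (\<alpha> a) (\<alpha> b) \<le> y" "y \<le> max (\<alpha> a) (\<alpha> b)" for y
        proof -
          have "{min (\<alpha> a) (\<alpha> b)..max (\<alpha> a) (\<alpha> b)} \<subseteq> \<alpha> ` {a..b}"
            by (rule connected_contains_Icc[OF \<open>connected _\<close>]) (use ab(2) in \<open>auto simp: min_def max_def\<close>)
          then show ?thesis using that by force
        qed
        have der: "(\<Psi> has_real_derivative \<Psi>' y) (at y)" if y: "min (\<alpha> a) (\<alpha> b) \<le> y" "y \<le> max (\<alpha> a) (\<alpha> b)" for y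
        proof -
          obtain s where s: "s \<in> {a..b}" "\<alpha> s = y" using hit[OF y] by blast
          then have "s \<in> {0..\<delta>}" using ab by auto
          then show ?thesis unfolding \<Psi>_def[abs_def] \<Psi>'_def s(2)[symmetric]
            by (intro DERIV_sum DERIV_cmult_right G)
        qed
        have small: "\<bar>\<Psi>' y\<bar> \<le> \<epsilon>" if y: "min (\<alpha> a) (\<alpha> b) \<le> y" "y \<le> max (\<alpha> a) (\<alpha> b)" for y
        proof -
          obtain s where s: "s \<in> {a..b}" "\<alpha> s = y" using hit[OF y] by blast
          have "\<Psi>' (\<alpha> a) = 0" unfolding \<Psi>'_def by (rule cancel[OF mem(1)])
          then have "\<Psi>' y = (\<Sum>i\<in>I. (G' i (\<alpha> s) - G' i (\<alpha> a)) * u i a)"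
            by (simp add: \<Psi>'_def s(2) left_diff_distrib sum_subtractf)
          then have "\<bar>\<Psi>' y\<bar> \<le> (\<Sum>i\<in>I. \<bar>(G' i (\<alpha> s) - G' i (\<alpha> a)) * u i a\<bar>)" by (simp add: sum_abs)
          also have "\<dots> \<le> (\<Sum>i\<in>I. U i * \<epsilon>')"
          proof (rule sum_mono)
            fix i assume i: "i \<in> I"
            have "\<bar>s - a\<bar> < d2" "s \<in> {0..\<delta>}" using s(1) ab by auto
            then have "\<bar>G' i (\<alpha> s) - G' i (\<alpha> a)\<bar> \<le> \<epsilon>'" using d2(2) i mem(1) by blast
            then have "\<bar>G' i (\<alpha> s) - G' i (\<alpha> a)\<bar> * \<bar>u i a\<bar> \<le> \<epsilon>' * U i"
              using U[OF i mem(1)] \<epsilon>'(1) by (intro mult_mono) auto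
            then show "\<bar>(G' i (\<alpha> s) - G' i (\<alpha> a)) * u i a\<bar> \<le> U i * \<epsilon>'" by (simp add: abs_mult mult.commute)
          qed
          also have "\<dots> = (\<Sum>i\<in>I. U i) * \<epsilon>'" by (simp add: sum_distrib_right)
          finally show ?thesis using \<epsilon>'(3) by simp
        qed
        have "\<bar>\<Psi> (\<alpha> b) - \<Psi> (\<alpha> a)\<bar> \<le> \<epsilon> * \<bar>\<alpha> b - \<alpha> a\<bar>"
        proof -
          let ?l = "min (\<alpha> a) (\<alpha> b)" and ?r = "max (\<alpha> a) (\<alpha> b)"
          have "\<bar>\<Psi> ?r - \<Psi> ?l\<bar> \<le> \<epsilon> * (?r - ?l)"
          proof (cases "?l < ?r")
            case True
            then obtain z where z: "?l < z" "z < ?r" "\<Psi> ?r - \<Psi> ?l = (?r - ?l) * \<Psi>' z"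
              using MVT2[of ?l ?r \<Psi> \<Psi>'] der by blast
            have "\<bar>\<Psi> ?r - \<Psi> ?l\<bar> = (?r - ?l) * \<bar>\<Psi>' z\<bar>" unfolding z(3) abs_mult using True by simp
            also have "\<dots> \<le> (?r - ?l) * \<epsilon>" using small[of z] z True by (intro mult_left_mono) auto
            finally show ?thesis by (simp add: mult.commute)
          next
            case False
            then have "?r = ?l" by linarith
            then show ?thesis by simp
          qed
          then show ?thesis by (cases "\<alpha> a \<le> \<alpha> b") (auto simp: min_def max_def)
        qed
        also have "\<dots> \<le> \<epsilon> * (LINT s:{a..b}|lborel. \<gamma> s)"
          using \<alpha>\<gamma>[OF ab(1-3)] \<epsilon> by (intro mult_left_mono) auto
        also have "\<Psi> (\<alpha> b) - \<Psi> (\<alpha> a) = D2"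
          by (simp add: \<Psi>_def D2_def left_diff_distrib sum_subtractf)
        finally show ?thesis .
      qed
      moreover have "B b - B a = (LINT s:{a..b}|lborel. \<gamma> s) + (LINT s:{a..b}|lborel. (\<Sum>i\<in>I. \<bar>\<eta> i s\<bar>))"
        using set_integral_Icc_combine(1)[OF \<beta>i ab(1-3)] set_integral_add(2)[OF ab_sub[OF \<gamma>] ab_sub[OF sum_\<eta>]]
        by (simp add: B_def \<beta>_def)
      ultimately show "\<bar>\<Phi> b - \<Phi> a\<bar> \<le> \<epsilon> * B b - \<epsilon> * B a"
        by (simp add: right_diff_distrib[symmetric] distrib_left)
    qed
    then show ?thesis by (simp add: right_diff_distrib)
  qed
  have "\<bar>\<Phi> t - \<Phi> 0\<bar> \<le> e" if "e > 0" for e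
  proof -
    define b where "b = \<bar>B t - B 0\<bar> + 1"
    have "b > 0" by (simp add: b_def)
    then have "\<bar>\<Phi> t - \<Phi> 0\<bar> \<le> (e / b) * (B t - B 0)" using that by (intro key) simp
    also have "\<dots> \<le> (e / b) * b" using that \<open>b > 0\<close> by (intro mult_left_mono) (auto simp: b_def)
    finally show ?thesis using \<open>b > 0\<close> by simp
  qed
  then have "\<bar>\<Phi> t - \<Phi> 0\<bar> \<le> 0" using field_le_epsilon[of "\<bar>\<Phi> t - \<Phi> 0\<bar>" 0] by simp
  moreover have "(LINT s:{0..0}|lborel. R s) = 0"
    using set_integral_Icc_combine(1)[OF Ri, of 0 0] t by simp
  ultimately show ?thesis by (simp add: \<Phi>_def R_def)
qed

text \<open>The entries are the coefficients of the Lagrange polynomials at the nodes 0, ..., N: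
  interpolating the monomial of degree l \<le> N reproduces it, and comparing coefficients gives the
  identity.\<close>

lemma vandermonde_inverse:
  obtains V :: "nat \<Rightarrow> nat \<Rightarrow> real" where
    "\<And>m l. m \<le> N \<Longrightarrow> l \<le> N \<Longrightarrow> (\<Sum>s\<le>N. V m s * real s ^ l) = (if m = l then 1 else 0)"
proof -
  define L :: "nat \<Rightarrow> real poly" where
    "L s = (\<Prod>j\<in>{..N} - {s}. smult (1 / (real s - real j)) [:- real j, 1:])" for s
  have pL: "poly (L s) (real i) = (\<Prod>j\<in>{..N} - {s}. 1 / (real s - real j) * (real i - real j))" for s i
    unfolding L_def poly_prod by (rule prod.cong) (auto simp: diff_divide_distrib)
  have L: "poly (L s) (real i) = (if i = s then 1 else 0)" if "s \<le> N" "i \<le> N" for s i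
  proof (cases "i = s")
    case True
    then show ?thesis unfolding pL by (auto intro!: prod.neutral)
  next
    case False
    have "(\<Prod>j\<in>{..N} - {s}. 1 / (real s - real j) * (real i - real j)) = 0"
      using that False by (intro prod_zero) (auto intro!: bexI[of _ i])
    then show ?thesis unfolding pL using False by simp
  qed
  have deg: "degree (L s) \<le> N" if "s \<le> N" for s
  proof -
    have "degree (L s) \<le> (\<Sum>j\<in>{..N} - {s}. degree (smult (1 / (real s - real j)) [:- real j, 1:]))"
      unfolding L_def by (rule degree_prod_sum_le[unfolded o_def]) simp
    also have "\<dots> \<le> (\<Sum>j\<in>{..N} - {s}. 1)" by (rule sum_mono) simp
    also have "\<dots> = N" using that by simp
    finally show ?thesis .
  qed
  have eq: "(\<Sum>s\<le>N. smult (real s ^ l) (L s)) = monom 1 l" if "l \<le> N" for l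
  proof -
    let ?P = "(\<Sum>s\<le>N. smult (real s ^ l) (L s)) - monom 1 l"
    have "degree (\<Sum>s\<le>N. smult (real s ^ l) (L s)) \<le> N"
    proof (rule degree_sum_le)
      fix s assume "s \<in> {..N}"
      then show "degree (smult (real s ^ l) (L s)) \<le> N"
        by (intro order_trans[OF degree_smult_le] deg) simp
    qed simp
    then have dP: "degree ?P \<le> N"
      using that by (intro degree_diff_le) (auto intro: order_trans[OF degree_monom_le])
    have "?P = 0"
    proof (rule ccontr)
      assume ne: "?P \<noteq> 0"
      have "poly ?P (real i) = 0" if "i \<le> N" for i
      proof -
        have "poly (\<Sum>s\<le>N. smult (real s ^ l) (L s)) (real i) = (\<Sum>s\<le>N. if i = s then real s ^ l else 0)"
          unfolding poly_sum by (rule sum.cong) (use that in \<open>auto simp: L\<close>)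
        then show ?thesis using that by (simp add: poly_monom)
      qed
      then have "real ` {..N} \<subseteq> {x. poly ?P x = 0}" by auto
      then have "card (real ` {..N}) \<le> card {x. poly ?P x = 0}" by (intro card_mono poly_roots_finite ne)
      also have "\<dots> \<le> degree ?P" by (rule card_poly_roots_bound[OF ne])
      finally show False using dP by (simp add: card_image)
    qed
    then show ?thesis by simp
  qed
  have "(\<Sum>s\<le>N. coeff (L s) m * real s ^ l) = (if m = l then 1 else 0)" if "m \<le> N" "l \<le> N" for m l
    using arg_cong[OF eq[OF that(2)], of "\<lambda>p. coeff p m"] by (simp add: coeff_sum mult.commute)
  then show ?thesis by (rule that)
qed

subsection \<open>Functions of exponential type\<close>

text \<open>
  The weak derivative of \<open>exp (s * \<alpha>) * (\<Sum>l\<le>j. s ^ l * B l)\<close> is again of this form, with one more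
  coefficient. The coefficients are recovered from the values at \<open>s = 0, ..., j\<close> by inverting a
  Vandermonde matrix, so that no products of derivatives of \<open>\<alpha>\<close> have to be estimated.
\<close>

lemma compact_line_in:
  fixes X :: "'e::euclidean_space set"
  assumes "open X" "compact K" "K \<subseteq> X"
  obtains \<delta> where "\<delta> > 0" "\<And>x. x \<in> K \<Longrightarrow> line_in X e \<delta> x"
proof -
  obtain \<epsilon> where \<epsilon>: "\<epsilon> > 0" "(\<Union>x\<in>K. cball x \<epsilon>) \<subseteq> X"
    using compact_subset_open_imp_cball_epsilon_subset[OF assms(2,1,3)] by blast
  define \<delta> where "\<delta> = \<epsilon> / (norm e + 1)"
  have n: "norm e + 1 > 0" by (simp add: add_nonneg_pos)
  have \<delta>: "\<delta> > 0" using \<epsilon>(1) n by (simp add: \<delta>_def)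
  have "line_in X e \<delta> x" if "x \<in> K" for x
    unfolding line_in_def
  proof
    fix \<sigma> assume \<sigma>: "\<sigma> \<in> {0..\<delta>}"
    have "\<sigma> * norm e \<le> \<delta> * (norm e + 1)" using \<sigma> \<delta> by (intro mult_mono) auto
    also have "\<dots> = \<epsilon>" using n by (simp add: \<delta>_def)
    finally have "x + \<sigma> *\<^sub>R e \<in> cball x \<epsilon>" using \<sigma> by (simp add: dist_norm)
    then show "x + \<sigma> *\<^sub>R e \<in> X" using \<epsilon>(2) that by blast
  qed
  then show ?thesis using that \<delta> by blast
qed

text \<open>The matrix V applied to exp (- s y) u s returns the coefficients b m, and 0 for m = Suc
  j. The second sum uses the y-derivatives of the weights in the first, with u s kept fixed:
  differentiating D m gives D (Suc m) b m, while the factor s coming from exp (- s y) shifts the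
  coefficients by one index and produces the same sum. This shift raises the degree in s to Suc j,
  hence the nodes up to Suc j.\<close>

lemma exp_combination_algebra:
  fixes D :: "nat \<Rightarrow> real \<Rightarrow> real"
  assumes V: "\<And>m l. m \<le> Suc j \<Longrightarrow> l \<le> Suc j \<Longrightarrow> (\<Sum>s\<le>Suc j. V m s * real s ^ l) = (if m = l then 1 else 0)"
    and u: "\<And>s. s \<le> Suc j \<Longrightarrow> u s = exp (real s * y) * (\<Sum>l\<le>j. real s ^ l * b l)"
  shows "(\<Sum>s\<le>Suc j. (\<Sum>m\<le>Suc j. D m y * V m s * exp (- real s * y)) * u s) = (\<Sum>m\<le>j. D m y * b m)"
    and "(\<Sum>s\<le>Suc j. (\<Sum>m\<le>Suc j. D (Suc m) y * V m s * exp (- real s * y)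
      - real s * (D m y * V m s * exp (- real s * y))) * u s) = 0"
proof -
  have e: "exp (- real s * y) * u s = (\<Sum>l\<le>j. real s ^ l * b l)" if "s \<le> Suc j" for s
  proof -
    have "exp (- real s * y) * exp (real s * y) = 1" by (simp add: exp_minus)
    then show ?thesis unfolding u[OF that] by (simp add: mult.assoc[symmetric])
  qed
  have A: "(\<Sum>s\<le>Suc j. V m s * (exp (- real s * y) * u s)) = (if m \<le> j then b m else 0)" if m: "m \<le> Suc j" for m
  proof -
    have "(\<Sum>s\<le>Suc j. V m s * (exp (- real s * y) * u s)) = (\<Sum>s\<le>Suc j. \<Sum>l\<le>j. b l * (V m s * real s ^ l))"
      by (rule sum.cong[OF refl]) (simp only: atMost_iff e, simp add: sum_distrib_left mult_ac)
    also have "\<dots> = (\<Sum>l\<le>j. b l * (\<Sum>s\<le>Suc j. V m s * real s ^ l))"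
      by (subst sum.swap) (simp only: sum_distrib_left)
    also have "\<dots> = (\<Sum>l\<le>j. if m = l then b l else 0)"
      by (rule sum.cong[OF refl]) (use V[OF m] in auto)
    finally show ?thesis by simp
  qed
  have A': "(\<Sum>s\<le>Suc j. V m s * (real s * (exp (- real s * y) * u s))) = (case m of 0 \<Rightarrow> 0 | Suc i \<Rightarrow> b i)" if m: "m \<le> Suc j" for m
  proof -
    have "(\<Sum>s\<le>Suc j. V m s * (real s * (exp (- real s * y) * u s))) = (\<Sum>s\<le>Suc j. \<Sum>l\<le>j. b l * (V m s * real s ^ Suc l))"
      by (rule sum.cong[OF refl]) (simp only: atMost_iff e, simp add: sum_distrib_left mult_ac)
    also have "\<dots> = (\<Sum>l\<le>j. b l * (\<Sum>s\<le>Suc j. V m s * real s ^ Suc l))"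
      by (subst sum.swap) (simp only: sum_distrib_left)
    also have "\<dots> = (\<Sum>l\<le>j. if m = Suc l then b l else 0)"
      by (rule sum.cong[OF refl]) (use V[OF m, of "Suc _"] in auto)
    also have "\<dots> = (case m of 0 \<Rightarrow> 0 | Suc i \<Rightarrow> b i)" using m by (cases m) auto
    finally show ?thesis .
  qed
  have swap: "(\<Sum>s\<le>Suc j. (\<Sum>m\<le>Suc j. C m * V m s * exp (- real s * y)) * u s) =
      (\<Sum>m\<le>Suc j. C m * (\<Sum>s\<le>Suc j. V m s * (exp (- real s * y) * u s)))" for C
    unfolding sum_distrib_right sum_distrib_left by (subst sum.swap) (simp only: mult.assoc)
  have swap': "(\<Sum>s\<le>Suc j. (\<Sum>m\<le>Suc j. real s * (C m * V m s * exp (- real s * y))) * u s) =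
      (\<Sum>m\<le>Suc j. C m * (\<Sum>s\<le>Suc j. V m s * (real s * (exp (- real s * y) * u s))))" for C
    unfolding sum_distrib_right sum_distrib_left by (subst sum.swap) (simp only: mult.assoc mult.left_commute)
  have B: "(\<Sum>m\<le>Suc j. C m * (\<Sum>s\<le>Suc j. V m s * (exp (- real s * y) * u s))) = (\<Sum>m\<le>j. C m * b m)" for C
  proof -
    have "(\<Sum>m\<le>Suc j. C m * (\<Sum>s\<le>Suc j. V m s * (exp (- real s * y) * u s))) =
        (\<Sum>m\<le>Suc j. C m * (if m \<le> j then b m else 0))"
      by (rule sum.cong[OF refl]) (simp only: atMost_iff A)
    then show ?thesis by simp
  qed
  have B': "(\<Sum>m\<le>Suc j. C m * (\<Sum>s\<le>Suc j. V m s * (real s * (exp (- real s * y) * u s)))) = (\<Sum>m\<le>j. C (Suc m) * b m)" for C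
  proof -
    have "(\<Sum>m\<le>Suc j. C m * (\<Sum>s\<le>Suc j. V m s * (real s * (exp (- real s * y) * u s)))) =
        (\<Sum>m\<le>Suc j. C m * (case m of 0 \<Rightarrow> 0 | Suc i \<Rightarrow> b i))"
      by (rule sum.cong[OF refl]) (simp only: atMost_iff A')
    also have "\<dots> = (\<Sum>m\<le>j. C (Suc m) * b m)" by (subst sum.atMost_Suc_shift) simp
    finally show ?thesis .
  qed
  show "(\<Sum>s\<le>Suc j. (\<Sum>m\<le>Suc j. D m y * V m s * exp (- real s * y)) * u s) = (\<Sum>m\<le>j. D m y * b m)"
    unfolding swap B ..
  have "(\<Sum>s\<le>Suc j. (\<Sum>m\<le>Suc j. D (Suc m) y * V m s * exp (- real s * y)
      - real s * (D m y * V m s * exp (- real s * y))) * u s) =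
    (\<Sum>s\<le>Suc j. (\<Sum>m\<le>Suc j. D (Suc m) y * V m s * exp (- real s * y)) * u s)
    - (\<Sum>s\<le>Suc j. (\<Sum>m\<le>Suc j. real s * (D m y * V m s * exp (- real s * y))) * u s)"
    by (simp only: sum_subtractf left_diff_distrib)
  also have "\<dots> = 0" unfolding swap swap' B B' by simp
  finally show "(\<Sum>s\<le>Suc j. (\<Sum>m\<le>Suc j. D (Suc m) y * V m s * exp (- real s * y)
      - real s * (D m y * V m s * exp (- real s * y))) * u s) = 0" .
qed

text \<open>Bounds increments of \<alpha> by those of exp \<alpha>, whose weak derivative is known
  to exist.\<close>

lemma abs_diff_le_exp:
  assumes "exp (- p) \<le> C" "exp (- q) \<le> (C::real)"
  shows "\<bar>p - q\<bar> \<le> C * \<bar>exp p - exp q\<bar>"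
proof -
  have *: "p - q \<le> C * \<bar>exp p - exp q\<bar>" if "q \<le> p" "exp (- q) \<le> C" for p q
  proof -
    have "p - q \<le> exp (p - q) - 1" using exp_ge_add_one_self[of "p - q"] by linarith
    also have "\<dots> = exp (- q) * (exp p - exp q)" by (simp add: exp_diff exp_minus field_simps)
    also have "\<dots> \<le> C * (exp p - exp q)" using that by (intro mult_right_mono) auto
    finally show ?thesis using that by simp
  qed
  show ?thesis
  proof (cases "q \<le> p")
    case True
    then show ?thesis using *[OF True assms(2)] by simp
  next
    case False
    then show ?thesis using *[of p q] assms(1) by (simp add: abs_minus_commute)
  qed
qed

text \<open>With G s y = \<Sum>m. D m y * V m s * exp (- s y), the function Z equals \<Sum>s. G s
  \<alpha> * u s, and R equals \<Sum>s. G s \<alpha> * H s. Along almost every line the u s are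
  absolutely continuous and the terms with the derivatives of G s cancel, so the product rule on
  lines yields the increments of Z.\<close>

lemma weak_deriv_exp_combination:
  fixes \<alpha> :: "'e::euclidean_space \<Rightarrow> real" and B H u :: "nat \<Rightarrow> 'e \<Rightarrow> real"
  assumes X: "open X" and \<alpha>: "continuous_on X \<alpha>" "\<alpha> ` X \<subseteq> T" and D: "derivative_sequence T D"
    and V: "\<And>m l. m \<le> Suc j \<Longrightarrow> l \<le> Suc j \<Longrightarrow> (\<Sum>s\<le>Suc j. V m s * real s ^ l) = (if m = l then 1 else 0)"
    and g: "locally_integrable X g" "locally_integrable X h" "weak_deriv X e g h" "\<And>x. x \<in> X \<Longrightarrow> g x = exp (\<alpha> x)"
    and u: "\<And>s. locally_integrable X (u s)" "\<And>s. locally_integrable X (H s)" "\<And>s. weak_deriv X e (u s) (H s)"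
      "\<And>s x. x \<in> X \<Longrightarrow> u s x = exp (real s * \<alpha> x) * (\<Sum>l\<le>j. real s ^ l * B l x)"
    and Z: "locally_integrable X Z" "\<And>x. x \<in> X \<Longrightarrow> Z x = (\<Sum>m\<le>j. D m (\<alpha> x) * B m x)"
    and R: "locally_integrable X R"
      "\<And>x. x \<in> X \<Longrightarrow> R x = (\<Sum>m\<le>Suc j. D m (\<alpha> x) * (\<Sum>s\<le>Suc j. V m s * exp (- real s * \<alpha> x) * H s x))"
  shows "weak_deriv X e Z R"
proof (rule weak_deriv_if_lines[OF Z(1) R(1)])
  fix K assume K: "compact K" "K \<subseteq> X"
  obtain \<delta> where \<delta>: "\<delta> > 0" "\<And>x. x \<in> K \<Longrightarrow> line_in X e \<delta> x"
    using compact_line_in[OF X K] by metis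
  define G where "G s y = (\<Sum>m\<le>Suc j. D m y * V m s * exp (- real s * y))" for s y
  define G' where "G' s y = (\<Sum>m\<le>Suc j. D (Suc m) y * V m s * exp (- real s * y)
      - real s * (D m y * V m s * exp (- real s * y)))" for s y
  have GD: "(G s has_real_derivative G' s y) (at y)" if "y \<in> T" for s y
  proof -
    have "(D m has_real_derivative D (Suc m) y) (at y)" for m
      using D that by (simp add: derivative_sequence_def)
    then show ?thesis
      unfolding G_def[abs_def] G'_def
      by (intro DERIV_sum) (auto intro!: derivative_eq_intros)
  qed
  have G'c: "continuous_on T (G' s)" for s
    unfolding G'_def[abs_def] by (intro continuous_intros derivative_sequence_continuous[OF D])
  have "AE x in lborel. \<forall>s\<in>{..Suc j}. x \<in> K \<longrightarrow> set_integrable lborel {0..\<delta>} (\<lambda>\<sigma>. H s (x + \<sigma> *\<^sub>R e)) \<and>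
    (AE t in lborel. t \<in> {0..\<delta>} \<longrightarrow> u s (x + t *\<^sub>R e) - u s x = line_integral (H s) e x t)"
    by (subst AE_ball_countable) (use weak_deriv_lines[OF X u(1,2,3) K(1) \<delta>(2)] in auto)
  moreover have "AE x in lborel. x \<in> K \<longrightarrow> set_integrable lborel {0..\<delta>} (\<lambda>\<sigma>. h (x + \<sigma> *\<^sub>R e)) \<and>
    (AE t in lborel. t \<in> {0..\<delta>} \<longrightarrow> g (x + t *\<^sub>R e) - g x = line_integral h e x t)"
    by (rule weak_deriv_lines[OF X g(1-3) K(1) \<delta>(2)])
  ultimately have "AE x in lborel. x \<in> K \<longrightarrow> (AE t in lborel. t \<in> {0..\<delta>} \<longrightarrow> Z (x + t *\<^sub>R e) - Z x = line_integral R e x t)"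
  proof eventually_elim
    case (elim x)
    show ?case
    proof
      assume x: "x \<in> K"
      have lin: "x + t *\<^sub>R e \<in> X" if "t \<in> {0..\<delta>}" for t using \<delta>(2)[OF x] that by (simp add: line_in_def)
      have xX: "x \<in> X" using lin[of 0] \<delta>(1) by simp
      have Hi: "set_integrable lborel {0..\<delta>} (\<lambda>\<sigma>. H s (x + \<sigma> *\<^sub>R e))"
        and Hl: "AE t in lborel. t \<in> {0..\<delta>} \<longrightarrow> u s (x + t *\<^sub>R e) - u s x = line_integral (H s) e x t" if "s \<le> Suc j" for s
        using elim(1) x that by auto
      have hi: "set_integrable lborel {0..\<delta>} (\<lambda>\<sigma>. h (x + \<sigma> *\<^sub>R e))"
        and hl: "AE t in lborel. t \<in> {0..\<delta>} \<longrightarrow> g (x + t *\<^sub>R e) - g x = line_integral h e x t"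
        using elim(2) x by auto
      define a where "a t = \<alpha> (x + t *\<^sub>R e)" for t
      \<comment> \<open>The absolutely continuous representative of u s on this line. It equals u s
        for almost every t only, but identities between continuous functions extend from almost
        every t to all t.\<close>
      define w where "w s t = u s x + line_integral (H s) e x t" for s t
      have ac: "continuous_on {0..\<delta>} a"
        unfolding a_def by (rule continuous_on_compose2[OF \<alpha>(1)]) (use lin in \<open>auto intro!: continuous_intros\<close>)
      have aT: "a t \<in> T" if "t \<in> {0..\<delta>}" for t using lin[OF that] \<alpha>(2) by (auto simp: a_def)
      have cont_int: "continuous_on {0..\<delta>} (\<lambda>t. LINT \<sigma>:{0..t}|lborel. f \<sigma>)" if f: "set_integrable lborel {0..\<delta>} f" for f :: "real \<Rightarrow> real"
      proof -
        have "continuous_on {0..\<delta>} (\<lambda>t. integral {0..t} f)"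
          by (rule indefinite_integral_continuous_1[OF set_borel_integral_eq_integral(1)[OF f]])
        then show ?thesis
        proof (rule continuous_on_eq)
          fix t assume "t \<in> {0..\<delta>}"
          then show "integral {0..t} f = (LINT \<sigma>:{0..t}|lborel. f \<sigma>)"
            by (intro set_borel_integral_eq_integral(2)[symmetric] set_integrable_subset[OF f]) auto
        qed
      qed
      have wc: "continuous_on {0..\<delta>} (w s)" if "s \<le> Suc j" for s
        unfolding w_def[abs_def] line_integral_def by (intro continuous_intros cont_int Hi that)
      have ga: "exp (a t) - exp (a 0) = (LINT \<sigma>:{0..t}|lborel. h (x + \<sigma> *\<^sub>R e))" if t: "t \<in> {0..\<delta>}" for t
      proof -
        have "exp (a t) - exp (a 0) - (LINT \<sigma>:{0..t}|lborel. h (x + \<sigma> *\<^sub>R e)) = 0"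
        proof (rule AE_continuous_zero[OF \<delta>(1) _ _ t])
          show "continuous_on {0..\<delta>} (\<lambda>t. exp (a t) - exp (a 0) - (LINT \<sigma>:{0..t}|lborel. h (x + \<sigma> *\<^sub>R e)))"
            by (intro continuous_intros cont_int hi ac)
          show "AE t in lborel. t \<in> {0..\<delta>} \<longrightarrow> exp (a t) - exp (a 0) - (LINT \<sigma>:{0..t}|lborel. h (x + \<sigma> *\<^sub>R e)) = 0"
            using hl
          proof eventually_elim
            case (elim t)
            show ?case
            proof
              assume t: "t \<in> {0..\<delta>}"
              show "exp (a t) - exp (a 0) - (LINT \<sigma>:{0..t}|lborel. h (x + \<sigma> *\<^sub>R e)) = 0"
                using elim t g(4)[OF lin[OF t]] g(4)[OF xX] by (simp add: a_def line_integral_def)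
            qed
          qed
        qed
        then show ?thesis by simp
      qed
      have "compact ((\<lambda>t. exp (- a t)) ` {0..\<delta>})"
        by (intro compact_continuous_image continuous_intros ac compact_Icc)
      then have "bounded ((\<lambda>t. exp (- a t)) ` {0..\<delta>})" by (rule compact_imp_bounded)
      then obtain C where "\<forall>y\<in>(\<lambda>t. exp (- a t)) ` {0..\<delta>}. norm y \<le> C" unfolding bounded_iff by blast
      then have C: "exp (- a t) \<le> C" if "t \<in> {0..\<delta>}" for t using that by auto
      have \<gamma>i: "set_integrable lborel {0..\<delta>} (\<lambda>\<sigma>. C * \<bar>h (x + \<sigma> *\<^sub>R e)\<bar>)"
        by (rule set_integrable_mult_right) (rule set_integrable_abs[OF hi])
      have C0: "0 \<le> C" using order_trans[OF exp_ge_zero C[of 0]] \<delta>(1) by simp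
      have a\<gamma>: "\<bar>a c - a b\<bar> \<le> (LINT \<sigma>:{b..c}|lborel. C * \<bar>h (x + \<sigma> *\<^sub>R e)\<bar>)"
        if bc: "0 \<le> b" "b \<le> c" "c \<le> \<delta>" for b c
      proof -
        have mem: "b \<in> {0..\<delta>}" "c \<in> {0..\<delta>}" using bc by auto
        note comb = set_integral_Icc_combine[OF hi bc]
        have "\<bar>a c - a b\<bar> \<le> C * \<bar>exp (a c) - exp (a b)\<bar>" by (rule abs_diff_le_exp) (use C mem in auto)
        also have "exp (a c) - exp (a b) = (LINT \<sigma>:{b..c}|lborel. h (x + \<sigma> *\<^sub>R e))"
          using comb(1) ga[OF mem(1)] ga[OF mem(2)] by simp
        also have "C * \<bar>\<dots>\<bar> \<le> C * (LINT \<sigma>:{b..c}|lborel. \<bar>h (x + \<sigma> *\<^sub>R e)\<bar>)"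
          using set_integral_norm_bound[OF comb(2)] C0 by (intro mult_left_mono) auto
        finally show ?thesis by simp
      qed
      have wu: "AE t in lborel. t \<in> {0..\<delta>} \<longrightarrow> (\<forall>s\<in>{..Suc j}. w s t = u s (x + t *\<^sub>R e))"
      proof -
        have "AE t in lborel. \<forall>s\<in>{..Suc j}. t \<in> {0..\<delta>} \<longrightarrow> u s (x + t *\<^sub>R e) - u s x = line_integral (H s) e x t"
          by (subst AE_ball_countable) (use Hl in auto)
        then show ?thesis
        proof eventually_elim
          case (elim t)
          have "w s t = u s (x + t *\<^sub>R e)" if "t \<in> {0..\<delta>}" "s \<in> {..Suc j}" for s
            using bspec[OF elim that(2)] that(1) by (simp add: w_def)
          then show ?case by blast
        qed
      qed
      note alg = exp_combination_algebra[OF V, where D = D]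
      have cancel: "(\<Sum>s\<le>Suc j. G' s (a t) * w s t) = 0" if t: "t \<in> {0..\<delta>}" for t
      proof (rule AE_continuous_zero[OF \<delta>(1) _ _ t])
        show "continuous_on {0..\<delta>} (\<lambda>t. \<Sum>s\<le>Suc j. G' s (a t) * w s t)"
          by (intro continuous_on_sum continuous_on_mult wc continuous_on_compose2[OF G'c ac]) (use aT in auto)
        show "AE t in lborel. t \<in> {0..\<delta>} \<longrightarrow> (\<Sum>s\<le>Suc j. G' s (a t) * w s t) = 0"
          using wu
        proof eventually_elim
          case (elim t)
          show ?case
          proof
            assume t: "t \<in> {0..\<delta>}"
            have "(\<Sum>s\<le>Suc j. G' s (a t) * w s t) = (\<Sum>s\<le>Suc j. G' s (a t) * u s (x + t *\<^sub>R e))"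
              by (rule sum.cong) (use elim t in auto)
            also have "\<dots> = 0"
              unfolding G'_def a_def
              by (rule alg(2)[where b = "\<lambda>l. B l (x + t *\<^sub>R e)"]) (use u(4)[OF lin[OF t]] in auto)
            finally show "(\<Sum>s\<le>Suc j. G' s (a t) * w s t) = 0" .
          qed
        qed
      qed
      have rule: "(\<Sum>s\<le>Suc j. G s (a t) * w s t) - (\<Sum>s\<le>Suc j. G s (a 0) * w s 0) =
          (LINT \<sigma>:{0..t}|lborel. (\<Sum>s\<le>Suc j. G s (a \<sigma>) * H s (x + \<sigma> *\<^sub>R e)))" if t: "t \<in> {0..\<delta>}" for t
      proof (rule line_product_rule[OF _ ac \<gamma>i a\<gamma>, where G' = G' and c = "\<lambda>s. u s x"])
        show "t \<in> {0..\<delta>}" by (rule t)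
        show "continuous_on (a ` {0..\<delta>}) (G' s)" for s
          by (rule continuous_on_subset[OF G'c]) (use aT in auto)
      qed (use Hi GD aT cancel in \<open>auto simp: w_def line_integral_def\<close>)
      have Zw: "(\<Sum>s\<le>Suc j. G s (a t) * u s (x + t *\<^sub>R e)) = Z (x + t *\<^sub>R e)" if t: "t \<in> {0..\<delta>}" for t
        unfolding Z(2)[OF lin[OF t]] G_def a_def
        by (rule alg(1)[where b = "\<lambda>l. B l (x + t *\<^sub>R e)"]) (use u(4)[OF lin[OF t]] in auto)
      have RG: "R (x + \<sigma> *\<^sub>R e) = (\<Sum>s\<le>Suc j. G s (a \<sigma>) * H s (x + \<sigma> *\<^sub>R e))" if "\<sigma> \<in> {0..\<delta>}" for \<sigma>
        unfolding R(2)[OF lin[OF that]] G_def a_def sum_distrib_left sum_distrib_right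
        by (subst sum.swap) (simp only: mult.assoc)
      have w0: "w s 0 = u s x" if "s \<le> Suc j" for s
        using set_integral_Icc_combine(1)[OF Hi[OF that], of 0 0] \<delta>(1) by (simp add: w_def line_integral_def)
      show "AE t in lborel. t \<in> {0..\<delta>} \<longrightarrow> Z (x + t *\<^sub>R e) - Z x = line_integral R e x t"
        using wu
      proof eventually_elim
        case (elim t)
        show ?case
        proof
          assume t: "t \<in> {0..\<delta>}"
          have "(\<Sum>s\<le>Suc j. G s (a t) * w s t) = Z (x + t *\<^sub>R e)"
            unfolding Zw[OF t, symmetric] by (rule sum.cong) (use elim t in auto)
          moreover have "(\<Sum>s\<le>Suc j. G s (a 0) * w s 0) = Z x"
          proof -
            have "(\<Sum>s\<le>Suc j. G s (a 0) * w s 0) = (\<Sum>s\<le>Suc j. G s (a 0) * u s (x + 0 *\<^sub>R e))"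
              by (rule sum.cong) (use w0 in auto)
            also have "\<dots> = Z (x + 0 *\<^sub>R e)" by (rule Zw) (use \<delta>(1) in auto)
            finally show ?thesis by simp
          qed
          moreover have "(LINT \<sigma>:{0..t}|lborel. (\<Sum>s\<le>Suc j. G s (a \<sigma>) * H s (x + \<sigma> *\<^sub>R e))) = line_integral R e x t"
            unfolding line_integral_def
            by (rule set_lebesgue_integral_cong) (use RG t in auto)
          ultimately show "Z (x + t *\<^sub>R e) - Z x = line_integral R e x t" using rule[OF t] by simp
        qed
      qed
    qed
  qed
  then show "\<exists>\<delta>>0. (\<forall>x\<in>K. line_in X e \<delta> x) \<and>
      (AE x in lborel. x \<in> K \<longrightarrow> (AE t in lborel. t \<in> {0..\<delta>} \<longrightarrow> Z (x + t *\<^sub>R e) - Z x = line_integral R e x t))"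
    using \<delta> by blast
qed

subsection \<open>Locally Sobolev functions by recursion on the order\<close>

text \<open>Only points of the bounding hyperplane are lost. Hence functions agreeing almost
  everywhere in the interior agree almost everywhere on S, including for integrals up to the
  boundary.\<close>

lemma halfspace_open_boundary_null:
  fixes S :: "'e::euclidean_space set"
  assumes "halfspace_open S"
  shows "S - interior S \<in> null_sets lborel"
proof -
  obtain a b where "openin (top_of_set {x. a \<bullet> x \<le> b}) S" using assms unfolding halfspace_open_def by blast
  then obtain T where T: "open T" "S = {x. a \<bullet> x \<le> b} \<inter> T" unfolding openin_open by auto
  have m: "S - interior S \<in> sets borel" using halfspace_open_borel[OF assms] by auto
  show ?thesis
  proof (cases "a = 0")
    case True
    then have "open S" using T by (cases "0 \<le> b") auto
    then show ?thesis by (simp add: interior_open)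
  next
    case False
    have "{x. a \<bullet> x < b} \<inter> T \<subseteq> interior S"
      by (intro interior_maximal open_Int open_halfspace_lt T(1)) (auto simp: T(2))
    then have sub: "S - interior S \<subseteq> {x. a \<bullet> x = b}" using T(2) by force
    have "negligible {x. a \<bullet> x = b}" using negligible_hyperplane[of a b] False by simp
    then have "negligible (S - interior S)" using sub by (rule negligible_subset)
    then have "S - interior S \<in> null_sets lebesgue" by (simp add: negligible_iff_null_sets)
    then show ?thesis using m by (simp add: null_sets_completion_iff)
  qed
qed

lemma AE_interior_halfspace:
  assumes "halfspace_open S" "AE x in lborel. x \<in> interior S \<longrightarrow> P x"
  shows "AE x in lborel. x \<in> S \<longrightarrow> P x"
  using AE_not_in[OF halfspace_open_boundary_null[OF assms(1)]] assms(2)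
  by eventually_elim auto

definition loc_Lp :: "real \<Rightarrow> 'e::euclidean_space set \<Rightarrow> ('e \<Rightarrow> real) \<Rightarrow> bool" where
  "loc_Lp p S h \<longleftrightarrow> h \<in> borel_measurable borel \<and>
     (\<forall>K. compact K \<longrightarrow> K \<subseteq> S \<longrightarrow> set_integrable lborel K (\<lambda>x. \<bar>h x\<bar> powr p))"

lemma loc_Lp_measurable: "loc_Lp p S h \<Longrightarrow> h \<in> borel_measurable borel"
  by (simp add: loc_Lp_def)

lemma loc_Lp_subset: "loc_Lp p S h \<Longrightarrow> S' \<subseteq> S \<Longrightarrow> loc_Lp p S' h"
  unfolding loc_Lp_def by blast

lemma set_integrable_const_compact:
  fixes c :: real
  shows "compact K \<Longrightarrow> set_integrable lborel K (\<lambda>x::'e::euclidean_space. c)"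
  unfolding set_integrable_def
  using emeasure_bounded_finite[OF compact_imp_bounded, of K]
  by (auto simp: borel_compact intro!: integrable_mult_left integrable_real_indicator)

lemma set_integrable_bound_real:
  fixes f g :: "'e::euclidean_space \<Rightarrow> real"
  assumes "set_integrable lborel K f" "g \<in> borel_measurable borel" "K \<in> sets borel"
    "\<And>x. x \<in> K \<Longrightarrow> \<bar>g x\<bar> \<le> f x"
  shows "set_integrable lborel K g"
  unfolding set_integrable_def
proof (rule Bochner_Integration.integrable_bound[OF assms(1)[unfolded set_integrable_def]])
  note [measurable] = assms(2,3)
  show "(\<lambda>x. indicator K x *\<^sub>R g x) \<in> borel_measurable lborel" by measurable
  show "AE x in lborel. norm (indicator K x *\<^sub>R g x) \<le> norm (indicator K x *\<^sub>R f x)"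
    using assms(4) by (intro AE_I2) (auto simp: indicator_def intro: order_trans[OF _ abs_ge_self])
qed

lemma loc_Lp_locally_integrable:
  assumes p: "1 \<le> p" and h: "loc_Lp p S h"
  shows "locally_integrable S h"
  unfolding locally_integrable_def
proof (intro conjI allI impI)
  show m: "h \<in> borel_measurable borel" using h by (rule loc_Lp_measurable)
  fix K assume K: "compact K" "K \<subseteq> S"
  have "set_integrable lborel K (\<lambda>x. 1 + \<bar>h x\<bar> powr p)"
    using h K unfolding loc_Lp_def by (intro set_integral_add(1) set_integrable_const_compact) auto
  then show "set_integrable lborel K h"
  proof (rule set_integrable_bound_real[OF _ m])
    show "K \<in> sets borel" using K by (simp add: borel_compact)
    fix x
    show "\<bar>h x\<bar> \<le> 1 + \<bar>h x\<bar> powr p"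
    proof (cases "\<bar>h x\<bar> \<le> 1")
      case False
      then have "\<bar>h x\<bar> powr 1 \<le> \<bar>h x\<bar> powr p" using p by (intro powr_mono) auto
      then show ?thesis using False by simp
    qed (simp add: add_increasing2)
  qed
qed

lemma loc_Lp_add:
  assumes p: "1 \<le> p" and "loc_Lp p S u" "loc_Lp p S h"
  shows "loc_Lp p S (\<lambda>x. u x + h x)"
  unfolding loc_Lp_def
proof (intro conjI allI impI)
  have [measurable]: "u \<in> borel_measurable borel" "h \<in> borel_measurable borel"
    using assms(2,3) by (auto intro: loc_Lp_measurable)
  show "(\<lambda>x. u x + h x) \<in> borel_measurable borel" by measurable
  fix K assume K: "compact K" "K \<subseteq> S"
  have "set_integrable lborel K (\<lambda>x. 2 powr p * (\<bar>u x\<bar> powr p + \<bar>h x\<bar> powr p))"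
    using assms(2,3) K unfolding loc_Lp_def by (intro set_integrable_mult_right set_integral_add(1)) auto
  then show "set_integrable lborel K (\<lambda>x. \<bar>u x + h x\<bar> powr p)"
  proof (rule set_integrable_bound_real)
    show "K \<in> sets borel" using K by (simp add: borel_compact)
    show "(\<lambda>x. \<bar>u x + h x\<bar> powr p) \<in> borel_measurable borel" by measurable
    fix x
    have "\<bar>u x + h x\<bar> \<le> 2 * max \<bar>u x\<bar> \<bar>h x\<bar>" by simp
    then have "\<bar>u x + h x\<bar> powr p \<le> (2 * max \<bar>u x\<bar> \<bar>h x\<bar>) powr p" using p by (intro powr_mono2) auto
    also have "\<dots> = 2 powr p * max \<bar>u x\<bar> \<bar>h x\<bar> powr p" by (simp add: powr_mult)
    also have "\<dots> \<le> 2 powr p * (\<bar>u x\<bar> powr p + \<bar>h x\<bar> powr p)"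
      by (intro mult_left_mono) (auto simp: max_def)
    finally show "\<bar>\<bar>u x + h x\<bar> powr p\<bar> \<le> 2 powr p * (\<bar>u x\<bar> powr p + \<bar>h x\<bar> powr p)" by simp
  qed
qed

lemma loc_Lp_zero: "loc_Lp p S (\<lambda>_. 0)"
  by (simp add: loc_Lp_def set_integrable_def)

lemma loc_Lp_sum:
  assumes "1 \<le> p" "\<And>i. i \<in> I \<Longrightarrow> loc_Lp p S (u i)"
  shows "loc_Lp p S (\<lambda>x. \<Sum>i\<in>I. u i x)"
  using assms(2)
  by (induction I rule: infinite_finite_induct) (auto intro: loc_Lp_zero loc_Lp_add assms(1))

text \<open>Extension by 0 turns a function that is continuous on a Borel set S into a Borel
  function on the whole space, as \<open>loc_Lp\<close> and \<open>sobr\<close> demand.\<close>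

definition restrict0 :: "'e set \<Rightarrow> ('e \<Rightarrow> real) \<Rightarrow> 'e \<Rightarrow> real" where
  "restrict0 S g x = (if x \<in> S then g x else 0)"

lemma restrict0_in [simp]: "x \<in> S \<Longrightarrow> restrict0 S g x = g x"
  by (simp add: restrict0_def)

lemma restrict0_measurable:
  fixes g :: "'e::euclidean_space \<Rightarrow> real"
  assumes "S \<in> sets borel" "continuous_on S g"
  shows "restrict0 S g \<in> borel_measurable borel"
proof -
  have "(\<lambda>x. indicator S x *\<^sub>R g x) \<in> borel_measurable borel"
    by (rule borel_measurable_continuous_on_indicator[OF assms])
  moreover have "(\<lambda>x. indicator S x *\<^sub>R g x) = restrict0 S g" by (auto simp: restrict0_def indicator_def)
  ultimately show ?thesis by simp
qed

lemma loc_Lp_mult: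
  fixes h \<phi> :: "'e::euclidean_space \<Rightarrow> real"
  assumes p: "1 \<le> p" and S: "S \<in> sets borel" and \<phi>: "continuous_on S \<phi>" and h: "loc_Lp p S h"
  shows "loc_Lp p S (restrict0 S (\<lambda>x. \<phi> x * h x))"
  unfolding loc_Lp_def
proof (intro conjI allI impI)
  have m [measurable]: "h \<in> borel_measurable borel" "restrict0 S \<phi> \<in> borel_measurable borel"
    using loc_Lp_measurable[OF h] restrict0_measurable[OF S \<phi>] by auto
  have "(\<lambda>x. restrict0 S \<phi> x * h x) = restrict0 S (\<lambda>x. \<phi> x * h x)" by (auto simp: restrict0_def)
  then show m2 [measurable]: "restrict0 S (\<lambda>x. \<phi> x * h x) \<in> borel_measurable borel"
    using borel_measurable_times[OF m(2,1)] by simp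
  fix K assume K: "compact K" "K \<subseteq> S"
  have "compact (\<phi> ` K)" using \<phi> K by (intro compact_continuous_image) (auto intro: continuous_on_subset)
  then have "bounded (\<phi> ` K)" by (rule compact_imp_bounded)
  then obtain M where "\<forall>y\<in>\<phi> ` K. norm y \<le> M" unfolding bounded_iff by blast
  then have M: "\<bar>\<phi> x\<bar> \<le> \<bar>M\<bar>" if "x \<in> K" for x using that by force
  have "set_integrable lborel K (\<lambda>x. \<bar>M\<bar> powr p * \<bar>h x\<bar> powr p)"
    using h K unfolding loc_Lp_def by (intro set_integrable_mult_right) auto
  then show "set_integrable lborel K (\<lambda>x. \<bar>restrict0 S (\<lambda>x. \<phi> x * h x) x\<bar> powr p)"
  proof (rule set_integrable_bound_real)
    show "K \<in> sets borel" using K by (simp add: borel_compact)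
    show "(\<lambda>x. \<bar>restrict0 S (\<lambda>x. \<phi> x * h x) x\<bar> powr p) \<in> borel_measurable borel" by measurable
    fix x assume x: "x \<in> K"
    have "\<bar>\<phi> x * h x\<bar> powr p \<le> (\<bar>M\<bar> * \<bar>h x\<bar>) powr p"
      using M[OF x] p by (intro powr_mono2) (auto simp: abs_mult mult_right_mono)
    then show "\<bar>\<bar>restrict0 S (\<lambda>x. \<phi> x * h x) x\<bar> powr p\<bar> \<le> \<bar>M\<bar> powr p * \<bar>h x\<bar> powr p"
      using x K(2) by (auto simp: powr_mult)
  qed
qed

lemma loc_Lp_continuous:
  fixes \<phi> :: "'e::euclidean_space \<Rightarrow> real"
  assumes "1 \<le> p" "S \<in> sets borel" "continuous_on S \<phi>"
  shows "loc_Lp p S (restrict0 S \<phi>)"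
proof -
  have "loc_Lp p S (\<lambda>_. 1)" using set_integrable_const_compact by (auto simp: loc_Lp_def)
  from loc_Lp_mult[OF assms this] show ?thesis by simp
qed

lemma loc_Lp_AE:
  fixes h h' :: "'e::euclidean_space \<Rightarrow> real"
  assumes h: "loc_Lp p S h" and m: "h' \<in> borel_measurable borel" and ae: "AE x in lborel. x \<in> S \<longrightarrow> h x = h' x"
  shows "loc_Lp p S h'"
  unfolding loc_Lp_def
proof (intro conjI m allI impI)
  note [measurable] = m loc_Lp_measurable[OF h]
  fix K assume K: "compact K" "K \<subseteq> S"
  then have [measurable]: "K \<in> sets borel" by (simp add: borel_compact)
  have "integrable lborel (\<lambda>x. indicator K x *\<^sub>R (\<bar>h x\<bar> powr p))"
    using h K unfolding loc_Lp_def set_integrable_def by blast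
  then show "set_integrable lborel K (\<lambda>x. \<bar>h' x\<bar> powr p)"
    unfolding set_integrable_def
  proof (rule integrable_cong_AE_imp)
    show "(\<lambda>x. indicator K x *\<^sub>R (\<bar>h' x\<bar> powr p)) \<in> borel_measurable lborel" by measurable
    show "AE x in lborel. indicator K x *\<^sub>R (\<bar>h x\<bar> powr p) = indicator K x *\<^sub>R (\<bar>h' x\<bar> powr p)"
      using ae by eventually_elim (use K(2) in \<open>auto simp: indicator_def\<close>)
  qed
qed

lemma weak_deriv_AE:
  assumes "weak_deriv X e u h" "u \<in> borel_measurable borel" "h \<in> borel_measurable borel"
    "u' \<in> borel_measurable borel" "h' \<in> borel_measurable borel"
    "AE x in lborel. x \<in> X \<longrightarrow> u x = u' x" "AE x in lborel. x \<in> X \<longrightarrow> h x = h' x"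
  shows "weak_deriv X e u' h'"
  unfolding weak_deriv_def
proof (intro allI impI)
  fix \<psi> assume \<psi>: "test_function X \<psi>"
  note [measurable] = assms(2-5) test_function_measurable[OF \<psi>] test_function_measurable[OF test_function_dderiv[OF \<psi>, of e]]
  have out: "\<psi> x = 0" "dderiv UNIV \<psi> e x = 0" if "x \<notin> X" for x
  proof -
    have n: "x \<notin> closure {x. \<psi> x \<noteq> 0}" using that test_function_support(2)[OF \<psi>] by blast
    show "\<psi> x = 0" by (rule test_function_support(3)[OF \<psi> n])
    show "dderiv UNIV \<psi> e x = 0" by (rule dderiv_zero_support[OF n])
  qed
  have 1: "(\<integral>x. dderiv UNIV \<psi> e x * u x \<partial>lborel) = (\<integral>x. dderiv UNIV \<psi> e x * u' x \<partial>lborel)"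
  proof (rule integral_cong_AE)
    show "AE x in lborel. dderiv UNIV \<psi> e x * u x = dderiv UNIV \<psi> e x * u' x"
      using assms(6)
    proof eventually_elim
      case (elim x)
      then show ?case by (cases "x \<in> X") (simp_all add: out)
    qed
  qed measurable
  have 2: "(\<integral>x. \<psi> x * h x \<partial>lborel) = (\<integral>x. \<psi> x * h' x \<partial>lborel)"
  proof (rule integral_cong_AE)
    show "AE x in lborel. \<psi> x * h x = \<psi> x * h' x"
      using assms(7)
    proof eventually_elim
      case (elim x)
      then show ?case by (cases "x \<in> X") (simp_all add: out)
    qed
  qed measurable
  show "(\<integral>x. dderiv UNIV \<psi> e x * u' x \<partial>lborel) = - (\<integral>x. \<psi> x * h' x \<partial>lborel)"
    using assms(1) \<psi> 1 2 unfolding weak_deriv_def by simp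
qed

lemma weak_deriv_add:
  assumes "weak_deriv X e u h" "weak_deriv X e u' h'"
    "locally_integrable X u" "locally_integrable X u'" "locally_integrable X h" "locally_integrable X h'"
  shows "weak_deriv X e (\<lambda>x. u x + u' x) (\<lambda>x. h x + h' x)"
  unfolding weak_deriv_def
proof (intro allI impI)
  fix \<psi> assume \<psi>: "test_function X \<psi>"
  note \<psi>' = test_function_dderiv[OF \<psi>, of e]
  show "(\<integral>x. dderiv UNIV \<psi> e x * (u x + u' x) \<partial>lborel) = - (\<integral>x. \<psi> x * (h x + h' x) \<partial>lborel)"
    using assms(1,2) \<psi> test_function_integrable[OF \<psi>' assms(3)] test_function_integrable[OF \<psi>' assms(4)]
      test_function_integrable[OF \<psi> assms(5)] test_function_integrable[OF \<psi> assms(6)]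
    unfolding weak_deriv_def by (simp add: distrib_left)
qed

lemma test_function_mono: "test_function X \<psi> \<Longrightarrow> X \<subseteq> Y \<Longrightarrow> test_function Y \<psi>"
  unfolding test_function_def by blast

lemma weak_deriv_subset: "weak_deriv X e u h \<Longrightarrow> Y \<subseteq> X \<Longrightarrow> weak_deriv Y e u h"
  unfolding weak_deriv_def using test_function_mono by blast

text \<open>Weak derivatives are determined only almost everywhere, so each step asks for some
  representative h; membership itself is stable under changes on null sets.\<close>

primrec sobr :: "real \<Rightarrow> 'e::euclidean_space set \<Rightarrow> nat \<Rightarrow> ('e \<Rightarrow> real) \<Rightarrow> bool" where
  "sobr p S 0 u \<longleftrightarrow> loc_Lp p S u"
| "sobr p S (Suc k) u \<longleftrightarrow> loc_Lp p S u \<and> (\<forall>e\<in>Basis. \<exists>h. weak_deriv (interior S) e u h \<and> sobr p S k h)"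

lemma sobr_SucE:
  assumes "sobr p S (Suc k) u" "e \<in> Basis"
  obtains h where "weak_deriv (interior S) e u h" "sobr p S k h"
  using assms by auto

lemma sobr_loc_Lp: "sobr p S k u \<Longrightarrow> loc_Lp p S u"
  by (cases k) auto

lemma sobr_decreasing: "sobr p S (Suc k) u \<Longrightarrow> sobr p S k u"
proof (induction k arbitrary: u)
  case (Suc k)
  have "\<exists>h. weak_deriv (interior S) e u h \<and> sobr p S k h" if e: "e \<in> Basis" for e
    by (rule sobr_SucE[OF Suc.prems e]) (use Suc.IH in blast)
  then show ?case using sobr_loc_Lp[OF Suc.prems] by simp
qed simp

lemma sobr_locally_integrable:
  "1 \<le> p \<Longrightarrow> sobr p S k u \<Longrightarrow> locally_integrable (interior S) u"
  by (rule locally_integrable_subset[OF loc_Lp_locally_integrable[OF _ sobr_loc_Lp] interior_subset])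

lemma sobr_AE:
  assumes "sobr p S k u" "u' \<in> borel_measurable borel" "AE x in lborel. x \<in> S \<longrightarrow> u x = u' x"
  shows "sobr p S k u'"
proof (cases k)
  case 0
  then show ?thesis using assms loc_Lp_AE by auto
next
  case (Suc j)
  have um: "u \<in> borel_measurable borel" using assms(1) by (blast intro: loc_Lp_measurable sobr_loc_Lp)
  have ae: "AE x in lborel. x \<in> interior S \<longrightarrow> u x = u' x"
    using assms(3) by eventually_elim (use interior_subset in blast)
  have "\<exists>h. weak_deriv (interior S) e u' h \<and> sobr p S j h" if e: "e \<in> Basis" for e
  proof -
    obtain h where h: "weak_deriv (interior S) e u h" "sobr p S j h"
      by (rule sobr_SucE[OF assms(1)[unfolded Suc] e])
    have hm: "h \<in> borel_measurable borel" using h(2) by (blast intro: loc_Lp_measurable sobr_loc_Lp)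
    have "weak_deriv (interior S) e u' h"
      by (rule weak_deriv_AE[OF h(1) um hm assms(2) hm ae]) simp
    then show ?thesis using h(2) by blast
  qed
  moreover have "loc_Lp p S u'" by (rule loc_Lp_AE[OF sobr_loc_Lp[OF assms(1)] assms(2,3)])
  ultimately show ?thesis unfolding Suc by simp
qed

lemma sobr_add:
  assumes p: "1 \<le> p" and "sobr p S k u" "sobr p S k u'"
  shows "sobr p S k (\<lambda>x. u x + u' x)"
  using assms(2,3)
proof (induction k arbitrary: u u')
  case 0
  then show ?case using loc_Lp_add[OF p] by simp
next
  case (Suc k)
  have "\<exists>h. weak_deriv (interior S) e (\<lambda>x. u x + u' x) h \<and> sobr p S k h" if e: "e \<in> Basis" for e
  proof -
    obtain h where h1: "weak_deriv (interior S) e u h" "sobr p S k h"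
      by (rule sobr_SucE[OF Suc.prems(1) e])
    obtain h' where h2: "weak_deriv (interior S) e u' h'" "sobr p S k h'"
      by (rule sobr_SucE[OF Suc.prems(2) e])
    note h = h1 h2
    have "weak_deriv (interior S) e (\<lambda>x. u x + u' x) (\<lambda>x. h x + h' x)"
      by (intro weak_deriv_add h sobr_locally_integrable[OF p h(2)] sobr_locally_integrable[OF p h(4)]
          sobr_locally_integrable[OF p Suc.prems(1)] sobr_locally_integrable[OF p Suc.prems(2)])
    then show ?thesis using Suc.IH[OF h(2,4)] by blast
  qed
  then show ?case
    using loc_Lp_add[OF p sobr_loc_Lp[OF Suc.prems(1)] sobr_loc_Lp[OF Suc.prems(2)]] by simp
qed

lemma sobr_openin:
  assumes "sobr p S k u" "S' \<subseteq> S"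
  shows "sobr p S' k u"
  using assms(1)
proof (induction k arbitrary: u)
  case 0
  then show ?case using loc_Lp_subset assms(2) by auto
next
  case (Suc k)
  have "\<exists>h. weak_deriv (interior S') e u h \<and> sobr p S' k h" if e: "e \<in> Basis" for e
  proof -
    obtain h where h: "weak_deriv (interior S) e u h" "sobr p S k h"
      by (rule sobr_SucE[OF Suc.prems e])
    then show ?thesis using weak_deriv_subset[OF h(1) interior_mono[OF assms(2)]] Suc.IH by blast
  qed
  then show ?case using loc_Lp_subset[OF sobr_loc_Lp[OF Suc.prems] assms(2)] by simp
qed

text \<open>The factor \<zeta> is smooth on S only. Since \<psi> has compact support in the
  interior, the product is smooth there and is 0 on the complement of the support, and these two
  open sets cover the space.\<close>

lemma test_function_times_smooth:
  assumes \<psi>: "test_function (interior S) \<psi>" and \<zeta>: "frechet_Ck_on \<infinity> S \<zeta>"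
  shows "test_function (interior S) (\<lambda>x. \<psi> x * restrict0 S \<zeta> x)"
    and "x \<in> interior S \<Longrightarrow> dderiv UNIV (\<lambda>x. \<psi> x * restrict0 S \<zeta> x) e x =
      dderiv UNIV \<psi> e x * \<zeta> x + \<psi> x * dderiv S \<zeta> e x"
proof -
  let ?X = "interior S" and ?K = "closure {x. \<psi> x \<noteq> 0}"
  let ?f = "\<lambda>x. \<psi> x * restrict0 S \<zeta> x"
  note supp = test_function_support[OF \<psi>]
  note sm = \<psi>[unfolded test_function_def, THEN conjunct1]
  have hX: "halfspace_open ?X" by (rule open_imp_halfspace_open) simp
  have \<zeta>X: "frechet_Ck_on \<infinity> ?X \<zeta>"
    by (rule smooth_openin[OF _ \<zeta>]) (simp add: open_subset interior_subset)
  have fX: "frechet_Ck_on \<infinity> ?X ?f"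
  proof -
    have "frechet_Ck_on \<infinity> ?X (\<lambda>x. \<psi> x * \<zeta> x)"
      by (intro smooth_mult hX \<zeta>X smooth_open_subset[OF sm]) simp
    moreover have "\<psi> x * \<zeta> x = ?f x" if "x \<in> ?X" for x using subsetD[OF interior_subset that] by simp
    ultimately show ?thesis using smooth_cong[of ?X "\<lambda>x. \<psi> x * \<zeta> x" ?f] by blast
  qed
  have "frechet_Ck_on \<infinity> UNIV ?f"
  proof (rule smooth_local)
    fix x :: 'a
    show "\<exists>S'. openin (top_of_set UNIV) S' \<and> x \<in> S' \<and> frechet_Ck_on \<infinity> S' ?f"
    proof (cases "x \<in> ?X")
      case True
      then show ?thesis using fX by (intro exI[of _ ?X]) auto
    next
      case False
      have o: "open (- ?K)" by (intro open_Compl closed_closure)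
      have "frechet_Ck_on \<infinity> (- ?K) (\<lambda>_. 0 :: real)"
        by (intro smooth_const open_imp_halfspace_open o)
      moreover have "0 = ?f y" if "y \<in> - ?K" for y using supp(3)[of y] that by simp
      ultimately have "frechet_Ck_on \<infinity> (- ?K) ?f"
        using smooth_cong[of "- ?K" "\<lambda>_. 0" ?f] by blast
      then show ?thesis using False supp(2) o by (intro exI[of _ "- ?K"]) auto
    qed
  qed
  then show "test_function ?X ?f"
  proof (rule test_function_I[OF _ supp(1,2)])
    show "?f x = 0" if "x \<notin> ?K" for x using supp(3)[OF that] by simp
  qed
  show "dderiv UNIV ?f e x = dderiv UNIV \<psi> e x * \<zeta> x + \<psi> x * dderiv S \<zeta> e x" if x: "x \<in> ?X"
  proof -
    have xS: "x \<in> S" using x interior_subset by auto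
    have 1: "(\<psi> has_derivative (\<lambda>e. dderiv UNIV \<psi> e x)) (at x)"
      using smooth_has_derivative[OF sm, of x] by simp
    have 2: "(\<zeta> has_derivative (\<lambda>e. dderiv S \<zeta> e x)) (at x)"
      using smooth_has_derivative[OF \<zeta> xS] by (simp add: at_within_interior[OF x])
    have "((\<lambda>x. \<psi> x * \<zeta> x) has_derivative (\<lambda>e. \<psi> x * dderiv S \<zeta> e x + dderiv UNIV \<psi> e x * \<zeta> x)) (at x)"
      by (rule has_derivative_mult[OF 1 2])
    then have "(?f has_derivative (\<lambda>e. \<psi> x * dderiv S \<zeta> e x + dderiv UNIV \<psi> e x * \<zeta> x)) (at x)"
    proof (rule has_derivative_transform_within_open[OF _ open_interior x])
      show "\<psi> y * \<zeta> y = ?f y" if "y \<in> ?X" for y using subsetD[OF interior_subset that] by simp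
    qed
    from halfspace_open_frechet_derivative[OF halfspace_open_UNIV UNIV_I, of ?f, OF this]
    show ?thesis unfolding dderiv_def[of UNIV ?f] by (simp add: add.commute)
  qed
qed

text \<open>The weak derivative of u is tested with \<psi> * \<zeta> in place of \<psi>, and the
  extra term of the product rule is moved to the other side.\<close>

lemma weak_deriv_times_smooth:
  fixes u h \<zeta> :: "'e::euclidean_space \<Rightarrow> real"
  assumes w: "weak_deriv (interior S) e u h" and \<zeta>: "frechet_Ck_on \<infinity> S \<zeta>" and S: "S \<in> sets borel"
    and u: "locally_integrable (interior S) u" and h: "locally_integrable (interior S) h"
  shows "weak_deriv (interior S) e (restrict0 S (\<lambda>x. \<zeta> x * u x))
    (restrict0 S (\<lambda>x. dderiv S \<zeta> e x * u x + \<zeta> x * h x))"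
  unfolding weak_deriv_def
proof (intro allI impI)
  fix \<psi> assume \<psi>: "test_function (interior S) \<psi>"
  let ?f = "\<lambda>x. \<psi> x * restrict0 S \<zeta> x"
  note f = test_function_times_smooth[OF \<psi> \<zeta>]
  note g = test_function_times_smooth(1)[OF \<psi> smooth_dderiv[OF \<zeta>, of e]]
  have out: "\<psi> x = 0" "dderiv UNIV \<psi> e x = 0" "dderiv UNIV ?f e x = 0" if "x \<notin> interior S" for x
  proof -
    have n: "x \<notin> closure {x. \<psi> x \<noteq> 0}" using that test_function_support(2)[OF \<psi>] by blast
    show "\<psi> x = 0" by (rule test_function_support(3)[OF \<psi> n])
    show "dderiv UNIV \<psi> e x = 0" by (rule dderiv_zero_support[OF n])
    have "x \<notin> closure {x. ?f x \<noteq> 0}" using that test_function_support(2)[OF f(1)] by blast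
    then show "dderiv UNIV ?f e x = 0" by (rule dderiv_zero_support)
  qed
  have "(\<integral>x. dderiv UNIV \<psi> e x * restrict0 S (\<lambda>x. \<zeta> x * u x) x \<partial>lborel) =
      (\<integral>x. dderiv UNIV ?f e x * u x - \<psi> x * restrict0 S (dderiv S \<zeta> e) x * u x \<partial>lborel)"
  proof (rule Bochner_Integration.integral_cong[OF refl])
    fix x
    show "dderiv UNIV \<psi> e x * restrict0 S (\<lambda>x. \<zeta> x * u x) x =
        dderiv UNIV ?f e x * u x - \<psi> x * restrict0 S (dderiv S \<zeta> e) x * u x"
    proof (cases "x \<in> interior S")
      case True
      then have "x \<in> S" using interior_subset by auto
      then show ?thesis using f(2)[OF True, of e] by (simp add: algebra_simps)
    qed (simp add: out)
  qed
  also have "\<dots> = (\<integral>x. dderiv UNIV ?f e x * u x \<partial>lborel) - (\<integral>x. \<psi> x * restrict0 S (dderiv S \<zeta> e) x * u x \<partial>lborel)"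
    by (intro Bochner_Integration.integral_diff test_function_integrable[OF _ u] test_function_dderiv f(1) g)
  also have "\<dots> = - ((\<integral>x. ?f x * h x \<partial>lborel) + (\<integral>x. \<psi> x * restrict0 S (dderiv S \<zeta> e) x * u x \<partial>lborel))"
    using w f(1) unfolding weak_deriv_def by simp
  also have "(\<integral>x. ?f x * h x \<partial>lborel) + (\<integral>x. \<psi> x * restrict0 S (dderiv S \<zeta> e) x * u x \<partial>lborel) =
      (\<integral>x. ?f x * h x + \<psi> x * restrict0 S (dderiv S \<zeta> e) x * u x \<partial>lborel)"
    by (intro Bochner_Integration.integral_add[symmetric] test_function_integrable[OF f(1) h] test_function_integrable[OF g u])
  also have "\<dots> = (\<integral>x. \<psi> x * restrict0 S (\<lambda>x. dderiv S \<zeta> e x * u x + \<zeta> x * h x) x \<partial>lborel)"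
    by (rule Bochner_Integration.integral_cong[OF refl]) (simp add: restrict0_def algebra_simps)
  finally show "(\<integral>x. dderiv UNIV \<psi> e x * restrict0 S (\<lambda>x. \<zeta> x * u x) x \<partial>lborel) =
      - (\<integral>x. \<psi> x * restrict0 S (\<lambda>x. dderiv S \<zeta> e x * u x + \<zeta> x * h x) x \<partial>lborel)" .
qed

lemma sobr_times_smooth:
  fixes u \<zeta> :: "'e::euclidean_space \<Rightarrow> real"
  assumes p: "1 \<le> p" and S: "halfspace_open S" and \<zeta>: "frechet_Ck_on \<infinity> S \<zeta>" and u: "sobr p S k u"
  shows "sobr p S k (restrict0 S (\<lambda>x. \<zeta> x * u x))"
  using \<zeta> u
proof (induction k arbitrary: u \<zeta>)
  case 0
  then show ?case using loc_Lp_mult[OF p halfspace_open_borel[OF S] smooth_continuous] by simp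
next
  case (Suc k)
  have "\<exists>h. weak_deriv (interior S) e (restrict0 S (\<lambda>x. \<zeta> x * u x)) h \<and> sobr p S k h" if e: "e \<in> Basis" for e
  proof -
    obtain h where h: "weak_deriv (interior S) e u h" "sobr p S k h"
      by (rule sobr_SucE[OF Suc.prems(2) e])
    have "weak_deriv (interior S) e (restrict0 S (\<lambda>x. \<zeta> x * u x))
        (restrict0 S (\<lambda>x. dderiv S \<zeta> e x * u x + \<zeta> x * h x))"
      by (rule weak_deriv_times_smooth[OF h(1) Suc.prems(1) halfspace_open_borel[OF S]
            sobr_locally_integrable[OF p Suc.prems(2)] sobr_locally_integrable[OF p h(2)]])
    moreover have "sobr p S k (\<lambda>x. restrict0 S (\<lambda>x. dderiv S \<zeta> e x * u x) x + restrict0 S (\<lambda>x. \<zeta> x * h x) x)"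
      by (intro sobr_add[OF p] Suc.IH Suc.prems(1) smooth_dderiv sobr_decreasing[OF Suc.prems(2)] h(2))
    moreover have "(\<lambda>x. restrict0 S (\<lambda>x. dderiv S \<zeta> e x * u x) x + restrict0 S (\<lambda>x. \<zeta> x * h x) x) =
        restrict0 S (\<lambda>x. dderiv S \<zeta> e x * u x + \<zeta> x * h x)" by (auto simp: restrict0_def)
    ultimately show ?thesis by auto
  qed
  then show ?case
    using loc_Lp_mult[OF p halfspace_open_borel[OF S] smooth_continuous[OF Suc.prems(1)] sobr_loc_Lp[OF Suc.prems(2)]] by simp
qed

text \<open>The fundamental theorem of calculus on segments in the interior, fed into the
  characterization by lines.\<close>

lemma weak_deriv_smooth:
  fixes g :: "'e::euclidean_space \<Rightarrow> real"
  assumes S: "halfspace_open S" and g: "frechet_Ck_on \<infinity> S g"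
  shows "weak_deriv (interior S) e (restrict0 S g) (restrict0 S (dderiv S g e))"
proof (rule weak_deriv_if_lines)
  have B: "S \<in> sets borel" by (rule halfspace_open_borel[OF S])
  have c: "continuous_on S (dderiv S g e)" by (intro smooth_continuous smooth_dderiv g)
  show "locally_integrable (interior S) (restrict0 S g)" "locally_integrable (interior S) (restrict0 S (dderiv S g e))"
    by (intro locally_integrable_subset[OF loc_Lp_locally_integrable[OF order_refl loc_Lp_continuous[OF order_refl B]] interior_subset]
        c smooth_continuous[OF g])+
  fix K assume K: "compact K" "K \<subseteq> interior S"
  obtain \<delta> where \<delta>: "\<delta> > 0" "\<And>x. x \<in> K \<Longrightarrow> line_in (interior S) e \<delta> x"
    using compact_line_in[OF open_interior K] by metis
  have "restrict0 S g (x + t *\<^sub>R e) - restrict0 S g x = line_integral (restrict0 S (dderiv S g e)) e x t"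
    if x: "x \<in> K" and t: "t \<in> {0..\<delta>}" for x t
  proof -
    have inX: "x + \<sigma> *\<^sub>R e \<in> interior S" if "\<sigma> \<in> {0..t}" for \<sigma>
      using \<delta>(2)[OF x] that t unfolding line_in_def by auto
    then have inS: "x + \<sigma> *\<^sub>R e \<in> S" if "\<sigma> \<in> {0..t}" for \<sigma> using that interior_subset by blast
    have "(\<integral>\<sigma>. indicator {0..t} \<sigma> *\<^sub>R dderiv S g e (x + \<sigma> *\<^sub>R e) \<partial>lborel) = g (x + t *\<^sub>R e) - g (x + 0 *\<^sub>R e)"
    proof (rule integral_FTC_atLeastAtMost)
      show "0 \<le> t" using t by simp
      show "continuous_on {0..t} (\<lambda>\<sigma>. dderiv S g e (x + \<sigma> *\<^sub>R e))"
        by (rule continuous_on_compose2[OF c]) (use inS in \<open>auto intro!: continuous_intros\<close>)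
      fix \<sigma> assume "0 \<le> \<sigma>" "\<sigma> \<le> t"
      then have \<sigma>: "\<sigma> \<in> {0..t}" by simp
      have D: "(g has_derivative (\<lambda>u. dderiv S g u (x + \<sigma> *\<^sub>R e))) (at (x + \<sigma> *\<^sub>R e))"
        using smooth_has_derivative[OF g inS[OF \<sigma>]] by (simp add: at_within_interior[OF inX[OF \<sigma>]])
      have "((\<lambda>\<sigma>. x + \<sigma> *\<^sub>R e) has_derivative (\<lambda>s. s *\<^sub>R e)) (at \<sigma> within {0..t})"
        by (auto intro!: derivative_eq_intros)
      from has_derivative_compose[OF this D]
      have "((\<lambda>\<sigma>. g (x + \<sigma> *\<^sub>R e)) has_derivative (\<lambda>s. dderiv S g (s *\<^sub>R e) (x + \<sigma> *\<^sub>R e))) (at \<sigma> within {0..t})" .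
      then show "((\<lambda>\<sigma>. g (x + \<sigma> *\<^sub>R e)) has_vector_derivative dderiv S g e (x + \<sigma> *\<^sub>R e)) (at \<sigma> within {0..t})"
        using linear_cmul[OF has_derivative_linear[OF D], of _ e] by (simp add: has_vector_derivative_def)
    qed
    moreover have "line_integral (restrict0 S (dderiv S g e)) e x t = (LINT \<sigma>:{0..t}|lborel. dderiv S g e (x + \<sigma> *\<^sub>R e))"
      unfolding line_integral_def by (rule set_lebesgue_integral_cong) (use inS in auto)
    ultimately show ?thesis using inS[of t] inS[of 0] t by (simp add: set_lebesgue_integral_def)
  qed
  then show "\<exists>\<delta>>0. (\<forall>x\<in>K. line_in (interior S) e \<delta> x) \<and>
      (AE x in lborel. x \<in> K \<longrightarrow> (AE t in lborel. t \<in> {0..\<delta>} \<longrightarrow>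
        restrict0 S g (x + t *\<^sub>R e) - restrict0 S g x = line_integral (restrict0 S (dderiv S g e)) e x t))"
    using \<delta> by (intro exI[of _ \<delta>]) auto
qed

lemma sobr_smooth:
  fixes g :: "'e::euclidean_space \<Rightarrow> real"
  assumes p: "1 \<le> p" and S: "halfspace_open S" and g: "frechet_Ck_on \<infinity> S g"
  shows "sobr p S k (restrict0 S g)"
  using g
proof (induction k arbitrary: g)
  case 0
  then show ?case using loc_Lp_continuous[OF p halfspace_open_borel[OF S] smooth_continuous] by simp
next
  case (Suc k)
  have "weak_deriv (interior S) e (restrict0 S g) (restrict0 S (dderiv S g e)) \<and> sobr p S k (restrict0 S (dderiv S g e))" for e
    using weak_deriv_smooth[OF S Suc.prems] Suc.IH[OF smooth_dderiv[OF Suc.prems]] by blast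
  then show ?case
    using loc_Lp_continuous[OF p halfspace_open_borel[OF S] smooth_continuous[OF Suc.prems]] by auto
qed

lemma derivative_sequence_exp_scaled: "derivative_sequence UNIV (\<lambda>m y. c ^ m * exp (c * y))"
  unfolding derivative_sequence_def
  by (auto intro!: derivative_eq_intros simp: mult_ac)

text \<open>The reason why integrability comes for free: the weights depend on \<alpha> alone and
  are continuous, so each h s is only multiplied by a locally bounded function.\<close>

lemma loc_Lp_exp_weighted:
  fixes \<alpha> :: "'e::euclidean_space \<Rightarrow> real" and h :: "nat \<Rightarrow> 'e \<Rightarrow> real" and V :: "nat \<Rightarrow> nat \<Rightarrow> real"
  assumes p: "1 \<le> p" and S: "halfspace_open S" and \<alpha>: "continuous_on S \<alpha>"
    and T: "\<alpha> ` S \<subseteq> T" and D: "derivative_sequence T D"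
    and h: "\<And>s. loc_Lp p S (h s)"
  shows "loc_Lp p S (restrict0 S (\<lambda>x. \<Sum>s\<le>N. (\<Sum>m\<le>N. D m (\<alpha> x) * V m s * exp (- real s * \<alpha> x)) * h s x))"
proof -
  have c: "continuous_on S (\<lambda>x. \<Sum>m\<le>N. D m (\<alpha> x) * V m s * exp (- real s * \<alpha> x))" for s
    by (intro continuous_intros \<alpha> continuous_on_compose2[OF derivative_sequence_continuous[OF D] \<alpha> T])
  have "loc_Lp p S (\<lambda>x. \<Sum>s\<le>N. restrict0 S (\<lambda>x. (\<Sum>m\<le>N. D m (\<alpha> x) * V m s * exp (- real s * \<alpha> x)) * h s x) x)"
    by (rule loc_Lp_sum[OF p]) (rule loc_Lp_mult[OF p halfspace_open_borel[OF S] c h])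
  moreover have "(\<lambda>x. \<Sum>s\<le>N. restrict0 S (\<lambda>x. (\<Sum>m\<le>N. D m (\<alpha> x) * V m s * exp (- real s * \<alpha> x)) * h s x) x) =
      restrict0 S (\<lambda>x. \<Sum>s\<le>N. (\<Sum>m\<le>N. D m (\<alpha> x) * V m s * exp (- real s * \<alpha> x)) * h s x)"
    by (rule ext) (simp add: restrict0_def)
  ultimately show ?thesis by simp
qed

lemma restrict0_cong: "(\<And>x. x \<in> S \<Longrightarrow> g x = h x) \<Longrightarrow> restrict0 S g = restrict0 S h"
  by (auto simp: restrict0_def)

text \<open>Induction on k for all j, B and D at once. The weak derivative of the combination has
  the same form with Suc j in place of j and new coefficients B', so it remains to verify the
  regularity hypothesis for B', which follows from uniqueness of weak derivatives.\<close>

lemma sobr_exp_type: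
  fixes \<alpha> :: "'e::euclidean_space \<Rightarrow> real" and B :: "nat \<Rightarrow> 'e \<Rightarrow> real"
  assumes p: "1 \<le> p" and S: "halfspace_open S" and \<alpha>: "continuous_on S \<alpha>"
    and g: "\<And>e. e \<in> Basis \<Longrightarrow> \<exists>h. weak_deriv (interior S) e (restrict0 S (\<lambda>x. exp (\<alpha> x))) h \<and> locally_integrable (interior S) h"
    and u: "\<And>s. sobr p S k (restrict0 S (\<lambda>x. exp (real s * \<alpha> x) * (\<Sum>l\<le>j. real s ^ l * B l x)))"
    and T: "\<alpha> ` S \<subseteq> T" and D: "derivative_sequence T D"
  shows "sobr p S k (restrict0 S (\<lambda>x. \<Sum>m\<le>j. D m (\<alpha> x) * B m x))"
  using u T D
proof (induction k arbitrary: j B T D)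
  case (0 j B T D)
  obtain V :: "nat \<Rightarrow> nat \<Rightarrow> real" where V: "\<And>m l. m \<le> Suc j \<Longrightarrow> l \<le> Suc j \<Longrightarrow>
      (\<Sum>s\<le>Suc j. V m s * real s ^ l) = (if m = l then 1 else 0)"
    using vandermonde_inverse[of "Suc j"] by blast
  let ?u = "\<lambda>s. restrict0 S (\<lambda>x. exp (real s * \<alpha> x) * (\<Sum>l\<le>j. real s ^ l * B l x))"
  have Z: "restrict0 S (\<lambda>x. \<Sum>s\<le>Suc j. (\<Sum>m\<le>Suc j. D' m (\<alpha> x) * V m s * exp (- real s * \<alpha> x)) * ?u s x) =
      restrict0 S (\<lambda>x. \<Sum>m\<le>j. D' m (\<alpha> x) * B m x)" for D'
    by (rule restrict0_cong, rule exp_combination_algebra(1)[OF V]) simp_all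
  have "loc_Lp p S (?u s)" for s using 0(1)[of s] by simp
  from loc_Lp_exp_weighted[where h = ?u and N = "Suc j" and V = V, OF p S \<alpha> 0(2,3) this] show ?case unfolding Z by simp
next
  case (Suc k j B T D)
  obtain V :: "nat \<Rightarrow> nat \<Rightarrow> real" where V: "\<And>m l. m \<le> Suc j \<Longrightarrow> l \<le> Suc j \<Longrightarrow>
      (\<Sum>s\<le>Suc j. V m s * real s ^ l) = (if m = l then 1 else 0)"
    using vandermonde_inverse[of "Suc j"] by blast
  let ?u = "\<lambda>s. restrict0 S (\<lambda>x. exp (real s * \<alpha> x) * (\<Sum>l\<le>j. real s ^ l * B l x))"
  have Z: "restrict0 S (\<lambda>x. \<Sum>s\<le>Suc j. (\<Sum>m\<le>Suc j. D' m (\<alpha> x) * V m s * exp (- real s * \<alpha> x)) * ?u s x) =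
      restrict0 S (\<lambda>x. \<Sum>m\<le>j. D' m (\<alpha> x) * B m x)" for D'
    by (rule restrict0_cong, rule exp_combination_algebra(1)[OF V]) simp_all
  have ZLp: "loc_Lp p S (restrict0 S (\<lambda>x. \<Sum>m\<le>j. D' m (\<alpha> x) * B m x))"
    if "\<alpha> ` S \<subseteq> T'" "derivative_sequence T' D'" for T' D'
    using loc_Lp_exp_weighted[where h = ?u and N = "Suc j" and V = V, OF p S \<alpha> that sobr_loc_Lp[OF Suc.prems(1)]] unfolding Z .
  have "\<exists>h. weak_deriv (interior S) e (restrict0 S (\<lambda>x. \<Sum>m\<le>j. D m (\<alpha> x) * B m x)) h \<and> sobr p S k h"
    if e: "e \<in> Basis" for e
  proof -
    have "\<forall>s. \<exists>h. weak_deriv (interior S) e (?u s) h \<and> sobr p S k h"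
      using sobr_SucE[OF Suc.prems(1) e] by metis
    from choice[OF this] obtain H where H: "\<And>s. weak_deriv (interior S) e (?u s) (H s)" "\<And>s. sobr p S k (H s)"
      by blast
    obtain h where h: "weak_deriv (interior S) e (restrict0 S (\<lambda>x. exp (\<alpha> x))) h" "locally_integrable (interior S) h"
      using g[OF e] by blast
    define B' where "B' m x = (\<Sum>s\<le>Suc j. V m s * exp (- real s * \<alpha> x) * H s x)" for m x
    have RLp: "loc_Lp p S (restrict0 S (\<lambda>x. \<Sum>m\<le>Suc j. D' m (\<alpha> x) * B' m x))"
      if "\<alpha> ` S \<subseteq> T'" "derivative_sequence T' D'" for T' D'
    proof -
      have "(\<Sum>m\<le>Suc j. D' m (\<alpha> x) * B' m x) =
          (\<Sum>s\<le>Suc j. (\<Sum>m\<le>Suc j. D' m (\<alpha> x) * V m s * exp (- real s * \<alpha> x)) * H s x)" for x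
        unfolding B'_def sum_distrib_left sum_distrib_right by (subst sum.swap) (simp only: mult.assoc)
      then show ?thesis using loc_Lp_exp_weighted[where h = H and N = "Suc j" and V = V, OF p S \<alpha> that sobr_loc_Lp[OF H(2)]] by simp
    qed
    note li = locally_integrable_subset[OF loc_Lp_locally_integrable[OF p] interior_subset]
    have inS: "x \<in> S" if "x \<in> interior S" for x using that interior_subset by blast
    have wd: "weak_deriv (interior S) e (restrict0 S (\<lambda>x. \<Sum>m\<le>j. D' m (\<alpha> x) * B m x))
        (restrict0 S (\<lambda>x. \<Sum>m\<le>Suc j. D' m (\<alpha> x) * B' m x))"
      if T': "\<alpha> ` S \<subseteq> T'" and D': "derivative_sequence T' D'" for T' D'
    proof (rule weak_deriv_exp_combination[OF open_interior _ _ D' V _ h(2,1)])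
      show "continuous_on (interior S) \<alpha>" by (rule continuous_on_subset[OF \<alpha> interior_subset])
      show "\<alpha> ` interior S \<subseteq> T'" using T' interior_subset by blast
      show "locally_integrable (interior S) (restrict0 S (\<lambda>x. exp (\<alpha> x)))"
        by (intro li loc_Lp_continuous[OF p halfspace_open_borel[OF S]] continuous_intros \<alpha>)
      show "locally_integrable (interior S) (?u s)" for s by (rule li[OF sobr_loc_Lp[OF Suc.prems(1)]])
      show "locally_integrable (interior S) (H s)" for s by (rule li[OF sobr_loc_Lp[OF H(2)]])
      show "weak_deriv (interior S) e (?u s) (H s)" for s by (rule H(1))
      show "locally_integrable (interior S) (restrict0 S (\<lambda>x. \<Sum>m\<le>j. D' m (\<alpha> x) * B m x))"
        by (rule li[OF ZLp[OF T' D']])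
      show "locally_integrable (interior S) (restrict0 S (\<lambda>x. \<Sum>m\<le>Suc j. D' m (\<alpha> x) * B' m x))"
        by (rule li[OF RLp[OF T' D']])
    qed (simp_all add: inS B'_def)
    have "sobr p S k (restrict0 S (\<lambda>x. exp (real s * \<alpha> x) * (\<Sum>l\<le>Suc j. real s ^ l * B' l x)))" for s
    proof -
      \<comment> \<open>For the derivative sequence s ^ m * exp (s * y) the combination is
        \<open>?u s\<close> itself. The derivative formula thus expresses a weak derivative of
        \<open>?u s\<close> through B', and it agrees almost everywhere with \<open>H s\<close>,
        whose regularity is known.\<close>
      let ?E = "\<lambda>m y. real s ^ m * exp (real s * y)"
      let ?R = "restrict0 S (\<lambda>x. \<Sum>m\<le>Suc j. ?E m (\<alpha> x) * B' m x)"
      have E: "\<alpha> ` S \<subseteq> UNIV" "derivative_sequence UNIV ?E" by (simp_all add: derivative_sequence_exp_scaled)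
      have "restrict0 S (\<lambda>x. \<Sum>m\<le>j. ?E m (\<alpha> x) * B m x) = ?u s"
        by (rule restrict0_cong) (simp add: sum_distrib_left mult_ac)
      then have "weak_deriv (interior S) e (?u s) ?R" using wd[OF E] by simp
      from weak_deriv_unique[OF open_interior li[OF sobr_loc_Lp[OF H(2)]] li[OF RLp[OF E]] H(1) this]
      have "AE x in lborel. x \<in> S \<longrightarrow> H s x = ?R x" by (rule AE_interior_halfspace[OF S])
      from sobr_AE[OF H(2) loc_Lp_measurable[OF RLp[OF E]] this] have "sobr p S k ?R" .
      moreover have "?R = restrict0 S (\<lambda>x. exp (real s * \<alpha> x) * (\<Sum>l\<le>Suc j. real s ^ l * B' l x))"
        by (rule restrict0_cong) (simp add: sum_distrib_left distrib_left mult_ac)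
      ultimately show ?thesis by simp
    qed
    from Suc.IH[OF this Suc.prems(2,3)] wd[OF Suc.prems(2,3)] show ?thesis by blast
  qed
  then show ?case using ZLp[OF Suc.prems(2,3)] by simp
qed

text \<open>The case j = 0 with coefficient 1. The condition 1 \<le> k provides the first weak
  derivatives of exp \<alpha> that control the increments of \<alpha>.\<close>

lemma sobr_compose:
  fixes \<alpha> :: "'e::euclidean_space \<Rightarrow> real"
  assumes p: "1 \<le> p" and k: "1 \<le> k" and S: "halfspace_open S" and \<alpha>: "continuous_on S \<alpha>"
    and u: "\<And>n::nat. sobr p S k (restrict0 S (\<lambda>x. exp (real n * \<alpha> x)))"
    and T: "\<alpha> ` S \<subseteq> T" and D: "derivative_sequence T D"
  shows "sobr p S k (restrict0 S (\<lambda>x. D 0 (\<alpha> x)))"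
proof -
  obtain i where k: "k = Suc i" using k by (cases k) auto
  have g: "\<exists>h. weak_deriv (interior S) e (restrict0 S (\<lambda>x. exp (\<alpha> x))) h \<and> locally_integrable (interior S) h"
    if e: "e \<in> Basis" for e
  proof -
    have "sobr p S (Suc i) (restrict0 S (\<lambda>x. exp (\<alpha> x)))" using u[of 1] k by simp
    then obtain h where "weak_deriv (interior S) e (restrict0 S (\<lambda>x. exp (\<alpha> x))) h" "sobr p S i h"
      by (rule sobr_SucE[OF _ e])
    then show ?thesis using sobr_locally_integrable[OF p] by blast
  qed
  have u': "sobr p S k (restrict0 S (\<lambda>x. exp (real s * \<alpha> x) * (\<Sum>l\<le>0. real s ^ l * 1)))" for s using u[of s] by simp
  from sobr_exp_type[OF p S \<alpha> g u' T D] show ?thesis by simp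
qed

subsection \<open>Gluing\<close>

lemma closed_ball_subset: "closed {x::'e::metric_space. ball x r \<subseteq> G}"
proof -
  have "{x. ball x r \<subseteq> G} = (\<Inter>y\<in>-G. {x. r \<le> dist x y})"
  proof (intro set_eqI iffI)
    fix x assume "x \<in> {x. ball x r \<subseteq> G}"
    then have "\<not> dist x y < r" if "y \<in> - G" for y using that by (auto simp: subset_eq)
    then show "x \<in> (\<Inter>y\<in>-G. {x. r \<le> dist x y})" by (simp add: not_less)
  next
    fix x assume "x \<in> (\<Inter>y\<in>-G. {x. r \<le> dist x y})"
    then have "y \<in> G" if "dist x y < r" for y using that not_less by blast
    then show "x \<in> {x. ball x r \<subseteq> G}" by auto
  qed
  moreover have "closed {x. r \<le> dist x y}" for y :: 'e by (intro closed_Collect_le continuous_intros)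
  ultimately show ?thesis by auto
qed

text \<open>A Lebesgue number \<epsilon> of the cover and finitely many closed balls of radius
  \<epsilon> / 2 cut K into compact pieces, each contained in a single U n.\<close>

lemma loc_Lp_glue:
  fixes u :: "'e::euclidean_space \<Rightarrow> real"
  assumes m: "u \<in> borel_measurable borel"
    and U: "\<And>n::nat. openin (top_of_set S) (U n)" "S \<subseteq> (\<Union>n. U n)" "\<And>n. loc_Lp p (U n) u"
  shows "loc_Lp p S u"
  unfolding loc_Lp_def
proof (intro conjI m allI impI)
  fix K assume K: "compact K" "K \<subseteq> S"
  have "\<forall>n. \<exists>T. open T \<and> U n = S \<inter> T" using U(1) unfolding openin_open by blast
  from choice[OF this] obtain T where T: "\<And>n. open (T n)" "\<And>n. U n = S \<inter> T n" by blast
  have cover: "K \<subseteq> \<Union>(range T)" using K(2) U(2) T(2) by blast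
  have op: "open G" if "G \<in> range T" for G using that T(1) by auto
  obtain \<epsilon> where \<epsilon>0: "\<epsilon> > 0" "\<And>x. x \<in> K \<Longrightarrow> \<exists>G\<in>range T. ball x \<epsilon> \<subseteq> G"
    by (rule Heine_Borel_lemma[OF K(1) cover]) (erule op, rule that)
  then have \<epsilon>: "\<epsilon> > 0" "\<And>x. x \<in> K \<Longrightarrow> \<exists>n. ball x \<epsilon> \<subseteq> T n" by blast+
  have "\<exists>F. finite F \<and> F \<subseteq> K \<and> K \<subseteq> (\<Union>x\<in>F. ball x (\<epsilon>/2))"
    by (rule seq_compact_imp_totally_bounded[OF compact_imp_seq_compact[OF K(1)], rule_format]) (use \<epsilon>(1) in simp)
  then obtain F where F: "finite F" "F \<subseteq> K" "K \<subseteq> (\<Union>x\<in>F. ball x (\<epsilon>/2))" by (elim exE conjE)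
  have Ki: "set_integrable lborel (K \<inter> cball x (\<epsilon>/2)) (\<lambda>x. \<bar>u x\<bar> powr p)" if x: "x \<in> F" for x
  proof -
    obtain n where n: "ball x \<epsilon> \<subseteq> T n" using \<epsilon>(2) F(2) x by blast
    have "K \<inter> cball x (\<epsilon>/2) \<subseteq> U n" unfolding T(2) using n K(2) \<epsilon>(1) by (auto simp: subset_iff)
    moreover have "compact (K \<inter> cball x (\<epsilon>/2))" using K(1) by (intro compact_Int) auto
    ultimately show ?thesis using U(3)[of n] unfolding loc_Lp_def by blast
  qed
  have b: "K \<inter> cball x (\<epsilon>/2) \<in> sets lborel" for x
    using borel_compact[OF compact_Int_closed[OF K(1) closed_cball]] by simp
  have "set_integrable lborel (\<Union>x\<in>F. K \<inter> cball x (\<epsilon>/2)) (\<lambda>x. \<bar>u x\<bar> powr p)"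
    by (rule set_integrable_UN[OF F(1) Ki b])
  moreover have "(\<Union>x\<in>F. K \<inter> cball x (\<epsilon>/2)) = K" using F(3) by (force simp: less_imp_le)
  ultimately show "set_integrable lborel K (\<lambda>x. \<bar>u x\<bar> powr p)" by simp
qed

text \<open>The characterization by lines replaces a partition of unity. With a Lebesgue number
  \<epsilon>, the points of K whose \<epsilon>-ball lies in U n form compact sets covering K, and
  segments of one common length starting there stay in U n.\<close>

lemma weak_deriv_glue:
  fixes u h :: "'e::euclidean_space \<Rightarrow> real"
  assumes X: "open X" and U: "\<And>n::nat. open (U n)" "X \<subseteq> (\<Union>n. U n)" "\<And>n. U n \<subseteq> X"
    and w: "\<And>n. weak_deriv (U n) e u h" and u: "locally_integrable X u" and h: "locally_integrable X h"
  shows "weak_deriv X e u h"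
proof (rule weak_deriv_if_lines[OF u h])
  fix K assume K: "compact K" "K \<subseteq> X"
  have cover: "K \<subseteq> \<Union>(range U)" using K(2) U(2) by blast
  have op: "open G" if "G \<in> range U" for G using that U(1) by auto
  obtain \<epsilon> where \<epsilon>0: "\<epsilon> > 0" "\<And>x. x \<in> K \<Longrightarrow> \<exists>G\<in>range U. ball x \<epsilon> \<subseteq> G"
    by (rule Heine_Borel_lemma[OF K(1) cover]) (erule op, rule that)
  then have \<epsilon>: "\<epsilon> > 0" "\<And>x. x \<in> K \<Longrightarrow> \<exists>n. ball x \<epsilon> \<subseteq> U n" by blast+
  define \<delta> where "\<delta> = \<epsilon> / (norm e + 1)"
  have n1: "norm e + 1 > 0" by (simp add: add_nonneg_pos)
  have \<delta>: "\<delta> > 0" "\<delta> * (norm e + 1) = \<epsilon>" using \<epsilon>(1) n1 by (simp_all add: \<delta>_def)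
  let ?K = "\<lambda>n. K \<inter> {x. ball x \<epsilon> \<subseteq> U n}"
  have lin: "line_in (U n) e \<delta> x" if "x \<in> ?K n" for n x
    unfolding line_in_def
  proof
    fix \<sigma> assume \<sigma>: "\<sigma> \<in> {0..\<delta>}"
    have "\<sigma> * norm e \<le> \<delta> * norm e" using \<sigma> by (intro mult_right_mono) auto
    also have "\<dots> < \<epsilon>" using \<delta> by (simp add: distrib_left)
    finally have "x + \<sigma> *\<^sub>R e \<in> ball x \<epsilon>" using \<sigma> by (simp add: dist_norm)
    then show "x + \<sigma> *\<^sub>R e \<in> U n" using that by blast
  qed
  have cK: "compact (?K n)" for n using K(1) closed_ball_subset by (intro compact_Int_closed)
  have "AE x in lborel. \<forall>n. x \<in> ?K n \<longrightarrow> set_integrable lborel {0..\<delta>} (\<lambda>\<sigma>. h (x + \<sigma> *\<^sub>R e)) \<and>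
      (AE t in lborel. t \<in> {0..\<delta>} \<longrightarrow> u (x + t *\<^sub>R e) - u x = line_integral h e x t)"
    by (subst AE_all_countable)
      (use weak_deriv_lines[OF U(1) locally_integrable_subset[OF u U(3)] locally_integrable_subset[OF h U(3)] w cK lin] in blast)
  then have ae: "AE x in lborel. x \<in> K \<longrightarrow> (AE t in lborel. t \<in> {0..\<delta>} \<longrightarrow> u (x + t *\<^sub>R e) - u x = line_integral h e x t)"
    by eventually_elim (use \<epsilon>(2) in blast)
  have "line_in X e \<delta> x" if x: "x \<in> K" for x
  proof -
    obtain n where "x \<in> ?K n" using \<epsilon>(2)[OF x] x by blast
    then show ?thesis using lin U(3) unfolding line_in_def by blast
  qed
  then show "\<exists>\<delta>>0. (\<forall>x\<in>K. line_in X e \<delta> x) \<and>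
      (AE x in lborel. x \<in> K \<longrightarrow> (AE t in lborel. t \<in> {0..\<delta>} \<longrightarrow> u (x + t *\<^sub>R e) - u x = line_integral h e x t))"
    using ae \<delta>(1) by blast
qed

text \<open>The local weak derivatives h n agree almost everywhere on overlaps. H pastes them along
  the disjointed cover, which keeps it measurable and makes it a representative of every h n; the
  induction hypothesis then applies to H.\<close>

lemma sobr_glue:
  fixes u :: "'e::euclidean_space \<Rightarrow> real"
  assumes p: "1 \<le> p" and S: "halfspace_open S" and m: "u \<in> borel_measurable borel"
    and U: "\<And>n::nat. openin (top_of_set S) (U n)" "S \<subseteq> (\<Union>n. U n)"
    and u: "\<And>n. sobr p (U n) k u"
  shows "sobr p S k u"
  using m u
proof (induction k arbitrary: u)
  case 0
  then show ?case using loc_Lp_glue[OF _ U] by simp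
next
  case (Suc k)
  have Uh: "halfspace_open (U n)" for n by (rule halfspace_open_openin[OF S U(1)])
  have Ub [measurable]: "U n \<in> sets borel" for n by (rule halfspace_open_borel[OF Uh])
  have Lu: "loc_Lp p S u" by (rule loc_Lp_glue[OF Suc.prems(1) U sobr_loc_Lp[OF Suc.prems(2)]])
  have int: "x \<in> interior (U n)" if "x \<in> interior S" "x \<in> U n" for x n
  proof -
    obtain T where T: "open T" "U n = S \<inter> T" using U(1) unfolding openin_open by blast
    have "interior S \<inter> T \<subseteq> interior (U n)"
      unfolding T(2) using interior_subset by (intro interior_maximal open_Int open_interior T(1)) blast
    then show ?thesis using that T(2) by blast
  qed
  have sub: "U n \<subseteq> S" for n using U(1) openin_imp_subset by blast
  have "\<exists>h. weak_deriv (interior S) e u h \<and> sobr p S k h" if e: "e \<in> Basis" for e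
  proof -
    have "\<forall>n. \<exists>h. weak_deriv (interior (U n)) e u h \<and> sobr p (U n) k h"
      using sobr_SucE[OF Suc.prems(2) e] by metis
    from choice[OF this] obtain h where h: "\<And>n. weak_deriv (interior (U n)) e u (h n)" "\<And>n. sobr p (U n) k (h n)"
      by blast
    have hm [measurable]: "h n \<in> borel_measurable borel" for n by (rule loc_Lp_measurable[OF sobr_loc_Lp[OF h(2)]])
    define H where "H x = (\<Sum>n. indicator (disjointed U n) x * h n x)" for x
    have dm [measurable]: "disjointed U n \<in> sets borel" for n
      by (rule sets.range_disjointed_sets'[of U borel, THEN subsetD]) auto
    have Hm [measurable]: "H \<in> borel_measurable borel" unfolding H_def[abs_def] by measurable
    have H_eq: "H x = h n x" if "x \<in> disjointed U n" for x n
    proof -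
      have "indicator (disjointed U i) x * h i x = 0" if "i \<notin> {n}" for i
        using disjoint_family_disjointed[of U] that \<open>x \<in> disjointed U n\<close> unfolding disjoint_family_on_def
        by (auto simp: indicator_def)
      then have "H x = (\<Sum>i\<in>{n}. indicator (disjointed U i) x * h i x)"
        unfolding H_def by (intro suminf_finite) auto
      then show ?thesis using that by simp
    qed
    have "AE x in lborel. x \<in> interior (U n) \<inter> interior (U i) \<longrightarrow> h n x = h i x" for n i
    proof (rule weak_deriv_unique[of _ _ _ e u])
      show "locally_integrable (interior (U n) \<inter> interior (U i)) (h n)" "locally_integrable (interior (U n) \<inter> interior (U i)) (h i)"
        using sobr_locally_integrable[OF p h(2)] locally_integrable_subset by (meson Int_lower1 Int_lower2)+
      show "weak_deriv (interior (U n) \<inter> interior (U i)) e u (h n)" "weak_deriv (interior (U n) \<inter> interior (U i)) e u (h i)"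
        using h(1) weak_deriv_subset by (meson Int_lower1 Int_lower2)+
    qed auto
    then have pairs: "AE x in lborel. \<forall>n i. x \<in> interior (U n) \<inter> interior (U i) \<longrightarrow> h n x = h i x"
      by (simp only: AE_all_countable) blast
    have HX: "AE x in lborel. x \<in> interior (U n) \<longrightarrow> h n x = H x" for n
      using pairs
    proof eventually_elim
      case (elim x)
      show ?case
      proof
        assume x: "x \<in> interior (U n)"
        then have "x \<in> U n" using interior_subset by blast
        then have "x \<in> (\<Union>i. disjointed U i)" unfolding UN_disjointed_eq by blast
        then obtain i where i: "x \<in> disjointed U i" by blast
        have "x \<in> interior S" using x interior_mono[OF sub] by blast
        then have "x \<in> interior (U i)" using int disjointed_subset[of U i] i by blast
        then show "h n x = H x" using elim x H_eq[OF i] by (metis IntI)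
      qed
    qed
    have "weak_deriv (interior (U n)) e u H" for n
      by (rule weak_deriv_AE[OF h(1) Suc.prems(1) hm Suc.prems(1) Hm _ HX]) simp
    moreover have "sobr p (U n) k H" for n
      by (rule sobr_AE[OF h(2) Hm AE_interior_halfspace[OF Uh HX]])
    then have H: "sobr p S k H" by (rule Suc.IH[OF Hm])
    moreover have "interior S \<subseteq> (\<Union>n. interior (U n))"
    proof
      fix x assume x: "x \<in> interior S"
      then have "x \<in> (\<Union>n. U n)" using interior_subset U(2) by blast
      then obtain n where "x \<in> U n" by blast
      then show "x \<in> (\<Union>n. interior (U n))" using int[OF x] by blast
    qed
    ultimately have "weak_deriv (interior S) e u H"
      using weak_deriv_glue[of "interior S" "\<lambda>n. interior (U n)" e u H] interior_mono[OF sub]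
        sobr_locally_integrable[OF p H] locally_integrable_subset[OF loc_Lp_locally_integrable[OF p Lu] interior_subset] by auto
    then show ?thesis using H by blast
  qed
  then show ?case using Lu by simp
qed

section \<open>Agreement of the recursive description with iterated weak derivatives\<close>

lemma test_function_frechet_iter:
  "test_function X \<psi> \<Longrightarrow> test_function X (\<lambda>x. frechet_iter UNIV \<psi> j x v)"
proof (induction j)
  case (Suc j)
  from test_function_dderiv[OF Suc.IH[OF Suc.prems], of "v j"] show ?case
    by (simp add: dderiv_def[abs_def])
qed simp

lemma test_function_set_integral:
  fixes g :: "'e::euclidean_space \<Rightarrow> real"
  assumes "test_function (interior S) \<psi>"
  shows "(LINT x:interior S|lborel. \<psi> x *\<^sub>R g x) = (\<integral>x. \<psi> x * restrict0 S g x \<partial>lborel)"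
    "(LINT x:interior S|lborel. \<psi> x *\<^sub>R g x) = (\<integral>x. \<psi> x * g x \<partial>lborel)"
proof -
  have out: "\<psi> x = 0" if "x \<notin> interior S" for x
    using test_function_support(2,3)[OF assms] that by blast
  have "indicator (interior S) x *\<^sub>R (\<psi> x *\<^sub>R g x) = \<psi> x * restrict0 S g x"
    "indicator (interior S) x *\<^sub>R (\<psi> x *\<^sub>R g x) = \<psi> x * g x" for x
  proof -
    show "indicator (interior S) x *\<^sub>R (\<psi> x *\<^sub>R g x) = \<psi> x * g x"
      using out[of x] by (cases "x \<in> interior S") auto
    show "indicator (interior S) x *\<^sub>R (\<psi> x *\<^sub>R g x) = \<psi> x * restrict0 S g x"
    proof (cases "x \<in> interior S")
      case True
      then show ?thesis using subsetD[OF interior_subset True] by simp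
    qed (simp add: out)
  qed
  then show "(LINT x:interior S|lborel. \<psi> x *\<^sub>R g x) = (\<integral>x. \<psi> x * restrict0 S g x \<partial>lborel)"
    "(LINT x:interior S|lborel. \<psi> x *\<^sub>R g x) = (\<integral>x. \<psi> x * g x \<partial>lborel)"
    unfolding set_lebesgue_integral_def by (simp_all only:)
qed

definition iterated_weak_deriv ::
  "'e::euclidean_space set \<Rightarrow> nat \<Rightarrow> (nat \<Rightarrow> 'e) \<Rightarrow> ('e \<Rightarrow> real) \<Rightarrow> ('e \<Rightarrow> real) \<Rightarrow> bool" where
  "iterated_weak_deriv X j v u h \<longleftrightarrow> (\<forall>\<psi>. test_function X \<psi> \<longrightarrow>
     (\<integral>x. frechet_iter UNIV \<psi> j x v * u x \<partial>lborel) = (- 1) ^ j * (\<integral>x. \<psi> x * h x \<partial>lborel))"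

lemma weak_derivative_on_iff:
  fixes g :: "'e::euclidean_space \<Rightarrow> real"
  shows "weak_derivative_on (interior S) g j v h \<longleftrightarrow> iterated_weak_deriv (interior S) j v (restrict0 S g) h"
  unfolding weak_derivative_on_def iterated_weak_deriv_def
proof (intro all_cong1 imp_cong refl)
  fix \<psi> assume \<psi>: "test_function (interior S) \<psi>"
  show "((LINT x:interior S|lborel. frechet_iter UNIV \<psi> j x v *\<^sub>R g x) =
        (- 1) ^ j *\<^sub>R (LINT x:interior S|lborel. \<psi> x *\<^sub>R h x)) \<longleftrightarrow>
      ((\<integral>x. frechet_iter UNIV \<psi> j x v * restrict0 S g x \<partial>lborel) = (- 1) ^ j * (\<integral>x. \<psi> x * h x \<partial>lborel))"
    unfolding test_function_set_integral(1)[OF test_function_frechet_iter[OF \<psi>]] test_function_set_integral(2)[OF \<psi>]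
    by simp
qed

lemma sobr_imp_iterated:
  assumes "sobr p S k u" "j \<le> k" "range v \<subseteq> Basis"
  shows "\<exists>h. loc_Lp p S h \<and> iterated_weak_deriv (interior S) j v u h"
  using assms(1,2)
proof (induction j arbitrary: k u)
  case 0
  then show ?case by (intro exI[of _ u]) (auto simp: iterated_weak_deriv_def intro: sobr_loc_Lp)
next
  case (Suc j)
  obtain i where k: "k = Suc i" "j \<le> i" using Suc.prems(2) by (cases k) auto
  have e: "v j \<in> Basis" using assms(3) by auto
  obtain h1 where h1: "weak_deriv (interior S) (v j) u h1" "sobr p S i h1"
    by (rule sobr_SucE[OF Suc.prems(1)[unfolded k(1)] e])
  obtain h where h: "loc_Lp p S h" "iterated_weak_deriv (interior S) j v h1 h"
    using Suc.IH[OF h1(2) k(2)] by blast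
  have "iterated_weak_deriv (interior S) (Suc j) v u h"
    unfolding iterated_weak_deriv_def
  proof (intro allI impI)
    fix \<psi> assume \<psi>: "test_function (interior S) \<psi>"
    have "(\<integral>x. frechet_iter UNIV \<psi> (Suc j) x v * u x \<partial>lborel) =
        (\<integral>x. dderiv UNIV (\<lambda>y. frechet_iter UNIV \<psi> j y v) (v j) x * u x \<partial>lborel)"
      by (simp add: dderiv_def)
    also have "\<dots> = - (\<integral>x. frechet_iter UNIV \<psi> j x v * h1 x \<partial>lborel)"
      using h1(1) test_function_frechet_iter[OF \<psi>] unfolding weak_deriv_def by blast
    also have "\<dots> = - ((- 1) ^ j * (\<integral>x. \<psi> x * h x \<partial>lborel))"
      using h(2) \<psi> unfolding iterated_weak_deriv_def by simp
    finally show "(\<integral>x. frechet_iter UNIV \<psi> (Suc j) x v * u x \<partial>lborel) = (- 1) ^ Suc j * (\<integral>x. \<psi> x * h x \<partial>lborel)"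
      by simp
  qed
  then show ?case using h(1) by blast
qed

text \<open>Testing with the derivative of \<psi> along e prepends e to the list of directions.
  Hence the derivative for \<open>case_nat e v\<close> is the weak derivative along e of the one for
  v, and descending induction on the number of remaining derivatives gives membership for order 0,
  which is u almost everywhere.\<close>

lemma iterated_imp_sobr:
  fixes u :: "'e::euclidean_space \<Rightarrow> real"
  assumes p: "1 \<le> p" and S: "halfspace_open S" and u: "locally_integrable (interior S) u"
    and H: "\<And>j v. j \<le> k \<Longrightarrow> range v \<subseteq> Basis \<Longrightarrow> loc_Lp p S (H j v) \<and> iterated_weak_deriv (interior S) j v u (H j v)"
  shows "sobr p S k u"
proof -
  have step: "weak_deriv (interior S) e (H j v) (H (Suc j) (case_nat e v))"
    if j: "Suc j \<le> k" and v: "range v \<subseteq> Basis" and e: "e \<in> Basis" for j v e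
    unfolding weak_deriv_def
  proof (intro allI impI)
    fix \<psi> assume \<psi>: "test_function (interior S) \<psi>"
    have v': "range (case_nat e v) \<subseteq> Basis" using v e by (auto simp: image_subset_iff split: nat.splits)
    have "(-1) ^ j * (\<integral>x. dderiv UNIV \<psi> e x * H j v x \<partial>lborel) = (\<integral>x. frechet_iter UNIV (dderiv UNIV \<psi> e) j x v * u x \<partial>lborel)"
      using H[of j v] j v test_function_dderiv[OF \<psi>, of e] unfolding iterated_weak_deriv_def by simp
    also have "\<dots> = (\<integral>x. frechet_iter UNIV \<psi> (Suc j) x (case_nat e v) * u x \<partial>lborel)"
      unfolding frechet_iter_shift by simp
    also have "\<dots> = (-1) ^ Suc j * (\<integral>x. \<psi> x * H (Suc j) (case_nat e v) x \<partial>lborel)"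
      using H[OF j v'] \<psi> unfolding iterated_weak_deriv_def by blast
    finally have "(-1) ^ j * (\<integral>x. dderiv UNIV \<psi> e x * H j v x \<partial>lborel) =
        (-1) ^ j * - (\<integral>x. \<psi> x * H (Suc j) (case_nat e v) x \<partial>lborel)"
      by simp
    then show "(\<integral>x. dderiv UNIV \<psi> e x * H j v x \<partial>lborel) = - (\<integral>x. \<psi> x * H (Suc j) (case_nat e v) x \<partial>lborel)"
      unfolding mult_cancel_left by simp
  qed
  have fam: "n + j \<le> k \<Longrightarrow> range v \<subseteq> Basis \<Longrightarrow> sobr p S n (H j v)" for n j v
  proof (induction n arbitrary: j v)
    case 0
    then show ?case using H by simp
  next
    case (Suc n)
    have "\<exists>h. weak_deriv (interior S) e (H j v) h \<and> sobr p S n h" if e: "e \<in> Basis" for e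
    proof -
      have "range (case_nat e v) \<subseteq> Basis" using Suc.prems(2) e by (auto simp: image_subset_iff split: nat.splits)
      then have "sobr p S n (H (Suc j) (case_nat e v))" using Suc.IH[of "Suc j"] Suc.prems(1) by simp
      then show ?thesis using step[of j v e] Suc.prems e by auto
    qed
    moreover have "loc_Lp p S (H j v)" using H[of j v] Suc.prems by simp
    ultimately show ?case by simp
  qed
  obtain b :: 'e where b: "b \<in> Basis" using nonempty_Basis by blast
  let ?v = "\<lambda>_::nat. b"
  have rb: "range ?v \<subseteq> Basis" using b by auto
  have s: "sobr p S k (H 0 ?v)" by (rule fam) (use rb in auto)
  have i0: "iterated_weak_deriv (interior S) 0 ?v u (H 0 ?v)" using H[of 0 ?v] rb by simp
  note l0 = sobr_locally_integrable[OF p s]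
  have "AE x in lborel. x \<in> interior S \<longrightarrow> H 0 ?v x + - u x = 0"
  proof (rule AE_eq_0_if_test_integrals_vanish[OF open_interior])
    show "locally_integrable (interior S) (\<lambda>x. H 0 ?v x + - u x)"
      by (intro locally_integrable_add locally_integrable_uminus l0 u)
    fix \<psi> assume \<psi>: "test_function (interior S) \<psi>"
    have "(\<integral>x. \<psi> x * u x \<partial>lborel) = (\<integral>x. \<psi> x * H 0 ?v x \<partial>lborel)"
      using i0 \<psi> unfolding iterated_weak_deriv_def by simp
    then show "(\<integral>x. \<psi> x * (H 0 ?v x + - u x) \<partial>lborel) = 0"
      using test_function_integrable[OF \<psi> l0] test_function_integrable[OF \<psi> u] by (simp add: right_diff_distrib)
  qed
  then have "AE x in lborel. x \<in> interior S \<longrightarrow> H 0 ?v x = u x" by eventually_elim auto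
  from sobr_AE[OF s locally_integrable_measurable[OF u] AE_interior_halfspace[OF S this]] show ?thesis .
qed

lemma sobolev_on_iff:
  fixes g :: "'e::euclidean_space \<Rightarrow> real"
  assumes p: "1 \<le> p" and S: "halfspace_open S"
  shows "sobolev_on k p S g \<longleftrightarrow> continuous_on S g \<and> sobr p S k (restrict0 S g)"
proof
  assume L: "sobolev_on k p S g"
  then have c: "continuous_on S g" by (simp add: sobolev_on_def)
  have "\<forall>q :: nat \<times> (nat \<Rightarrow> 'e). \<exists>h. fst q \<le> k \<longrightarrow> range (snd q) \<subseteq> Basis \<longrightarrow> loc_Lp p S h \<and>
      iterated_weak_deriv (interior S) (fst q) (snd q) (restrict0 S g) h"
    using L unfolding sobolev_on_def weak_derivative_on_iff loc_Lp_def real_norm_def by meson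
  from choice[OF this] obtain H where H: "\<And>j (v :: nat \<Rightarrow> 'e). j \<le> k \<Longrightarrow> range v \<subseteq> Basis \<Longrightarrow>
      loc_Lp p S (H (j, v)) \<and> iterated_weak_deriv (interior S) j v (restrict0 S g) (H (j, v))"
    by auto
  have "locally_integrable (interior S) (restrict0 S g)"
    by (rule locally_integrable_subset[OF loc_Lp_locally_integrable[OF p loc_Lp_continuous[OF p halfspace_open_borel[OF S] c]] interior_subset])
  from iterated_imp_sobr[OF p S this, of k "\<lambda>j v. H (j, v)"] H c
  show "continuous_on S g \<and> sobr p S k (restrict0 S g)" by blast
next
  assume R: "continuous_on S g \<and> sobr p S k (restrict0 S g)"
  show "sobolev_on k p S g"
    unfolding sobolev_on_def weak_derivative_on_iff
  proof (intro conjI allI impI)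
    show "continuous_on S g" using R by blast
    fix j and v :: "nat \<Rightarrow> 'e" assume jv: "j \<le> k" "range v \<subseteq> Basis"
    obtain h where "loc_Lp p S h" "iterated_weak_deriv (interior S) j v (restrict0 S g) h"
      using sobr_imp_iterated[OF _ jv] R by blast
    then show "\<exists>h. h \<in> borel_measurable borel \<and> iterated_weak_deriv (interior S) j v (restrict0 S g) h \<and>
        (\<forall>K. compact K \<and> K \<subseteq> S \<longrightarrow> set_integrable lborel K (\<lambda>x. norm (h x) powr p))"
      by (auto simp: loc_Lp_def)
  qed
qed

section \<open>Common properties of the smoothness classes\<close>

lemma frechet_Ck_on_iff_hold: "frechet_Ck_on k S g \<longleftrightarrow> (\<forall>j. enat j \<le> k \<longrightarrow> hold 0 j S g)"
proof
  assume L: "frechet_Ck_on k S g"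
  show "\<forall>j. enat j \<le> k \<longrightarrow> hold 0 j S g"
    unfolding frechet_nat_eq_hold[symmetric] frechet_Ck_on_def
  proof (intro allI impI conjI)
    fix j i v assume j: "enat j \<le> k"
    show "(\<lambda>x. frechet_iter S g i x v) differentiable_on S" if "enat i < enat j"
      using L less_le_trans[OF that j] unfolding frechet_Ck_on_def by blast
    show "continuous_on S (\<lambda>x. frechet_iter S g i x v)" if "enat i \<le> enat j"
      using L order_trans[OF that j] unfolding frechet_Ck_on_def by blast
  qed
next
  assume R: "\<forall>j. enat j \<le> k \<longrightarrow> hold 0 j S g"
  then have R': "frechet_Ck_on (enat j) S g" if "enat j \<le> k" for j using that by (simp add: frechet_nat_eq_hold)
  show "frechet_Ck_on k S g"
    unfolding frechet_Ck_on_def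
  proof (intro conjI allI impI)
    fix j v assume "enat j < k"
    then have "enat (Suc j) \<le> k" by (simp add: Suc_ile_eq)
    from R'[OF this] show "(\<lambda>x. frechet_iter S g j x v) differentiable_on S"
      by (auto simp: frechet_Ck_on_def)
  next
    fix j v assume "enat j \<le> k"
    from R'[OF this] show "continuous_on S (\<lambda>x. frechet_iter S g j x v)"
      by (auto simp: frechet_Ck_on_def)
  qed
qed

text \<open>On relatively open subsets of half-spaces, all classes except the Sobolev classes are
  intersections of the classes \<open>hold a j\<close>.\<close>

definition hold_indices :: "smoothness \<Rightarrow> (real \<times> nat) set" where
  "hold_indices \<kappa> = (case \<kappa> of Frechet k \<Rightarrow> {(0, j) | j. enat j \<le> k}
    | Michal_Bastiani k \<Rightarrow> {(0, j) | j. enat j \<le> k} | Hoelder k a \<Rightarrow> {(a, k)} | Sobolev k p \<Rightarrow> {})"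

lemma class_on_hold:
  assumes "halfspace_open S" "\<forall>k p. \<kappa> \<noteq> Sobolev k p"
  shows "class_on \<kappa> S g \<longleftrightarrow> (\<forall>(a, j)\<in>hold_indices \<kappa>. hold a j S g)"
  using assms by (cases \<kappa>)
    (auto simp: hold_indices_def frechet_Ck_on_iff_hold bastiani_eq_frechet hoelder_eq_hold)

lemma hold_indices_range:
  "admissible d \<kappa> \<Longrightarrow> (a, j) \<in> hold_indices \<kappa> \<Longrightarrow> 0 \<le> a \<and> a \<le> 1"
  by (cases \<kappa>) (auto simp: hold_indices_def)

lemma class_on_holdI:
  assumes S: "halfspace_open S" and \<kappa>: "admissible d \<kappa>" "\<forall>k p. \<kappa> \<noteq> Sobolev k p"
    and "\<And>a j. 0 \<le> a \<Longrightarrow> a \<le> 1 \<Longrightarrow> (a, j) \<in> hold_indices \<kappa> \<Longrightarrow> hold a j S g"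
  shows "class_on \<kappa> S g"
  unfolding class_on_hold[OF S \<kappa>(2)] using assms(4) hold_indices_range[OF \<kappa>(1)] by blast

lemma class_on_holdD:
  assumes "halfspace_open S" "\<forall>k p. \<kappa> \<noteq> Sobolev k p" "class_on \<kappa> S g" "(a, j) \<in> hold_indices \<kappa>"
  shows "hold a j S g"
  using assms(3,4) unfolding class_on_hold[OF assms(1,2)] by blast

lemma class_on_Sobolev:
  fixes g :: "'e::euclidean_space \<Rightarrow> real"
  assumes "admissible d (Sobolev k p)" "halfspace_open S"
  shows "class_on (Sobolev k p) S g \<longleftrightarrow> continuous_on S g \<and> sobr p S k (restrict0 S g)"
  using assms by (simp add: sobolev_on_iff)

lemma class_on_continuous: "class_on \<kappa> S g \<Longrightarrow> continuous_on S g"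
proof (cases \<kappa>)
  case (Frechet k)
  assume "class_on \<kappa> S g"
  then have "continuous_on S (\<lambda>x. frechet_iter S g 0 x v)" for v
    unfolding Frechet class_on.simps frechet_Ck_on_def using zero_enat_def i0_lb by metis
  then show ?thesis by simp
next
  case (Hoelder k a)
  assume "class_on \<kappa> S g"
  then show ?thesis unfolding Hoelder class_on.simps hoelder_eq_hold by (rule hold_continuous)
qed (auto simp: bastiani_Ck_on_def sobolev_on_def)

lemma class_on_smooth:
  fixes g :: "'e::euclidean_space \<Rightarrow> real"
  assumes \<kappa>: "admissible d \<kappa>" and S: "halfspace_open S" and g: "frechet_Ck_on \<infinity> S g"
  shows "class_on \<kappa> S g"
proof (cases "\<exists>k p. \<kappa> = Sobolev k p")
  case True
  then obtain k p where kp: "\<kappa> = Sobolev k p" by blast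
  then have "1 \<le> p" using \<kappa> by simp
  then show ?thesis
    unfolding kp class_on_Sobolev[OF \<kappa>[unfolded kp] S] using sobr_smooth[OF _ S g] smooth_continuous[OF g] by blast
next
  case False
  then show ?thesis by (intro class_on_holdI[OF S \<kappa>]) (auto intro: smooth_hold[OF S _ _ g])
qed

lemma class_on_cong:
  fixes g h :: "'e::euclidean_space \<Rightarrow> real"
  assumes \<kappa>: "admissible d \<kappa>" and S: "halfspace_open S" and eq: "\<And>x. x \<in> S \<Longrightarrow> g x = h x" and g: "class_on \<kappa> S g"
  shows "class_on \<kappa> S h"
proof (cases "\<exists>k p. \<kappa> = Sobolev k p")
  case True
  then obtain k p where kp: "\<kappa> = Sobolev k p" by blast
  show ?thesis
    using g restrict0_cong[of S g h, OF eq] continuous_on_cong[OF refl, of S g h, OF eq]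
    unfolding kp class_on_Sobolev[OF \<kappa>[unfolded kp] S] by simp
next
  case False
  show ?thesis
  proof (rule class_on_holdI[OF S \<kappa>])
    fix a j assume "(a, j) \<in> hold_indices \<kappa>"
    with g False have "hold a j S g" by (intro class_on_holdD[OF S]) auto
    then show "hold a j S h" by (subst (asm) hold_cong[OF eq])
  qed (use False in auto)
qed

lemma class_on_openin:
  fixes g :: "'e::euclidean_space \<Rightarrow> real"
  assumes \<kappa>: "admissible d \<kappa>" and S: "halfspace_open S" and S': "openin (top_of_set S) S'" and g: "class_on \<kappa> S g"
  shows "class_on \<kappa> S' g"
proof (cases "\<exists>k p. \<kappa> = Sobolev k p")
  case True
  then obtain k p where kp: "\<kappa> = Sobolev k p" by blast
  note hS' = halfspace_open_openin[OF S S']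
  have sub: "S' \<subseteq> S" using S' openin_imp_subset by blast
  have c: "continuous_on S g" and s: "sobr p S k (restrict0 S g)"
    using g unfolding kp class_on_Sobolev[OF \<kappa>[unfolded kp] S] by auto
  have c': "continuous_on S' g" using c sub by (rule continuous_on_subset)
  have "sobr p S' k (restrict0 S' g)"
  proof (rule sobr_AE[OF sobr_openin[OF s sub]])
    show "restrict0 S' g \<in> borel_measurable borel" by (rule restrict0_measurable[OF halfspace_open_borel[OF hS'] c'])
    show "AE x in lborel. x \<in> S' \<longrightarrow> restrict0 S g x = restrict0 S' g x" using sub by (intro AE_I2) auto
  qed
  then show ?thesis using c' unfolding kp class_on_Sobolev[OF \<kappa>[unfolded kp] hS'] by blast
next
  case False
  show ?thesis
  proof (rule class_on_holdI[OF halfspace_open_openin[OF S S'] \<kappa>])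
    fix a j assume "(a, j) \<in> hold_indices \<kappa>"
    with g False have "hold a j S g" by (intro class_on_holdD[OF S]) auto
    then show "hold a j S' g" by (rule hold_openin[OF S'])
  qed (use False in auto)
qed

lemma class_on_add:
  fixes g h :: "'e::euclidean_space \<Rightarrow> real"
  assumes \<kappa>: "admissible d \<kappa>" and S: "halfspace_open S" and g: "class_on \<kappa> S g" and h: "class_on \<kappa> S h"
  shows "class_on \<kappa> S (\<lambda>x. g x + h x)"
proof (cases "\<exists>k p. \<kappa> = Sobolev k p")
  case True
  then obtain k p where kp: "\<kappa> = Sobolev k p" by blast
  have p: "1 \<le> p" using \<kappa> kp by simp
  have "(\<lambda>x. restrict0 S g x + restrict0 S h x) = restrict0 S (\<lambda>x. g x + h x)" by (auto simp: restrict0_def)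
  then show ?thesis
    using g h sobr_add[OF p, of S k "restrict0 S g" "restrict0 S h"]
    unfolding kp class_on_Sobolev[OF \<kappa>[unfolded kp] S] by (auto intro: continuous_intros)
next
  case False
  show ?thesis
  proof (rule class_on_holdI[OF S \<kappa>])
    fix a j assume aj: "(a, j) \<in> hold_indices \<kappa>"
    show "hold a j S (\<lambda>x. g x + h x)"
      using class_on_holdD[OF S _ g aj] class_on_holdD[OF S _ h aj] False by (intro hold_add[OF S]) auto
  qed (use False in auto)
qed

lemma class_on_times_smooth:
  fixes g \<zeta> :: "'e::euclidean_space \<Rightarrow> real"
  assumes \<kappa>: "admissible d \<kappa>" and S: "halfspace_open S" and \<zeta>: "frechet_Ck_on \<infinity> S \<zeta>" and g: "class_on \<kappa> S g"
  shows "class_on \<kappa> S (\<lambda>x. \<zeta> x * g x)"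
proof (cases "\<exists>k p. \<kappa> = Sobolev k p")
  case True
  then obtain k p where kp: "\<kappa> = Sobolev k p" by blast
  have p: "1 \<le> p" using \<kappa> kp by simp
  have "restrict0 S (\<lambda>x. \<zeta> x * restrict0 S g x) = restrict0 S (\<lambda>x. \<zeta> x * g x)" by (auto simp: restrict0_def)
  then show ?thesis
    using g sobr_times_smooth[OF p S \<zeta>, of k "restrict0 S g"] smooth_continuous[OF \<zeta>]
    unfolding kp class_on_Sobolev[OF \<kappa>[unfolded kp] S] by (auto intro: continuous_intros)
next
  case False
  show ?thesis
  proof (rule class_on_holdI[OF S \<kappa>])
    fix a j assume a: "0 \<le> a" "a \<le> 1" and aj: "(a, j) \<in> hold_indices \<kappa>"
    show "hold a j S (\<lambda>x. \<zeta> x * g x)"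
      using class_on_holdD[OF S _ g aj] smooth_hold[OF S a \<zeta>] False by (intro hold_mult[OF S a]) auto
  qed (use False in auto)
qed

text \<open>Composing a Sobolev function with a smooth function requires estimates of Moser type. For the logarithm
  of a function all of whose powers belong to the class the composition rule is elementary.\<close>

lemma class_on_compose:
  fixes \<alpha> :: "'e::euclidean_space \<Rightarrow> real"
  assumes \<kappa>: "admissible d \<kappa>" and S: "halfspace_open S" and \<alpha>: "continuous_on S \<alpha>"
    and powers: "\<And>n::nat. class_on \<kappa> S (\<lambda>x. exp (real n * \<alpha> x))"
    and T: "open T" "\<alpha> ` S \<subseteq> T" and D: "derivative_sequence T D"
  shows "class_on \<kappa> S (\<lambda>x. D 0 (\<alpha> x))"
proof (cases "\<exists>k p. \<kappa> = Sobolev k p")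
  case True
  then obtain k p where kp: "\<kappa> = Sobolev k p" by blast
  have p: "1 \<le> p" "1 \<le> k" using \<kappa> kp by simp_all
  have "sobr p S k (restrict0 S (\<lambda>x. exp (real n * \<alpha> x)))" for n :: nat
    using powers[of n] unfolding kp class_on_Sobolev[OF \<kappa>[unfolded kp] S] by blast
  from sobr_compose[OF p S \<alpha> this T(2) D] continuous_on_compose2[OF derivative_sequence_continuous[OF D] \<alpha> T(2)]
  show ?thesis unfolding kp class_on_Sobolev[OF \<kappa>[unfolded kp] S] by blast
next
  case False
  show ?thesis
  proof (rule class_on_holdI[OF S \<kappa>])
    fix a j assume a: "0 \<le> a" "a \<le> 1" and aj: "(a, j) \<in> hold_indices \<kappa>"
    have "hold a j S (\<lambda>x. exp (real 1 * \<alpha> x))" by (rule class_on_holdD[OF S _ powers aj]) (use False in auto)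
    then have "hold a j S (\<lambda>x. ln (exp (real 1 * \<alpha> x)))"
      by (intro hold_compose[OF S _ a smooth_ln]) (auto intro: open_imp_halfspace_open)
    then have "hold a j S \<alpha>" by simp
    then show "hold a j S (\<lambda>x. D 0 (\<alpha> x))"
      by (rule hold_compose[OF S open_imp_halfspace_open[OF T(1)] a derivative_sequence_smooth[OF D T(1)] _ T(2)])
  qed (use False in auto)
qed

lemma class_on_local:
  fixes g :: "'e::euclidean_space \<Rightarrow> real"
  assumes \<kappa>: "admissible d \<kappa>" and S: "halfspace_open S"
    and loc: "\<And>x. x \<in> S \<Longrightarrow> \<exists>S'. openin (top_of_set S) S' \<and> x \<in> S' \<and> class_on \<kappa> S' g"
  shows "class_on \<kappa> S g"
proof (cases "\<exists>k p. \<kappa> = Sobolev k p")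
  case True
  then obtain k p where kp: "\<kappa> = Sobolev k p" by blast
  have p: "1 \<le> p" using \<kappa> kp by simp
  have "hold 0 0 S g"
  proof (rule hold_local)
    fix x assume "x \<in> S"
    then obtain S' where S': "openin (top_of_set S) S'" "x \<in> S'" "class_on \<kappa> S' g" using loc by blast
    then have "hold 0 0 S' g" using class_on_continuous[OF S'(3)] by (simp add: continuous_locally_hoelder_0)
    then show "\<exists>S'. openin (top_of_set S) S' \<and> x \<in> S' \<and> hold 0 0 S' g" using S' by blast
  qed
  then have c: "continuous_on S g" by simp
  show ?thesis
  proof (cases "S = {}")
    case True
    show ?thesis
      by (rule class_on_cong[OF \<kappa> S _ class_on_smooth[OF \<kappa> S smooth_const[OF S, of 0]]]) (simp add: True)
  next
    case ne: False
    \<comment> \<open>Weak derivatives are pasted up to null sets, so the local pieces are first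
      reduced to a sequence by the Lindelof property.\<close>
    let ?F = "{S'. openin (top_of_set S) S' \<and> class_on \<kappa> S' g}"
    obtain F where F: "F \<subseteq> ?F" "countable F" "\<Union>F = \<Union>?F"
      by (rule Lindelof_openin[of ?F S]) auto
    have cov: "S \<subseteq> \<Union>F" unfolding F(3) using loc by blast
    then have "F \<noteq> {}" using ne by blast
    define U where "U = from_nat_into F"
    have rU: "range U = F" unfolding U_def by (rule range_from_nat_into[OF \<open>F \<noteq> {}\<close> F(2)])
    have UF: "U n \<in> ?F" for n using rU F(1) by blast
    have U: "openin (top_of_set S) (U n)" "class_on \<kappa> (U n) g" for n using UF[of n] by blast+
    have "sobr p S k (restrict0 S g)"
    proof (rule sobr_glue[OF p S _ U(1)])
      show m: "restrict0 S g \<in> borel_measurable borel" by (rule restrict0_measurable[OF halfspace_open_borel[OF S] c])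
      show "S \<subseteq> (\<Union>n. U n)" using cov rU by simp
      fix n
      note hU = halfspace_open_openin[OF S U(1)]
      have "sobr p (U n) k (restrict0 (U n) g)"
        using U(2)[of n] unfolding kp class_on_Sobolev[OF \<kappa>[unfolded kp] hU] by blast
      then show "sobr p (U n) k (restrict0 S g)"
        by (rule sobr_AE[OF _ m]) (use openin_imp_subset[OF U(1)[of n]] in \<open>auto intro!: AE_I2\<close>)
    qed
    then show ?thesis using c unfolding kp class_on_Sobolev[OF \<kappa>[unfolded kp] S] by blast
  qed
next
  case False
  show ?thesis
  proof (rule class_on_holdI[OF S \<kappa>])
    fix a j assume aj: "(a, j) \<in> hold_indices \<kappa>"
    show "hold a j S g"
    proof (rule hold_local)
      fix x assume "x \<in> S"
      then obtain S' where S': "openin (top_of_set S) S'" "x \<in> S'" "class_on \<kappa> S' g" using loc by blast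
      then have "hold a j S' g"
        by (intro class_on_holdD[OF halfspace_open_openin[OF S S'(1)] _ S'(3) aj]) (use False in auto)
      then show "\<exists>S'. openin (top_of_set S) S' \<and> x \<in> S' \<and> hold a j S' g" using S' by blast
    qed
  qed (use False in auto)
qed

text \<open>In the Sobolev case the vector-valued weak derivative is assembled from those of the
  components, and its norm is at most the sum of their absolute values.\<close>

lemma class_on_componentwise:
  fixes g :: "'e::euclidean_space \<Rightarrow> 'f::euclidean_space"
  assumes \<kappa>: "admissible d \<kappa>" and S: "halfspace_open S"
    and comp: "\<And>b. b \<in> Basis \<Longrightarrow> class_on \<kappa> S (\<lambda>x. g x \<bullet> b)"
  shows "class_on \<kappa> S g"
proof (cases "\<exists>k p. \<kappa> = Sobolev k p")
  case True
  then obtain k p where kp: "\<kappa> = Sobolev k p" by blast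
  have p: "1 \<le> p" using \<kappa> kp by simp
  have cb: "sobolev_on k p S (\<lambda>x. g x \<bullet> b)" if "b \<in> Basis" for b using comp[OF that] kp by simp
  have c: "continuous_on S g"
    by (subst continuous_on_componentwise) (use cb in \<open>auto simp: sobolev_on_def\<close>)
  have "\<exists>h. h \<in> borel_measurable borel \<and> weak_derivative_on (interior S) g j v h \<and>
      (\<forall>K. compact K \<and> K \<subseteq> S \<longrightarrow> set_integrable lborel K (\<lambda>x. norm (h x) powr p))"
    if jv: "j \<le> k" "range v \<subseteq> Basis" for j v
  proof -
    have "\<forall>b. \<exists>h. b \<in> Basis \<longrightarrow> loc_Lp p S h \<and> weak_derivative_on (interior S) (\<lambda>x. g x \<bullet> b) j v h"
      using cb jv unfolding sobolev_on_def loc_Lp_def real_norm_def by meson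
    from choice[OF this] obtain h where h: "\<And>b. b \<in> Basis \<Longrightarrow> loc_Lp p S (h b)"
      "\<And>b. b \<in> Basis \<Longrightarrow> weak_derivative_on (interior S) (\<lambda>x. g x \<bullet> b) j v (h b)" by blast
    define H where "H x = (\<Sum>b\<in>Basis. h b x *\<^sub>R b)" for x
    have hm: "h b \<in> borel_measurable borel" if "b \<in> Basis" for b by (rule loc_Lp_measurable[OF h(1)[OF that]])
    have Hm [measurable]: "H \<in> borel_measurable borel"
      unfolding H_def[abs_def] by (intro borel_measurable_sum borel_measurable_scaleR hm borel_measurable_const)
    have gi: "integrable lborel (\<lambda>x. \<phi> x * restrict0 S (\<lambda>x. g x \<bullet> b) x)"
      if "b \<in> Basis" "test_function (interior S) \<phi>" for b \<phi>
      by (rule test_function_integrable[OF that(2) locally_integrable_subset[OF loc_Lp_locally_integrable[OF p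
          loc_Lp_continuous[OF p halfspace_open_borel[OF S]]] interior_subset]])
        (intro continuous_intros c)
    have hi: "integrable lborel (\<lambda>x. \<phi> x * h b x)"
      if "b \<in> Basis" "test_function (interior S) \<phi>" for b \<phi>
      by (rule test_function_integrable[OF that(2) locally_integrable_subset[OF loc_Lp_locally_integrable[OF p h(1)[OF that(1)]] interior_subset]])
    have "weak_derivative_on (interior S) g j v H"
      unfolding weak_derivative_on_def
    proof (intro allI impI)
      fix \<psi> assume \<psi>: "test_function (interior S) \<psi>"
      note \<psi>' = test_function_frechet_iter[OF \<psi>, of j v]
      have out: "\<phi> x = 0" if "test_function (interior S) \<phi>" "x \<notin> interior S" for \<phi> and x
        using test_function_support(2,3)[OF that(1)] that(2) by blast
      have 1: "(LINT x:interior S|lborel. frechet_iter UNIV \<psi> j x v *\<^sub>R g x) =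
          (\<Sum>b\<in>Basis. (\<integral>x. frechet_iter UNIV \<psi> j x v * restrict0 S (\<lambda>x. g x \<bullet> b) x \<partial>lborel) *\<^sub>R b)"
      proof -
        have "indicator (interior S) x *\<^sub>R frechet_iter UNIV \<psi> j x v *\<^sub>R g x =
            (\<Sum>b\<in>Basis. (frechet_iter UNIV \<psi> j x v * restrict0 S (\<lambda>x. g x \<bullet> b) x) *\<^sub>R b)" for x
        proof (cases "x \<in> interior S")
          case True
          then have "x \<in> S" using interior_subset by blast
          then show ?thesis using True euclidean_representation[of "g x"]
            by (simp add: scaleR_scaleR[symmetric] scaleR_sum_right[symmetric] del: scaleR_scaleR)
        qed (simp add: out[OF \<psi>'])
        then show ?thesis
          unfolding set_lebesgue_integral_def
          using gi[OF _ \<psi>'] by (simp add: Bochner_Integration.integral_sum)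
      qed
      have 2: "(LINT x:interior S|lborel. \<psi> x *\<^sub>R H x) = (\<Sum>b\<in>Basis. (\<integral>x. \<psi> x * h b x \<partial>lborel) *\<^sub>R b)"
      proof -
        have "indicator (interior S) x *\<^sub>R \<psi> x *\<^sub>R H x = (\<Sum>b\<in>Basis. (\<psi> x * h b x) *\<^sub>R b)" for x
          using out[OF \<psi>, of x] by (cases "x \<in> interior S") (simp_all add: H_def scaleR_sum_right)
        then show ?thesis
          unfolding set_lebesgue_integral_def
          using hi[OF _ \<psi>] by (simp add: Bochner_Integration.integral_sum)
      qed
      have "(\<integral>x. frechet_iter UNIV \<psi> j x v * restrict0 S (\<lambda>x. g x \<bullet> b) x \<partial>lborel) = (- 1) ^ j * (\<integral>x. \<psi> x * h b x \<partial>lborel)"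
        if "b \<in> Basis" for b
        using h(2)[OF that] \<psi> unfolding weak_derivative_on_iff iterated_weak_deriv_def by blast
      then show "(LINT x:interior S|lborel. frechet_iter UNIV \<psi> j x v *\<^sub>R g x) = (- 1) ^ j *\<^sub>R (LINT x:interior S|lborel. \<psi> x *\<^sub>R H x)"
        unfolding 1 2 scaleR_sum_right by simp
    qed
    moreover have "set_integrable lborel K (\<lambda>x. norm (H x) powr p)" if K: "compact K \<and> K \<subseteq> S" for K
    proof -
      have abs: "loc_Lp p S (\<lambda>x. \<bar>h b x\<bar>)" if "b \<in> Basis" for b
        using h(1)[OF that] unfolding loc_Lp_def by (auto intro: borel_measurable_abs)
      have "loc_Lp p S (\<lambda>x. \<Sum>b\<in>Basis. \<bar>h b x\<bar>)" by (rule loc_Lp_sum[OF p abs])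
      then have "set_integrable lborel K (\<lambda>x. \<bar>\<Sum>b\<in>Basis. \<bar>h b x\<bar>\<bar> powr p)" using K unfolding loc_Lp_def by blast
      then show ?thesis
      proof (rule set_integrable_bound_real)
        show "(\<lambda>x. norm (H x) powr p) \<in> borel_measurable borel" by measurable
        show "K \<in> sets borel" using K by (simp add: borel_compact)
        fix x
        have "norm (H x) \<le> (\<Sum>b\<in>Basis. norm (h b x *\<^sub>R b))" unfolding H_def by (rule norm_sum)
        also have "\<dots> = (\<Sum>b\<in>Basis. \<bar>h b x\<bar>)" by simp
        also have "\<dots> \<le> \<bar>\<Sum>b\<in>Basis. \<bar>h b x\<bar>\<bar>" by (rule abs_ge_self)
        finally show "\<bar>norm (H x) powr p\<bar> \<le> \<bar>\<Sum>b\<in>Basis. \<bar>h b x\<bar>\<bar> powr p"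
          using p by (simp add: powr_mono2)
      qed
    qed
    ultimately show ?thesis using Hm by blast
  qed
  then show ?thesis unfolding kp class_on.simps sobolev_on_def using c by blast
next
  case False
  show ?thesis
  proof (rule class_on_holdI[OF S \<kappa>])
    fix a j assume aj: "(a, j) \<in> hold_indices \<kappa>"
    show "hold a j S g"
      by (rule hold_componentwise[OF S]) (use class_on_holdD[OF S _ comp aj] False in auto)
  qed (use False in auto)
qed

section \<open>Functions on manifolds\<close>

lemma atlas_chart:
  assumes "smooth_atlas d \<A>" "(U, c) \<in> \<A>"
  shows "open U" "homeomorphism U (c ` U) c (inv_into U c)" "model_open d (c ` U)"
    "inj_on c U" "continuous_on U c" "continuous_on (c ` U) (inv_into U c)"
proof -
  show "open U" "model_open d (c ` U)" and h: "homeomorphism U (c ` U) c (inv_into U c)"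
    using assms unfolding smooth_atlas_def by fast+
  show "continuous_on U c" "continuous_on (c ` U) (inv_into U c)" using h by (auto simp: homeomorphism_def)
  show "inj_on c U" using h unfolding homeomorphism_def by (intro inj_on_inverseI[of U "inv_into U c"]) auto
qed

lemma atlas_cover:
  assumes "smooth_atlas d \<A>"
  obtains U c where "(U, c) \<in> \<A>" "v \<in> U"
proof -
  have "v \<in> (\<Union>(U, c)\<in>\<A>. U)" using assms by (simp add: smooth_atlas_def)
  then show ?thesis using that by fast
qed

lemma atlas_halfspace_open:
  assumes "smooth_atlas d \<A>" "(U, c) \<in> \<A>" "d \<noteq> 0"
  shows "halfspace_open (c ` U)"
  using atlas_chart(3)[OF assms(1,2)] assms(3) unfolding model_open_def halfspace_open_def by auto

lemma chart_openin:
  assumes "smooth_atlas d \<A>" "(U, c) \<in> \<A>" "open N"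
  shows "openin (top_of_set (c ` U)) (c ` (U \<inter> N))"
  using homeomorphism_imp_open_map[OF atlas_chart(2)[OF assms(1,2)], of "U \<inter> N"] assms(3)
  by (auto intro: openin_open_Int)

lemma chart_ball_open:
  assumes "smooth_atlas d \<A>" "(U, c) \<in> \<A>"
  shows "open {v \<in> U. dist (c v) y < r}"
proof -
  have "{v \<in> U. dist (c v) y < r} = U \<inter> c -` ball y r" by (auto simp: dist_commute)
  then show ?thesis
    using continuous_open_preimage[OF atlas_chart(5)[OF assms] atlas_chart(1)[OF assms] open_ball] by simp
qed

lemma chart_ball_subset:
  assumes A: "smooth_atlas d \<A>" "(U, c) \<in> \<A>" and N: "open N" "v0 \<in> N" "v0 \<in> U"
  obtains r where "r > 0" "\<And>v. v \<in> U \<Longrightarrow> dist (c v) (c v0) \<le> r \<Longrightarrow> v \<in> N"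
proof -
  have "c v0 \<in> c ` (U \<inter> N)" using N by blast
  with chart_openin[OF A N(1)] obtain e where e: "e > 0" "ball (c v0) e \<inter> c ` U \<subseteq> c ` (U \<inter> N)"
    unfolding openin_contains_ball by blast
  have "v \<in> N" if "v \<in> U" "dist (c v) (c v0) \<le> e / 2" for v
  proof -
    have "c v \<in> c ` (U \<inter> N)" using e(1) that by (intro subsetD[OF e(2)]) (auto simp: dist_commute)
    then show ?thesis using inj_onD[OF atlas_chart(4)[OF A], of v] that(1) by auto
  qed
  then show ?thesis using e(1) by (intro that[of "e / 2"]) auto
qed

text \<open>The image of a chart is open in a closed half-space, so a small closed ball meets it in
  the intersection of that ball with the half-space, which is compact even at boundary
  points.\<close>

lemma chart_compact_ball:
  assumes A: "smooth_atlas d \<A>" "(U, c) \<in> \<A>" "d \<noteq> 0" and N: "open N" "v0 \<in> N" "v0 \<in> U"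
  obtains r where "r > 0" "compact (c ` U \<inter> cball (c v0) r)" "\<And>v. v \<in> U \<Longrightarrow> dist (c v) (c v0) \<le> r \<Longrightarrow> v \<in> N"
proof -
  obtain a b T where T: "open T" "c ` U = {x. a \<bullet> x \<le> b} \<inter> T"
    using atlas_halfspace_open[OF A] unfolding halfspace_open_def openin_open by auto
  have "c v0 \<in> T" using N(3) T(2) by blast
  then obtain q where q: "q > 0" "cball (c v0) q \<subseteq> T" using T(1) open_contains_cball by blast
  obtain r where r: "r > 0" "\<And>v. v \<in> U \<Longrightarrow> dist (c v) (c v0) \<le> r \<Longrightarrow> v \<in> N"
    by (rule chart_ball_subset[OF A(1,2) N]) blast
  let ?r = "min q r"
  have "cball (c v0) ?r \<subseteq> T" using q(2) by (auto simp: subset_iff)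
  then have "c ` U \<inter> cball (c v0) ?r = {x. a \<bullet> x \<le> b} \<inter> cball (c v0) ?r" unfolding T(2) by blast
  moreover have "compact ({x. a \<bullet> x \<le> b} \<inter> cball (c v0) ?r)"
    by (intro closed_Int_compact closed_halfspace_le compact_cball)
  ultimately have "compact (c ` U \<inter> cball (c v0) ?r)" by simp
  then show ?thesis using q(1) r by (intro that[of ?r]) auto
qed

lemma class_functions_continuous:
  assumes A: "smooth_atlas d \<A>" and x: "x \<in> class_functions \<kappa> \<A>"
  shows "continuous_on UNIV x"
proof -
  have "\<exists>T. open T \<and> v \<in> T \<and> continuous_on T x" for v
  proof -
    obtain U c where U: "(U, c) \<in> \<A>" "v \<in> U" by (rule atlas_cover[OF A])
    have "continuous_on (c ` U) (x \<circ> inv_into U c)"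
      using x U(1) class_on_continuous unfolding class_functions_def by blast
    from continuous_on_compose[OF atlas_chart(5)[OF A U(1)] this]
    have "continuous_on U ((x \<circ> inv_into U c) \<circ> c)" .
    then have "continuous_on U x"
      by (subst continuous_on_cong[OF refl, of U x "(x \<circ> inv_into U c) \<circ> c"])
        (simp_all add: inv_into_f_f[OF atlas_chart(4)[OF A U(1)]])
    then show ?thesis using U(2) atlas_chart(1)[OF A U(1)] by blast
  qed
  then show ?thesis by (meson continuous_at_imp_continuous_on continuous_on_eq_continuous_at)
qed

section \<open>Smooth functions carried by a single chart\<close>

definition chart_extension :: "'v set \<Rightarrow> ('v \<Rightarrow> 'e) \<Rightarrow> ('e \<Rightarrow> real) \<Rightarrow> real \<Rightarrow> 'v \<Rightarrow> real" where
  "chart_extension U c s k v = (if v \<in> U then s (c v) else k)"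

text \<open>The coordinate ball pulls back to a compact subset of the manifold, which is closed by
  the Hausdorff property. On its open complement the function is the constant k, and on U it is
  smooth by the chart changes.\<close>

lemma smooth_chart_extension:
  fixes \<A> :: "('v::t2_space, 'e::euclidean_space) atlas"
  assumes A: "smooth_atlas d \<A>" "(U, c) \<in> \<A>" "d \<noteq> 0"
    and s: "frechet_Ck_on \<infinity> UNIV s" "\<And>y. r \<le> dist y y0 \<Longrightarrow> s y = k"
    and K: "compact (c ` U \<inter> cball y0 r)"
  shows "chart_extension U c s k \<in> class_functions (Frechet \<infinity>) \<A>"
proof -
  have "frechet_Ck_on \<infinity> (c' ` U') (chart_extension U c s k \<circ> inv_into U' c')" if U': "(U', c') \<in> \<A>" for U' c'
  proof (rule smooth_local)
    fix y assume "y \<in> c' ` U'"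
    then obtain v where v: "v \<in> U'" "y = c' v" by blast
    note hU' = atlas_halfspace_open[OF A(1) U' A(3)]
    have inv: "inv_into U' c' (c' v) = v" if "v \<in> U'" for v using atlas_chart(4)[OF A(1) U'] that by simp
    show "\<exists>S'. openin (top_of_set (c' ` U')) S' \<and> y \<in> S' \<and> frechet_Ck_on \<infinity> S' (chart_extension U c s k \<circ> inv_into U' c')"
    proof (cases "v \<in> U")
      case True
      let ?S = "c' ` (U' \<inter> U)"
      have o: "openin (top_of_set (c' ` U')) ?S" by (rule chart_openin[OF A(1) U' atlas_chart(1)[OF A(1,2)]])
      have "frechet_Ck_on \<infinity> ?S (c \<circ> inv_into U' c')"
        using A(1,2) U' unfolding smooth_atlas_def by fast
      then have "frechet_Ck_on \<infinity> ?S (\<lambda>y. s ((c \<circ> inv_into U' c') y))"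
        by (rule smooth_compose[OF halfspace_open_openin[OF hU' o] halfspace_open_UNIV s(1)]) simp
      then have "frechet_Ck_on \<infinity> ?S (chart_extension U c s k \<circ> inv_into U' c')"
        by (subst smooth_cong[where h = "\<lambda>y. s ((c \<circ> inv_into U' c') y)"]) (auto simp: chart_extension_def inv)
      then show ?thesis using o v True by blast
    next
      case False
      let ?K = "inv_into U c ` (c ` U \<inter> cball y0 r)"
      have "compact ?K"
        by (rule compact_continuous_image[OF continuous_on_subset[OF atlas_chart(6)[OF A(1,2)]] K]) simp
      then have "open (- ?K)" using compact_imp_closed by blast
      then have o: "openin (top_of_set (c' ` U')) (c' ` (U' \<inter> - ?K))" by (rule chart_openin[OF A(1) U'])
      have "v \<notin> ?K" using False inv_into_into[of _ c U] by blast
      moreover have "frechet_Ck_on \<infinity> (c' ` (U' \<inter> - ?K)) (chart_extension U c s k \<circ> inv_into U' c')"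
      proof (subst smooth_cong[where h = "\<lambda>_. k"])
        show "frechet_Ck_on \<infinity> (c' ` (U' \<inter> - ?K)) (\<lambda>_. k)" by (rule smooth_const[OF halfspace_open_openin[OF hU' o]])
        fix y assume "y \<in> c' ` (U' \<inter> - ?K)"
        then obtain u where u: "u \<in> U'" "u \<notin> ?K" "y = c' u" by blast
        have "s (c u) = k" if "u \<in> U"
        proof (rule s(2), rule ccontr)
          assume "\<not> r \<le> dist (c u) y0"
          then have "c u \<in> c ` U \<inter> cball y0 r" using that by (simp add: dist_commute)
          then have "inv_into U c (c u) \<in> ?K" by blast
          then show False using u(2) that atlas_chart(4)[OF A(1,2)] by simp
        qed
        then show "(chart_extension U c s k \<circ> inv_into U' c') y = k" using u by (simp add: inv chart_extension_def)
      qed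
      ultimately show ?thesis using o v by blast
    qed
  qed
  then show ?thesis by (auto simp: class_functions_def)
qed

lemma class_functions_smooth:
  assumes "smooth_atlas d \<A>" "d \<noteq> 0" "admissible d \<kappa>" "x \<in> class_functions (Frechet \<infinity>) \<A>"
  shows "x \<in> class_functions \<kappa> \<A>"
  using assms(4) class_on_smooth[OF assms(3) atlas_halfspace_open[OF assms(1) _ assms(2)]]
  by (auto simp: class_functions_def)

lemma class_functions_add:
  assumes "smooth_atlas d \<A>" "d \<noteq> 0" "admissible d \<kappa>" "x \<in> class_functions \<kappa> \<A>" "y \<in> class_functions \<kappa> \<A>"
  shows "(\<lambda>v. x v + y v) \<in> class_functions \<kappa> \<A>"
  using assms(4,5) class_on_add[OF assms(3) atlas_halfspace_open[OF assms(1) _ assms(2)]]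
  by (fastforce simp: class_functions_def comp_def)

lemma class_functions_times_smooth:
  assumes "smooth_atlas d \<A>" "d \<noteq> 0" "admissible d \<kappa>"
    and "z \<in> class_functions (Frechet \<infinity>) \<A>" "x \<in> class_functions \<kappa> \<A>"
  shows "(\<lambda>v. z v * x v) \<in> class_functions \<kappa> \<A>"
  using assms(4,5) class_on_times_smooth[OF assms(3) atlas_halfspace_open[OF assms(1) _ assms(2)]]
  by (fastforce simp: class_functions_def comp_def)

lemma class_functions_const_smooth:
  assumes "smooth_atlas d \<A>" "d \<noteq> 0"
  shows "(\<lambda>_. k) \<in> class_functions (Frechet \<infinity>) \<A>"
  using smooth_const[OF atlas_halfspace_open[OF assms(1) _ assms(2)]]
  by (auto simp: class_functions_def comp_def)

lemma class_on_subset_singleton: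
  fixes g :: "'e::euclidean_space \<Rightarrow> real"
  assumes "S \<subseteq> {0}"
  shows "class_on \<kappa> S g"
proof -
  have "S = {} \<or> S = {0}" using assms by blast
  then have c: "continuous_on S h" and d: "h differentiable_on S" for h :: "'e \<Rightarrow> real"
    by (auto simp: differentiable_on_def differentiable_def has_derivative_within_singleton_iff intro: exI[of _ "\<lambda>_. 0"] bounded_linear_zero)
  have i: "interior S = {}" using interior_mono[OF assms] by simp
  have f: "frechet_Ck_on k S g" for k by (simp add: frechet_Ck_on_def c d)
  show ?thesis
  proof (cases \<kappa>)
    case (Michal_Bastiani k)
    have "\<exists>G :: 'e \<times> (nat \<Rightarrow> 'e) \<Rightarrow> real. continuous_on (S \<times> UNIV) G"
      by (intro exI[of _ "\<lambda>_. 0"] continuous_intros)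
    then show ?thesis by (simp add: Michal_Bastiani bastiani_Ck_on_def i c)
  next
    case (Hoelder k a)
    have "locally_hoelder_on a S h" for h :: "'e \<Rightarrow> real"
      unfolding locally_hoelder_on_def
    proof (intro ballI exI conjI)
      fix x y z assume "y \<in> S \<inter> ball x 1" "z \<in> S \<inter> ball x 1"
      then have "y = z" using assms by blast
      then show "norm (h y - h z) \<le> 0 * dist y z powr a" by simp
    qed simp
    then show ?thesis by (simp add: Hoelder hoelder_Ck_on_def f)
  next
    case (Sobolev k p)
    have "set_integrable lborel K (\<lambda>x::'e. norm (0::real) powr p)" for K by (simp add: set_integrable_def)
    then show ?thesis
      by (auto simp: Sobolev sobolev_on_def c i weak_derivative_on_def set_lebesgue_integral_def
          intro!: exI[of _ "\<lambda>_. 0"])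
  qed (simp add: f)
qed

text \<open>Covers dimension 0 as well, because constants are used before the dimensions are shown
  to be positive.\<close>

lemma class_functions_const:
  assumes "smooth_atlas d \<A>" "admissible d \<kappa>"
  shows "(\<lambda>_. k) \<in> class_functions \<kappa> \<A>"
proof (cases "d = 0")
  case True
  then have "c ` U \<subseteq> {0}" if "(U, c) \<in> \<A>" for U c
    using atlas_chart(3)[OF assms(1) that] by (simp add: model_open_def)
  then have "class_on \<kappa> (c ` U) ((\<lambda>_. k) \<circ> inv_into U c)" if "(U, c) \<in> \<A>" for U c
    using class_on_subset_singleton that by blast
  then show ?thesis by (auto simp: class_functions_def)
next
  case False
  then show ?thesis
    using class_functions_smooth[OF assms(1) _ assms(2) class_functions_const_smooth[OF assms(1)]] by simp
qed

lemma open_singleton_if_dim_0: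
  fixes \<A> :: "('v::t2_space, 'e::euclidean_space) atlas" and v :: 'v
  assumes "smooth_atlas 0 \<A>"
  shows "open {v}"
proof -
  obtain U c where U: "(U, c) \<in> \<A>" "v \<in> U" by (rule atlas_cover[OF assms])
  have "c ` U \<subseteq> {0}" using atlas_chart(3)[OF assms U(1)] by (simp add: model_open_def)
  then have "u = v" if "u \<in> U" for u
    using that U(2) by (intro inj_onD[OF atlas_chart(4)[OF assms U(1)]]) (auto simp: image_subset_iff)
  then have "U = {v}" using U(2) by blast
  then show ?thesis using atlas_chart(1)[OF assms U(1)] by simp
qed

lemma cutoff_function:
  assumes A: "smooth_atlas d \<A>" "d \<noteq> 0" and N: "open N" "v0 \<in> N"
  obtains z M where "z \<in> class_functions (Frechet \<infinity>) \<A>" "\<And>v. 0 \<le> z v" "\<And>v. z v \<le> 1"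
    "\<And>v. v \<notin> N \<Longrightarrow> z v = 0" "open M" "v0 \<in> M" "\<And>v. v \<in> M \<Longrightarrow> z v = 1"
proof -
  obtain U c where U: "(U, c) \<in> \<A>" "v0 \<in> U" by (rule atlas_cover[OF A(1)])
  obtain r where r: "r > 0" "compact (c ` U \<inter> cball (c v0) r)" "\<And>v. v \<in> U \<Longrightarrow> dist (c v) (c v0) \<le> r \<Longrightarrow> v \<in> N"
    by (rule chart_compact_ball[OF A(1) U(1) A(2) N U(2)]) blast
  show ?thesis
  proof (rule that[of "chart_extension U c (bump (c v0) r) 0" "{v \<in> U. dist (c v) (c v0) < r / 2}"])
    show "chart_extension U c (bump (c v0) r) 0 \<in> class_functions (Frechet \<infinity>) \<A>"
      using bump_eq_0[OF r(1)] by (rule smooth_chart_extension[OF A(1) U(1) A(2) smooth_bump _ r(2)])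
    show "chart_extension U c (bump (c v0) r) 0 v = 0" if "v \<notin> N" for v
      using that r(3)[of v] bump_eq_0[OF r(1), of "c v" "c v0"] by (force simp: chart_extension_def)
  qed (use U r(1) in \<open>auto simp: chart_extension_def bump_bounds bump_eq_1 intro!: chart_ball_open[OF A(1) U(1)] simp del: less_divide_eq_numeral1\<close>)
qed

section \<open>Multiplicative maps\<close>

lemma additive_scale_nat:
  fixes A :: "real \<Rightarrow> real"
  assumes add: "\<And>s t. A (s + t) = A s + A t"
  shows "A (real n * t) = real n * A t"
proof (induction n)
  case 0
  have "A (0 + 0) = A 0 + A 0" by (rule add)
  then show ?case by simp
next
  case (Suc n)
  then show ?case by (simp add: add distrib_right)
qed

text \<open>The additive function g t = A t - t * A 1 vanishes on the rationals, and every t lies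
  within \<delta> above some rational, so g is bounded above on the whole line. By g (n t) = n g t
  it is then nonpositive, and being odd it is 0.\<close>

lemma additive_bounded_above_linear:
  fixes A :: "real \<Rightarrow> real"
  assumes add: "\<And>s t. A (s + t) = A s + A t" and \<delta>: "\<delta> > 0" and bound: "\<And>t. 0 < t \<Longrightarrow> t < \<delta> \<Longrightarrow> A t \<le> B"
  shows "A t = t * A 1"
proof -
  define g where "g t = A t - t * A 1" for t
  have g_add: "g (s + t) = g s + g t" for s t by (simp add: g_def add algebra_simps)
  note g_nat = additive_scale_nat[of g, OF g_add]
  have g0: "g 0 = 0" using g_add[of 0 0] by simp
  have g_neg: "g (- t) = - g t" for t using g_add[of t "- t"] g0 by simp
  have g1: "g 1 = 0" by (simp add: g_def)
  have g_rat: "g q = 0" if q: "q \<in> \<rat>" for q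
  proof -
    have frac: "g (real m / real n) = 0" if "n \<noteq> 0" for m n
    proof -
      have "real n * g (real m / real n) = g (real m * 1)" using g_nat[of n "real m / real n"] that by simp
      also have "\<dots> = 0" using g_nat[of m 1] g1 by simp
      finally show ?thesis using that by simp
    qed
    obtain m n :: nat where mn: "n \<noteq> 0" "\<bar>q\<bar> = real m / real n" by (rule Rats_abs_nat_div_natE[OF q]) blast
    have "g \<bar>q\<bar> = 0" unfolding mn(2) by (rule frac[OF mn(1)])
    then show ?thesis using g_neg[of q] by (cases "q \<ge> 0") auto
  qed
  define B' where "B' = B + \<delta> * \<bar>A 1\<bar>"
  have g_bound: "g t \<le> B'" for t
  proof -
    obtain q where q: "t - \<delta> < q" "q < t" "q \<in> \<rat>" using Rats_dense_in_real[of "t - \<delta>" t] \<delta> by auto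
    have "g t = g (t - q)" using g_add[of q "t - q"] g_rat[OF q(3)] by simp
    also have "\<dots> = A (t - q) - (t - q) * A 1" by (simp add: g_def)
    also have "\<dots> \<le> B + \<bar>(t - q) * A 1\<bar>" using bound[of "t - q"] q by linarith
    also have "\<bar>(t - q) * A 1\<bar> \<le> \<delta> * \<bar>A 1\<bar>"
      unfolding abs_mult using q by (intro mult_right_mono) auto
    finally show ?thesis unfolding B'_def by simp
  qed
  have g_le: "g t \<le> 0" for t
  proof (rule ccontr)
    assume "\<not> g t \<le> 0"
    then obtain n :: nat where "B' < real n * g t" using reals_Archimedean3[of "g t"] by auto
    then show False using g_bound[of "real n * t"] g_nat[of n t] by simp
  qed
  have "g t = 0" using g_le[of t] g_le[of "- t"] g_neg[of t] by simp
  then show ?thesis by (simp add: g_def)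
qed

text \<open>A locale, because the results are used with two target classes: the given one and, for
  the lower bound on the exponent, \<open>Frechet 1\<close>.\<close>

locale multiplicative_map =
  fixes \<A> :: "('v::t2_space, 'e::euclidean_space) atlas"
    and \<B> :: "('w::t2_space, 'f::euclidean_space) atlas"
    and dV dW :: nat
    and \<kappa> \<kappa>' :: smoothness
    and f :: "('v \<Rightarrow> real) \<Rightarrow> ('w \<Rightarrow> real)"
    and \<phi> :: "'w \<Rightarrow> 'v"
  assumes V: "smooth_atlas dV \<A>"
    and W: "smooth_atlas dW \<B>"
    and class_V: "admissible dV \<kappa>"
    and class_W: "admissible dW \<kappa>'"
    and f_maps: "f \<in> class_functions \<kappa> \<A> \<rightarrow> class_functions \<kappa>' \<B>"
    and f_hom: "\<And>x y. x \<in> class_functions \<kappa> \<A> \<Longrightarrow> y \<in> class_functions \<kappa> \<A> \<Longrightarrow>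
                  f (\<lambda>v. x v * y v) = (\<lambda>w. f x w * f y w)"
    and f_pos: "f ` {x \<in> class_functions \<kappa> \<A>. range x \<subseteq> {0<..} - {1}}
                  \<subseteq> {y \<in> class_functions \<kappa>' \<B>. range y \<subseteq> {0<..} - {1}}"
    and f_const: "\<And>w. (\<lambda>c. f (\<lambda>_. c) w) ` {0<..} = {0<..}"
    and phi_nonconst: "\<And>T. open T \<Longrightarrow> T \<noteq> {} \<Longrightarrow> \<not> \<phi> constant_on T"
    and phi_support: "\<And>w. \<phi> w \<in> support_points (class_functions \<kappa> \<A>) (\<lambda>x. f x w)"
begin

section \<open>Locality of the map and continuity of \<phi>\<close>

lemma f_continuous: "x \<in> class_functions \<kappa> \<A> \<Longrightarrow> continuous_on UNIV (f x)"
  using class_functions_continuous[OF W] f_maps by blast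

lemmas const_mem = class_functions_const[OF V class_V]

lemma f_mult: "x \<in> class_functions \<kappa> \<A> \<Longrightarrow> y \<in> class_functions \<kappa> \<A> \<Longrightarrow> f (\<lambda>v. x v * y v) w = f x w * f y w"
  using f_hom[of x y] by simp

lemma f_const_mult: "f (\<lambda>_. s * t) w = f (\<lambda>_. s) w * f (\<lambda>_. t) w"
  using f_mult[OF const_mem const_mem] by simp

lemma f_const_surj:
  assumes "s > 0"
  obtains k where "k > 0" "f (\<lambda>_. k) w = s"
proof -
  have "s \<in> (\<lambda>c. f (\<lambda>_. c) w) ` {0<..}" using assms by (simp only: f_const greaterThan_iff)
  then show ?thesis using that by auto
qed

lemma f_const_pos: "k > 0 \<Longrightarrow> f (\<lambda>_. k) w > 0"
proof -
  assume "k > 0"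
  then have "f (\<lambda>_. k) w \<in> (\<lambda>c. f (\<lambda>_. c) w) ` {0<..}" by blast
  then show ?thesis unfolding f_const by simp
qed

text \<open>Multiplication by a constant whose image at w is 2: the image of 0 equals twice itself,
  and the image of 1 times 2 is 2.\<close>

lemma f_zero_one: "f (\<lambda>_. 0) w = 0" "f (\<lambda>_. 1) w = 1"
proof -
  obtain k where k: "f (\<lambda>_. k) w = 2" by (rule f_const_surj[of 2 w]) auto
  show "f (\<lambda>_. 0) w = 0" using f_const_mult[of 0 k w] k by simp
  show "f (\<lambda>_. 1) w = 1" using f_const_mult[of 1 k w] k by simp
qed

lemma support_function:
  assumes "open N" "\<phi> w \<in> N"
  obtains x where "x \<in> class_functions \<kappa> \<A>" "supp x \<subseteq> N" "f x w \<noteq> 0"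
  using phi_support[of w] assms unfolding support_points_def by blast

lemma supp_outside: "v \<notin> supp x \<Longrightarrow> x v = 0"
  using subsetD[OF closure_subset, of v "{v. x v \<noteq> 0}"] by (auto simp: supp_def)

text \<open>Multiply by a function supported where \<open>x\<close> and \<open>y\<close> agree.\<close>

lemma f_germ:
  assumes x: "x \<in> class_functions \<kappa> \<A>" and y: "y \<in> class_functions \<kappa> \<A>"
    and N: "open N" "\<phi> w \<in> N" and eq: "\<And>v. v \<in> N \<Longrightarrow> x v = y v"
  shows "f x w = f y w"
proof -
  obtain z where z: "z \<in> class_functions \<kappa> \<A>" "supp z \<subseteq> N" "f z w \<noteq> 0" by (rule support_function[OF N])
  have "x v * z v = y v * z v" for v using supp_outside[of v z] z(2) eq[of v] by (cases "v \<in> N") auto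
  then have "f (\<lambda>v. x v * z v) w = f (\<lambda>v. y v * z v) w" by presburger
  then show ?thesis using z(3) f_mult[OF x z(1)] f_mult[OF y z(1)] by simp
qed

lemma phi_in_supp:
  assumes x: "x \<in> class_functions \<kappa> \<A>" and w: "f x w \<noteq> 0"
  shows "\<phi> w \<in> supp x"
proof (rule ccontr)
  assume "\<phi> w \<notin> supp x"
  then have "f x w = f (\<lambda>_. 0) w"
    using supp_outside by (intro f_germ[OF x const_mem, of "- supp x"]) (auto simp: supp_def)
  then show False using w f_zero_one(1) by simp
qed

text \<open>If x is supported in N, the open set where f x is nonzero is mapped by \<phi> into the
  support of x, hence into N. The support condition supplies such x with f x w nonzero.\<close>

lemma phi_continuous: "continuous_on UNIV \<phi>"
proof -
  have "\<exists>T. open T \<and> w \<in> T \<and> \<phi> ` T \<subseteq> N" if N: "open N" "\<phi> w \<in> N" for N w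
  proof -
    obtain x where x: "x \<in> class_functions \<kappa> \<A>" "supp x \<subseteq> N" "f x w \<noteq> 0" by (rule support_function[OF N])
    have "open (f x -` (- {0}))" by (rule open_vimage[OF _ f_continuous[OF x(1)]]) auto
    then show ?thesis using x phi_in_supp[OF x(1)] by (intro exI[of _ "f x -` (- {0})"]) auto
  qed
  then have "continuous (at w) \<phi>" for w
    unfolding continuous_at_open by (metis image_subset_iff)
  then show ?thesis by (simp add: continuous_on_eq_continuous_at)
qed

lemma phi_open_vimage: "open N \<Longrightarrow> open (\<phi> -` N)"
  by (rule open_vimage[OF _ phi_continuous])

lemma phi_moves:
  assumes "open T" "w \<in> T"
  obtains w' where "w' \<in> T" "\<phi> w' \<noteq> \<phi> w"
  using phi_nonconst[OF assms(1)] assms(2) unfolding constant_on_def by blast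

text \<open>Points of a zero-dimensional manifold are open. In W this would make \<phi> constant on
  the open set {w}; in V it would make \<phi> constant on the open preimage of a point.\<close>

lemma dimensions: "dV \<noteq> 0" "dW \<noteq> 0"
proof -
  fix w :: 'w
  have "\<not> open {w}" for w :: 'w by (metis phi_moves singletonD singletonI)
  then show "dW \<noteq> 0" using open_singleton_if_dim_0 W by metis
  show "dV \<noteq> 0"
  proof
    assume "dV = 0"
    then have "open (\<phi> -` {\<phi> w})" using open_singleton_if_dim_0[of \<A>] V by (intro phi_open_vimage) simp
    then show False using phi_moves[of "\<phi> -` {\<phi> w}" w] by auto
  qed
qed

section \<open>Dependence on the value at \<phi> w\<close>

lemmas smooth_mem = class_functions_smooth[OF V dimensions(1) class_V]

text \<open>The hypothesis on f concerns functions avoiding 1 everywhere, so x is replaced by y = k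
  + z * (x - k) with a cutoff z. The values of y are convex combinations of k and values of x in the
  same interval I, below or above 1, so y avoids 1 and has the germ of x at \<phi> w.\<close>

lemma f_pos_ne_1:
  assumes x: "x \<in> class_functions \<kappa> \<A>" and k: "x (\<phi> w) > 0" "x (\<phi> w) \<noteq> 1"
  shows "f x w > 0" "f x w \<noteq> 1"
proof -
  define k where "k = x (\<phi> w)"
  define I :: "real set" where "I = (if k < 1 then {0<..<1} else {1<..})"
  have I: "open I" "k \<in> I" "convex I" "I \<subseteq> {0<..} - {1}" using k by (auto simp: I_def k_def)
  have "open (x -` I)" by (rule open_vimage[OF I(1) class_functions_continuous[OF V x]])
  moreover have "\<phi> w \<in> x -` I" using I(2) by (simp add: k_def)
  ultimately obtain z M where z: "z \<in> class_functions (Frechet \<infinity>) \<A>" "\<And>v. 0 \<le> z v" "\<And>v. z v \<le> 1"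
    "\<And>v. v \<notin> x -` I \<Longrightarrow> z v = 0" and M: "open M" "\<phi> w \<in> M" "\<And>v. v \<in> M \<Longrightarrow> z v = 1"
    by (rule cutoff_function[OF V dimensions(1)]) blast
  define y where "y v = k + z v * (x v + - k)" for v
  have y: "y \<in> class_functions \<kappa> \<A>"
    unfolding y_def[abs_def]
    by (intro class_functions_add[OF V dimensions(1) class_V] const_mem
        class_functions_times_smooth[OF V dimensions(1) class_V z(1)] x)
  have "y v \<in> I" for v
  proof (cases "x v \<in> I")
    case True
    have "(1 - z v) *\<^sub>R k + z v *\<^sub>R x v \<in> I" using I(2) True z(2,3)[of v] by (intro convexD_alt[OF I(3)]) auto
    moreover have "(1 - z v) *\<^sub>R k + z v *\<^sub>R x v = y v" by (simp add: y_def algebra_simps)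
    ultimately show ?thesis by simp
  qed (use z(4) I(2) in \<open>simp add: y_def\<close>)
  then have "range y \<subseteq> {0<..} - {1}" using I(4) unfolding image_subset_iff by blast
  then have "f y \<in> f ` {x \<in> class_functions \<kappa> \<A>. range x \<subseteq> {0<..} - {1}}" using y by simp
  from subsetD[OF f_pos this] have "range (f y) \<subseteq> {0<..} - {1}" by simp
  then have "f y w \<in> {0<..} - {1}" by (rule subsetD) simp
  moreover have "f x w = f y w" by (rule f_germ[OF x y M(1,2)]) (simp add: y_def M(3))
  ultimately show "f x w > 0" "f x w \<noteq> 1" by auto
qed

text \<open>A constant k with the same image as x at w is found by surjectivity. Then x / k has
  image 1 at w, which by the preceding lemma forces x / k to be 1 at \<phi> w.\<close>

lemma f_eq_const:
  assumes x: "x \<in> class_functions \<kappa> \<A>" and pos: "x (\<phi> w) > 0"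
  shows "f x w = f (\<lambda>_. x (\<phi> w)) w"
proof -
  have "f x w > 0"
  \<comment> \<open>At value 1 the preceding lemma does not apply to x; it applies to 2 x, and the
    constant 2 has positive image.\<close>
  proof (cases "x (\<phi> w) = 1")
    case True
    have y: "(\<lambda>v. 2 * x v) \<in> class_functions \<kappa> \<A>"
      by (rule class_functions_times_smooth[OF V dimensions(1) class_V class_functions_const_smooth[OF V dimensions(1)] x])
    have "f (\<lambda>v. 2 * x v) w > 0" using True by (intro f_pos_ne_1[OF y]) auto
    then show ?thesis using f_mult[OF const_mem x, of 2 w] f_const_pos[of 2 w] by (simp add: zero_less_mult_iff)
  qed (use f_pos_ne_1[OF x pos] in simp)
  then obtain k where k: "k > 0" "f (\<lambda>_. k) w = f x w" by (rule f_const_surj)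
  have y: "(\<lambda>v. 1 / k * x v) \<in> class_functions \<kappa> \<A>"
    by (rule class_functions_times_smooth[OF V dimensions(1) class_V class_functions_const_smooth[OF V dimensions(1)] x])
  have "f (\<lambda>v. 1 / k * x v) w = 1"
    using f_mult[OF const_mem x, of "1 / k" w] f_const_mult[of "1 / k" k w] k f_zero_one(2)[of w] by simp
  then have "1 / k * x (\<phi> w) = 1"
    using f_pos_ne_1(2)[OF y, of w] pos k(1) by fastforce
  then show ?thesis using k by (simp add: field_simps)
qed

lemma f_sgn:
  assumes x: "x \<in> class_functions \<kappa> \<A>" and nz: "x (\<phi> w) \<noteq> 0"
  shows "f x w = f (\<lambda>_. sgn (x (\<phi> w))) w * f (\<lambda>_. \<bar>x (\<phi> w)\<bar>) w"
proof (cases "x (\<phi> w) > 0")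
  case True
  then show ?thesis using f_eq_const[OF x] f_zero_one(2) by simp
next
  case False
  have y: "(\<lambda>v. - 1 * x v) \<in> class_functions \<kappa> \<A>"
    by (rule class_functions_times_smooth[OF V dimensions(1) class_V class_functions_const_smooth[OF V dimensions(1)] x])
  have "f (\<lambda>v. - 1 * (- 1 * x v)) w = f (\<lambda>_. - 1) w * f (\<lambda>v. - 1 * x v) w"
    by (rule f_mult[OF const_mem y])
  moreover have "f (\<lambda>v. - 1 * x v) w = f (\<lambda>_. - 1 * x (\<phi> w)) w"
    using False nz by (intro f_eq_const[OF y]) auto
  ultimately show ?thesis using False nz by simp
qed

lemma f_sgn_abs: "k \<noteq> 0 \<Longrightarrow> \<bar>f (\<lambda>_. sgn k) w\<bar> = 1"
proof -
  assume k: "k \<noteq> 0"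
  then have "f (\<lambda>_. sgn k * sgn k) w = 1" using f_zero_one(2) by (simp add: mult_sgn_abs sgn_if)
  then have "(f (\<lambda>_. sgn k) w)\<^sup>2 = 1" unfolding f_const_mult by (simp add: power2_eq_square)
  then show ?thesis by (simp add: power2_eq_1_iff) auto
qed

section \<open>Linearity of the logarithm of the images of constants\<close>

definition log_f :: "'w \<Rightarrow> real \<Rightarrow> real" where
  "log_f w t = ln (f (\<lambda>_. exp t) w)"

lemma exp_log_f: "exp (log_f w t) = f (\<lambda>_. exp t) w"
  by (simp add: log_f_def f_const_pos)

lemma log_f_add: "log_f w (s + t) = log_f w s + log_f w t"
  by (simp add: log_f_def exp_add f_const_mult ln_mult f_const_pos less_imp_neq[OF f_const_pos, symmetric])

lemma log_f_continuous: "continuous_on UNIV (\<lambda>w. log_f w t)"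
  unfolding log_f_def using f_const_pos[of "exp t"]
  by (intro continuous_on_ln f_continuous const_mem) (simp add: less_imp_neq[symmetric])

lemma f_exp:
  assumes "x \<in> class_functions \<kappa> \<A>" "x (\<phi> w) = exp t"
  shows "f x w = exp (log_f w t)"
  using f_eq_const[OF assms(1), of w] assms(2) by (simp add: exp_log_f)

text \<open>If \<open>log_f\<close> were not linear at \<open>w0\<close>, nor then near \<open>w0\<close>, choose \<open>w n\<close> tending to \<open>w0\<close> with \<open>\<phi> (w n)\<close>
  tending to \<open>\<phi> w0\<close> so fast that a smooth function takes prescribed tiny values \<open>\<epsilon> n\<close> at \<open>\<phi> (w n)\<close>.
  Since \<open>log_f (w n)\<close> is unbounded above on every interval \<open>(0, \<delta>)\<close>, the \<open>\<epsilon> n\<close> can be chosen such that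
  the image under \<open>f\<close> of its exponential is unbounded near \<open>w0\<close>.\<close>

lemma log_f_linear: "log_f w0 t = t * log_f w0 1"
proof (rule ccontr)
  assume nonlin: "log_f w0 t \<noteq> t * log_f w0 1"
  define D where "D = {w. log_f w t \<noteq> t * log_f w 1}"
  have D: "open D" unfolding D_def
    by (intro open_Collect_neq log_f_continuous continuous_intros)
  have w0: "w0 \<in> D" using nonlin by (simp add: D_def)
  obtain U c where U: "(U, c) \<in> \<A>" "\<phi> w0 \<in> U" by (rule atlas_cover[OF V])
  obtain U' c' where U': "(U', c') \<in> \<B>" "w0 \<in> U'" by (rule atlas_cover[OF W])
  define y0 where "y0 = c (\<phi> w0)"
  obtain \<rho> where \<rho>: "\<rho> > 0" "compact (c ` U \<inter> cball y0 \<rho>)"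
    unfolding y0_def by (rule chart_compact_ball[OF V U(1) dimensions(1) open_UNIV UNIV_I U(2)])
  \<comment> \<open>Candidates for the points \<open>w n\<close>: close to w0 in a chart of W, with
    \<phi> close to \<phi> w0 and with nonlinear logarithm. These open sets contain w0, so each also
    contains points whose image under \<phi> differs from \<phi> w0.\<close>
  define G where "G n e = {w \<in> U'. dist (c' w) (c' w0) < 1 / real (Suc n)} \<inter> D \<inter> \<phi> -` {v \<in> U. dist (c v) y0 < e}" for n e
  have G: "open (G n e)" for n e
    unfolding G_def by (intro open_Int D chart_ball_open[OF W U'(1)] phi_open_vimage chart_ball_open[OF V U(1)])
  have Gw0: "w0 \<in> G n e" if "e > 0" for n e using that w0 U U' by (simp add: G_def y0_def)
  have step: "\<exists>w'. w' \<in> G n e \<and> \<phi> w' \<noteq> \<phi> w0" if "e > 0" for n e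
    by (rule phi_moves[OF G Gw0[OF that]]) blast
  define P where "P n w \<longleftrightarrow> w \<in> G n (\<rho> / 2) \<and> \<phi> w \<noteq> \<phi> w0" for n w
  have ne: "c (\<phi> w) \<noteq> y0" if "P n w" for n w
    using that inj_onD[OF atlas_chart(4)[OF V U(1)], of "\<phi> w" "\<phi> w0"] U(2) by (auto simp: P_def G_def y0_def)
  have ex0: "\<exists>w. P 0 w" using step[of "\<rho> / 2" 0] \<rho>(1) by (auto simp: P_def)
  have exS: "\<exists>w'. P (Suc n) w' \<and> dist (c (\<phi> w')) y0 \<le> dist (c (\<phi> w)) y0 / 2" if "P n w" for n w
  proof -
    have e: "min (\<rho> / 2) (dist (c (\<phi> w)) y0 / 2) > 0" using ne[OF that] \<rho>(1) by simp
    from step[OF e, of "Suc n"] show ?thesis by (fastforce simp: P_def G_def)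
  qed
  obtain w where w: "\<And>n. P n (w n)" "\<And>n. dist (c (\<phi> (w (Suc n)))) y0 \<le> dist (c (\<phi> (w n))) y0 / 2"
    using dependent_nat_choice[of P "\<lambda>_ w w'. dist (c (\<phi> w')) y0 \<le> dist (c (\<phi> w)) y0 / 2", OF ex0 exS] by blast
  \<comment> \<open>Squaring makes the radial function smooth at y0 and turns halved distances into
    the ratio 1/4 that the interpolation asks for.\<close>
  define r where "r n = (dist (c (\<phi> (w n))) y0)\<^sup>2" for n
  have r: "r n > 0" "r (Suc n) \<le> r n / 4" for n
  proof -
    show "r n > 0" using ne[OF w(1)] by (simp add: r_def)
    have "r (Suc n) \<le> (dist (c (\<phi> (w n))) y0 / 2)\<^sup>2" unfolding r_def by (intro power_mono w(2)) simp
    then show "r (Suc n) \<le> r n / 4" by (simp add: r_def power_divide)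
  qed
  obtain \<delta> :: "nat \<Rightarrow> real" where \<delta>: "\<And>n. \<delta> n > 0"
    "\<And>\<epsilon>. (\<And>n. \<bar>\<epsilon> n\<bar> \<le> \<delta> n) \<Longrightarrow> \<exists>\<theta>. frechet_Ck_on \<infinity> UNIV \<theta> \<and> (\<forall>n. \<theta> (r n) = \<epsilon> n)"
    by (rule smooth_interpolation[where r = r, OF r]) blast
  \<comment> \<open>A bound on (0, \<delta> n) would make the additive function linear, contrary to
    the choice of \<open>w n\<close>.\<close>
  have "\<exists>s. 0 < s \<and> s < \<delta> n \<and> real n < log_f (w n) s" for n
  proof (rule ccontr)
    assume "\<nexists>s. 0 < s \<and> s < \<delta> n \<and> real n < log_f (w n) s"
    then have "log_f (w n) s \<le> real n" if "0 < s" "s < \<delta> n" for s using that by (meson not_le_imp_less)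
    from additive_bounded_above_linear[of "log_f (w n)", OF log_f_add \<delta>(1) this]
    have "log_f (w n) t = t * log_f (w n) 1" .
    then show False using w(1)[of n] by (simp add: P_def G_def D_def)
  qed
  then obtain \<epsilon> where \<epsilon>: "\<And>n. 0 < \<epsilon> n" "\<And>n. \<epsilon> n < \<delta> n" "\<And>n. real n < log_f (w n) (\<epsilon> n)" by metis
  have "\<bar>\<epsilon> n\<bar> \<le> \<delta> n" for n using \<epsilon>(1,2)[of n] by simp
  from \<delta>(2)[OF this] obtain \<theta> where \<theta>: "frechet_Ck_on \<infinity> UNIV \<theta>" "\<And>n. \<theta> (r n) = \<epsilon> n" by blast
  \<comment> \<open>The exponent is \<theta> of the squared distance near y0 and 0 outside the
    coordinate ball, so that s extends by 1. At \<phi> (w n) it takes the value \<epsilon> n, since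
    these points lie where the bump is 1.\<close>
  define s where "s y = exp (bump y0 \<rho> y * \<theta> ((dist y y0)\<^sup>2))" for y
  define x where "x = chart_extension U c s 1"
  have sm: "frechet_Ck_on \<infinity> UNIV s"
    unfolding s_def[abs_def]
    by (rule smooth_compose_UNIV[OF smooth_exp])
      (intro smooth_mult halfspace_open_UNIV smooth_bump smooth_compose_UNIV[OF \<theta>(1) smooth_dist_square])
  have "x \<in> class_functions (Frechet \<infinity>) \<A>"
    unfolding x_def by (rule smooth_chart_extension[OF V U(1) dimensions(1) sm _ \<rho>(2)]) (simp add: s_def bump_eq_0 \<rho>(1))
  then have x: "x \<in> class_functions \<kappa> \<A>" by (rule smooth_mem)
  have big: "f x (w n) > real n" for n
  proof -
    have "\<phi> (w n) \<in> U" "dist (c (\<phi> (w n))) y0 < \<rho> / 2" using w(1)[of n] by (auto simp: P_def G_def)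
    then have "x (\<phi> (w n)) = exp (\<epsilon> n)"
      using bump_eq_1[OF \<rho>(1), of "c (\<phi> (w n))" y0] \<theta>(2)[of n] by (simp add: x_def chart_extension_def s_def r_def)
    from f_exp[OF x this] have "f x (w n) = exp (log_f (w n) (\<epsilon> n))" .
    moreover have "log_f (w n) (\<epsilon> n) < exp (log_f (w n) (\<epsilon> n))"
      using exp_ge_add_one_self[of "log_f (w n) (\<epsilon> n)"] by linarith
    ultimately show ?thesis using \<epsilon>(3)[of n] by linarith
  qed
  have "open (f x -` {..<f x w0 + 1})" by (rule open_vimage[OF _ f_continuous[OF x]]) simp
  then obtain \<eta> where \<eta>: "\<eta> > 0" "\<And>u. u \<in> U' \<Longrightarrow> dist (c' u) (c' w0) \<le> \<eta> \<Longrightarrow> u \<in> f x -` {..<f x w0 + 1}"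
    by (rule chart_ball_subset[OF W U'(1) _ _ U'(2)]) auto
  obtain n0 :: nat where n0: "1 / real (Suc n0) < \<eta>" using \<eta>(1) nat_approx_posE by metis
  obtain n1 :: nat where n1: "f x w0 + 1 < real n1" using reals_Archimedean2 by blast
  let ?n = "max n0 n1"
  have "w ?n \<in> U'" "dist (c' (w ?n)) (c' w0) < 1 / real (Suc ?n)" using w(1)[of ?n] by (auto simp: P_def G_def)
  moreover have "1 / real (Suc ?n) \<le> 1 / real (Suc n0)" by (intro divide_left_mono) auto
  ultimately have "f x (w ?n) < f x w0 + 1" using \<eta>(2)[of "w ?n"] n0 by auto
  then show False using big[of ?n] n1 by simp
qed

section \<open>The exponent and its positivity\<close>

definition exponent :: "'w \<Rightarrow> real" where "exponent w = log_f w 1"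

lemma exponent_continuous: "continuous_on UNIV exponent"
  unfolding exponent_def[abs_def] by (rule log_f_continuous)

lemma f_const_exp: "f (\<lambda>_. exp t) w = exp (t * exponent w)"
  using exp_log_f[of w t] log_f_linear[of w t] by (simp add: exponent_def)

lemma f_formula:
  assumes "x \<in> class_functions \<kappa> \<A>" "x (\<phi> w) \<noteq> 0"
  shows "f x w = f (\<lambda>_. sgn (x (\<phi> w))) w * \<bar>x (\<phi> w)\<bar> powr exponent w"
  using f_sgn[OF assms] f_const_exp[of "ln \<bar>x (\<phi> w)\<bar>" w] assms(2) by (simp add: powr_def mult.commute)

lemma f_formula_abs:
  assumes "x \<in> class_functions \<kappa> \<A>" "x (\<phi> w) \<noteq> 0"
  shows "\<bar>f x w\<bar> = \<bar>x (\<phi> w)\<bar> powr exponent w"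
  using f_formula[OF assms] f_sgn_abs[OF assms(2)] by (simp add: abs_mult)

text \<open>A function vanishing only at \<open>\<phi> w\<close> would have unbounded image near \<open>w\<close> if the exponent were negative.\<close>

lemma exponent_pos: "exponent w > 0"
proof (rule ccontr)
  assume "\<not> exponent w > 0"
  \<comment> \<open>The constant exp 1 differs from 1, hence so does its image exp (exponent
    w).\<close>
  moreover have "exponent w \<noteq> 0"
    using f_pos_ne_1(2)[OF const_mem, of "exp 1" w] f_const_exp[of 1 w] by auto
  ultimately have neg: "exponent w < 0" by simp
  obtain U c where U: "(U, c) \<in> \<A>" "\<phi> w \<in> U" by (rule atlas_cover[OF V])
  define y0 where "y0 = c (\<phi> w)"
  obtain \<rho> where \<rho>: "\<rho> > 0" "compact (c ` U \<inter> cball y0 \<rho>)"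
    unfolding y0_def by (rule chart_compact_ball[OF V U(1) dimensions(1) open_UNIV UNIV_I U(2)])
  \<comment> \<open>The squared distance near y0 and 1 outside the ball. In between it is a convex
    combination of the two, hence positive away from y0.\<close>
  define s where "s y = 1 + bump y0 \<rho> y * ((dist y y0)\<^sup>2 + - 1)" for y
  define x where "x = chart_extension U c s 1"
  have sm: "frechet_Ck_on \<infinity> UNIV s"
    unfolding s_def[abs_def]
    by (intro smooth_add smooth_mult halfspace_open_UNIV smooth_const smooth_bump smooth_dist_square)
  have "x \<in> class_functions (Frechet \<infinity>) \<A>"
    unfolding x_def by (rule smooth_chart_extension[OF V U(1) dimensions(1) sm _ \<rho>(2)]) (simp add: s_def bump_eq_0 \<rho>(1))
  then have x: "x \<in> class_functions \<kappa> \<A>" by (rule smooth_mem)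
  have x0: "x (\<phi> w) = 0" using U(2) bump_eq_1[OF \<rho>(1), of y0 y0] \<rho>(1) by (simp add: x_def chart_extension_def s_def y0_def)
  have xnz: "x v > 0" if "v \<noteq> \<phi> w" for v
  proof (cases "v \<in> U")
    case True
    then have "c v \<noteq> y0" using inj_onD[OF atlas_chart(4)[OF V U(1)], of v "\<phi> w"] U(2) that by (auto simp: y0_def)
    then have d: "(dist (c v) y0)\<^sup>2 > 0" by simp
    let ?b = "bump y0 \<rho> (c v)"
    have s: "s (c v) = (1 - ?b) + ?b * (dist (c v) y0)\<^sup>2" by (simp add: s_def algebra_simps)
    have "0 \<le> ?b * (dist (c v) y0)\<^sup>2" using bump_bounds(1) by (intro mult_nonneg_nonneg) auto
    then have "s (c v) > 0"
      unfolding s using d bump_bounds(2)[of y0 \<rho> "c v"] by (cases "?b = 1") (auto intro: add_pos_nonneg)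
    then show ?thesis using True by (simp add: x_def chart_extension_def)
  qed (simp add: x_def chart_extension_def)
  define b where "b = - exponent w / 2"
  define M where "M = \<bar>f x w\<bar> + 2"
  have b: "b > 0" using neg by (simp add: b_def)
  have M: "M > 1" by (simp add: M_def)
  \<comment> \<open>On T the exponent is below -b, so a positive value x (\<phi> u) < exp (- (ln M /
    b)) forces f x u > M, while T also requires f x u < M. Since M > 1, such values lie below
    1.\<close>
  define T where "T = exponent -` {..< - b} \<inter> f x -` {..<M} \<inter> \<phi> -` (x -` {..<exp (- (ln M / b))})"
  have "open T" unfolding T_def
    by (intro open_Int phi_open_vimage open_vimage f_continuous x exponent_continuous class_functions_continuous[OF V x]) auto
  moreover have "w \<in> T" using neg x0 by (simp add: T_def b_def M_def)
  ultimately obtain u where u: "u \<in> T" "\<phi> u \<noteq> \<phi> w" by (rule phi_moves)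
  have pos: "x (\<phi> u) > 0" by (rule xnz[OF u(2)])
  define l where "l = ln (x (\<phi> u))"
  have xl: "x (\<phi> u) = exp l" using pos by (simp add: l_def)
  have "exp l < exp (- (ln M / b))" using u(1) by (simp add: T_def xl)
  then have l: "ln M < b * (- l)" using b by (simp add: field_simps)
  then have "0 < b * (- l)" using ln_gt_zero[OF M] by linarith
  then have "l < 0" using b by (simp add: zero_less_mult_iff mult_less_0_iff)
  have "b * (- l) \<le> - exponent u * (- l)" using u(1) \<open>l < 0\<close> by (intro mult_right_mono) (auto simp: T_def)
  then have "ln M < l * exponent u" using l by (simp add: mult.commute)
  then have "exp (ln M) < exp (l * exponent u)" by simp
  then have "M < f x u" using f_eq_const[OF x pos] f_const_exp[of l u] M by (simp add: xl)
  then show False using u(1) by (simp add: T_def)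
qed

text \<open>The exponent is bounded below by some b > 0 near w. At nearby points u with x (\<phi> u)
  nonzero but small, the formula makes f x u small, so f x w is 0 by continuity.\<close>

lemma f_zero_limit:
  assumes x: "x \<in> class_functions \<kappa> \<A>" and x0: "x (\<phi> w) = 0"
    and lim: "\<And>T. open T \<Longrightarrow> w \<in> T \<Longrightarrow> \<exists>u\<in>T. x (\<phi> u) \<noteq> 0"
  shows "f x w = 0"
proof (rule ccontr)
  assume nz: "f x w \<noteq> 0"
  define b where "b = exponent w / 2"
  define M where "M = \<bar>f x w\<bar> / 2"
  have b: "b > 0" using exponent_pos[of w] by (simp add: b_def)
  have M: "M > 0" using nz by (simp add: M_def)
  \<comment> \<open>Values of size at most q have b-th power at most M, and q \<le> 1 lets the
    larger exponents near w be replaced by b.\<close>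
  define q where "q = min 1 (M powr (1 / b))"
  have q: "0 < q" "q \<le> 1" using M by (auto simp: q_def)
  define T where "T = exponent -` {b<..} \<inter> f x -` {u. M < \<bar>u\<bar>} \<inter> \<phi> -` (x -` {- q<..<q})"
  have "open {u::real. M < \<bar>u\<bar>}" by (intro open_Collect_less continuous_intros)
  then have "open T" unfolding T_def
    by (intro open_Int phi_open_vimage open_vimage f_continuous x exponent_continuous class_functions_continuous[OF V x]) auto
  moreover have "w \<in> T" using x0 q exponent_pos[of w] nz by (simp add: T_def b_def M_def)
  ultimately obtain u where u: "u \<in> T" "x (\<phi> u) \<noteq> 0" using lim by blast
  have "\<bar>f x u\<bar> = \<bar>x (\<phi> u)\<bar> powr exponent u" by (rule f_formula_abs[OF x u(2)])
  also have "\<dots> \<le> \<bar>x (\<phi> u)\<bar> powr b" using u q(2) by (intro powr_mono') (auto simp: T_def)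
  also have "\<dots> \<le> (M powr (1 / b)) powr b" using u b by (intro powr_mono2) (auto simp: T_def q_def)
  also have "\<dots> = M" using b M by (simp add: powr_powr)
  finally show False using u(1) by (simp add: T_def)
qed

text \<open>At a zero of x \<circ> \<phi> the right-hand side is 0. Either nonzero values occur
  arbitrarily near w, or x \<circ> \<phi> vanishes on a neighbourhood of w; in the latter case
  openness of \<phi> makes x vanish on a neighbourhood of \<phi> w, and f x w depends only on the
  germ.\<close>

lemma f_formula_open:
  assumes open_map: "open_map euclidean euclidean \<phi>" and x: "x \<in> class_functions \<kappa> \<A>"
  shows "f x w = f (\<lambda>_. sgn (x (\<phi> w))) w * \<bar>x (\<phi> w)\<bar> powr exponent w"
proof (cases "x (\<phi> w) = 0")
  case True
  have "f x w = 0"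
  proof (cases "\<forall>T. open T \<longrightarrow> w \<in> T \<longrightarrow> (\<exists>u\<in>T. x (\<phi> u) \<noteq> 0)")
    case lim: True
    then show ?thesis by (intro f_zero_limit[OF x True]) blast
  next
    case False
    then obtain T where T: "open T" "w \<in> T" "\<forall>u\<in>T. x (\<phi> u) = 0" by blast
    have "open (\<phi> ` T)" using open_map T(1) by (simp add: open_map_def)
    then have "f x w = f (\<lambda>_. 0) w" using T by (intro f_germ[OF x const_mem, of "\<phi> ` T"]) auto
    then show ?thesis by (simp add: f_zero_one)
  qed
  then show ?thesis using True f_zero_one(1) by simp
qed (rule f_formula[OF x])

section \<open>Regularity of the exponent and of \<phi>\<close>

lemma exponent_powers:
  assumes U': "(U', c') \<in> \<B>"
  shows "class_on \<kappa>' (c' ` U') (\<lambda>y. exp (real n * (exponent \<circ> inv_into U' c') y))"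
proof -
  have "f (\<lambda>_. exp (real n)) \<in> class_functions \<kappa>' \<B>" using f_maps const_mem by blast
  then have "class_on \<kappa>' (c' ` U') (f (\<lambda>_. exp (real n)) \<circ> inv_into U' c')"
    using U' by (auto simp: class_functions_def)
  then show ?thesis by (simp add: comp_def f_const_exp)
qed

lemma exponent_chart_continuous:
  assumes U': "(U', c') \<in> \<B>"
  shows "continuous_on (c' ` U') (exponent \<circ> inv_into U' c')"
  by (rule continuous_on_compose[OF atlas_chart(6)[OF W U']]) (rule continuous_on_subset[OF exponent_continuous subset_UNIV])

text \<open>Composition with the identity as outer function: what is known beforehand is that the
  powers of exp (exponent) belong to the class, being the images of the constants exp n.\<close>

lemma exponent_mem: "exponent \<in> class_functions \<kappa>' \<B>"
proof -
  have "class_on \<kappa>' (c' ` U') (exponent \<circ> inv_into U' c')" if U': "(U', c') \<in> \<B>" for U' c'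
    using class_on_compose[OF class_W atlas_halfspace_open[OF W U' dimensions(2)] exponent_chart_continuous[OF U']
        exponent_powers[OF U'] open_UNIV subset_UNIV derivative_sequence_id]
    by (simp add: comp_def)
  then show ?thesis by (auto simp: class_functions_def)
qed

end

context multiplicative_map
begin

text \<open>The functions exp (n * exp y), with y a coordinate, are cut off inside the chart. Their
  images are the powers of the exponential of exp y * exponent, and the inner exponential keeps this
  product positive, so that its logarithm exists. The neighbourhood N serves all directions b and
  all n.\<close>

lemma coordinate_functions:
  assumes U: "(U, c) \<in> \<A>" "v0 \<in> U"
  obtains N where "open N" "v0 \<in> N" "N \<subseteq> U"
    "\<And>b n. \<exists>x\<in>class_functions \<kappa> \<A>. \<forall>w. \<phi> w \<in> N \<longrightarrow> f x w = exp (real n * (exp (c (\<phi> w) \<bullet> b) * exponent w))"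
proof -
  define y0 where "y0 = c v0"
  obtain \<rho> where \<rho>: "\<rho> > 0" "compact (c ` U \<inter> cball y0 \<rho>)"
    unfolding y0_def by (rule chart_compact_ball[OF V U(1) dimensions(1) open_UNIV UNIV_I U(2)])
  define N where "N = {v \<in> U. dist (c v) y0 < \<rho> / 2}"
  have "\<exists>x\<in>class_functions \<kappa> \<A>. \<forall>w. \<phi> w \<in> N \<longrightarrow> f x w = exp (real n * (exp (c (\<phi> w) \<bullet> b) * exponent w))" for b and n :: nat
  proof -
    define s where "s y = exp (bump y0 \<rho> y * (real n * exp (y \<bullet> b)))" for y
    define x where "x = chart_extension U c s 1"
    have sm: "frechet_Ck_on \<infinity> UNIV s"
      unfolding s_def[abs_def]
      by (rule smooth_compose_UNIV[OF smooth_exp])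
        (intro smooth_mult halfspace_open_UNIV smooth_bump smooth_const smooth_compose_UNIV[OF smooth_exp] smooth_inner)
    have "x \<in> class_functions (Frechet \<infinity>) \<A>"
      unfolding x_def by (rule smooth_chart_extension[OF V U(1) dimensions(1) sm _ \<rho>(2)]) (simp add: s_def bump_eq_0 \<rho>(1))
    then have x: "x \<in> class_functions \<kappa> \<A>" by (rule smooth_mem)
    have "f x w = exp (real n * (exp (c (\<phi> w) \<bullet> b) * exponent w))" if w: "\<phi> w \<in> N" for w
    proof -
      have "x (\<phi> w) = exp (real n * exp (c (\<phi> w) \<bullet> b))"
        using w bump_eq_1[OF \<rho>(1), of "c (\<phi> w)" y0] by (simp add: N_def x_def chart_extension_def s_def)
      then show ?thesis using f_eq_const[OF x, of w] f_const_exp by (simp add: mult.assoc)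
    qed
    then show ?thesis using x by blast
  qed
  note x = this
  show ?thesis
  proof (rule that[of N])
    show "open N" unfolding N_def by (rule chart_ball_open[OF V U(1)])
    show "\<exists>x\<in>class_functions \<kappa> \<A>. \<forall>w. \<phi> w \<in> N \<longrightarrow> f x w = exp (real n * (exp (c (\<phi> w) \<bullet> b) * exponent w))" for b n
      by (rule x)
  qed (use U(2) \<rho>(1) in \<open>auto simp: N_def y0_def\<close>)
qed

text \<open>The coordinates \<open>c \<bullet> b\<close> of \<open>\<phi>\<close> are recovered as \<open>ln (exponent * exp (c \<bullet> b)) - ln exponent\<close>, where both
  arguments of \<open>ln\<close> are logarithms of functions all of whose powers lie in the image of \<open>f\<close>.\<close>

lemma phi_class_map: "class_map \<kappa>' \<B> \<A> \<phi>"
  unfolding class_map_def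
proof (intro conjI phi_continuous, clarify)
  fix U c U' c' assume U: "(U, c) \<in> \<A>" and U': "(U', c') \<in> \<B>"
  let ?S = "c' ` (U' \<inter> \<phi> -` U)" and ?g = "c \<circ> \<phi> \<circ> inv_into U' c'"
  note hU' = atlas_halfspace_open[OF W U' dimensions(2)]
  have inv: "inv_into U' c' (c' w) = w" if "w \<in> U'" for w using atlas_chart(4)[OF W U'] that by simp
  have S: "openin (top_of_set (c' ` U')) ?S"
    by (rule chart_openin[OF W U' phi_open_vimage[OF atlas_chart(1)[OF V U]]])
  show "class_on \<kappa>' ?S ?g"
  proof (rule class_on_componentwise[OF class_W halfspace_open_openin[OF hU' S]], rule class_on_local[OF class_W halfspace_open_openin[OF hU' S]])
    fix b :: 'e and y assume "y \<in> ?S"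
    then obtain w0 where w0: "w0 \<in> U'" "\<phi> w0 \<in> U" "y = c' w0" by blast
    obtain N where N: "open N" "\<phi> w0 \<in> N" "N \<subseteq> U"
      "\<And>b n. \<exists>x\<in>class_functions \<kappa> \<A>. \<forall>w. \<phi> w \<in> N \<longrightarrow> f x w = exp (real n * (exp (c (\<phi> w) \<bullet> b) * exponent w))"
      by (rule coordinate_functions[OF U w0(2)]) blast
    let ?S' = "c' ` (U' \<inter> \<phi> -` N)"
    have S': "openin (top_of_set (c' ` U')) ?S'" by (rule chart_openin[OF W U' phi_open_vimage[OF N(1)]])
    note hS' = halfspace_open_openin[OF hU' S']
    have sub: "?S' \<subseteq> ?S" using N(3) by blast
    have S'S: "openin (top_of_set ?S) ?S'"
      by (rule openin_subset_trans[OF S' sub]) (use openin_imp_subset[OF S] in blast)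
    have c: "continuous_on ?S' ?g"
    proof (intro continuous_on_compose)
      have "?S' \<subseteq> c' ` U'" by blast
      then show "continuous_on ?S' (inv_into U' c')" by (rule continuous_on_subset[OF atlas_chart(6)[OF W U']])
      show "continuous_on (inv_into U' c' ` ?S') \<phi>" by (rule continuous_on_subset[OF phi_continuous subset_UNIV])
      show "continuous_on (\<phi> ` inv_into U' c' ` ?S') c"
        by (rule continuous_on_subset[OF atlas_chart(5)[OF V U]]) (use N(3) inv in auto)
    qed
    have ln_class: "class_on \<kappa>' ?S' (\<lambda>y. ln (\<beta> y))"
      if "continuous_on ?S' \<beta>" "\<And>y. \<beta> y > 0" "\<And>n::nat. class_on \<kappa>' ?S' (\<lambda>y. exp (real n * \<beta> y))" for \<beta>
      using class_on_compose[OF class_W hS' that(1,3) _ _ derivative_sequence_ln] that(2) by (simp add: image_subset_iff)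
    have exponent: "class_on \<kappa>' ?S' (\<lambda>y. ln (exponent (inv_into U' c' y)))"
    proof (rule ln_class)
      have "continuous_on ?S' (exponent \<circ> inv_into U' c')"
        by (rule continuous_on_subset[OF exponent_chart_continuous[OF U']]) blast
      then show "continuous_on ?S' (\<lambda>y. exponent (inv_into U' c' y))" by (simp add: comp_def)
      show "class_on \<kappa>' ?S' (\<lambda>y. exp (real n * exponent (inv_into U' c' y)))" for n
        using class_on_openin[OF class_W hU' S' exponent_powers[OF U']] by (simp add: comp_def)
    qed (rule exponent_pos)
    have product: "class_on \<kappa>' ?S' (\<lambda>y. ln (exp (?g y \<bullet> b) * exponent (inv_into U' c' y)))"
    proof (rule ln_class)
      have "continuous_on ?S' (exponent \<circ> inv_into U' c')"
        by (rule continuous_on_subset[OF exponent_chart_continuous[OF U']]) blast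
      then show "continuous_on ?S' (\<lambda>y. exp (?g y \<bullet> b) * exponent (inv_into U' c' y))"
        using c by (intro continuous_on_mult continuous_on_exp continuous_on_inner continuous_on_const) (auto simp: comp_def)
      show "class_on \<kappa>' ?S' (\<lambda>y. exp (real n * (exp (?g y \<bullet> b) * exponent (inv_into U' c' y))))" for n
      proof -
        obtain x where x: "x \<in> class_functions \<kappa> \<A>"
          "\<And>w. \<phi> w \<in> N \<Longrightarrow> f x w = exp (real n * (exp (c (\<phi> w) \<bullet> b) * exponent w))" using N(4)[of n b] by blast
        have "f x \<in> class_functions \<kappa>' \<B>" using f_maps x(1) by blast
        then have "class_on \<kappa>' (c' ` U') (f x \<circ> inv_into U' c')" using U' by (auto simp: class_functions_def)
        from class_on_openin[OF class_W hU' S' this] show ?thesis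
          by (rule class_on_cong[OF class_W hS', rotated]) (auto simp: x(2) inv)
      qed
    qed (simp add: exponent_pos)
    have "class_on \<kappa>' ?S' (\<lambda>y. ln (exp (?g y \<bullet> b) * exponent (inv_into U' c' y)) + - 1 * ln (exponent (inv_into U' c' y)))"
      by (intro class_on_add[OF class_W hS'] class_on_times_smooth[OF class_W hS' smooth_const[OF hS']] product exponent)
    then have "class_on \<kappa>' ?S' (\<lambda>y. ?g y \<bullet> b)"
      by (rule class_on_cong[OF class_W hS', rotated])
        (simp add: ln_mult exponent_pos less_imp_neq[OF exponent_pos, symmetric])
    then show "\<exists>S'. openin (top_of_set ?S) S' \<and> y \<in> S' \<and> class_on \<kappa>' S' (\<lambda>y. ?g y \<bullet> b)"
      using S'S w0 N(2) by blast
  qed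
qed

end

section \<open>The lower bound on the exponent for continuously differentiable images\<close>

lemma frechet_1_differentiable: "class_on (Frechet 1) S g \<Longrightarrow> g differentiable_on S"
proof -
  assume "class_on (Frechet 1) S g"
  then have "(\<lambda>x. frechet_iter S g 0 x v) differentiable_on S" for v
    unfolding class_on.simps frechet_Ck_on_def by (metis zero_enat_def zero_less_one)
  then show ?thesis by simp
qed

text \<open>The function \<open>h\<close> is the image under \<open>f\<close>, along a curve, of a function with values \<open>g t - g z\<close>.\<close>

lemma exponent_obstruction:
  fixes g h :: "real \<Rightarrow> real"
  assumes g: "DERIV g z :> l" "l \<noteq> 0" and h: "DERIV h z :> m" "h z = 0" and a: "a < 1"
    and ev: "eventually (\<lambda>t. \<bar>h t\<bar> = \<bar>g t - g z\<bar> powr e t \<and> e t < a) (at z)"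
  shows False
proof -
  have gz: "(g \<longlongrightarrow> g z) (at z)" using DERIV_isCont[OF g(1)] by (simp add: isCont_def)
  have "((\<lambda>t. (g t - g z) / (t - z)) \<longlongrightarrow> l) (at z)" using g(1) by (simp add: has_field_derivative_iff)
  then have L: "((\<lambda>t. \<bar>(g t - g z) / (t - z)\<bar>) \<longlongrightarrow> \<bar>l\<bar>) (at z)" by (rule tendsto_rabs)
  have "((\<lambda>t. h t / (t - z)) \<longlongrightarrow> m) (at z)" using h by (simp add: has_field_derivative_iff)
  then have "((\<lambda>t. \<bar>h t / (t - z)\<bar>) \<longlongrightarrow> \<bar>m\<bar>) (at z)" by (rule tendsto_rabs)
  moreover have d: "((\<lambda>t. \<bar>g t - g z\<bar>) \<longlongrightarrow> 0) (at z)"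
    using tendsto_rabs[OF tendsto_diff[OF gz tendsto_const[of "g z"]]] by simp
  then have "((\<lambda>t. \<bar>g t - g z\<bar> powr (1 - a)) \<longlongrightarrow> 0 powr (1 - a)) (at z)"
    using a by (intro tendsto_powr2 tendsto_const) auto
  ultimately have R: "((\<lambda>t. \<bar>g t - g z\<bar> powr (1 - a) * \<bar>h t / (t - z)\<bar>) \<longlongrightarrow> 0 * \<bar>m\<bar>) (at z)"
    by (intro tendsto_mult) auto
  have "eventually (\<lambda>t. \<bar>g t - g z\<bar> < 1) (at z)" by (rule order_tendstoD(2)[OF d]) simp
  \<comment> \<open>Since |g t - g z| < 1 and the exponents are below a, |h t| is at least |g t - g
    z| powr a. After division by |t - z| the left side tends to |l|, which is positive, and the
    right side to 0 because 1 - a > 0.\<close>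
  with ev have "eventually (\<lambda>t. \<bar>(g t - g z) / (t - z)\<bar> \<le> \<bar>g t - g z\<bar> powr (1 - a) * \<bar>h t / (t - z)\<bar>) (at z)"
  proof eventually_elim
    case (elim t)
    let ?d = "\<bar>g t - g z\<bar>"
    have "?d = ?d powr (1 - a) * ?d powr a" by (cases "?d = 0") (simp_all add: powr_add[symmetric])
    also have "\<dots> \<le> ?d powr (1 - a) * \<bar>h t\<bar>"
    proof (rule mult_left_mono)
      show "?d powr a \<le> \<bar>h t\<bar>" using elim by (simp add: powr_mono')
    qed simp
    finally have "?d / \<bar>t - z\<bar> \<le> ?d powr (1 - a) * \<bar>h t\<bar> / \<bar>t - z\<bar>" by (rule divide_right_mono) simp
    then show ?case by simp
  qed
  from tendsto_le[OF _ R L this] show False using g(2) by simp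
qed

context multiplicative_map
begin

lemma exponent_ge_1:
  assumes C1: "\<kappa>' = Frechet 1"
  shows "exponent w0 \<ge> 1"
proof (rule ccontr)
  assume less: "\<not> exponent w0 \<ge> 1"
  obtain U c where U: "(U, c) \<in> \<A>" "\<phi> w0 \<in> U" by (rule atlas_cover[OF V])
  obtain U' c' where U': "(U', c') \<in> \<B>" "w0 \<in> U'" by (rule atlas_cover[OF W])
  let ?i = "inv_into U' c'"
  have inv: "?i (c' w) = w" if "w \<in> U'" for w using atlas_chart(4)[OF W U'(1)] that by simp
  define T where "T = \<phi> -` U \<inter> exponent -` {..<1}"
  have T: "open T" unfolding T_def
    by (intro open_Int phi_open_vimage atlas_chart(1)[OF V U(1)] open_vimage exponent_continuous) simp
  have hS: "halfspace_open (c' ` (U' \<inter> T))"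
    by (rule halfspace_open_openin[OF atlas_halfspace_open[OF W U'(1) dimensions(2)] chart_openin[OF W U'(1) T]])
  have w0T: "w0 \<in> U' \<inter> T" using U U' less by (simp add: T_def)
  then have "c' w0 \<in> c' ` (U' \<inter> T)" by blast
  from halfspace_open_convex_ball[OF hS this zero_less_one] obtain r where
    r: "r > 0" "convex (c' ` (U' \<inter> T) \<inter> ball (c' w0) r)" by blast
  \<comment> \<open>Convexity keeps the straight segment from c' w0 to c' w1 in the chart image,
    where in addition \<phi> stays in U and the exponent stays below 1.\<close>
  define C where "C = c' ` (U' \<inter> T) \<inter> ball (c' w0) r"
  obtain w1 where w1: "w1 \<in> {w \<in> U'. dist (c' w) (c' w0) < r} \<inter> T" "\<phi> w1 \<noteq> \<phi> w0"
    by (rule phi_moves[of "{w \<in> U'. dist (c' w) (c' w0) < r} \<inter> T" w0])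
      (use chart_ball_open[OF W U'(1)] T w0T r(1) in auto)
  have "c (\<phi> w1) \<noteq> c (\<phi> w0)"
    using w1 U inj_onD[OF atlas_chart(4)[OF V U(1)], of "\<phi> w1" "\<phi> w0"] by (auto simp: T_def)
  then obtain b where b: "b \<in> Basis" "c (\<phi> w1) \<bullet> b \<noteq> c (\<phi> w0) \<bullet> b" by (meson euclidean_eqI)
  define p where "p t = c' w0 + t *\<^sub>R (c' w1 - c' w0)" for t
  define \<gamma> where "\<gamma> t = ?i (p t)" for t
  have pC: "p t \<in> C" if "t \<in> {0..1}" for t
  proof -
    have "c' w0 \<in> C" "c' w1 \<in> C" using w0T w1(1) r(1) by (auto simp: C_def dist_commute)
    then have "(1 - t) *\<^sub>R c' w0 + t *\<^sub>R c' w1 \<in> C" using that r(2) by (intro convexD_alt) (auto simp: C_def)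
    then show ?thesis by (simp add: p_def algebra_simps)
  qed
  have \<gamma>T: "\<gamma> t \<in> U' \<inter> T" "p t = c' (\<gamma> t)" if "t \<in> {0..1}" for t
    using pC[OF that] inv by (auto simp: C_def \<gamma>_def)
  have pU: "p ` {0..1} \<subseteq> c' ` (U' \<inter> \<phi> -` U)" using \<gamma>T by (auto simp: T_def)
  have p_diff: "p differentiable (at t within {0..1})" for t
    unfolding p_def by (intro derivative_intros)
  have along: "(\<lambda>t. q (p t)) differentiable_on {0..1}"
    if "q differentiable_on A" "p ` {0..1} \<subseteq> A" for q :: "'f \<Rightarrow> 'g::euclidean_space" and A
    unfolding differentiable_on_def
  proof
    fix t :: real assume "t \<in> {0..1}"
    then have "p t \<in> A" using that(2) by blast
    then have "q differentiable (at (p t) within A)" using that(1) by (auto simp: differentiable_on_def)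
    then have "q differentiable (at (p t) within p ` {0..1})"
      by (rule differentiable_within_subset[OF _ that(2)])
    from differentiable_chain_within[OF p_diff this] show "(\<lambda>t. q (p t)) differentiable (at t within {0..1})"
      by (simp add: comp_def)
  qed
  define g where "g t = c (\<phi> (\<gamma> t)) \<bullet> b" for t
  have "(c \<circ> \<phi> \<circ> ?i) differentiable_on c' ` (U' \<inter> \<phi> -` U)"
    using phi_class_map U(1) U'(1) unfolding class_map_def C1 by (intro frechet_1_differentiable) fast
  from along[OF this pU] have "(\<lambda>t. c (\<phi> (\<gamma> t))) differentiable_on {0..1}" by (simp add: \<gamma>_def)
  then have g_diff: "g differentiable_on {0..1}" unfolding g_def differentiable_on_def by (auto intro!: derivative_intros)
  have int: "q differentiable (at t)" if "q differentiable_on {0..1}" "0 < t" "t < 1" for q :: "real \<Rightarrow> real" and t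
  proof -
    have "q differentiable (at t within {0..1})" using that by (simp add: differentiable_on_def)
    then show ?thesis using at_within_Icc_at[of 0 t 1] that by simp
  qed
  \<comment> \<open>The chosen coordinate of \<phi> differs at the ends of the segment, so its
    derivative is nonzero at some parameter strictly inside. There the derivatives along the segment
    are two-sided even if the segment lies in the boundary of W.\<close>
  obtain l z where z: "0 < z" "z < 1" "DERIV g z :> l" "g 1 - g 0 = (1 - 0) * l"
    using MVT[of 0 1 g, OF _ differentiable_imp_continuous_on[OF g_diff] int[OF g_diff]] by auto
  have "g 1 \<noteq> g 0" using b(2) inv w1(1) w0T by (simp add: g_def \<gamma>_def p_def)
  then have l: "l \<noteq> 0" using z(4) by simp
  define v where "v = \<phi> (\<gamma> z)"
  have v: "v \<in> U" "exponent (\<gamma> z) < 1" using \<gamma>T(1)[of z] z by (auto simp: v_def T_def)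
  obtain \<rho> where \<rho>: "\<rho> > 0" "compact (c ` U \<inter> cball (c v) \<rho>)"
    by (rule chart_compact_ball[OF V U(1) dimensions(1) open_UNIV UNIV_I v(1)])
  \<comment> \<open>Near v this is the coordinate minus its value at v, so that x (\<phi> (\<gamma>
    t)) = g t - g z for t near z.\<close>
  define s where "s y = bump (c v) \<rho> y * (y \<bullet> b + - g z)" for y
  define x where "x = chart_extension U c s 0"
  have sm: "frechet_Ck_on \<infinity> UNIV s"
    unfolding s_def[abs_def]
    by (intro smooth_add smooth_mult halfspace_open_UNIV smooth_const smooth_bump smooth_inner)
  have "x \<in> class_functions (Frechet \<infinity>) \<A>"
    unfolding x_def by (rule smooth_chart_extension[OF V U(1) dimensions(1) sm _ \<rho>(2)]) (simp add: s_def bump_eq_0 \<rho>(1))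
  then have x: "x \<in> class_functions \<kappa> \<A>" by (rule smooth_mem)
  define h where "h t = f x (\<gamma> t)" for t
  have "f x \<in> class_functions (Frechet 1) \<B>" using f_maps x C1 by blast
  then have "class_on (Frechet 1) (c' ` U') (f x \<circ> ?i)" using U'(1) by (auto simp: class_functions_def)
  from frechet_1_differentiable[OF this] have "(\<lambda>t. (f x \<circ> ?i) (p t)) differentiable_on {0..1}"
    by (rule along) (use pU in blast)
  then have "h differentiable_on {0..1}" by (simp add: h_def[abs_def] \<gamma>_def)
  from int[OF this z(1,2)] obtain m where m: "DERIV h z :> m"
    unfolding real_differentiable_def by blast
  \<comment> \<open>The midpoint leaves room on both sides: by continuity the exponent stays below a
    near \<gamma> z, and still a < 1.\<close>
  define a where "a = (exponent (\<gamma> z) + 1) / 2"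
  have a: "exponent (\<gamma> z) < a" "a < 1" using v(2) by (auto simp: a_def)
  define M where "M = exponent -` {..<a} \<inter> \<phi> -` {v' \<in> U. dist (c v') (c v) < \<rho> / 2}"
  have M: "open M" unfolding M_def
    by (intro open_Int phi_open_vimage chart_ball_open[OF V U(1)] open_vimage exponent_continuous) simp
  have zM: "\<gamma> z \<in> M" using a(1) v(1) \<rho>(1) by (simp add: M_def v_def)
  have x\<gamma>: "x (\<phi> (\<gamma> t)) = g t - g z" if "\<gamma> t \<in> M" for t
    using that bump_eq_1[OF \<rho>(1), of "c (\<phi> (\<gamma> t))" "c v"] by (simp add: M_def x_def chart_extension_def s_def g_def)
  have "continuous_on {0..1} \<gamma>"
    unfolding \<gamma>_def[abs_def]
    by (rule continuous_on_compose2[OF atlas_chart(6)[OF W U'(1)]]) (use pU in \<open>auto simp: p_def[abs_def] intro!: continuous_intros\<close>)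
  then have "isCont \<gamma> z" using z(1,2) by (intro continuous_on_interior[of "{0..1}"]) auto
  then have near: "eventually (\<lambda>t. \<gamma> t \<in> N) (at z)" if "open N" "\<gamma> z \<in> N" for N
    using that unfolding isCont_def by (auto dest: topological_tendstoD)
  have "((\<lambda>t. (g t - g z) / (t - z)) \<longlongrightarrow> l) (at z)" using z(3) by (simp add: has_field_derivative_iff)
  from tendsto_imp_eventually_ne[OF this l] have g_ne: "eventually (\<lambda>t. g t \<noteq> g z) (at z)"
    by eventually_elim auto
  \<comment> \<open>As l is nonzero, g t differs from g z for t near z, so x \<circ> \<phi> has
    nonzero values arbitrarily close to \<gamma> z.\<close>
  have "f x (\<gamma> z) = 0"
  proof (rule f_zero_limit[OF x])
    show "x (\<phi> (\<gamma> z)) = 0" using x\<gamma>[OF zM] by simp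
    fix N assume "open N" "\<gamma> z \<in> N"
    from near[OF this] near[OF M zM] g_ne have "eventually (\<lambda>t. \<gamma> t \<in> N \<and> x (\<phi> (\<gamma> t)) \<noteq> 0) (at z)"
      by eventually_elim (simp add: x\<gamma>)
    then have "\<exists>t. \<gamma> t \<in> N \<and> x (\<phi> (\<gamma> t)) \<noteq> 0" by (intro eventually_happens'[of "at z"]) auto
    then show "\<exists>u\<in>N. x (\<phi> u) \<noteq> 0" by blast
  qed
  then have hz: "h z = 0" by (simp add: h_def)
  have "eventually (\<lambda>t. \<bar>h t\<bar> = \<bar>g t - g z\<bar> powr exponent (\<gamma> t) \<and> exponent (\<gamma> t) < a) (at z)"
    using near[OF M zM] g_ne
  proof eventually_elim
    case (elim t)
    then have "x (\<phi> (\<gamma> t)) \<noteq> 0" by (simp add: x\<gamma>)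
    from f_formula_abs[OF x this] show ?case using elim by (simp add: h_def x\<gamma>) (simp add: M_def)
  qed
  from exponent_obstruction[OF z(3) l m hz a(2) this] show False .
qed

end

theorem theorem9p3:
  fixes \<A> :: "('v::t2_space, 'e::euclidean_space) atlas"
    and \<B> :: "('w::t2_space, 'f::euclidean_space) atlas"
    and dV dW :: nat
    and \<kappa> \<kappa>' :: smoothness
    and f :: "('v \<Rightarrow> real) \<Rightarrow> ('w \<Rightarrow> real)"
    and \<phi> :: "'w \<Rightarrow> 'v"
  assumes V: "smooth_atlas dV \<A>"
    and W: "smooth_atlas dW \<B>"
    and class_V: "admissible dV \<kappa>"
    and class_W: "admissible dW \<kappa>'"
    and f_maps: "f \<in> class_functions \<kappa> \<A> \<rightarrow> class_functions \<kappa>' \<B>"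
    and f_hom: "\<And>x y. x \<in> class_functions \<kappa> \<A> \<Longrightarrow> y \<in> class_functions \<kappa> \<A> \<Longrightarrow>
                  f (\<lambda>v. x v * y v) = (\<lambda>w. f x w * f y w)"
    and f_pos: "f ` {x \<in> class_functions \<kappa> \<A>. range x \<subseteq> {0<..} - {1}}
                  \<subseteq> {y \<in> class_functions \<kappa>' \<B>. range y \<subseteq> {0<..} - {1}}"
    and f_const: "\<And>w. (\<lambda>c. f (\<lambda>_. c) w) ` {0<..} = {0<..}"
    and phi_nonconst: "\<And>T. open T \<Longrightarrow> T \<noteq> {} \<Longrightarrow> \<not> \<phi> constant_on T"
    and phi_support: "\<And>w. \<phi> w \<in> support_points (class_functions \<kappa> \<A>) (\<lambda>x. f x w)"
  shows "\<exists>\<alpha>.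
      (\<alpha> \<in> class_functions \<kappa>' \<B> \<and> range \<alpha> \<subseteq> {0<..} \<and>
       (\<forall>w. \<forall>x\<in>class_functions \<kappa> \<A>. x (\<phi> w) \<noteq> 0 \<longrightarrow>
          f x w = f (\<lambda>_. sgn (x (\<phi> w))) w * \<bar>x (\<phi> w)\<bar> powr \<alpha> w) \<and>
       class_map \<kappa>' \<B> \<A> \<phi>) \<and>
      (open_map euclidean euclidean \<phi> \<longrightarrow>
       (\<forall>w. \<forall>x\<in>class_functions \<kappa> \<A>.
          f x w = f (\<lambda>_. sgn (x (\<phi> w))) w * \<bar>x (\<phi> w)\<bar> powr \<alpha> w)) \<and>
      (class_functions \<kappa> \<A> \<subseteq> class_functions (Frechet 1) \<A> \<and>
       (\<forall>x\<in>class_functions \<kappa> \<A>. f x \<in> class_functions (Frechet 1) \<B>) \<longrightarrow>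
       (\<forall>w. \<alpha> w \<ge> 1))"
proof -
  interpret M: multiplicative_map \<A> \<B> dV dW \<kappa> \<kappa>' f \<phi>
    by unfold_locales (fact V W class_V class_W f_maps f_hom f_pos f_const phi_nonconst phi_support)+
  have "1 \<le> M.exponent w" if C1: "\<And>x. x \<in> class_functions \<kappa> \<A> \<Longrightarrow> f x \<in> class_functions (Frechet 1) \<B>" for w
  proof -
    have pos: "f ` {x \<in> class_functions \<kappa> \<A>. range x \<subseteq> {0<..} - {1}}
        \<subseteq> {y \<in> class_functions (Frechet 1) \<B>. range y \<subseteq> {0<..} - {1}}"
    proof
      fix y assume "y \<in> f ` {x \<in> class_functions \<kappa> \<A>. range x \<subseteq> {0<..} - {1}}"
      then show "y \<in> {y \<in> class_functions (Frechet 1) \<B>. range y \<subseteq> {0<..} - {1}}"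
        using subsetD[OF f_pos] C1 by auto
    qed
    have adm: "admissible dW (Frechet 1)" by simp
    have maps: "f \<in> class_functions \<kappa> \<A> \<rightarrow> class_functions (Frechet 1) \<B>" using C1 by blast
    \<comment> \<open>The exponent is defined from f alone, so both interpretations have the same
      one; with target class C^1 the map \<phi> is C^1 in charts.\<close>
    interpret N: multiplicative_map \<A> \<B> dV dW \<kappa> "Frechet 1" f \<phi>
      by unfold_locales (fact V W class_V adm maps f_hom pos f_const phi_nonconst phi_support)+
    show ?thesis by (rule N.exponent_ge_1[OF refl])
  qed
  then show ?thesis
    using M.exponent_mem M.exponent_pos M.f_formula M.f_formula_open M.phi_class_map
    by (intro exI[of _ M.exponent]) auto
qed

end
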